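(* Let $d\ge1$, $\alpha,\beta,\gamma\in\mathbb{R}\setminus\{0\}$ and $\theta:=\alpha\beta\gamma\left(\frac1\alpha-\frac1\beta-\frac1\gamma\right)$. Assume $s\in\mathbb{R}$ if $(\alpha-\gamma)(\beta+\gamma)=0$; $s<1$ if $\theta=0$; and $s<1/2$ if $\theta<0$. Then the flow map of the system $$(i\partial_t+\alpha\Delta)u=-(\nabla\cdot w)v,\quad (i\partial_t+\beta\Delta)v=-(\nabla\cdot\overline w)u,\quad (i\partial_t+\gamma\Delta)w=\nabla(u\cdot\overline v),\quad (u,v,w)|_{t=0}=(u_0,v_0,w_0)$$ on $\mathbb{R}^d$ (with $\mathbb{C}^d$-valued unknowns) is not $C^2$ in $H^s$.
   Context: $u\cdot\overline v=\sum_ju_j\overline{v_j}$. "The flow map is $C^2$ in $H^s$" means: for some $T>0$ and $\rho>0$ there is a map $S:\{\phi\in H^s(\mathbb{R}^d)^3:\|\phi\|\le\rho\}\to C([0,T];H^s(\mathbb{R}^d))^3$ (each factor being a space of $\mathbb{C}^d$-valued functions) that is twice continuously Fréchet differentiable (over $\mathbb{R}$) near the origin and such that $S(u_0,v_0,w_0)=(u,v,w)$ whenever $(u_0,v_0,w_0)$ is smooth data in the ball (all components in $\bigcap_{\sigma}H^\sigma$) for which $(u,v,w)\in C([0,T];\bigcap_\sigma H^\sigma)^3$ is the smooth solution of the system on $[0,T]$ with that initial data. *)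

theory Defs
  imports "HOL-Analysis.Analysis" "HOL-Library.Function_Algebras"
begin

section \<open>Normed spaces on a carrier and Frechet differentiability\<close>

text \<open>
  The space \<open>H\<^sup>s\<close> depends on the real number \<open>s\<close>, so it cannot be a type. Normed spaces are therefore
  pairs of a carrier (a linear subspace of a real vector space type) and a norm on that carrier; the
  value of the norm off the carrier is meaningless. Function types are made real vector spaces with
  pointwise operations, and elements of function spaces are normalised to be \<open>0\<close> outside their domain,
  so that equality in the carrier is equality of functions on the domain.
\<close>

instantiation "fun" :: (type, real_vector) real_vector
begin

definition scaleR_fun :: "real \<Rightarrow> ('a \<Rightarrow> 'b) \<Rightarrow> 'a \<Rightarrow> 'b"
  where "scaleR_fun r f = (\<lambda>x. r *\<^sub>R f x)"

instance
  by standard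
    (auto simp: scaleR_fun_def fun_eq_iff scaleR_add_right scaleR_add_left)

end

type_synonym 'a nspace = "'a set \<times> ('a \<Rightarrow> real)"

abbreviation carr :: "'a nspace \<Rightarrow> 'a set" where "carr \<equiv> fst"

abbreviation nrm :: "'a nspace \<Rightarrow> 'a \<Rightarrow> real" where "nrm \<equiv> snd"

definition prod_space :: "'a nspace \<Rightarrow> 'b nspace \<Rightarrow> ('a \<times> 'b) nspace"
  where "prod_space X Y =
    (carr X \<times> carr Y, \<lambda>(x, y). sqrt ((nrm X x)\<^sup>2 + (nrm Y y)\<^sup>2))"

definition cube_space :: "'a nspace \<Rightarrow> ('a \<times> 'a \<times> 'a) nspace"
  where "cube_space X = prod_space X (prod_space X X)"

definition vec_space :: "'a nspace \<Rightarrow> ('a, 'n::finite) vec nspace"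
  where "vec_space X =
    ({x. \<forall>j. x $ j \<in> carr X}, \<lambda>x. sqrt (\<Sum>j\<in>UNIV. (nrm X (x $ j))\<^sup>2))"

text \<open>The space \<open>C([0,T]; X)\<close> with the supremum norm.\<close>

definition curve_space :: "real \<Rightarrow> 'a::real_vector nspace \<Rightarrow> (real \<Rightarrow> 'a) nspace"
  where "curve_space T X =
    ({f. (\<forall>t\<in>{0..T}. f t \<in> carr X \<and>
            ((\<lambda>t'. nrm X (f t' - f t)) \<longlongrightarrow> 0) (at t within {0..T})) \<and>
         (\<forall>t. t \<notin> {0..T} \<longrightarrow> f t = 0)},
     \<lambda>f. SUP t\<in>{0..T}. nrm X (f t))"

text \<open>Bounded real-linear maps with the operator norm.\<close>

definition blin_space ::
    "'a::real_vector nspace \<Rightarrow> 'b::real_vector nspace \<Rightarrow> ('a \<Rightarrow> 'b) nspace"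
  where "blin_space X Y =
    ({L. (\<forall>x\<in>carr X. L x \<in> carr Y) \<and>
         (\<forall>x\<in>carr X. \<forall>y\<in>carr X. L (x + y) = L x + L y) \<and>
         (\<forall>r. \<forall>x\<in>carr X. L (r *\<^sub>R x) = r *\<^sub>R L x) \<and>
         (\<exists>K. \<forall>x\<in>carr X. nrm Y (L x) \<le> K * nrm X x) \<and>
         (\<forall>x. x \<notin> carr X \<longrightarrow> L x = 0)},
     \<lambda>L. SUP x\<in>{x\<in>carr X. nrm X x \<le> 1}. nrm Y (L x))"

definition has_frechet_derivative ::
    "'a::real_vector nspace \<Rightarrow> 'b::real_vector nspace \<Rightarrow> ('a \<Rightarrow> 'b) \<Rightarrow> ('a \<Rightarrow> 'b) \<Rightarrow> 'a \<Rightarrow> bool"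
  where "has_frechet_derivative X Y f L x \<longleftrightarrow>
    L \<in> carr (blin_space X Y) \<and>
    (\<forall>e>0. \<exists>\<delta>>0. \<forall>h\<in>carr X. nrm X h < \<delta> \<longrightarrow>
        f (x + h) \<in> carr Y \<and> nrm Y (f (x + h) - f x - L h) \<le> e * nrm X h)"

definition C2_near_0 :: "'a::real_vector nspace \<Rightarrow> 'b::real_vector nspace \<Rightarrow> ('a \<Rightarrow> 'b) \<Rightarrow> bool"
  where "C2_near_0 X Y f \<longleftrightarrow>
    (\<exists>r>0. \<exists>D1 D2. \<forall>x\<in>carr X. nrm X x < r \<longrightarrow>
       has_frechet_derivative X Y f (D1 x) x \<and>
       has_frechet_derivative X (blin_space X Y) D1 (D2 x) x \<and>
       (\<forall>e>0. \<exists>\<delta>>0. \<forall>y\<in>carr X. nrm X y < r \<and> nrm X (y - x) < \<delta> \<longrightarrow>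
          nrm (blin_space X (blin_space X Y)) (D2 y - D2 x) < e))"


section \<open>Classical derivatives and smooth functions\<close>

definition partial_deriv ::
    "'d::finite \<Rightarrow> (real^'d \<Rightarrow> 'b::real_normed_vector) \<Rightarrow> real^'d \<Rightarrow> 'b"
  where "partial_deriv i f x = vector_derivative (\<lambda>h. f (x + h *\<^sub>R axis i 1)) (at 0)"

definition iter_partial ::
    "'d::finite list \<Rightarrow> (real^'d \<Rightarrow> 'b::real_normed_vector) \<Rightarrow> real^'d \<Rightarrow> 'b"
  where "iter_partial js f = foldr partial_deriv js f"

definition smooth :: "(real^'d::finite \<Rightarrow> 'b::real_normed_vector) \<Rightarrow> bool"
  where "smooth f \<longleftrightarrow> (\<forall>js x. iter_partial js f differentiable (at x))"

definition gradient :: "(real^'d::finite \<Rightarrow> complex) \<Rightarrow> real^'d \<Rightarrow> complex^'d"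
  where "gradient f x = (\<chi> i. partial_deriv i f x)"

definition divergence :: "(real^'d::finite \<Rightarrow> complex^'d) \<Rightarrow> real^'d \<Rightarrow> complex"
  where "divergence f x = (\<Sum>i\<in>UNIV. partial_deriv i (\<lambda>y. f y $ i) x)"

definition laplacian :: "(real^'d::finite \<Rightarrow> complex^'d) \<Rightarrow> real^'d \<Rightarrow> complex^'d"
  where "laplacian f x = (\<Sum>i\<in>UNIV. partial_deriv i (partial_deriv i f) x)"

definition cnj_vec :: "complex^'d::finite \<Rightarrow> complex^'d"
  where "cnj_vec z = (\<chi> j. cnj (z $ j))"

text \<open>The bilinear product without conjugation; the system uses it as \<open>u \<cdot> cnj v\<close>.\<close>

definition cdot :: "complex^'d::finite \<Rightarrow> complex^'d \<Rightarrow> complex"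
  where "cdot y z = (\<Sum>j\<in>UNIV. y $ j * z $ j)"


section \<open>Tempered distributions and Sobolev spaces\<close>

definition schwartz :: "(real^'d::finite \<Rightarrow> complex) \<Rightarrow> bool"
  where "schwartz \<phi> \<longleftrightarrow> smooth \<phi> \<and>
    (\<forall>k js. bounded (range (\<lambda>x. (1 + norm x) ^ k * norm (iter_partial js \<phi> x))))"

definition schwartz_seminorm :: "nat \<Rightarrow> (real^'d::finite \<Rightarrow> complex) \<Rightarrow> real"
  where "schwartz_seminorm N \<phi> =
    (SUP (js, x)\<in>{js. length js \<le> N} \<times> UNIV. (1 + norm x) ^ N * norm (iter_partial js \<phi> x))"

type_synonym 'd distr = "((real, 'd) vec \<Rightarrow> complex) \<Rightarrow> complex"

definition tempered :: "'d::finite distr \<Rightarrow> bool"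
  where "tempered F \<longleftrightarrow>
    (\<forall>\<phi> \<psi>. schwartz \<phi> \<longrightarrow> schwartz \<psi> \<longrightarrow> F (\<lambda>x. \<phi> x + \<psi> x) = F \<phi> + F \<psi>) \<and>
    (\<forall>c \<phi>. schwartz \<phi> \<longrightarrow> F (\<lambda>x. c * \<phi> x) = c * F \<phi>) \<and>
    (\<exists>N C. \<forall>\<phi>. schwartz \<phi> \<longrightarrow> norm (F \<phi>) \<le> C * schwartz_seminorm N \<phi>) \<and>
    (\<forall>\<phi>. \<not> schwartz \<phi> \<longrightarrow> F \<phi> = 0)"

definition fourier :: "(real^'d::finite \<Rightarrow> complex) \<Rightarrow> real^'d \<Rightarrow> complex"
  where "fourier \<phi> \<xi> = (LINT x|lborel. cis (- (x \<bullet> \<xi>)) * \<phi> x)"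

text \<open>The Fourier transform of the tempered distribution \<open>F\<close>, given by \<open>\<phi> \<mapsto> F (fourier \<phi>)\<close>, is the
  function \<open>g\<close>; such a \<open>g\<close> is unique up to null sets.\<close>

definition has_fourier_transform :: "'d::finite distr \<Rightarrow> (real^'d \<Rightarrow> complex) \<Rightarrow> bool"
  where "has_fourier_transform F g \<longleftrightarrow> g \<in> borel_measurable lborel \<and>
    (\<forall>\<phi>. schwartz \<phi> \<longrightarrow>
       integrable lborel (\<lambda>\<xi>. g \<xi> * \<phi> \<xi>) \<and> F (fourier \<phi>) = (LINT \<xi>|lborel. g \<xi> * \<phi> \<xi>))"

definition fourier_transform :: "'d::finite distr \<Rightarrow> real^'d \<Rightarrow> complex"
  where "fourier_transform F = (SOME g. has_fourier_transform F g)"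

definition sobolev :: "real \<Rightarrow> 'd::finite distr nspace"
  where "sobolev s =
    ({F. tempered F \<and>
         (\<exists>g. has_fourier_transform F g \<and>
              integrable lborel (\<lambda>\<xi>. (1 + (norm \<xi>)\<^sup>2) powr s * (norm (g \<xi>))\<^sup>2))},
     \<lambda>F. sqrt (LINT \<xi>|lborel. (1 + (norm \<xi>)\<^sup>2) powr s * (norm (fourier_transform F \<xi>))\<^sup>2))"

text \<open>The distribution represented by a function, componentwise.\<close>

definition distr_of :: "(real^'d::finite \<Rightarrow> complex^'d) \<Rightarrow> ('d distr)^'d"
  where "distr_of f =
    (\<chi> j. (\<lambda>\<phi>. if schwartz \<phi> then (LINT x|lborel. f x $ j * \<phi> x) else 0))"

text \<open>Elements of the intersection of all \<open>H\<^sup>\<sigma>\<close> are identified with their smooth representatives.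
  The integrability condition says that \<open>f\<close> defines a distribution at all (the integral of a
  non-integrable function is \<open>0\<close> by convention).\<close>

definition H_infty :: "(real^'d::finite \<Rightarrow> complex^'d) \<Rightarrow> bool"
  where "H_infty f \<longleftrightarrow> smooth f \<and>
    (\<forall>\<phi> j. schwartz \<phi> \<longrightarrow> integrable lborel (\<lambda>x. f x $ j * \<phi> x)) \<and>
    (\<forall>\<sigma>. distr_of f \<in> carr (vec_space (sobolev \<sigma>)))"

definition distr_curve ::
    "real \<Rightarrow> (real \<Rightarrow> real^'d::finite \<Rightarrow> complex^'d) \<Rightarrow> real \<Rightarrow> ('d distr)^'d"
  where "distr_curve T u = (\<lambda>t. if t \<in> {0..T} then distr_of (u t) else 0)"

definition C_H_infty :: "real \<Rightarrow> (real \<Rightarrow> real^'d::finite \<Rightarrow> complex^'d) \<Rightarrow> bool"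
  where "C_H_infty T u \<longleftrightarrow>
    (\<forall>t\<in>{0..T}. H_infty (u t)) \<and>
    (\<forall>\<sigma>. distr_curve T u \<in> carr (curve_space T (vec_space (sobolev \<sigma>))))"


section \<open>The system and its flow map\<close>

definition smooth_solution ::
    "real \<Rightarrow> real \<Rightarrow> real \<Rightarrow> real \<Rightarrow>
     (real^'d::finite \<Rightarrow> complex^'d) \<Rightarrow> (real^'d \<Rightarrow> complex^'d) \<Rightarrow> (real^'d \<Rightarrow> complex^'d) \<Rightarrow>
     (real \<Rightarrow> real^'d \<Rightarrow> complex^'d) \<Rightarrow> (real \<Rightarrow> real^'d \<Rightarrow> complex^'d) \<Rightarrow>
     (real \<Rightarrow> real^'d \<Rightarrow> complex^'d) \<Rightarrow> bool"
  where "smooth_solution \<alpha> \<beta> \<gamma> T u0 v0 w0 u v w \<longleftrightarrow>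
    C_H_infty T u \<and> C_H_infty T v \<and> C_H_infty T w \<and>
    u 0 = u0 \<and> v 0 = v0 \<and> w 0 = w0 \<and>
    (\<forall>t\<in>{0..T}. \<forall>x. \<exists>u' v' w'.
       ((\<lambda>\<tau>. u \<tau> x) has_vector_derivative u') (at t within {0..T}) \<and>
       ((\<lambda>\<tau>. v \<tau> x) has_vector_derivative v') (at t within {0..T}) \<and>
       ((\<lambda>\<tau>. w \<tau> x) has_vector_derivative w') (at t within {0..T}) \<and>
       \<i> *s u' + \<alpha> *\<^sub>R laplacian (u t) x = - (divergence (w t) x *s v t x) \<and>
       \<i> *s v' + \<beta> *\<^sub>R laplacian (v t) x = - (divergence (\<lambda>y. cnj_vec (w t y)) x *s u t x) \<and>
       \<i> *s w' + \<gamma> *\<^sub>R laplacian (w t) x = gradient (\<lambda>y. cdot (u t y) (cnj_vec (v t y))) x)"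

definition flow_map_C2 :: "'d::finite itself \<Rightarrow> real \<Rightarrow> real \<Rightarrow> real \<Rightarrow> real \<Rightarrow> bool"
  where "flow_map_C2 (_ :: 'd itself) \<alpha> \<beta> \<gamma> s \<longleftrightarrow>
    (let Hs = (vec_space (sobolev s) :: (('d distr)^'d) nspace); X = cube_space Hs in
     \<exists>T>0. \<exists>\<rho>>0. \<exists>S.
       (\<forall>\<Phi>\<in>carr X. nrm X \<Phi> \<le> \<rho> \<longrightarrow> S \<Phi> \<in> carr (cube_space (curve_space T Hs))) \<and>
       C2_near_0 X (cube_space (curve_space T Hs)) S \<and>
       (\<forall>u0 v0 w0 u v w.
          H_infty u0 \<and> H_infty v0 \<and> H_infty w0 \<and>
          nrm X (distr_of u0, distr_of v0, distr_of w0) \<le> \<rho> \<and>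
          smooth_solution \<alpha> \<beta> \<gamma> T u0 v0 w0 u v w \<longrightarrow>
          S (distr_of u0, distr_of v0, distr_of w0) =
            (distr_curve T u, distr_curve T v, distr_curve T w)))"

end

theory Submission
  imports Defs "HOL-Probability.Characteristic_Functions" "HOL-Probability.Sinc_Integral"
begin

text \<open>
  A flow map that is \<open>C\<^sup>2\<close> in \<open>H\<^sup>s\<close> makes the second Picard iterate a bounded bilinear operator on \<open>H\<^sup>s\<close>. To see
  this, data with compactly supported Fourier transform is scaled by a small \<open>\<epsilon>\<close>; its smooth solution on \<open>[0,T]\<close>
  comes from a contraction in exponentially weighted spaces on the Fourier side, and equals
  \<open>\<epsilon>\<close> times the free solution plus \<open>\<epsilon>\<^sup>2\<close> times the second iterate plus \<open>O(\<epsilon>\<^sup>3)\<close>.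

  The iterate is an integral over \<open>\<eta>\<close> whose phase is \<open>a \<bar>\<xi>\<bar>\<^sup>2 - g \<bar>\<eta>\<bar>\<^sup>2 - b \<bar>\<xi> - \<eta>\<bar>\<^sup>2\<close>. Choosing \<open>p\<close> and \<open>q\<close> with
  \<open>a (p + q)\<^sup>2 = g p\<^sup>2 + b q\<^sup>2\<close> and data concentrated near \<open>p N e\<^sub>k\<close> and \<open>q N e\<^sub>k\<close>, in slabs of width \<open>1/N\<close> along \<open>e\<^sub>k\<close> or,
  if the gradient of the phase vanishes too, in balls of radius \<open>1\<close>, keeps the phase bounded. There is then no
  cancellation, and the derivative in the nonlinearity contributes a factor \<open>N\<close>. The slabs cost \<open>N\<^sup>1\<^sup>/\<^sup>2\<close> and a data
  frequency \<open>q N\<close> with \<open>q \<noteq> 0\<close> costs \<open>N\<^sup>s\<close>, so boundedness fails as \<open>N \<rightarrow> \<infinity>\<close>. One can take \<open>q = 0\<close> if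
  \<open>(\<alpha> - \<gamma>)(\<beta> + \<gamma>) = 0\<close>; for \<open>q = 1\<close> a real root \<open>p\<close> exists if \<open>\<theta> \<le> 0\<close>, and it is a double root if \<open>\<theta> = 0\<close>.
\<close>

section \<open>Rapidly decreasing functions\<close>

text \<open>Little is known about \<open>S\<close>: it is twice differentiable near 0 and gives the
  right answer on data whose smooth solution lives on all of \<open>[0,T]\<close>, with
  \<open>T\<close> prescribed. So solutions are needed on an interval that cannot be shortened,
  although the nonlinearity loses a derivative. A norm with exponential rate
  \<open>1 + T - t\<close> in frequency achieves this; smallness comes from
  \<open>\<epsilon>\<close> alone.

  The number \<theta> is a discriminant. For q = 1 the resonance condition of the first equation
  reads (\<alpha> - \<gamma>) p^2 + 2 \<alpha> p + (\<alpha> - \<beta>) = 0, and a quarter of its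
  discriminant is \<alpha>^2 - (\<alpha> - \<gamma>)(\<alpha> - \<beta>) = -\<theta>.

  To isolate the second iterate, the datum of the unknown under observation is set to zero, which
  removes its term of order \<open>\<epsilon>\<close>. With \<Lambda> the inverse width of the slabs
  and R = N or, if q = 0, R = 1, boundedness forces N <= C \<Lambda>^(1/2) R^s. For q nonzero,
  \<Lambda> = N gives the threshold 1/2 and \<Lambda> = 1 the threshold 1.\<close>

definition decay_weight :: "real^'d::finite \<Rightarrow> real"
  where "decay_weight x = (1 + norm x) ^ (2 * CARD('d))"

lemma decay_weight_ge_1: "1 \<le> decay_weight x"
  by (simp add: decay_weight_def)

lemma decay_weight_pos: "0 < decay_weight x"
  using decay_weight_ge_1[of x] by linarith

lemma continuous_on_decay_weight [continuous_intros]: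
  "continuous_on S f \<Longrightarrow> continuous_on S (\<lambda>x. decay_weight (f x))"
  unfolding decay_weight_def by (intro continuous_intros)

text \<open>Each of the \<open>CARD('d)\<close> factors is at most
  \<open>(1 + norm x)\<^sup>2\<close>, which explains the exponent in \<open>decay_weight\<close>.
  The product form reduces integrability of the inverse weight to one dimension.\<close>

lemma prod_Basis_le_decay_weight:
  fixes x :: "real^'d::finite"
  shows "(\<Prod>b\<in>Basis. 1 + (x \<bullet> b)\<^sup>2) \<le> decay_weight x"
proof -
  have "1 + (x \<bullet> b)\<^sup>2 \<le> (1 + norm x)\<^sup>2" if "b \<in> Basis" for b
  proof -
    have "(x \<bullet> b)\<^sup>2 \<le> (norm x)\<^sup>2"
      using Basis_le_norm[OF that, of x] by (metis abs_le_square_iff abs_norm_cancel)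
    then show ?thesis
    proof -
      assume "(x \<bullet> b)\<^sup>2 \<le> (norm x)\<^sup>2"
      moreover have "(1 + norm x)\<^sup>2 = 1 + (norm x)\<^sup>2 + 2 * norm x" by (simp add: power2_sum)
      ultimately show ?thesis using norm_ge_zero[of x] by linarith
    qed
  qed
  then have "(\<Prod>b\<in>Basis. 1 + (x \<bullet> b)\<^sup>2) \<le> (\<Prod>b\<in>(Basis::(real^'d) set). (1 + norm x)\<^sup>2)"
    by (intro prod_mono) (auto intro: add_nonneg_nonneg)
  also have "\<dots> = decay_weight x"
    by (simp add: decay_weight_def power_mult)
  finally show ?thesis .
qed

lemma integrable_inverse_decay_weight:
  "integrable lborel (\<lambda>x::real^'d::finite. 1 / decay_weight x)"
proof (rule integrableI_bounded)
  show "(\<lambda>x::real^'d. 1 / decay_weight x) \<in> borel_measurable lborel"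
    unfolding decay_weight_def by measurable
  have one: "integrable lborel (\<lambda>x::real. inverse (1 + x\<^sup>2))"
    using integrable_inverse_1_plus_square by (simp add: set_integrable_def)
  have "(\<integral>\<^sup>+(x::real^'d). ennreal (norm (1 / decay_weight x)) \<partial>lborel)
      \<le> (\<integral>\<^sup>+(x::real^'d). (\<Prod>b\<in>Basis. ennreal (inverse (1 + (x \<bullet> b)\<^sup>2))) \<partial>lborel)"
  proof (rule nn_integral_mono)
    fix x :: "real^'d"
    have "0 < (\<Prod>b\<in>Basis. 1 + (x \<bullet> b)\<^sup>2)"
      by (intro prod_pos) (simp add: add_pos_nonneg)
    then have "1 / decay_weight x \<le> (\<Prod>b\<in>Basis. inverse (1 + (x \<bullet> b)\<^sup>2))"
      using prod_Basis_le_decay_weight[of x]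
      by (simp add: prod_inversef[symmetric] inverse_eq_divide frac_le prod_dividef)
    then show "ennreal (norm (1 / decay_weight x)) \<le> (\<Prod>b\<in>Basis. ennreal (inverse (1 + (x \<bullet> b)\<^sup>2)))"
      by (subst prod_ennreal) (auto simp: decay_weight_pos less_imp_le intro!: ennreal_leI)
  qed
  also have "\<dots> = (\<Prod>b\<in>(Basis::(real^'d) set). \<integral>\<^sup>+x. ennreal (inverse (1 + x\<^sup>2)) \<partial>lborel)"
    by (intro nn_integral_lborel_prod) auto
  also have "\<dots> < \<infinity>"
  proof -
    have "(\<integral>\<^sup>+x. ennreal (inverse (1 + x\<^sup>2)) \<partial>lborel) < \<infinity>"
      using integrableD(2)[OF one] by (simp add: top.not_eq_extremum)
    then show ?thesis
      by (simp add: power_less_top_ennreal)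
  qed
  finally show "(\<integral>\<^sup>+(x::real^'d). ennreal (norm (1 / decay_weight x)) \<partial>lborel) < \<infinity>" .
qed

text \<open>No derivatives occur: this is the class for Fourier transforms, where decay alone makes
  the inverse integral smooth. It is stable under multiplication by continuous functions of
  polynomial growth, in particular by the symbols of derivatives.\<close>

definition rapid :: "(real^'d::finite \<Rightarrow> complex) \<Rightarrow> bool"
  where "rapid f \<longleftrightarrow> continuous_on UNIV f \<and> (\<forall>k. \<exists>M. \<forall>x. (1 + norm x) ^ k * norm (f x) \<le> M)"

lemma rapid_continuous: "rapid f \<Longrightarrow> continuous_on UNIV f"
  by (simp add: rapid_def)

lemma rapid_measurable [measurable_dest]: "rapid f \<Longrightarrow> f \<in> borel_measurable borel"
  using rapid_continuous by (rule borel_measurable_continuous_onI)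

lemma rapidE:
  assumes "rapid f"
  obtains M where "0 \<le> M" "\<And>x. (1 + norm x) ^ k * norm (f x) \<le> M"
proof -
  obtain M where M: "\<And>x. (1 + norm x) ^ k * norm (f x) \<le> M"
    using assms by (auto simp: rapid_def)
  have "0 \<le> (1 + norm (0::real^'a)) ^ k * norm (f 0)" by simp
  also note M
  finally show ?thesis using that M by blast
qed

lemma rapid_power_bound:
  fixes f :: "real^'d::finite \<Rightarrow> complex"
  assumes "rapid f"
  obtains M where "0 \<le> M" "\<And>x. (1 + norm x) ^ k * norm (f x) \<le> M / decay_weight x"
proof -
  obtain M where M: "0 \<le> M" "\<And>x. (1 + norm x) ^ (k + 2 * CARD('d)) * norm (f x) \<le> M"
    using rapidE[OF assms] by blast
  have "(1 + norm x) ^ k * norm (f x) \<le> M / decay_weight x" for x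
    using M(2)[of x] decay_weight_pos[of x]
    by (simp add: pos_le_divide_eq decay_weight_def power_add mult_ac)
  with M(1) show ?thesis using that by blast
qed

lemma rapid_integrable_power:
  fixes f :: "real^'d::finite \<Rightarrow> complex"
  assumes "rapid f"
  shows "integrable lborel (\<lambda>x. (1 + norm x) ^ k * norm (f x))"
proof -
  obtain M where M: "0 \<le> M" "\<And>x. (1 + norm x) ^ k * norm (f x) \<le> M / decay_weight x"
    using rapid_power_bound[OF assms] by blast
  note [measurable] = rapid_measurable[OF assms]
  show ?thesis
  proof (rule Bochner_Integration.integrable_bound)
    show "integrable lborel (\<lambda>x::real^'d. M * (1 / decay_weight x))"
      by (intro integrable_mult_right integrable_inverse_decay_weight)
    show "AE x in lborel. norm ((1 + norm x) ^ k * norm (f x)) \<le> norm (M * (1 / decay_weight x))"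
    proof (rule AE_I2)
      fix x :: "real^'d"
      show "norm ((1 + norm x) ^ k * norm (f x)) \<le> norm (M * (1 / decay_weight x))"
        using M(1) M(2)[of x] decay_weight_pos[of x] by (simp add: abs_mult)
    qed
  qed measurable
qed

lemma rapid_integrable: "rapid f \<Longrightarrow> integrable lborel f"
proof -
  assume f: "rapid f"
  note [measurable] = rapid_measurable[OF f]
  show "integrable lborel f"
    by (rule Bochner_Integration.integrable_bound[OF rapid_integrable_power[OF f, of 0]]) auto
qed

lemma rapid_mult:
  fixes f g :: "real^'d::finite \<Rightarrow> complex"
  assumes f: "rapid f" and g: "continuous_on UNIV g" "\<And>x. norm (g x) \<le> C * (1 + norm x) ^ m"
  shows "rapid (\<lambda>x. g x * f x)"
  unfolding rapid_def
proof safe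
  show "continuous_on UNIV (\<lambda>x. g x * f x)"
    by (intro continuous_intros g rapid_continuous[OF f])
  fix k
  obtain M where M: "0 \<le> M" "\<And>x. (1 + norm x) ^ (k + m) * norm (f x) \<le> M"
    using rapidE[OF f] by blast
  have C: "0 \<le> C"
    using order_trans[OF norm_ge_zero g(2)[of 0]] by simp
  have "(1 + norm x) ^ k * norm (g x * f x) \<le> C * M" for x
  proof -
    have "(1 + norm x) ^ k * norm (g x * f x) \<le> (1 + norm x) ^ k * ((C * (1 + norm x) ^ m) * norm (f x))"
      unfolding norm_mult by (intro mult_left_mono mult_right_mono g) auto
    also have "\<dots> = C * ((1 + norm x) ^ (k + m) * norm (f x))"
      by (simp add: power_add)
    also have "\<dots> \<le> C * M"
      by (intro mult_left_mono M C)
    finally show ?thesis .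
  qed
  then show "\<exists>M. \<forall>x. (1 + norm x) ^ k * norm (g x * f x) \<le> M" by blast
qed

lemma rapid_cmult: "rapid f \<Longrightarrow> rapid (\<lambda>x. c * f x)"
  by (rule rapid_mult[where C = "norm c" and m = 0]) auto

lemma rapid_coord: "rapid f \<Longrightarrow> rapid (\<lambda>x. complex_of_real (x $ i) * f x)"
proof (rule rapid_mult[where C = 1 and m = 1])
  show "norm (complex_of_real (x $ i)) \<le> 1 * (1 + norm x) ^ 1" for x :: "real^'a"
    using component_le_norm_cart[of x i] by simp
qed (auto intro!: continuous_intros)

lemma rapid_add:
  assumes "rapid f" "rapid g"
  shows "rapid (\<lambda>x. f x + g x)"
  unfolding rapid_def
proof safe
  show "continuous_on UNIV (\<lambda>x. f x + g x)"
    by (intro continuous_intros rapid_continuous assms)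
  fix k
  obtain M where M: "\<And>x. (1 + norm x) ^ k * norm (f x) \<le> M"
    using rapidE[OF assms(1)] by blast
  obtain N where N: "\<And>x. (1 + norm x) ^ k * norm (g x) \<le> N"
    using rapidE[OF assms(2)] by blast
  have "(1 + norm x) ^ k * norm (f x + g x) \<le> M + N" for x
  proof -
    have "(1 + norm x) ^ k * norm (f x + g x) \<le> (1 + norm x) ^ k * (norm (f x) + norm (g x))"
      by (intro mult_left_mono norm_triangle_ineq) auto
    then show ?thesis using M[of x] N[of x] by (simp add: distrib_left)
  qed
  then show "\<exists>M. \<forall>x. (1 + norm x) ^ k * norm (f x + g x) \<le> M" by blast
qed

lemma rapid_cmod_cong:
  assumes "rapid f" "continuous_on UNIV g" "\<And>x. norm (g x) \<le> norm (f x)"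
  shows "rapid g"
  unfolding rapid_def
proof safe
  fix k
  obtain M where M: "\<And>x. (1 + norm x) ^ k * norm (f x) \<le> M"
    using rapidE[OF assms(1)] by blast
  have "(1 + norm x) ^ k * norm (g x) \<le> M" for x
    by (rule order_trans[OF mult_left_mono[OF assms(3)] M]) simp
  then show "\<exists>M. \<forall>x. (1 + norm x) ^ k * norm (g x) \<le> M" by blast
qed fact

lemma rapid_reflect: "rapid f \<Longrightarrow> rapid (\<lambda>x. f (- x))"
  unfolding rapid_def
proof safe
  assume *: "continuous_on UNIV f" "\<forall>k. \<exists>M. \<forall>x. (1 + norm x) ^ k * cmod (f x) \<le> M"
  show "continuous_on UNIV (\<lambda>x. f (- x))"
    by (rule continuous_on_compose2[OF *(1)]) (auto intro!: continuous_intros)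
  fix k
  obtain M where "\<And>x. (1 + norm x) ^ k * cmod (f x) \<le> M" using * by blast
  from this[of "- _"] show "\<exists>M. \<forall>x. (1 + norm x) ^ k * cmod (f (- x)) \<le> M" by auto
qed

lemma rapid_cnj: "rapid f \<Longrightarrow> rapid (\<lambda>x. cnj (f x))"
  by (rule rapid_cmod_cong[of f]) (auto intro!: continuous_on_cnj dest: rapid_continuous)


section \<open>The inverse Fourier integral\<close>

definition ift :: "(real^'d::finite \<Rightarrow> complex) \<Rightarrow> real^'d \<Rightarrow> complex"
  where "ift f x = (LINT \<xi>|lborel. cis (x \<bullet> \<xi>) * f \<xi>)"

lemma integrable_cis_mult:
  fixes f :: "real^'d::finite \<Rightarrow> complex"
  assumes "integrable lborel f"
  shows "integrable lborel (\<lambda>\<xi>. cis (x \<bullet> \<xi>) * f \<xi>)"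
proof (rule Bochner_Integration.integrable_bound[OF assms])
  have "(\<lambda>\<xi>. cis (x \<bullet> \<xi>)) \<in> borel_measurable borel"
    by (intro borel_measurable_continuous_onI continuous_intros)
  then show "(\<lambda>\<xi>. cis (x \<bullet> \<xi>) * f \<xi>) \<in> borel_measurable lborel"
    using borel_measurable_integrable[OF assms] by simp
qed (simp add: norm_mult)

lemma norm_ift_le: "norm (ift f x) \<le> (LINT \<xi>|lborel. norm (f \<xi>))"
  unfolding ift_def using integral_norm_bound[of lborel "\<lambda>\<xi>. cis (x \<bullet> \<xi>) * f \<xi>"]
  by (simp add: norm_mult)

lemma cis_taylor: "norm (cis y - 1 - \<i> * complex_of_real y) \<le> y\<^sup>2 / 2"
  using iexp_approx1[of y 1]
  by (simp add: cis_conv_exp diff_diff_eq flip: power2_eq_square)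

text \<open>The first order remainder of \<open>cis\<close> is quadratic, so the error of the linear
  approximation is at most the square of \<open>norm h\<close> times the integral of
  \<open>(1 + norm \<xi>)\<^sup>2 * norm (f \<xi>)\<close>, which is finite by rapid decay.\<close>

lemma has_derivative_ift:
  fixes f :: "real^'d::finite \<Rightarrow> complex"
  assumes f: "rapid f"
  shows "(ift f has_derivative
    (\<lambda>h. \<Sum>i\<in>UNIV. (h $ i) *\<^sub>R ift (\<lambda>\<xi>. \<i> * complex_of_real (\<xi> $ i) * f \<xi>) x)) (at x)"
proof (rule has_derivativeI_sandwich[where e = 1])
  let ?D = "\<lambda>h. \<Sum>i\<in>UNIV. (h $ i) *\<^sub>R ift (\<lambda>\<xi>. \<i> * complex_of_real (\<xi> $ i) * f \<xi>) x"
  let ?K = "LINT \<xi>|lborel. (1 + norm \<xi>)\<^sup>2 * norm (f \<xi>)"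
  show "bounded_linear ?D"
    by (intro bounded_linear_sum bounded_linear_scaleR_const bounded_linear_vec_nth)
  show "((\<lambda>y. norm (y - x) * ?K) \<longlongrightarrow> 0) (at x within UNIV)"
    by (auto intro!: tendsto_eq_intros)
  have int: "integrable lborel f" by (rule rapid_integrable[OF f])
  have inti: "integrable lborel (\<lambda>\<xi>. \<i> * complex_of_real (\<xi> $ i) * f \<xi>)" for i
    using rapid_integrable[OF rapid_cmult[OF rapid_coord[OF f]]] by (simp add: mult.assoc)
  have intK: "integrable lborel (\<lambda>\<xi>. (1 + norm \<xi>)\<^sup>2 * norm (f \<xi>))"
    by (rule rapid_integrable_power[OF f])
  fix y assume "y \<noteq> x"
  define h where "h = y - x"
  have D: "?D h = (LINT \<xi>|lborel. (\<Sum>i\<in>UNIV. (h $ i) *\<^sub>R (cis (x \<bullet> \<xi>) * (\<i> * complex_of_real (\<xi> $ i) * f \<xi>))))"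
    unfolding ift_def
    by (subst Bochner_Integration.integral_sum) (auto intro!: integrable_cis_mult inti)
  also have "\<dots> = (LINT \<xi>|lborel. \<i> * complex_of_real (h \<bullet> \<xi>) * cis (x \<bullet> \<xi>) * f \<xi>)"
    by (intro Bochner_Integration.integral_cong)
       (auto simp: inner_vec_def sum_distrib_left sum_distrib_right scaleR_conv_of_real mult_ac)
  finally have D: "?D h = (LINT \<xi>|lborel. \<i> * complex_of_real (h \<bullet> \<xi>) * cis (x \<bullet> \<xi>) * f \<xi>)" .
  have intD: "integrable lborel (\<lambda>\<xi>. \<i> * complex_of_real (h \<bullet> \<xi>) * cis (x \<bullet> \<xi>) * f \<xi>)"
  proof -
    have "integrable lborel (\<lambda>\<xi>. (\<Sum>i\<in>UNIV. (h $ i) *\<^sub>R (cis (x \<bullet> \<xi>) * (\<i> * complex_of_real (\<xi> $ i) * f \<xi>))))"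
      by (intro Bochner_Integration.integrable_sum integrable_scaleR_right integrable_cis_mult inti)
    also have "(\<lambda>\<xi>. (\<Sum>i\<in>UNIV. (h $ i) *\<^sub>R (cis (x \<bullet> \<xi>) * (\<i> * complex_of_real (\<xi> $ i) * f \<xi>))))
      = (\<lambda>\<xi>. \<i> * complex_of_real (h \<bullet> \<xi>) * cis (x \<bullet> \<xi>) * f \<xi>)"
      by (auto simp: inner_vec_def sum_distrib_left sum_distrib_right scaleR_conv_of_real mult_ac)
    finally show ?thesis .
  qed
  have "ift f y - ift f x - ?D h
      = (LINT \<xi>|lborel. cis (y \<bullet> \<xi>) * f \<xi> - cis (x \<bullet> \<xi>) * f \<xi> - \<i> * complex_of_real (h \<bullet> \<xi>) * cis (x \<bullet> \<xi>) * f \<xi>)"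
    unfolding D unfolding ift_def using integrable_cis_mult[OF int] intD
    by (subst Bochner_Integration.integral_diff; simp?)+
  also have "norm \<dots> \<le> (LINT \<xi>|lborel. (norm h)\<^sup>2 * ((1 + norm \<xi>)\<^sup>2 * norm (f \<xi>)))"
  proof (rule Bochner_Integration.integral_norm_bound_integral)
    show "integrable lborel (\<lambda>\<xi>. cis (y \<bullet> \<xi>) * f \<xi> - cis (x \<bullet> \<xi>) * f \<xi> - \<i> * complex_of_real (h \<bullet> \<xi>) * cis (x \<bullet> \<xi>) * f \<xi>)"
      by (intro Bochner_Integration.integrable_diff integrable_cis_mult int intD)
    show "integrable lborel (\<lambda>\<xi>. (norm h)\<^sup>2 * ((1 + norm \<xi>)\<^sup>2 * norm (f \<xi>)))"
      by (intro integrable_mult_right intK)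
    fix \<xi> :: "real^'d"
    have "cis (y \<bullet> \<xi>) * f \<xi> - cis (x \<bullet> \<xi>) * f \<xi> - \<i> * complex_of_real (h \<bullet> \<xi>) * cis (x \<bullet> \<xi>) * f \<xi>
      = cis (x \<bullet> \<xi>) * (cis (h \<bullet> \<xi>) - 1 - \<i> * complex_of_real (h \<bullet> \<xi>)) * f \<xi>"
      by (simp add: h_def algebra_simps cis_mult)
    then have "norm (cis (y \<bullet> \<xi>) * f \<xi> - cis (x \<bullet> \<xi>) * f \<xi> - \<i> * complex_of_real (h \<bullet> \<xi>) * cis (x \<bullet> \<xi>) * f \<xi>)
      = norm (cis (h \<bullet> \<xi>) - 1 - \<i> * complex_of_real (h \<bullet> \<xi>)) * norm (f \<xi>)"
      by (simp add: norm_mult)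
    also have "\<dots> \<le> (norm h)\<^sup>2 * (1 + norm \<xi>)\<^sup>2 * norm (f \<xi>)"
    proof (rule mult_right_mono)
      have "norm (cis (h \<bullet> \<xi>) - 1 - \<i> * complex_of_real (h \<bullet> \<xi>)) \<le> (h \<bullet> \<xi>)\<^sup>2"
        using cis_taylor[of "h \<bullet> \<xi>"] by (smt (verit) field_sum_of_halves zero_le_power2)
      also have "\<dots> \<le> (norm h * norm \<xi>)\<^sup>2"
        using Cauchy_Schwarz_ineq2[of h \<xi>] by (simp add: abs_le_square_iff[symmetric] abs_mult)
      also have "\<dots> \<le> (norm h)\<^sup>2 * (1 + norm \<xi>)\<^sup>2"
        by (simp add: power_mult_distrib mult_left_mono power_mono)
      finally show "norm (cis (h \<bullet> \<xi>) - 1 - \<i> * complex_of_real (h \<bullet> \<xi>)) \<le> (norm h)\<^sup>2 * (1 + norm \<xi>)\<^sup>2" .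
    qed simp
    finally show "norm (cis (y \<bullet> \<xi>) * f \<xi> - cis (x \<bullet> \<xi>) * f \<xi> - \<i> * complex_of_real (h \<bullet> \<xi>) * cis (x \<bullet> \<xi>) * f \<xi>)
      \<le> (norm h)\<^sup>2 * ((1 + norm \<xi>)\<^sup>2 * norm (f \<xi>))" by (simp add: mult_ac)
  qed
  also have "\<dots> = (norm h)\<^sup>2 * ?K"
    using intK by simp
  finally show "norm (ift f y - ift f x - ?D (y - x)) / norm (y - x) \<le> norm (y - x) * ?K"
    using \<open>y \<noteq> x\<close> by (simp add: h_def[symmetric] divide_le_eq power2_eq_square mult_ac)
qed simp

lemma partial_deriv_eq:
  assumes "(f has_derivative D) (at x)"
  shows "partial_deriv i f x = D (axis i 1)"
  unfolding partial_deriv_def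
proof (rule vector_derivative_at)
  have "((\<lambda>h. x + h *\<^sub>R axis i 1) has_derivative (\<lambda>h. h *\<^sub>R axis i 1)) (at 0)"
    by (auto intro!: derivative_eq_intros)
  from has_derivative_compose[OF this, of f D]
  have "((\<lambda>h. f (x + h *\<^sub>R axis i 1)) has_derivative (\<lambda>h. D (h *\<^sub>R axis i 1))) (at 0)"
    using assms by simp
  then show "((\<lambda>h. f (x + h *\<^sub>R axis i 1)) has_vector_derivative D (axis i 1)) (at 0)"
    unfolding has_vector_derivative_def
    using linear_cmul[OF bounded_linear.linear[OF has_derivative_bounded_linear[OF assms]]] by simp
qed

lemma partial_deriv_ift:
  assumes "rapid f"
  shows "partial_deriv i (ift f) = ift (\<lambda>\<xi>. \<i> * complex_of_real (\<xi> $ i) * f \<xi>)"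
proof
  fix x
  have "partial_deriv i (ift f) x = (\<Sum>j\<in>UNIV. (axis i 1 $ j) *\<^sub>R ift (\<lambda>\<xi>. \<i> * complex_of_real (\<xi> $ j) * f \<xi>) x)"
    by (rule partial_deriv_eq[OF has_derivative_ift[OF assms]])
  also have "\<dots> = (\<Sum>j\<in>UNIV. if j = i then ift (\<lambda>\<xi>. \<i> * complex_of_real (\<xi> $ j) * f \<xi>) x else 0)"
    by (intro sum.cong) (auto simp: axis_def)
  finally show "partial_deriv i (ift f) x = ift (\<lambda>\<xi>. \<i> * complex_of_real (\<xi> $ i) * f \<xi>) x"
    by simp
qed

lemma rapid_icoord: "rapid f \<Longrightarrow> rapid (\<lambda>\<xi>. \<i> * complex_of_real (\<xi> $ i) * f \<xi>)"
  using rapid_cmult[OF rapid_coord] by (simp add: mult.assoc)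


section \<open>Schwartz functions\<close>

lemma iter_partial_Nil [simp]: "iter_partial [] f = f"
  and iter_partial_Cons [simp]: "iter_partial (j # js) f = partial_deriv j (iter_partial js f)"
  and iter_partial_snoc: "iter_partial (js @ [j]) f = iter_partial js (partial_deriv j f)"
  by (simp_all add: iter_partial_def)

lemma smooth_differentiable: "smooth f \<Longrightarrow> f differentiable (at x)"
  unfolding smooth_def by (metis iter_partial_Nil)

lemma smooth_partial: "smooth f \<Longrightarrow> smooth (partial_deriv i f)"
  unfolding smooth_def by (metis iter_partial_snoc)

text \<open>Smoothness speaks of all iterated partial derivatives, for which no closed formula is at
  hand. It is enough to enclose the function in a class of differentiable functions that is stable
  under partial derivatives; the smoothness and Schwartz proofs below each name such a
  class.\<close>

lemma smoothI_class:
  assumes "f \<in> \<F>"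
    and "\<And>g x. g \<in> \<F> \<Longrightarrow> g differentiable (at x)"
    and "\<And>g i. g \<in> \<F> \<Longrightarrow> partial_deriv i g \<in> \<F>"
  shows "smooth f"
proof -
  have "iter_partial js f \<in> \<F>" for js
    by (induction js) (auto intro: assms)
  then show ?thesis unfolding smooth_def using assms(2) by blast
qed

lemma schwartzI_class:
  assumes f: "f \<in> \<F>"
    and d: "\<And>g x. g \<in> \<F> \<Longrightarrow> g differentiable (at x)"
    and p: "\<And>g i. g \<in> \<F> \<Longrightarrow> partial_deriv i g \<in> \<F>"
    and b: "\<And>g k. g \<in> \<F> \<Longrightarrow> \<exists>M. \<forall>x. (1 + norm x) ^ k * norm (g x) \<le> M"
  shows "schwartz f"
proof -
  have "iter_partial js f \<in> \<F>" for js
    by (induction js) (auto intro: f p)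
  then have "\<exists>M. \<forall>x. (1 + norm x) ^ k * norm (iter_partial js f x) \<le> M" for k js
    using b by blast
  then have "bounded (range (\<lambda>x. (1 + norm x) ^ k * norm (iter_partial js f x)))" for k js
    unfolding bounded_iff by (force simp: abs_mult)
  with smoothI_class[of f \<F>] f d p show ?thesis
    unfolding schwartz_def by blast
qed

lemma schwartz_partial: "schwartz f \<Longrightarrow> schwartz (partial_deriv i f)"
  unfolding schwartz_def using smooth_partial by (metis iter_partial_snoc)

lemma schwartz_differentiable: "schwartz f \<Longrightarrow> f differentiable (at x)"
  by (simp add: schwartz_def smooth_differentiable)

lemma schwartz_rapid: "schwartz f \<Longrightarrow> rapid f"
  unfolding rapid_def
proof safe
  assume f: "schwartz f"
  show "continuous_on UNIV f"
    using schwartz_differentiable[OF f] differentiable_imp_continuous_within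
    by (metis continuous_at_imp_continuous_on)
  fix k
  have "bounded (range (\<lambda>x. (1 + norm x) ^ k * norm (iter_partial [] f x)))"
    using f unfolding schwartz_def by blast
  then show "\<exists>M. \<forall>x. (1 + norm x) ^ k * norm (f x) \<le> M"
    unfolding bounded_iff by (auto intro: order_trans[OF abs_ge_self])
qed

lemma partial_deriv_frechet:
  "f differentiable (at x) \<Longrightarrow> partial_deriv i f x = frechet_derivative f (at x) (axis i 1)"
  by (rule partial_deriv_eq) (simp add: frechet_derivative_works)

lemma schwartz_add:
  assumes "schwartz f" "schwartz g"
  shows "schwartz (\<lambda>x. f x + g x)"
proof (rule schwartzI_class[where \<F> = "{\<lambda>x. f x + g x | f g. schwartz f \<and> schwartz g}"])
  show "(\<lambda>x. f x + g x) \<in> {\<lambda>x. f x + g x | f g. schwartz f \<and> schwartz g}"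
    using assms by blast
next
  fix h x assume "h \<in> {\<lambda>x. f x + g x | f g. schwartz f \<and> schwartz (g :: real^'a \<Rightarrow> complex)}"
  then show "h differentiable (at x)"
    by (elim CollectE exE conjE) (simp add: differentiable_add schwartz_differentiable)
next
  fix h i assume "h \<in> {\<lambda>x. f x + g x | f g. schwartz f \<and> schwartz (g :: real^'a \<Rightarrow> complex)}"
  then obtain f g where h: "h = (\<lambda>x. f x + g x)" and fg: "schwartz f" "schwartz g" by blast
  have "partial_deriv i h = (\<lambda>x. partial_deriv i f x + partial_deriv i g x)"
  proof
    fix x
    note D = schwartz_differentiable[OF fg(1), of x] schwartz_differentiable[OF fg(2), of x]
    have "(h has_derivative (\<lambda>y. frechet_derivative f (at x) y + frechet_derivative g (at x) y)) (at x)"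
      unfolding h using D by (intro has_derivative_add) (auto simp: frechet_derivative_works)
    from partial_deriv_eq[OF this, of i] D
    show "partial_deriv i h x = partial_deriv i f x + partial_deriv i g x"
      by (simp add: partial_deriv_frechet)
  qed
  with fg show "partial_deriv i h \<in> {\<lambda>x. f x + g x | f g. schwartz f \<and> schwartz g}"
    using schwartz_partial by blast
next
  fix h k assume "h \<in> {\<lambda>x. f x + g x | f g. schwartz f \<and> schwartz (g :: real^'a \<Rightarrow> complex)}"
  then have "rapid h" by (elim CollectE exE conjE) (simp add: rapid_add schwartz_rapid)
  then show "\<exists>M. \<forall>x. (1 + norm x) ^ k * norm (h x) \<le> M" by (simp add: rapid_def)
qed

lemma schwartz_cmult:
  assumes "schwartz f"
  shows "schwartz (\<lambda>x. c * f x)"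
proof (rule schwartzI_class[where \<F> = "{\<lambda>x. c * f x | f. schwartz f}"])
  show "(\<lambda>x. c * f x) \<in> {\<lambda>x. c * f x | f. schwartz f}"
    using assms by blast
next
  fix h x assume "h \<in> {\<lambda>x. c * f x | f. schwartz (f :: real^'a \<Rightarrow> complex)}"
  then show "h differentiable (at x)"
    by (elim CollectE exE conjE) (simp add: differentiable_mult schwartz_differentiable)
next
  fix h i assume "h \<in> {\<lambda>x. c * f x | f. schwartz (f :: real^'a \<Rightarrow> complex)}"
  then obtain f where h: "h = (\<lambda>x. c * f x)" and f: "schwartz f" by blast
  have "partial_deriv i h = (\<lambda>x. c * partial_deriv i f x)"
  proof
    fix x
    note D = schwartz_differentiable[OF f, of x]
    have "(h has_derivative (\<lambda>y. c * frechet_derivative f (at x) y)) (at x)"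
      unfolding h using D by (intro has_derivative_mult_right) (auto simp: frechet_derivative_works)
    from partial_deriv_eq[OF this, of i] D
    show "partial_deriv i h x = c * partial_deriv i f x"
      by (simp add: partial_deriv_frechet)
  qed
  with f show "partial_deriv i h \<in> {\<lambda>x. c * f x | f. schwartz f}"
    using schwartz_partial by blast
next
  fix h k assume "h \<in> {\<lambda>x. c * f x | f. schwartz (f :: real^'a \<Rightarrow> complex)}"
  then have "rapid h" by (elim CollectE exE conjE) (simp add: rapid_cmult schwartz_rapid)
  then show "\<exists>M. \<forall>x. (1 + norm x) ^ k * norm (h x) \<le> M" by (simp add: rapid_def)
qed

lemma schwartz_zero: "schwartz (\<lambda>x. 0)"
proof (rule schwartzI_class[where \<F> = "{\<lambda>x. 0}"])
  fix g :: "real^'a \<Rightarrow> complex" and i assume "g \<in> {\<lambda>x. 0}"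
  moreover have "partial_deriv i (\<lambda>x. 0 :: complex) = (\<lambda>x::real^'a. 0)"
    by (rule ext) (simp add: partial_deriv_def)
  ultimately show "partial_deriv i g \<in> {\<lambda>x. 0}" by simp
qed auto

text \<open>The products \<open>x $ j * f x\<close> alone do not form a stable class, since the
  product rule leaves a summand \<open>f\<close>; adding an arbitrary Schwartz function
  \<open>g\<close> absorbs it.\<close>

lemma schwartz_coord:
  assumes "schwartz f"
  shows "schwartz (\<lambda>x. complex_of_real (x $ j) * f x)"
proof -
  let ?F = "{\<lambda>x. complex_of_real (x $ j) * f x + g x | f g. schwartz f \<and> schwartz (g :: real^'a \<Rightarrow> complex)}"
  show ?thesis
  proof (rule schwartzI_class[where \<F> = ?F])
    show "(\<lambda>x. complex_of_real (x $ j) * f x) \<in> ?F"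
      by (rule CollectI, rule exI[of _ f], rule exI[of _ "\<lambda>x. 0"]) (simp add: assms schwartz_zero)
  next
    fix h x assume "h \<in> ?F"
    then obtain f g where h: "h = (\<lambda>x. complex_of_real (x $ j) * f x + g x)" and fg: "schwartz f" "schwartz g"
      by blast
    show "h differentiable (at x)"
      unfolding h
      by (intro differentiable_add differentiable_mult schwartz_differentiable fg
          bounded_linear_imp_differentiable bounded_linear_compose[OF bounded_linear_of_real]
          bounded_linear_vec_nth)
  next
    fix h i assume "h \<in> ?F"
    then obtain f g where h: "h = (\<lambda>x. complex_of_real (x $ j) * f x + g x)" and fg: "schwartz f" "schwartz g"
      by blast
    have "partial_deriv i h = (\<lambda>x. complex_of_real (x $ j) * partial_deriv i f x +
        ((if i = j then 1 else 0) * f x + partial_deriv i g x))"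
    proof
      fix x
      note D = schwartz_differentiable[OF fg(1), of x] schwartz_differentiable[OF fg(2), of x]
      have "((\<lambda>x::real^'a. complex_of_real (x $ j)) has_derivative (\<lambda>y. complex_of_real (y $ j))) (at x)"
        by (intro bounded_linear_imp_has_derivative bounded_linear_compose[OF bounded_linear_of_real]
            bounded_linear_vec_nth)
      then have "(h has_derivative (\<lambda>y. complex_of_real (x $ j) * frechet_derivative f (at x) y +
          complex_of_real (y $ j) * f x + frechet_derivative g (at x) y)) (at x)"
        unfolding h using D
        by (intro has_derivative_add has_derivative_mult) (auto simp: frechet_derivative_works)
      from partial_deriv_eq[OF this, of i] D
      show "partial_deriv i h x = complex_of_real (x $ j) * partial_deriv i f x +
        ((if i = j then 1 else 0) * f x + partial_deriv i g x)"
        by (simp add: partial_deriv_frechet axis_def)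
    qed
    moreover have "schwartz (\<lambda>x. (if i = j then 1 else 0) * f x + partial_deriv i g x)"
      by (intro schwartz_add schwartz_cmult schwartz_partial fg)
    ultimately show "partial_deriv i h \<in> ?F"
      using schwartz_partial[OF fg(1), of i]
      by (intro CollectI exI[of _ "partial_deriv i f"]
          exI[of _ "\<lambda>x. (if i = j then 1 else 0) * f x + partial_deriv i g x"]) simp
  next
    fix h k assume "h \<in> ?F"
    then have "rapid h"
      by (elim CollectE exE conjE) (simp add: rapid_add rapid_coord schwartz_rapid)
    then show "\<exists>M. \<forall>x. (1 + norm x) ^ k * norm (h x) \<le> M" by (simp add: rapid_def)
  qed
qed


section \<open>The Fourier transform on Schwartz functions\<close>

lemma integral_translation:
  fixes f :: "real^'d::finite \<Rightarrow> 'b::{banach, second_countable_topology}"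
  assumes [measurable]: "f \<in> borel_measurable borel"
  shows "(LINT x|lborel. f (c + x)) = (LINT x|lborel. f x)"
proof -
  have "(LINT x|lborel. f x) = (LINT x|distr lborel borel ((+) c). f x)"
    by (simp add: lborel_distr_plus)
  also have "\<dots> = (LINT x|lborel. f (c + x))"
    by (rule integral_distr) auto
  finally show ?thesis ..
qed

lemma lborel_scale:
  fixes c :: "real^'d::finite"
  assumes "h \<noteq> 0"
  shows "lborel = density (distr lborel borel (\<lambda>x. c + h *\<^sub>R x)) (\<lambda>_. ennreal (\<bar>h\<bar> ^ CARD('d)))"
  using lborel_affine[OF assms, of c] by simp

lemma integral_scale:
  fixes f :: "real^'d::finite \<Rightarrow> 'b::{banach, second_countable_topology}"
  assumes [measurable]: "f \<in> borel_measurable borel" and h: "h \<noteq> 0"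
  shows "(LINT x|lborel. f x) = \<bar>h\<bar> ^ CARD('d) *\<^sub>R (LINT x|lborel. f (c + h *\<^sub>R x))"
proof -
  have "(LINT x|lborel. f x) = (LINT x|density (distr lborel borel (\<lambda>x. c + h *\<^sub>R x)) (\<lambda>_. ennreal (\<bar>h\<bar> ^ CARD('d))). f x)"
    using lborel_scale[OF h, of c] by simp
  also have "\<dots> = \<bar>h\<bar> ^ CARD('d) *\<^sub>R (LINT x|lborel. f (c + h *\<^sub>R x))"
    by (subst integral_density) (auto simp: integral_distr)
  finally show ?thesis .
qed

lemma integral_reflect:
  fixes f :: "real^'d::finite \<Rightarrow> 'b::{banach, second_countable_topology}"
  assumes "f \<in> borel_measurable borel"
  shows "(LINT x|lborel. f (- x)) = (LINT x|lborel. f x)"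
  using integral_scale[OF assms, of "-1" 0] by simp

lemma integrable_scale:
  fixes f :: "real^'d::finite \<Rightarrow> 'b::{banach, second_countable_topology}"
  assumes "integrable lborel f" and h: "h \<noteq> 0"
  shows "integrable lborel (\<lambda>x. f (c + h *\<^sub>R x))"
proof -
  have [measurable]: "f \<in> borel_measurable borel"
    using borel_measurable_integrable[OF assms(1)] by simp
  have "integrable (density (distr lborel borel (\<lambda>x. c + h *\<^sub>R x)) (\<lambda>_. ennreal (\<bar>h\<bar> ^ CARD('d)))) f"
    using lborel_scale[OF h, of c] assms(1) by simp
  then show ?thesis
    using h integrable_scaleR_right[of "inverse (\<bar>h\<bar> ^ CARD('d))" lborel "\<lambda>x. \<bar>h\<bar> ^ CARD('d) *\<^sub>R f (c + h *\<^sub>R x)"]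
    by (simp add: integrable_density integrable_distr_eq)
qed

lemma fourier_eq_ift: "fourier f x = ift f (- x)"
  by (simp add: fourier_def ift_def inner_commute)

text \<open>Transfers the calculus of \<open>ift\<close> to \<open>fourier\<close>. Reflecting
  \<open>f\<close> instead of the argument of the transform keeps the form in which the derivatives
  of \<open>ift\<close> were computed.\<close>

lemma fourier_eq_ift_reflect:
  assumes "rapid f"
  shows "fourier f = ift (\<lambda>x. f (- x))"
proof
  fix \<xi>
  have [measurable]: "(\<lambda>x. cis (- (x \<bullet> \<xi>)) * f x) \<in> borel_measurable borel"
    by (intro borel_measurable_continuous_onI continuous_intros rapid_continuous assms)
  show "fourier f \<xi> = ift (\<lambda>x. f (- x)) \<xi>"
    unfolding fourier_def ift_def
    by (subst integral_reflect[symmetric]) (auto simp: inner_commute)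
qed

lemma partial_deriv_fourier:
  assumes "schwartz f"
  shows "partial_deriv i (fourier f) = fourier (\<lambda>x. (- \<i>) * (complex_of_real (x $ i) * f x))"
proof -
  have r: "rapid f" by (rule schwartz_rapid[OF assms])
  have "partial_deriv i (fourier f) = ift (\<lambda>\<xi>. \<i> * complex_of_real (\<xi> $ i) * f (- \<xi>))"
    unfolding fourier_eq_ift_reflect[OF r] by (rule partial_deriv_ift[OF rapid_reflect[OF r]])
  also have "\<dots> = fourier (\<lambda>x. (- \<i>) * (complex_of_real (x $ i) * f x))"
    by (subst fourier_eq_ift_reflect[OF rapid_cmult[OF rapid_coord[OF r]]]) (simp add: mult.assoc)
  finally show ?thesis .
qed

lemma fourier_differentiable:
  assumes "rapid f"
  shows "fourier f differentiable (at x)"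
  unfolding fourier_eq_ift_reflect[OF assms]
  using has_derivative_ift[OF rapid_reflect[OF assms]] by (rule differentiableI)

lemma le_double_plus: "a \<le> b + 1 \<Longrightarrow> 0 \<le> b \<Longrightarrow> 1 + a \<le> 2 * (1 + (b :: real))"
  by simp

text \<open>An integrable majorant for difference quotients, uniform in the step. The mean value
  inequality bounds the increment by the derivative along the segment; a shift of length at most 1
  changes \<open>1 + norm x\<close> by at most a factor 2, hence \<open>decay_weight\<close> by at
  most \<open>2 ^ (2 * CARD('d))\<close>.\<close>

lemma schwartz_difference_bound:
  assumes "schwartz f"
  obtains M where "0 \<le> M"
    and "\<And>x h. \<bar>h\<bar> \<le> 1 \<Longrightarrow> norm (f (x + h *\<^sub>R axis i 1) - f x) \<le> \<bar>h\<bar> * (M / decay_weight (x :: real^'d::finite))"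
proof -
  obtain M where M: "0 \<le> M" "\<And>x. norm (partial_deriv i f x) \<le> M / decay_weight x"
    using rapid_power_bound[OF schwartz_rapid[OF schwartz_partial[OF assms, of i]], of 0]
    by auto
  let ?M = "2 ^ (2 * CARD('d)) * M"
  have "norm (f (x + h *\<^sub>R axis i 1) - f x) \<le> \<bar>h\<bar> * (?M / decay_weight x)" if h: "\<bar>h\<bar> \<le> 1" for x h
  proof -
    define p where "p t = f (x + t *\<^sub>R axis i 1)" for t
    have p: "(p has_derivative (\<lambda>s. s *\<^sub>R partial_deriv i f (x + t *\<^sub>R axis i 1))) (at t within {-1..1})" for t
    proof -
      let ?y = "x + t *\<^sub>R axis i 1"
      have D: "f differentiable (at ?y)"
        by (rule schwartz_differentiable[OF assms])
      have "((\<lambda>t. x + t *\<^sub>R axis i 1) has_derivative (\<lambda>s. s *\<^sub>R axis i 1)) (at t within {-1..1})"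
        by (auto intro!: derivative_eq_intros)
      from has_derivative_compose[OF this, of f "frechet_derivative f (at ?y)"]
      have "(p has_derivative (\<lambda>s. frechet_derivative f (at ?y) (s *\<^sub>R axis i 1))) (at t within {-1..1})"
        using D unfolding p_def by (simp add: frechet_derivative_works)
      moreover have "frechet_derivative f (at ?y) (s *\<^sub>R axis i 1) = s *\<^sub>R partial_deriv i f ?y" for s
        using linear_frechet_derivative[OF D] by (simp add: partial_deriv_frechet[OF D] linear_cmul)
      ultimately show ?thesis by simp
    qed
    have "norm (p h - p 0) \<le> (?M / decay_weight x) * norm (h - 0)"
    proof (rule differentiable_bound[OF convex_real_interval(5) p])
      fix t :: real assume t: "t \<in> {-1..1}"
      let ?y = "x + t *\<^sub>R axis i 1"
      have "norm x \<le> norm ?y + norm (t *\<^sub>R axis i (1::real))"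
        using norm_triangle_ineq4[of ?y "t *\<^sub>R axis i 1"] by simp
      also have "\<dots> \<le> norm ?y + 1" using t by auto
      finally have "1 + norm x \<le> 2 * (1 + norm ?y)"
        by (rule le_double_plus[OF _ norm_ge_zero])
      then have "(1 + norm x) ^ (2 * CARD('d)) \<le> (2 * (1 + norm ?y)) ^ (2 * CARD('d))"
        by (intro power_mono) auto
      then have w: "decay_weight x \<le> 2 ^ (2 * CARD('d)) * decay_weight ?y"
        unfolding decay_weight_def power_mult_distrib .
      have "norm (partial_deriv i f ?y) \<le> M / decay_weight ?y" by (rule M)
      also have "\<dots> \<le> ?M / decay_weight x"
        using mult_left_mono[OF w M(1)] decay_weight_pos[of x] decay_weight_pos[of ?y]
        by (simp add: divide_simps mult_ac)
      finally have "norm (partial_deriv i f ?y) \<le> ?M / decay_weight x" .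
      then show "onorm (\<lambda>s. s *\<^sub>R partial_deriv i f ?y) \<le> ?M / decay_weight x"
        using M(1) decay_weight_pos[of x]
        by (intro onorm_bound) (simp_all only: norm_scaleR mult.commute[of "?M / decay_weight x"] mult_left_mono
              norm_ge_zero real_norm_def abs_ge_zero, simp)
    qed (use h in auto)
    then show ?thesis by (simp add: p_def mult.commute)
  qed
  then show ?thesis using that[of ?M] M(1) by simp
qed

lemma has_vector_derivative_quotient:
  assumes "(g has_vector_derivative d) (at a within S)"
  shows "((\<lambda>t. (g t - g a) /\<^sub>R (t - a)) \<longlongrightarrow> d) (at a within S)"
proof -
  have "((\<lambda>y. norm (g y - g a - (y - a) *\<^sub>R d) / norm (y - a)) \<longlongrightarrow> 0) (at a within S)"
    using assms by (simp only: has_vector_derivative_def has_derivative_iff_norm)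
  moreover have "eventually (\<lambda>y. norm (g y - g a - (y - a) *\<^sub>R d) / norm (y - a)
      = norm ((g y - g a) /\<^sub>R (y - a) - d)) (at a within S)"
    unfolding eventually_at_filter
  proof (intro always_eventually allI impI)
    fix y assume "y \<noteq> a"
    then have "(g y - g a) /\<^sub>R (y - a) - d = (g y - g a - (y - a) *\<^sub>R d) /\<^sub>R (y - a)"
      by (simp only: scaleR_diff_right scaleR_scaleR) simp
    then show "norm (g y - g a - (y - a) *\<^sub>R d) / norm (y - a) = norm ((g y - g a) /\<^sub>R (y - a) - d)"
      by (simp only: norm_scaleR) (simp add: divide_inverse mult.commute abs_inverse)
  qed
  ultimately have "((\<lambda>y. norm ((g y - g a) /\<^sub>R (y - a) - d)) \<longlongrightarrow> 0) (at a within S)"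
    by (rule Lim_transform_eventually)
  then show ?thesis
    by (rule LIM_zero_cancel[OF tendsto_norm_zero_cancel])
qed

lemma has_vector_derivative_cis_mult:
  "((\<lambda>t. cis (t * c)) has_vector_derivative c *\<^sub>R (\<i> * cis (t * c))) (at t within S)"
proof -
  have "((\<lambda>t. t * c) has_derivative (\<lambda>s. s * c)) (at t within S)"
    by (auto intro!: derivative_eq_intros)
  from has_derivative_cis[OF this] show ?thesis
    by (simp add: has_vector_derivative_def)
qed

text \<open>Integration by parts in the form of a limit: by translation invariance the transform of
  a difference quotient of \<open>f\<close> is \<open>fourier f\<close> times a difference quotient
  of \<open>cis\<close>. Both sides are passed to the limit, the left one by dominated
  convergence.\<close>

lemma fourier_partial_deriv:
  assumes f: "schwartz f"
  shows "fourier (partial_deriv i f) \<xi> = \<i> * complex_of_real (\<xi> $ i) * fourier f \<xi>"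
proof -
  obtain M where M: "0 \<le> M"
    "\<And>x h. \<bar>h\<bar> \<le> 1 \<Longrightarrow> norm (f (x + h *\<^sub>R axis i 1) - f x) \<le> \<bar>h\<bar> * (M / decay_weight x)"
    using schwartz_difference_bound[OF f] by blast
  have rf: "rapid f" by (rule schwartz_rapid[OF f])
  define h where "h n = 1 / real (Suc n)" for n
  have h: "h \<longlonglongrightarrow> 0" "\<And>n. h n \<noteq> 0" "\<And>n. \<bar>h n\<bar> \<le> 1"
    using LIMSEQ_inverse_real_of_nat by (auto simp: h_def[abs_def] inverse_eq_divide)
  define q where "q n x = inverse (h n) *\<^sub>R (f (x + h n *\<^sub>R axis i 1) - f x)" for n x
  have cf: "continuous_on UNIV f" by (rule rapid_continuous[OF rf])
  have cq: "continuous_on UNIV (q n)" for n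
    unfolding q_def by (intro continuous_intros continuous_on_compose2[OF cf]) auto
  have cd: "continuous_on UNIV (partial_deriv i f)"
    by (rule rapid_continuous[OF schwartz_rapid[OF schwartz_partial[OF f]]])
  have 1: "(\<lambda>n. LINT x|lborel. cis (- (x \<bullet> \<xi>)) * q n x) \<longlonglongrightarrow> fourier (partial_deriv i f) \<xi>"
    unfolding fourier_def
  proof (rule integral_dominated_convergence)
    show "integrable lborel (\<lambda>x::real^'a. M * (1 / decay_weight x))"
      by (intro integrable_mult_right integrable_inverse_decay_weight)
    show "AE x in lborel. (\<lambda>n. cis (- (x \<bullet> \<xi>)) * q n x) \<longlonglongrightarrow> cis (- (x \<bullet> \<xi>)) * partial_deriv i f x"
    proof (intro AE_I2 tendsto_mult tendsto_const)
      fix x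
      have D: "f differentiable (at x)" by (rule schwartz_differentiable[OF f])
      have "((\<lambda>h. x + h *\<^sub>R axis i 1) has_derivative (\<lambda>s. s *\<^sub>R axis i 1)) (at 0)"
        by (auto intro!: derivative_eq_intros)
      from has_derivative_compose[OF this, of f "frechet_derivative f (at x)"]
      have "((\<lambda>h. f (x + h *\<^sub>R axis i 1)) has_derivative (\<lambda>s. frechet_derivative f (at x) (s *\<^sub>R axis i 1))) (at 0)"
        using D by (simp add: frechet_derivative_works)
      then have "((\<lambda>h. f (x + h *\<^sub>R axis i 1)) has_vector_derivative partial_deriv i f x) (at 0)"
        unfolding has_vector_derivative_def
        using linear_frechet_derivative[OF D] by (simp add: partial_deriv_frechet[OF D] linear_cmul)
      from has_vector_derivative_quotient[OF this]
      have "((\<lambda>y. (f (x + y *\<^sub>R axis i 1) - f x) /\<^sub>R y) \<longlongrightarrow> partial_deriv i f x) (at 0)"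
        by simp
      then show "(\<lambda>n. q n x) \<longlonglongrightarrow> partial_deriv i f x"
        unfolding q_def using h by (auto simp: tendsto_at_iff_sequentially o_def)
    qed
    show "AE x in lborel. norm (cis (- (x \<bullet> \<xi>)) * q n x) \<le> M * (1 / decay_weight x)" for n
    proof (rule AE_I2)
      fix x :: "real^'a"
      have "norm (q n x) = norm (f (x + h n *\<^sub>R axis i 1) - f x) / \<bar>h n\<bar>"
        by (simp add: q_def divide_inverse)
      also have "\<dots> \<le> M / decay_weight x"
        using M(2)[of "h n" x] h(2)[of n] h(3)[of n] by (simp add: divide_le_eq mult.commute)
      finally show "norm (cis (- (x \<bullet> \<xi>)) * q n x) \<le> M * (1 / decay_weight x)"
        by (simp add: norm_mult)
    qed
  qed (auto intro!: borel_measurable_continuous_onI continuous_intros cq cd)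
  have 2: "(LINT x|lborel. cis (- (x \<bullet> \<xi>)) * q n x) = inverse (h n) *\<^sub>R (cis (h n * (\<xi> $ i)) - 1) * fourier f \<xi>" for n
  proof -
    let ?c = "h n *\<^sub>R axis i (1::real)"
    have int: "integrable lborel (\<lambda>x. cis (- (x \<bullet> \<xi>)) * f x)"
      using integrable_cis_mult[OF rapid_integrable[OF rf], of "- \<xi>"] by (simp add: inner_commute)
    have int2: "integrable lborel (\<lambda>x. cis (- (x \<bullet> \<xi>)) * f (x + ?c))"
    proof -
      have "integrable lborel (\<lambda>x. f (?c + 1 *\<^sub>R x))"
        by (rule integrable_scale[OF rapid_integrable[OF rf]]) simp
      then show ?thesis
        using integrable_cis_mult[of "\<lambda>x. f (?c + 1 *\<^sub>R x)" "- \<xi>"] by (simp add: inner_commute add.commute)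
    qed
    have "(LINT x|lborel. cis (- (x \<bullet> \<xi>)) * q n x)
      = (LINT x|lborel. inverse (h n) *\<^sub>R (cis (- (x \<bullet> \<xi>)) * f (x + ?c) - cis (- (x \<bullet> \<xi>)) * f x))"
      by (intro Bochner_Integration.integral_cong) (auto simp: q_def algebra_simps)
    also have "\<dots> = inverse (h n) *\<^sub>R ((LINT x|lborel. cis (- (x \<bullet> \<xi>)) * f (x + ?c)) - fourier f \<xi>)"
      unfolding fourier_def using int int2 by simp
    also have "(LINT x|lborel. cis (- (x \<bullet> \<xi>)) * f (x + ?c)) = (LINT x|lborel. cis (h n * (\<xi> $ i)) * (cis (- ((?c + x) \<bullet> \<xi>)) * f (?c + x)))"
    proof (intro Bochner_Integration.integral_cong refl)
      fix x
      have "?c \<bullet> \<xi> = h n * (\<xi> $ i)" by (simp add: inner_axis')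
      then have "cis (- (x \<bullet> \<xi>)) = cis (h n * (\<xi> $ i)) * cis (- ((?c + x) \<bullet> \<xi>))"
        by (simp add: cis_mult inner_add_left del: inner_scaleR_left)
      then show "cis (- (x \<bullet> \<xi>)) * f (x + ?c) = cis (h n * (\<xi> $ i)) * (cis (- ((?c + x) \<bullet> \<xi>)) * f (?c + x))"
        by (simp add: add.commute)
    qed
    also have "\<dots> = cis (h n * (\<xi> $ i)) * fourier f \<xi>"
      unfolding fourier_def
      using integral_translation[of "\<lambda>x. cis (- (x \<bullet> \<xi>)) * f x" ?c] borel_measurable_integrable[OF int]
      by simp
    finally show ?thesis by (simp add: algebra_simps)
  qed
  have 3: "(\<lambda>n. inverse (h n) *\<^sub>R (cis (h n * (\<xi> $ i)) - 1)) \<longlonglongrightarrow> \<i> * complex_of_real (\<xi> $ i)"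
  proof -
    have "((\<lambda>t. cis (t * (\<xi> $ i))) has_vector_derivative (\<xi> $ i) *\<^sub>R (\<i> * cis (0 * (\<xi> $ i)))) (at 0)"
      by (rule has_vector_derivative_cis_mult)
    from has_vector_derivative_quotient[OF this]
    have "((\<lambda>t. (cis (t * (\<xi> $ i)) - 1) /\<^sub>R t) \<longlongrightarrow> \<i> * complex_of_real (\<xi> $ i)) (at 0)"
      by (simp add: scaleR_conv_of_real mult.commute)
    then show ?thesis
      using h by (auto simp: tendsto_at_iff_sequentially o_def)
  qed
  have "(\<lambda>n. LINT x|lborel. cis (- (x \<bullet> \<xi>)) * q n x) \<longlonglongrightarrow> \<i> * complex_of_real (\<xi> $ i) * fourier f \<xi>"
    unfolding 2 by (intro tendsto_intros 3)
  with 1 show ?thesis by (rule LIMSEQ_unique)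
qed

text \<open>Each induction step trades one factor \<open>1 + norm \<xi>\<close> for derivatives: it
  is at most 1 plus the sum of the \<open>\<bar>\<xi> $ i\<bar>\<close>, and
  \<open>\<xi> $ i\<close> times the transform of \<open>f\<close> is, up to a unit, the transform
  of \<open>partial_deriv i f\<close>, again a Schwartz function.\<close>

lemma fourier_rapid_decay:
  assumes "schwartz f"
  shows "\<exists>M. \<forall>\<xi>. (1 + norm \<xi>) ^ k * norm (fourier f \<xi>) \<le> M"
  using assms
proof (induction k arbitrary: f)
  case 0
  have "norm (fourier f \<xi>) \<le> (LINT x|lborel. norm (f x))" for \<xi>
    using norm_ift_le[of f "- \<xi>"] by (simp add: fourier_eq_ift)
  then show ?case by auto
next
  case (Suc k)
  obtain M where M: "\<And>\<xi>. (1 + norm \<xi>) ^ k * norm (fourier f \<xi>) \<le> M"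
    using Suc by blast
  have "\<forall>i. \<exists>M. \<forall>\<xi>. (1 + norm \<xi>) ^ k * norm (fourier (partial_deriv i f) \<xi>) \<le> M"
    using Suc.IH[OF schwartz_partial[OF Suc.prems]] by blast
  then obtain N where N: "\<And>i \<xi>. (1 + norm \<xi>) ^ k * norm (fourier (partial_deriv i f) \<xi>) \<le> N i"
    by metis
  have "(1 + norm \<xi>) ^ Suc k * norm (fourier f \<xi>) \<le> M + (\<Sum>i\<in>UNIV. N i)" for \<xi>
  proof -
    have "norm \<xi> \<le> (\<Sum>i\<in>UNIV. \<bar>\<xi> $ i\<bar>)"
      by (rule norm_le_l1_cart)
    then have "(1 + norm \<xi>) * ((1 + norm \<xi>) ^ k * norm (fourier f \<xi>))
      \<le> (1 + (\<Sum>i\<in>UNIV. \<bar>\<xi> $ i\<bar>)) * ((1 + norm \<xi>) ^ k * norm (fourier f \<xi>))"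
      by (intro mult_right_mono) auto
    also have "\<dots> = (1 + norm \<xi>) ^ k * norm (fourier f \<xi>)
      + (\<Sum>i\<in>UNIV. (1 + norm \<xi>) ^ k * norm (fourier (partial_deriv i f) \<xi>))"
      by (simp add: fourier_partial_deriv[OF Suc.prems] norm_mult distrib_right sum_distrib_right mult_ac distrib_left sum_distrib_left)
    also have "\<dots> \<le> M + (\<Sum>i\<in>UNIV. N i)"
      by (intro add_mono sum_mono M N)
    finally show ?thesis by simp
  qed
  then show ?case by blast
qed

lemma schwartz_fourier:
  assumes "schwartz f"
  shows "schwartz (fourier f)"
proof (rule schwartzI_class[where \<F> = "{fourier f | f. schwartz f}"])
  show "fourier f \<in> {fourier f | f. schwartz f}" using assms by blast
next
  fix g i assume "g \<in> {fourier f | f. schwartz (f :: real^'a \<Rightarrow> complex)}"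
  then show "partial_deriv i g \<in> {fourier f | f. schwartz f}"
    using partial_deriv_fourier schwartz_cmult schwartz_coord by blast
qed (auto intro: fourier_differentiable schwartz_rapid fourier_rapid_decay)


section \<open>Gaussians, Fourier inversion and uniqueness of the transform\<close>

definition gauss :: "real^'d::finite \<Rightarrow> complex"
  where "gauss x = complex_of_real (exp (- ((norm x)\<^sup>2 / 2)))"

definition gauss_mass :: "'d::finite itself \<Rightarrow> real"
  where "gauss_mass _ = sqrt (2 * pi) ^ CARD('d)"

lemma gauss_mass_pos: "0 < gauss_mass TYPE('d::finite)"
  by (simp add: gauss_mass_def)

lemma gauss_mass_sq: "gauss_mass TYPE('d::finite) * gauss_mass TYPE('d) = (2 * pi) ^ CARD('d)"
  unfolding gauss_mass_def power_mult_distrib[symmetric] by simp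

lemma one_plus_power_le_exp:
  fixes y :: real
  assumes "0 \<le> y"
  shows "(1 + y) ^ k \<le> fact k * exp (1 + y)"
proof -
  have "(1 + y) ^ k /\<^sub>R fact k = (\<Sum>n\<in>{k}. (1 + y) ^ n /\<^sub>R fact n)" by simp
  also have "\<dots> \<le> (\<Sum>n. (1 + y) ^ n /\<^sub>R fact n)"
    using assms by (intro sum_le_suminf summable_exp_generic) auto
  also have "\<dots> = exp (1 + y)" by (simp add: exp_def)
  finally show ?thesis by (simp add: field_simps)
qed

lemma quadratic_exponent_bound:
  fixes a b y :: real
  assumes "0 < a"
  shows "- a * y\<^sup>2 + b * y \<le> b\<^sup>2 / (4 * a)"
proof -
  have "0 \<le> (2 * a * y - b)\<^sup>2 / (4 * a)" using assms by simp
  also have "\<dots> = b\<^sup>2 / (4 * a) + a * y\<^sup>2 - b * y"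
    using assms by (simp add: field_simps power2_eq_square)
  finally show ?thesis by simp
qed

lemma gauss_decay:
  fixes b :: "'a::real_inner"
  assumes a: "0 < a"
  obtains M where "0 \<le> M" "\<And>x. (1 + norm x) ^ k * exp (- a * (norm x)\<^sup>2 + b \<bullet> x) \<le> M"
proof -
  let ?M = "fact k * exp (1 + (norm b + 1)\<^sup>2 / (4 * a)) :: real"
  have "(1 + norm x) ^ k * exp (- a * (norm x)\<^sup>2 + b \<bullet> x) \<le> ?M" for x :: 'a
  proof -
    have "(1 + norm x) ^ k * exp (- a * (norm x)\<^sup>2 + b \<bullet> x)
        \<le> (fact k * exp (1 + norm x)) * exp (- a * (norm x)\<^sup>2 + norm b * norm x)"
      using norm_cauchy_schwarz[of b x] by (intro mult_mono one_plus_power_le_exp) auto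
    also have "\<dots> = fact k * exp (1 + (- a * (norm x)\<^sup>2 + (norm b + 1) * norm x))"
      by (simp add: exp_add[symmetric] algebra_simps)
    also have "\<dots> \<le> ?M"
      using quadratic_exponent_bound[OF a, of "norm x" "norm b + 1"] by (intro mult_left_mono) auto
    finally show ?thesis .
  qed
  then show ?thesis using that[of ?M] by simp
qed

lemma real_polynomial_function_growth:
  assumes "real_polynomial_function q"
  shows "\<exists>C m. \<forall>x. \<bar>q x\<bar> \<le> C * (1 + norm x) ^ m"
  using assms
proof induction
  case (linear f)
  obtain K where K: "\<And>x. norm (f x) \<le> norm x * K" "0 \<le> K"
    using bounded_linear.nonneg_bounded[OF linear] by blast
  have "\<bar>f x\<bar> \<le> K * (1 + norm x) ^ 1" for x
    using K(1)[of x] K(2) by (simp add: algebra_simps)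
  then show ?case by blast
next
  case (const c)
  have "\<bar>c\<bar> \<le> \<bar>c\<bar> * (1 + norm x) ^ 0" for x :: 'a by simp
  then show ?case by blast
next
  case (add f g)
  then obtain C m D n where fg: "\<And>x. \<bar>f x\<bar> \<le> C * (1 + norm x) ^ m" "\<And>x. \<bar>g x\<bar> \<le> D * (1 + norm x) ^ n"
    by blast
  have C: "0 \<le> C" using order_trans[OF abs_ge_zero fg(1)[of 0]] by simp
  have D: "0 \<le> D" using order_trans[OF abs_ge_zero fg(2)[of 0]] by simp
  have "\<bar>f x + g x\<bar> \<le> (C + D) * (1 + norm x) ^ (m + n)" for x
  proof -
    have "\<bar>f x + g x\<bar> \<le> \<bar>f x\<bar> + \<bar>g x\<bar>" by simp
    also have "\<dots> \<le> C * (1 + norm x) ^ m + D * (1 + norm x) ^ n" by (intro add_mono fg)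
    also have "\<dots> \<le> C * (1 + norm x) ^ (m + n) + D * (1 + norm x) ^ (m + n)"
      by (intro add_mono mult_left_mono power_increasing C D) auto
    finally show ?thesis by (simp add: distrib_right)
  qed
  then show ?case by blast
next
  case (mult f g)
  then obtain C m D n where fg: "\<And>x. \<bar>f x\<bar> \<le> C * (1 + norm x) ^ m" "\<And>x. \<bar>g x\<bar> \<le> D * (1 + norm x) ^ n"
    by blast
  have "\<bar>f x * g x\<bar> \<le> (C * D) * (1 + norm x) ^ (m + n)" for x
  proof -
    have "\<bar>f x * g x\<bar> \<le> (C * (1 + norm x) ^ m) * (D * (1 + norm x) ^ n)"
      unfolding abs_mult by (rule mult_mono[OF fg]) (auto intro: order_trans[OF abs_ge_zero fg(1)])
    then show ?thesis by (simp add: power_add mult_ac)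
  qed
  then show ?case by blast
qed

lemma real_polynomial_function_derivative:
  fixes q :: "'a::real_normed_vector \<Rightarrow> real"
  assumes "real_polynomial_function q"
  shows "\<exists>q'. (\<forall>x. (q has_derivative q' x) (at x)) \<and> (\<forall>v. real_polynomial_function (\<lambda>x. q' x v))"
  using assms
proof induction
  case (linear f)
  then show ?case
    by (intro exI[of _ "\<lambda>x. f"]) (auto intro: bounded_linear_imp_has_derivative)
next
  case (const c)
  show ?case by (intro exI[of _ "\<lambda>x v. 0"]) auto
next
  case (add f g)
  then obtain f' g' where "\<And>x. (f has_derivative f' x) (at x)" "\<And>v. real_polynomial_function (\<lambda>x. f' x v)"
    "\<And>x. (g has_derivative g' x) (at x)" "\<And>v. real_polynomial_function (\<lambda>x. g' x v)"
    by metis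
  then show ?case by (intro exI[of _ "\<lambda>x v. f' x v + g' x v"]) (auto intro: has_derivative_add)
next
  case (mult f g)
  then obtain f' g' where "\<And>x. (f has_derivative f' x) (at x)" "\<And>v. real_polynomial_function (\<lambda>x. f' x v)"
    "\<And>x. (g has_derivative g' x) (at x)" "\<And>v. real_polynomial_function (\<lambda>x. g' x v)"
    by metis
  with mult.hyps show ?case
    by (intro exI[of _ "\<lambda>x v. f x * g' x v + f' x v * g x"])
       (auto intro!: has_derivative_mult real_polynomial_function.intros(3) real_polynomial_function.intros(4))
qed

text \<open>Polynomials times this exponential are stable under differentiation, and they decay
  because the quadratic term wins. The linear term \<open>b \<bullet> x\<close> is there for
  products of Gaussians with different centres, which occur in the uniqueness proof for the
  transform.\<close>

lemma schwartz_gauss: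
  fixes b :: "real^'d::finite"
  assumes a: "0 < a"
  shows "schwartz (\<lambda>x. complex_of_real (exp (- a * (norm x)\<^sup>2 + b \<bullet> x)))"
proof -
  let ?e = "\<lambda>x. exp (- a * (norm x)\<^sup>2 + b \<bullet> x) :: real"
  let ?F = "{\<lambda>x. complex_of_real (q x * ?e x) | q. real_polynomial_function q}"
  have e: "(?e has_derivative (\<lambda>v. ?e x * (- 2 * a * (x \<bullet> v) + b \<bullet> v))) (at x)" for x
    unfolding power2_norm_eq_inner
    by (auto intro!: derivative_eq_intros simp: inner_commute algebra_simps)
  have D: "\<exists>q'. (\<forall>x. ((\<lambda>x. complex_of_real (q x * ?e x)) has_derivative (\<lambda>v. complex_of_real (q' v x * ?e x))) (at x))
      \<and> (\<forall>v. real_polynomial_function (q' v))" if q: "real_polynomial_function q" for q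
  proof -
    obtain p where p: "\<And>x. (q has_derivative p x) (at x)" "\<And>v. real_polynomial_function (\<lambda>x. p x v)"
      using real_polynomial_function_derivative[OF q] by blast
    let ?q = "\<lambda>v x. p x v + q x * (- 2 * a * (x \<bullet> v) + b \<bullet> v)"
    have "((\<lambda>x. q x * ?e x) has_derivative (\<lambda>v. ?q v x * ?e x)) (at x)" for x
      by (rule has_derivative_eq_rhs[OF has_derivative_mult[OF p(1) e]]) (auto simp: algebra_simps)
    then have "((\<lambda>x. complex_of_real (q x * ?e x)) has_derivative (\<lambda>v. complex_of_real (?q v x * ?e x))) (at x)" for x
      by (rule has_derivative_of_real)
    moreover have "real_polynomial_function (?q v)" for v
    proof -
      have "bounded_linear (\<lambda>x. - 2 * a * (x \<bullet> v))"
        by (intro bounded_linear_const_mult bounded_linear_inner_left)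
      then have "real_polynomial_function (\<lambda>x. - 2 * a * (x \<bullet> v) + b \<bullet> v)"
        by (rule real_polynomial_function.intros(3)[OF real_polynomial_function.intros(1) real_polynomial_function.intros(2)])
      then have "real_polynomial_function (\<lambda>x. q x * (- 2 * a * (x \<bullet> v) + b \<bullet> v))"
        by (rule real_polynomial_function.intros(4)[OF q])
      then show ?thesis
        by (rule real_polynomial_function.intros(3)[OF p(2)])
    qed
    ultimately show ?thesis by (intro exI[of _ ?q] conjI allI)
  qed
  show ?thesis
  proof (rule schwartzI_class[where \<F> = ?F])
    show "(\<lambda>x. complex_of_real (?e x)) \<in> ?F"
      by (rule CollectI, rule exI[of _ "\<lambda>x. 1"]) auto
  next
    fix g x assume "g \<in> ?F"
    then show "g differentiable (at x)"
    proof -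
      assume "g \<in> ?F"
      then obtain q where g: "g = (\<lambda>x. complex_of_real (q x * ?e x))" and q: "real_polynomial_function q" by blast
      show ?thesis
        using D[OF q] unfolding g differentiable_def by blast
    qed
  next
    fix g i assume "g \<in> ?F"
    then obtain q where g: "g = (\<lambda>x. complex_of_real (q x * ?e x))" and q: "real_polynomial_function q" by blast
    obtain q' where q': "\<And>x. (g has_derivative (\<lambda>v. complex_of_real (q' v x * ?e x))) (at x)"
      "\<And>v. real_polynomial_function (q' v)"
      using D[OF q] unfolding g by blast
    have "partial_deriv i g = (\<lambda>x. complex_of_real (q' (axis i 1) x * ?e x))"
      by (rule ext) (rule partial_deriv_eq[OF q'(1)])
    then show "partial_deriv i g \<in> ?F" using q'(2) by blast
  next
    fix g k assume "g \<in> ?F"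
    then obtain q where g: "g = (\<lambda>x. complex_of_real (q x * ?e x))" and q: "real_polynomial_function q" by blast
    obtain C m where C: "\<And>x. \<bar>q x\<bar> \<le> C * (1 + norm x) ^ m"
      using real_polynomial_function_growth[OF q] by blast
    have C0: "0 \<le> C" using order_trans[OF abs_ge_zero C[of 0]] by simp
    obtain M where M: "\<And>x. (1 + norm x) ^ (k + m) * ?e x \<le> M"
      using gauss_decay[OF a, of "k + m" b] by blast
    have "(1 + norm x) ^ k * norm (g x) \<le> C * M" for x
    proof -
      have "(1 + norm x) ^ k * norm (g x) = (1 + norm x) ^ k * (\<bar>q x\<bar> * ?e x)"
        unfolding g by (simp only: norm_of_real abs_mult abs_exp_cancel)
      also have "\<dots> \<le> (1 + norm x) ^ k * (C * (1 + norm x) ^ m * ?e x)"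
        by (intro mult_left_mono mult_right_mono C) auto
      also have "\<dots> = C * ((1 + norm x) ^ (k + m) * ?e x)" by (simp add: power_add)
      also have "\<dots> \<le> C * M" by (intro mult_left_mono M C0)
      finally show ?thesis .
    qed
    then show "\<exists>M. \<forall>x. (1 + norm x) ^ k * norm (g x) \<le> M" by blast
  qed
qed

lemma gauss_schwartz: "schwartz gauss"
  using schwartz_gauss[of "1/2" 0] by (simp add: gauss_def[abs_def])

lemma rapid_gauss: "rapid gauss"
  by (rule schwartz_rapid[OF gauss_schwartz])

lemma continuous_on_gauss [continuous_intros]:
  "continuous_on S f \<Longrightarrow> continuous_on S (\<lambda>x. gauss (f x))"
  unfolding gauss_def by (intro continuous_intros) auto

lemma continuous_UNIV_isCont: "continuous_on UNIV f \<Longrightarrow> isCont f x"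
  by (simp add: continuous_on_eq_continuous_at)

lemma continuous_imp_lborel_measurable:
  "continuous_on UNIV f \<Longrightarrow> f \<in> borel_measurable lborel"
  by (simp add: borel_measurable_continuous_onI)

lemma gauss_minus [simp]: "gauss (- x) = gauss x"
  by (simp add: gauss_def)

lemma integral_lborel_prod:
  fixes f :: "'a::euclidean_space \<Rightarrow> real \<Rightarrow> complex"
  assumes f: "\<And>b. b \<in> Basis \<Longrightarrow> integrable lborel (f b)"
  shows "(LINT x|lborel. (\<Prod>b\<in>Basis. f b (x \<bullet> b))) = (\<Prod>b\<in>Basis. LINT y|lborel. f b y)"
proof -
  interpret P: product_sigma_finite "\<lambda>_::'a. lborel :: real measure" ..
  have [measurable]: "f b \<in> borel_measurable borel" if "b \<in> Basis" for b
    using borel_measurable_integrable[OF f[OF that]] by simp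
  have "(LINT x|lborel. (\<Prod>b\<in>Basis. f b (x \<bullet> b)))
      = (LINT x|distr (\<Pi>\<^sub>M b\<in>Basis. lborel) borel (\<lambda>f. \<Sum>b\<in>Basis. f b *\<^sub>R b). (\<Prod>b\<in>Basis. f b (x \<bullet> b)))"
    by (simp add: lborel_eq[symmetric])
  also have "\<dots> = (LINT x|(\<Pi>\<^sub>M b\<in>Basis. lborel). (\<Prod>b\<in>Basis. f b ((\<Sum>b\<in>Basis. x b *\<^sub>R b) \<bullet> b)))"
    by (rule integral_distr) measurable
  also have "\<dots> = (LINT x|(\<Pi>\<^sub>M b\<in>Basis. lborel). (\<Prod>b\<in>Basis. f b (x b)))"
    by (intro Bochner_Integration.integral_cong prod.cong) (auto simp: inner_sum_left_Basis)
  also have "\<dots> = (\<Prod>b\<in>Basis. LINT y|lborel. f b y)"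
    by (rule P.product_integral_prod) (auto intro: f)
  finally show ?thesis .
qed

text \<open>Up to the factor \<open>sqrt (2 * pi)\<close> this is the characteristic function of the
  standard normal distribution.\<close>

lemma gauss_1d:
  "integrable lborel (\<lambda>y::real. cis (t * y) * complex_of_real (exp (- y\<^sup>2 / 2)))"
  "(LINT y|lborel. cis (t * y) * complex_of_real (exp (- y\<^sup>2 / 2))) = complex_of_real (sqrt (2 * pi) * exp (- t\<^sup>2 / 2))"
proof -
  have *: "cis (t * y) * complex_of_real (exp (- y\<^sup>2 / 2))
      = complex_of_real (sqrt (2 * pi)) * (cis (t * y) * complex_of_real (std_normal_density y))" for y
    by (simp add: std_normal_density_def)
  have i: "integrable lborel std_normal_density" by simp
  have "integrable lborel (\<lambda>y. cis (t * y) * complex_of_real (std_normal_density y))"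
  proof (rule Bochner_Integration.integrable_bound[OF i])
    show "(\<lambda>y. cis (t * y) * complex_of_real (std_normal_density y)) \<in> borel_measurable lborel"
      unfolding std_normal_density_def by (intro continuous_imp_lborel_measurable continuous_intros) auto
  qed (simp add: norm_mult)
  then show "integrable lborel (\<lambda>y::real. cis (t * y) * complex_of_real (exp (- y\<^sup>2 / 2)))"
    unfolding * by (rule integrable_mult_right)
  have "(LINT y|lborel. cis (t * y) * complex_of_real (exp (- y\<^sup>2 / 2)))
      = complex_of_real (sqrt (2 * pi)) * (LINT y|lborel. cis (t * y) * complex_of_real (std_normal_density y))"
    unfolding * by (rule integral_mult_right_zero)
  also have "(LINT y|lborel. cis (t * y) * complex_of_real (std_normal_density y))
      = (LINT y|density lborel std_normal_density. cis (t * y))"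
  proof (subst integral_density)
    show "(\<lambda>y. cis (t * y)) \<in> borel_measurable lborel"
      by (intro continuous_imp_lborel_measurable continuous_intros)
  qed (auto simp: scaleR_conv_of_real mult_ac)
  also have "\<dots> = char std_normal_distribution t"
    by (simp add: char_def cis_conv_exp)
  finally show "(LINT y|lborel. cis (t * y) * complex_of_real (exp (- y\<^sup>2 / 2))) = complex_of_real (sqrt (2 * pi) * exp (- t\<^sup>2 / 2))"
    by (simp add: char_std_normal_distribution)
qed

lemma ift_gauss: "ift gauss (x :: real^'d::finite) = complex_of_real (gauss_mass TYPE('d)) * gauss x"
proof -
  have sq: "(norm y)\<^sup>2 = (\<Sum>b\<in>Basis. (y \<bullet> b)\<^sup>2)" for y :: "real^'d"
    unfolding power2_norm_eq_inner by (subst euclidean_inner) (simp add: power2_eq_square)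
  have "ift gauss x = (LINT \<xi>|lborel. (\<Prod>b\<in>Basis. cis ((x \<bullet> b) * (\<xi> \<bullet> b)) * complex_of_real (exp (- (\<xi> \<bullet> b)\<^sup>2 / 2))))"
    unfolding ift_def
  proof (intro Bochner_Integration.integral_cong refl)
    fix \<xi> :: "real^'d"
    have "cis (x \<bullet> \<xi>) = (\<Prod>b\<in>Basis. cis ((x \<bullet> b) * (\<xi> \<bullet> b)))"
      by (subst euclidean_inner) (simp add: cis_conv_exp exp_sum sum_distrib_left)
    moreover have "gauss \<xi> = (\<Prod>b\<in>Basis. complex_of_real (exp (- (\<xi> \<bullet> b)\<^sup>2 / 2)))"
      by (simp add: gauss_def sq exp_sum[symmetric] sum_divide_distrib sum_negf of_real_prod[symmetric] del: of_real_prod)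
    ultimately show "cis (x \<bullet> \<xi>) * gauss \<xi> = (\<Prod>b\<in>Basis. cis ((x \<bullet> b) * (\<xi> \<bullet> b)) * complex_of_real (exp (- (\<xi> \<bullet> b)\<^sup>2 / 2)))"
      by (simp add: prod.distrib)
  qed
  also have "\<dots> = (\<Prod>b\<in>Basis. complex_of_real (sqrt (2 * pi) * exp (- (x \<bullet> b)\<^sup>2 / 2)))"
    by (subst integral_lborel_prod) (simp_all only: gauss_1d)
  also have "\<dots> = complex_of_real (sqrt (2 * pi) ^ CARD('d) * (\<Prod>b\<in>Basis. exp (- (x \<bullet> b)\<^sup>2 / 2)))"
    by (simp only: of_real_prod[symmetric] prod.distrib prod_constant) simp
  also have "(\<Prod>b\<in>Basis. exp (- (x \<bullet> b)\<^sup>2 / 2)) = exp (- ((norm x)\<^sup>2 / 2))"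
    by (simp add: sq exp_sum[symmetric] sum_divide_distrib sum_negf)
  finally show ?thesis by (simp only: gauss_mass_def gauss_def[of x] of_real_mult)
qed

lemma integral_gauss: "(LINT x|lborel. gauss (x :: real^'d::finite)) = complex_of_real (gauss_mass TYPE('d))"
  using ift_gauss[of "0 :: real^'d"] unfolding ift_def by (simp add: gauss_def[of 0])

section \<open>Mollification by Gaussians\<close>

definition mesh :: "nat \<Rightarrow> real"
  where "mesh n = 1 / real (Suc n)"

lemma mesh: "mesh \<longlonglongrightarrow> 0" "0 < mesh n"
  using LIMSEQ_inverse_real_of_nat by (simp_all add: mesh_def[abs_def] inverse_eq_divide)

text \<open>\<open>gauss\<close> has mass \<open>gauss_mass\<close> and not 1, so these averages
  tend to \<open>gauss_mass\<close> times \<open>f\<close>. This accounts for one of the two factors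
  \<open>gauss_mass\<close> in the inversion formula.\<close>

definition mollify :: "real \<Rightarrow> (real^'d::finite \<Rightarrow> complex) \<Rightarrow> real^'d \<Rightarrow> complex"
  where "mollify h f x = (LINT z|lborel. f (x + h *\<^sub>R z) * gauss z)"

lemma mollify_integrable:
  assumes f: "continuous_on UNIV f" "\<And>x. norm (f x) \<le> C"
  shows "integrable lborel (\<lambda>z. f (x + h *\<^sub>R z) * gauss z)"
proof (rule Bochner_Integration.integrable_bound)
  show "integrable lborel (\<lambda>z::real^'a. C * norm (gauss z))"
    by (intro integrable_mult_right integrable_norm rapid_integrable rapid_gauss)
  show "(\<lambda>z. f (x + h *\<^sub>R z) * gauss z) \<in> borel_measurable lborel"
    by (intro continuous_imp_lborel_measurable continuous_on_mult continuous_on_compose2[OF f(1)] continuous_intros) auto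
  show "AE z in lborel. norm (f (x + h *\<^sub>R z) * gauss z) \<le> norm (C * norm (gauss z))"
    by (intro AE_I2) (auto simp: norm_mult abs_mult intro!: mult_right_mono order_trans[OF f(2)])
qed

lemma mollify_bound:
  fixes f :: "real^'d::finite \<Rightarrow> complex"
  assumes f: "continuous_on UNIV f" "\<And>x. norm (f x) \<le> C"
  shows "norm (mollify h f x) \<le> C * (LINT z|lborel. norm (gauss (z :: real^'d)))"
proof -
  have "norm (mollify h f x) \<le> (LINT z|lborel. C * norm (gauss (z :: real^'d)))"
    unfolding mollify_def
    by (rule Bochner_Integration.integral_norm_bound_integral[OF mollify_integrable[OF f]])
       (simp_all add: rapid_integrable rapid_gauss mult_right_mono f norm_mult)
  then show ?thesis by simp
qed

lemma mollify_tendsto: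
  fixes f :: "real^'d::finite \<Rightarrow> complex"
  assumes f: "continuous_on UNIV f" "\<And>x. norm (f x) \<le> C"
  shows "(\<lambda>n. mollify (mesh n) f x) \<longlonglongrightarrow> complex_of_real (gauss_mass TYPE('d)) * f x"
proof -
  have m: "(\<lambda>z. f (x + mesh n *\<^sub>R z) * gauss z) \<in> borel_measurable lborel" for n
    by (rule borel_measurable_integrable[OF mollify_integrable[OF f]])
  have m0: "(\<lambda>z::real^'d. f x * gauss z) \<in> borel_measurable lborel"
    by (rule borel_measurable_integrable[OF integrable_mult_right[OF rapid_integrable[OF rapid_gauss]]])
  have w: "integrable lborel (\<lambda>z::real^'d. C * norm (gauss z))"
    by (intro integrable_mult_right integrable_norm rapid_integrable rapid_gauss)
  have lim: "(\<lambda>n. f (x + mesh n *\<^sub>R z) * gauss z) \<longlonglongrightarrow> f x * gauss z" for z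
  proof -
    have "(\<lambda>n. x + mesh n *\<^sub>R z) \<longlonglongrightarrow> x + 0 *\<^sub>R z"
      by (intro tendsto_add tendsto_scaleR tendsto_const mesh)
    then have "(\<lambda>n. x + mesh n *\<^sub>R z) \<longlonglongrightarrow> x" by simp
    then have "(\<lambda>n. f (x + mesh n *\<^sub>R z)) \<longlonglongrightarrow> f x"
      by (rule isCont_tendsto_compose[OF continuous_UNIV_isCont[OF f(1)]])
    then show ?thesis by (rule tendsto_mult[OF _ tendsto_const])
  qed
  have bd: "norm (f (x + mesh n *\<^sub>R z) * gauss z) \<le> C * norm (gauss z)" for n z
    unfolding norm_mult by (rule mult_right_mono[OF f(2) norm_ge_zero])
  have "(\<lambda>n. mollify (mesh n) f x) \<longlonglongrightarrow> (LINT z|lborel. f x * gauss (z :: real^'d))"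
    unfolding mollify_def
    by (rule integral_dominated_convergence[OF m0 m w AE_I2[OF lim] AE_I2[OF bd]])
  also have "(LINT z|lborel. f x * gauss (z :: real^'d)) = complex_of_real (gauss_mass TYPE('d)) * f x"
    by (subst integral_mult_right_zero) (simp add: integral_gauss mult.commute)
  finally show ?thesis .
qed

lemma integrable_pair_mult:
  fixes f :: "'a::euclidean_space \<Rightarrow> complex" and g :: "'b::euclidean_space \<Rightarrow> complex"
  assumes f: "integrable lborel f" and g: "integrable lborel g"
    and k: "k \<in> borel_measurable (borel \<Otimes>\<^sub>M borel)" "\<And>p. norm (k p) \<le> 1"
  shows "integrable (lborel \<Otimes>\<^sub>M lborel) (\<lambda>(x, y). k (x, y) * (f x * g y))"
proof -
  have [measurable]: "f \<in> borel_measurable borel" "g \<in> borel_measurable borel"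
    using borel_measurable_integrable[OF f] borel_measurable_integrable[OF g] by simp_all
  note [measurable] = k(1)
  have "integrable (lborel \<Otimes>\<^sub>M lborel) (\<lambda>p. f (fst p) * g (snd p))"
  proof (rule lborel_pair.Fubini_integrable)
    show "(\<lambda>p. f (fst p) * g (snd p)) \<in> borel_measurable (lborel \<Otimes>\<^sub>M lborel)"
      by measurable
    show "integrable lborel (\<lambda>x. LINT y|lborel. norm (f (fst (x, y)) * g (snd (x, y))))"
      using f by (simp add: norm_mult)
    show "AE x in lborel. integrable lborel (\<lambda>y. f (fst (x, y)) * g (snd (x, y)))"
      using g by simp
  qed
  then show ?thesis
  proof (rule Bochner_Integration.integrable_bound)
    show "(\<lambda>(x, y). k (x, y) * (f x * g y)) \<in> borel_measurable (lborel \<Otimes>\<^sub>M lborel)"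
      by measurable
    show "AE p in lborel \<Otimes>\<^sub>M lborel. norm (case p of (x, y) \<Rightarrow> k (x, y) * (f x * g y)) \<le> norm (f (fst p) * g (snd p))"
      by (intro AE_I2) (auto simp: norm_mult intro!: mult_left_le_one_le k split: prod.splits)
  qed
qed

lemma cis_inner_measurable:
  "(\<lambda>p. cis (fst p \<bullet> snd p)) \<in> borel_measurable (borel \<Otimes>\<^sub>M (borel :: (real^'d::finite) measure))"
  unfolding borel_prod by (intro borel_measurable_continuous_onI continuous_intros)

text \<open>Fubini for an integrable kernel; the unimodular factor
  \<open>cis (x \<bullet> \<xi>)\<close> is symmetric in the two variables.\<close>

lemma ift_adjoint:
  fixes f g :: "real^'d::finite \<Rightarrow> complex"
  assumes f: "integrable lborel f" and g: "integrable lborel g"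
  shows "(LINT x|lborel. ift f x * g x) = (LINT \<xi>|lborel. f \<xi> * ift g \<xi>)"
proof -
  have "integrable (lborel \<Otimes>\<^sub>M lborel) (\<lambda>(x, \<xi>). cis (fst (x, \<xi>) \<bullet> snd (x, \<xi>)) * (g x * f \<xi>))"
    by (rule integrable_pair_mult[OF g f cis_inner_measurable]) simp
  then have "(LINT \<xi>|lborel. LINT x|lborel. cis (x \<bullet> \<xi>) * (g x * f \<xi>)) = (LINT x|lborel. LINT \<xi>|lborel. cis (x \<bullet> \<xi>) * (g x * f \<xi>))"
    by (intro lborel_pair.Fubini_integral) simp
  moreover have "(LINT x|lborel. cis (x \<bullet> \<xi>) * (g x * f \<xi>)) = f \<xi> * ift g \<xi>" for \<xi>
    unfolding ift_def by (subst integral_mult_right_zero[symmetric]) (simp add: inner_commute mult_ac)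
  moreover have "(LINT \<xi>|lborel. cis (x \<bullet> \<xi>) * (g x * f \<xi>)) = ift f x * g x" for x
    unfolding ift_def by (subst integral_mult_left_zero[symmetric]) (simp add: mult_ac)
  ultimately show ?thesis by simp
qed

text \<open>Inserting the Gaussian factor \<open>gauss (h \<xi>)\<close> and moving the transform onto it turns the
  regularised inversion integral into a mollification of \<open>f\<close>.\<close>

lemma mollify_eq_ift:
  fixes f :: "real^'d::finite \<Rightarrow> complex"
  assumes f: "rapid f" and h: "0 < h"
  shows "(LINT \<xi>|lborel. cis (x \<bullet> \<xi>) * gauss (h *\<^sub>R \<xi>) * fourier f \<xi>) = complex_of_real (gauss_mass TYPE('d)) * mollify h f x"
proof -
  let ?G = "\<lambda>\<xi>. cis (x \<bullet> \<xi>) * gauss (h *\<^sub>R \<xi>)"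
  have cg: "continuous_on UNIV gauss" by (rule rapid_continuous[OF rapid_gauss])
  have ig: "integrable lborel (\<lambda>\<xi>. gauss (h *\<^sub>R \<xi>))"
    using integrable_scale[OF rapid_integrable[OF rapid_gauss], of h 0] h by simp
  have iG: "integrable lborel ?G"
    by (rule integrable_cis_mult[OF ig])
  have ifr: "integrable lborel (\<lambda>x. f (- x))"
    by (rule rapid_integrable[OF rapid_reflect[OF f]])
  have "(LINT \<xi>|lborel. ?G \<xi> * fourier f \<xi>) = (LINT y|lborel. ift ?G y * f (- y))"
    unfolding fourier_eq_ift_reflect[OF f] by (rule ift_adjoint[OF iG ifr, symmetric])
  also have "ift ?G = (\<lambda>y. (complex_of_real (gauss_mass TYPE('d)) / complex_of_real (h ^ CARD('d))) * gauss ((x + y) /\<^sub>R h))"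
  proof
    fix y :: "real^'d"
    have "ift ?G y = (LINT \<xi>|lborel. cis ((x + y) \<bullet> \<xi>) * gauss (h *\<^sub>R \<xi>))"
      unfolding ift_def by (intro Bochner_Integration.integral_cong) (auto simp: inner_add_left cis_mult mult.assoc[symmetric] add.commute)
    also have "\<dots> = (1 / h) ^ CARD('d) *\<^sub>R (LINT \<xi>|lborel. cis ((x + y) \<bullet> (0 + (1 / h) *\<^sub>R \<xi>)) * gauss (h *\<^sub>R (0 + (1 / h) *\<^sub>R \<xi>)))"
      using h by (subst integral_scale[of _ "1 / h" 0])
        (intro borel_measurable_continuous_onI continuous_intros | simp)+
    also have "\<dots> = (1 / h) ^ CARD('d) *\<^sub>R ift gauss ((x + y) /\<^sub>R h)"
      using h by (simp add: ift_def inverse_eq_divide)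
    finally show "ift ?G y = (complex_of_real (gauss_mass TYPE('d)) / complex_of_real (h ^ CARD('d))) * gauss ((x + y) /\<^sub>R h)"
      by (simp add: ift_gauss scaleR_conv_of_real power_divide)
  qed
  also have "(LINT y|lborel. (complex_of_real (gauss_mass TYPE('d)) / complex_of_real (h ^ CARD('d))) * gauss ((x + y) /\<^sub>R h) * f (- y))
    = (complex_of_real (gauss_mass TYPE('d)) / complex_of_real (h ^ CARD('d))) * (LINT y|lborel. gauss ((x + y) /\<^sub>R h) * f (- y))"
    by (subst integral_mult_right_zero[symmetric]) (simp add: mult_ac)
  also have "(LINT y|lborel. gauss ((x + y) /\<^sub>R h) * f (- y)) = h ^ CARD('d) *\<^sub>R mollify h f x"
  proof -
    have "(\<lambda>y. gauss ((x + y) /\<^sub>R h) * f (- y)) \<in> borel_measurable borel"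
      by (intro borel_measurable_continuous_onI continuous_on_mult
          continuous_on_compose2[OF rapid_continuous[OF f]] continuous_intros) auto
    from integral_scale[OF this, of "- h" "- x"] h
    show ?thesis unfolding mollify_def by (simp add: mult.commute add.commute)
  qed
  finally show ?thesis using h by (simp add: scaleR_conv_of_real)
qed

text \<open>As \<open>h\<close> tends to 0 in \<open>mollify_eq_ift\<close>, the left side tends to
  the inversion integral by dominated convergence and the right side to the square of
  \<open>gauss_mass\<close> times \<open>f\<close>. That square is
  \<open>(2 * pi) ^ CARD('d)\<close>.\<close>

theorem fourier_inversion:
  fixes f :: "real^'d::finite \<Rightarrow> complex"
  assumes f: "schwartz f"
  shows "ift (fourier f) x = complex_of_real ((2 * pi) ^ CARD('d)) * f x"
proof -
  have rf: "rapid f" and rF: "rapid (fourier f)"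
    using schwartz_rapid[OF f] schwartz_rapid[OF schwartz_fourier[OF f]] by auto
  have cg: "continuous_on UNIV gauss" by (rule rapid_continuous[OF rapid_gauss])
  obtain C where C: "\<And>x. norm (f x) \<le> C"
    using rapidE[OF rf, of 0] by auto
  have g1: "norm (gauss \<xi>) \<le> 1" for \<xi> :: "real^'d" by (simp add: gauss_def)
  have "(\<lambda>n. LINT \<xi>|lborel. cis (x \<bullet> \<xi>) * gauss (mesh n *\<^sub>R \<xi>) * fourier f \<xi>) \<longlonglongrightarrow> (LINT \<xi>|lborel. cis (x \<bullet> \<xi>) * fourier f \<xi>)"
  proof (rule integral_dominated_convergence)
    show "integrable lborel (\<lambda>\<xi>. norm (fourier f \<xi>))"
      by (intro integrable_norm rapid_integrable rF)
    show "AE \<xi> in lborel. (\<lambda>n. cis (x \<bullet> \<xi>) * gauss (mesh n *\<^sub>R \<xi>) * fourier f \<xi>) \<longlonglongrightarrow> cis (x \<bullet> \<xi>) * fourier f \<xi>"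
    proof (rule AE_I2)
      fix \<xi> :: "real^'d"
      have "(\<lambda>n. mesh n *\<^sub>R \<xi>) \<longlonglongrightarrow> 0 *\<^sub>R \<xi>"
        by (intro tendsto_scaleR tendsto_const mesh)
      then have "(\<lambda>n. mesh n *\<^sub>R \<xi>) \<longlonglongrightarrow> 0" by simp
      moreover have "isCont gauss (0 :: real^'d)"
        by (rule continuous_UNIV_isCont[OF cg])
      ultimately have "(\<lambda>n. gauss (mesh n *\<^sub>R \<xi>)) \<longlonglongrightarrow> gauss (0 :: real^'d)"
        by (rule isCont_tendsto_compose[rotated])
      from tendsto_mult[OF tendsto_mult[OF tendsto_const[of "cis (x \<bullet> \<xi>)"] this] tendsto_const[of "fourier f \<xi>"]]
      show "(\<lambda>n. cis (x \<bullet> \<xi>) * gauss (mesh n *\<^sub>R \<xi>) * fourier f \<xi>) \<longlonglongrightarrow> cis (x \<bullet> \<xi>) * fourier f \<xi>"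
        by (simp add: gauss_def)
    qed
    show "AE \<xi> in lborel. norm (cis (x \<bullet> \<xi>) * gauss (mesh n *\<^sub>R \<xi>) * fourier f \<xi>) \<le> norm (fourier f \<xi>)" for n
      by (intro AE_I2) (auto simp: norm_mult intro!: mult_left_le_one_le g1)
  qed (intro continuous_imp_lborel_measurable continuous_intros rapid_continuous[OF rF])+
  then have "(\<lambda>n. complex_of_real (gauss_mass TYPE('d)) * mollify (mesh n) f x) \<longlonglongrightarrow> ift (fourier f) x"
    by (simp add: mollify_eq_ift[OF rf mesh(2)] ift_def)
  moreover have "(\<lambda>n. complex_of_real (gauss_mass TYPE('d)) * mollify (mesh n) f x)
      \<longlonglongrightarrow> complex_of_real (gauss_mass TYPE('d)) * (complex_of_real (gauss_mass TYPE('d)) * f x)"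
    by (intro tendsto_mult tendsto_const mollify_tendsto[OF rapid_continuous[OF rf] C])
  ultimately have "ift (fourier f) x = complex_of_real (gauss_mass TYPE('d)) * (complex_of_real (gauss_mass TYPE('d)) * f x)"
    by (rule LIMSEQ_unique)
  also have "\<dots> = complex_of_real (gauss_mass TYPE('d) * gauss_mass TYPE('d)) * f x"
    by (simp only: of_real_mult mult.assoc)
  finally show ?thesis unfolding gauss_mass_sq .
qed


text \<open>After \<open>f\<close> is mollified, Fubini leaves inner integrals of \<open>g\<close>
  against a product of two Gaussians, a Schwartz function, so they vanish; then the width tends to
  0. The factor \<open>gauss\<close> turns \<open>g\<close> into an integrable function, as Fubini
  and dominated convergence require.\<close>

lemma integral_mult_continuous_eq_0:
  fixes g f :: "real^'d::finite \<Rightarrow> complex"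
  assumes g: "\<And>\<phi>. schwartz \<phi> \<Longrightarrow> integrable lborel (\<lambda>x. g x * \<phi> x)"
    and z: "\<And>\<phi>. schwartz \<phi> \<Longrightarrow> (LINT x|lborel. g x * \<phi> x) = 0"
    and f: "continuous_on UNIV f" "\<And>x. norm (f x) \<le> C"
  shows "(LINT x|lborel. g x * gauss x * f x) = 0"
proof -
  define k where "k x = g x * gauss x" for x
  have ik: "integrable lborel k"
    unfolding k_def by (rule g[OF gauss_schwartz])
  have mk [measurable]: "k \<in> borel_measurable borel"
    using borel_measurable_integrable[OF ik] by simp
  have mf [measurable]: "f \<in> borel_measurable borel"
    by (rule borel_measurable_continuous_onI[OF f(1)])
  have mg [measurable]: "gauss \<in> borel_measurable borel"
    by (rule rapid_measurable[OF rapid_gauss])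
  have C: "0 \<le> C" using order_trans[OF norm_ge_zero f(2)] .
  let ?m = "complex_of_real (gauss_mass TYPE('d))"
  let ?G = "LINT z|lborel. norm (gauss (z :: real^'d))"
  have 0: "(LINT x|lborel. k x * mollify h f x) = 0" if h: "0 < h" for h
  proof -
    let ?e = "\<lambda>x y. gauss ((1 / h) *\<^sub>R (y - x))"
    have mol: "complex_of_real (h ^ CARD('d)) * mollify h f x = (LINT y|lborel. f y * ?e x y)" for x
    proof -
      have "(\<lambda>y. f y * ?e x y) \<in> borel_measurable borel"
        by (intro borel_measurable_continuous_onI continuous_on_mult f(1) continuous_intros)
      from integral_scale[OF this, of h x] h show ?thesis
        by (simp add: mollify_def scaleR_conv_of_real[where 'a = complex])
    qed
    have ie: "integrable lborel (\<lambda>y. ?e x y)" for x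
      using integrable_scale[OF rapid_integrable[OF rapid_gauss], of "1 / h" "- ((1 / h) *\<^sub>R x)"] h
      by (simp add: scaleR_diff_right algebra_simps)
    have ne: "(LINT y|lborel. norm (?e x y)) = h ^ CARD('d) * ?G" for x :: "real^'d"
    proof -
      have "(\<lambda>y. norm (?e x y)) \<in> borel_measurable borel"
        by (intro borel_measurable_continuous_onI continuous_intros)
      from integral_scale[OF this, of h x] h show ?thesis by simp
    qed
    have meas: "(\<lambda>p. k (fst p) * (f (snd p) * ?e (fst p) (snd p))) \<in> borel_measurable (lborel \<Otimes>\<^sub>M lborel)"
      by measurable
    have nb: "norm (k x * (f y * ?e x y)) \<le> norm (k x) * (C * norm (?e x y))" for x y
      unfolding norm_mult by (intro mult_left_mono mult_right_mono f) auto
    have "integrable (lborel \<Otimes>\<^sub>M lborel) (\<lambda>p. norm (k (fst p)) * (C * norm (?e (fst p) (snd p))))"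
    proof (rule lborel_pair.Fubini_integrable)
      show "(\<lambda>p. norm (k (fst p)) * (C * norm (?e (fst p) (snd p)))) \<in> borel_measurable (lborel \<Otimes>\<^sub>M lborel)"
        by measurable
      have "(\<lambda>x. LINT y|lborel. norm (norm (k (fst (x, y))) * (C * norm (?e (fst (x, y)) (snd (x, y))))))
        = (\<lambda>x. (C * (h ^ CARD('d) * ?G)) * norm (k x))"
        using C by (simp add: abs_mult ne mult_ac)
      then show "integrable lborel (\<lambda>x. LINT y|lborel. norm (norm (k (fst (x, y))) * (C * norm (?e (fst (x, y)) (snd (x, y))))))"
        using integrable_mult_right[OF integrable_norm[OF ik]] by (simp only:)
      show "AE x in lborel. integrable lborel (\<lambda>y. norm (k (fst (x, y))) * (C * norm (?e (fst (x, y)) (snd (x, y)))))"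
        unfolding fst_conv snd_conv
        by (intro AE_I2 integrable_mult_right integrable_norm ie)
    qed
    then have int: "integrable (lborel \<Otimes>\<^sub>M lborel) (\<lambda>p. k (fst p) * (f (snd p) * ?e (fst p) (snd p)))"
      by (rule Bochner_Integration.integrable_bound[OF _ meas])
         (intro AE_I2 order_trans[OF nb], simp)
    have "complex_of_real (h ^ CARD('d)) * (LINT x|lborel. k x * mollify h f x)
      = (LINT x|lborel. k x * (complex_of_real (h ^ CARD('d)) * mollify h f x))"
      by (subst integral_mult_right_zero[symmetric]) (simp add: mult_ac)
    also have "\<dots> = (LINT x|lborel. LINT y|lborel. k x * (f y * ?e x y))"
      unfolding mol by simp
    also have "\<dots> = (LINT y|lborel. LINT x|lborel. k x * (f y * ?e x y))"
      by (rule lborel_pair.Fubini_integral[symmetric]) (use int in \<open>simp add: case_prod_unfold\<close>)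
    also have "\<dots> = (LINT y|(lborel :: (real^'d) measure). 0)"
    proof (intro Bochner_Integration.integral_cong refl)
      fix y :: "real^'d"
      \<comment> \<open>The square in the exponent of
        \<open>gauss ((1 / h) *\<^sub>R (y - x))\<close> is expanded and combined with
        \<open>gauss x\<close>: \<open>?a\<close> is the quadratic coefficient, \<open>?b\<close>
        the linear one, and the rest depends on \<open>y\<close> only.\<close>
      let ?a = "1 / 2 + 1 / (2 * h\<^sup>2)" and ?b = "(1 / h\<^sup>2) *\<^sub>R y"
      let ?\<phi> = "\<lambda>x. complex_of_real (exp (- ?a * (norm x)\<^sup>2 + ?b \<bullet> x))"
      let ?c = "f y * complex_of_real (exp (- ((norm y)\<^sup>2 / (2 * h\<^sup>2))))"
      have a: "0 < ?a" using h by (simp add: add_pos_pos)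
      have "gauss x * ?e x y = complex_of_real (exp (- ((norm y)\<^sup>2 / (2 * h\<^sup>2)))) * ?\<phi> x" for x
      proof -
        have "(norm ((1 / h) *\<^sub>R (y - x)))\<^sup>2 = ((norm y)\<^sup>2 - 2 * (y \<bullet> x) + (norm x)\<^sup>2) / h\<^sup>2"
          using h by (simp add: power_mult_distrib power_divide dot_norm_neg[symmetric] power2_norm_eq_inner
              inner_diff_left inner_diff_right inner_commute)
        then show ?thesis
          unfolding gauss_def of_real_mult[symmetric] exp_add[symmetric]
          using h by (simp only:) (simp add: field_simps)
      qed
      then have "(LINT x|lborel. k x * (f y * ?e x y)) = (LINT x|lborel. ?c * (g x * ?\<phi> x))"
        by (intro Bochner_Integration.integral_cong) (auto simp: k_def mult_ac)
      also have "\<dots> = ?c * (LINT x|lborel. g x * ?\<phi> x)"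
        by (rule integral_mult_right_zero)
      also have "(LINT x|lborel. g x * ?\<phi> x) = 0"
        by (rule z[OF schwartz_gauss[OF a]])
      finally show "(LINT x|lborel. k x * (f y * ?e x y)) = 0" by simp
    qed
    finally show ?thesis using h by simp
  qed
  have mmol: "mollify h f \<in> borel_measurable borel" for h
  proof -
    have "(\<lambda>p. f (fst p + h *\<^sub>R snd p) * gauss (snd p)) \<in> borel_measurable (borel \<Otimes>\<^sub>M lborel)"
      by measurable
    then have "(\<lambda>x. LINT z|lborel. f (fst (x, z) + h *\<^sub>R snd (x, z)) * gauss (snd (x, z))) \<in> borel_measurable borel"
      by (intro lborel.borel_measurable_lebesgue_integral) (simp add: case_prod_unfold)
    then show ?thesis by (simp add: mollify_def[abs_def])
  qed
  have "(\<lambda>n. LINT x|lborel. k x * mollify (mesh n) f x) \<longlonglongrightarrow> (LINT x|lborel. k x * (?m * f x))"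
  proof (rule integral_dominated_convergence)
    show "integrable lborel (\<lambda>x. (C * ?G) * norm (k x))"
      by (intro integrable_mult_right integrable_norm ik)
    show "AE x in lborel. (\<lambda>n. k x * mollify (mesh n) f x) \<longlonglongrightarrow> k x * (?m * f x)"
      by (intro AE_I2 tendsto_mult tendsto_const mollify_tendsto[OF f])
    show "AE x in lborel. norm (k x * mollify (mesh n) f x) \<le> (C * ?G) * norm (k x)" for n
      unfolding norm_mult mult.commute[of "norm (k _)"]
      by (intro AE_I2 mult_right_mono mollify_bound[OF f]) auto
    show "(\<lambda>x. k x * (?m * f x)) \<in> borel_measurable lborel" by measurable
    show "(\<lambda>x. k x * mollify (mesh n) f x) \<in> borel_measurable lborel" for n
      using mmol by measurable
  qed
  then have "(LINT x|lborel. k x * (?m * f x)) = 0"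
    by (simp add: 0[OF mesh(2)] LIMSEQ_const_iff)
  moreover have "(LINT x|lborel. k x * (?m * f x)) = ?m * (LINT x|lborel. k x * f x)"
    by (subst integral_mult_right_zero[symmetric]) (simp add: mult_ac)
  ultimately show ?thesis
    using gauss_mass_pos[where 'd = 'd] by (simp add: k_def)
qed

text \<open>Bounded continuous functions approximate indicators of closed sets, so the complex
  measure with density \<open>g * gauss\<close> vanishes on closed sets. These are stable under
  intersection and generate the Borel sets, so it vanishes everywhere; and \<open>gauss\<close> has
  no zeros.\<close>

theorem schwartz_separating:
  fixes g :: "real^'d::finite \<Rightarrow> complex"
  assumes m: "g \<in> borel_measurable borel"
    and g: "\<And>\<phi>. schwartz \<phi> \<Longrightarrow> integrable lborel (\<lambda>x. g x * \<phi> x)"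
    and z: "\<And>\<phi>. schwartz \<phi> \<Longrightarrow> (LINT x|lborel. g x * \<phi> x) = 0"
  shows "AE x in lborel. g x = 0"
proof -
  define k where "k x = g x * gauss x" for x
  have ik: "integrable lborel k"
    unfolding k_def by (rule g[OF gauss_schwartz])
  have mk [measurable]: "k \<in> borel_measurable borel"
    using borel_measurable_integrable[OF ik] by simp
  have closed: "(LINT x:A|lborel. k x) = 0" if A: "closed A" for A
  proof (cases "A = {}")
    case False
    \<comment> \<open>Continuous functions with values in [0,1], equal to 1 on \<open>A\<close> and,
      since \<open>A\<close> is closed, eventually 0 at each point outside.\<close>
    define f where "f n x = max 0 (1 - real n * infdist x A)" for n x
    have cf: "continuous_on UNIV (f n)" for n
      unfolding f_def by (intro continuous_intros)
    have b: "0 \<le> f n x" "f n x \<le> 1" for n x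
      by (auto simp: f_def infdist_nonneg)
    have lim: "(\<lambda>n. f n x) \<longlonglongrightarrow> indicator A x" for x
    proof (cases "x \<in> A")
      case True
      then show ?thesis by (simp add: f_def)
    next
      case notin: False
      have pos: "0 < infdist x A"
        by (rule infdist_pos_not_in_closed[OF A False notin])
      obtain N where N: "1 / infdist x A < real N" using reals_Archimedean2 by blast
      have "f n x = 0" if "n \<ge> N" for n
      proof -
        have "1 < real N * infdist x A" using N pos by (simp add: divide_less_eq)
        also have "\<dots> \<le> real n * infdist x A" using that pos by (intro mult_right_mono) auto
        finally show ?thesis by (simp add: f_def)
      qed
      then have "eventually (\<lambda>n. f n x = 0) sequentially"
        unfolding eventually_sequentially by blast
      then have "(\<lambda>n. f n x) \<longlonglongrightarrow> 0" by (rule tendsto_eventually)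
      then show ?thesis using notin by simp
    qed
    have "(\<lambda>n. LINT x|lborel. k x * complex_of_real (f n x)) \<longlonglongrightarrow> (LINT x|lborel. k x * complex_of_real (indicator A x))"
    proof (rule integral_dominated_convergence)
      show "integrable lborel (\<lambda>x. norm (k x))" by (intro integrable_norm ik)
      show "AE x in lborel. (\<lambda>n. k x * complex_of_real (f n x)) \<longlonglongrightarrow> k x * complex_of_real (indicator A x)"
        by (intro AE_I2 tendsto_mult tendsto_const tendsto_of_real lim)
      show "AE x in lborel. norm (k x * complex_of_real (f n x)) \<le> norm (k x)" for n
        using b by (intro AE_I2) (simp add: norm_mult mult_left_le)
      have [measurable]: "f n \<in> borel_measurable borel" for n
        by (rule borel_measurable_continuous_onI[OF cf])
      show "(\<lambda>x. k x * complex_of_real (f n x)) \<in> borel_measurable lborel" for n by measurable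
      have [measurable]: "A \<in> sets borel" using A by simp
      show "(\<lambda>x. k x * complex_of_real (indicator A x)) \<in> borel_measurable lborel" by measurable
    qed
    moreover have "(LINT x|lborel. k x * complex_of_real (f n x)) = 0" for n
      unfolding k_def using b
      by (intro integral_mult_continuous_eq_0[OF g z, of _ 1] continuous_intros cf) auto
    ultimately have "(LINT x|lborel. k x * complex_of_real (indicator A x)) = 0"
      by (simp add: LIMSEQ_const_iff)
    moreover have "(LINT x:A|lborel. k x) = (LINT x|lborel. k x * complex_of_real (indicator A x))"
      unfolding set_lebesgue_integral_def
      by (intro Bochner_Integration.integral_cong) (auto simp: scaleR_conv_of_real)
    ultimately show ?thesis by simp
  qed (simp add: set_lebesgue_integral_def)
  have sint: "set_integrable lborel A k" if "A \<in> sets borel" for A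
    unfolding set_integrable_def using integrable_mult_indicator[OF _ ik, of A] that by simp
  have all: "(LINT x:A|lborel. k x) = 0" if "A \<in> sets borel" for A
  proof -
    have "Int_stable (Collect closed :: (real^'d) set set)" "Collect closed \<subseteq> Pow (UNIV :: (real^'d) set)"
      by (auto simp: Int_stable_def)
    moreover have "A \<in> sigma_sets UNIV (Collect closed)"
      using that by (simp add: borel_eq_closed)
    ultimately show ?thesis
    proof (induction rule: sigma_sets_induct_disjoint)
      case (basic A)
      then show ?case using closed by simp
    next
      case empty
      show ?case by (simp add: set_lebesgue_integral_def)
    next
      case (compl A)
      then have A: "A \<in> sets borel" by (simp add: borel_eq_closed)
      have "(LINT x:UNIV|lborel. k x) = (LINT x:A \<union> (UNIV - A)|lborel. k x)" by simp
      also have "\<dots> = (LINT x:A|lborel. k x) + (LINT x:(UNIV - A)|lborel. k x)"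
        using A by (intro set_integral_Un sint) auto
      finally show ?case using compl closed[OF closed_UNIV] by simp
    next
      case (union A)
      then have A: "\<And>i. A i \<in> sets borel" by (auto simp: borel_eq_closed)
      have "(LINT x:(\<Union>i. A i)|lborel. k x) = (\<Sum>i. (LINT x:(A i)|lborel. k x))"
        using union(1) A by (intro lebesgue_integral_countable_add sint) (auto simp: disjoint_family_on_def)
      then show ?case using union by simp
    qed
  qed
  have "AE x in lborel. Re (k x) = 0"
  proof (rule density_unique_real)
    show "integrable lborel (\<lambda>x. Re (k x))" using ik by (rule integrable_Re)
    fix A :: "(real^'d) set" assume "A \<in> sets lborel"
    then have A: "A \<in> sets borel" by simp
    have "(LINT x:A|lborel. Re (k x)) = Re (LINT x:A|lborel. k x)"
      using sint[OF A] unfolding set_lebesgue_integral_def set_integrable_def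
      by (subst integral_Re[symmetric]) auto
    then show "(LINT x:A|lborel. Re (k x)) = (LINT x:A|lborel. 0)"
      using all[OF A] by (simp add: set_lebesgue_integral_def)
  qed simp
  moreover have "AE x in lborel. Im (k x) = 0"
  proof (rule density_unique_real)
    show "integrable lborel (\<lambda>x. Im (k x))" using ik by (rule integrable_Im)
    fix A :: "(real^'d) set" assume "A \<in> sets lborel"
    then have A: "A \<in> sets borel" by simp
    have "(LINT x:A|lborel. Im (k x)) = Im (LINT x:A|lborel. k x)"
      using sint[OF A] unfolding set_lebesgue_integral_def set_integrable_def
      by (subst integral_Im[symmetric]) auto
    then show "(LINT x:A|lborel. Im (k x)) = (LINT x:A|lborel. 0)"
      using all[OF A] by (simp add: set_lebesgue_integral_def)
  qed simp
  ultimately show ?thesis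
    by eventually_elim (auto simp: k_def gauss_def complex_eq_iff)
qed


section \<open>Quasi-seminorms on the function spaces\<close>

text \<open>The constant \<open>2\<close> in the triangle inequality avoids Minkowski's inequality for integrals; it is
  stable under all the space constructions, and boundedness arguments do not see it.\<close>

definition qsnorm :: "'a::real_vector nspace \<Rightarrow> bool"
  where "qsnorm X \<longleftrightarrow>
    (\<forall>x\<in>carr X. \<forall>y\<in>carr X. x + y \<in> carr X \<and> nrm X (x + y) \<le> 2 * (nrm X x + nrm X y)) \<and>
    (\<forall>x\<in>carr X. \<forall>r. r *\<^sub>R x \<in> carr X \<and> nrm X (r *\<^sub>R x) \<le> \<bar>r\<bar> * nrm X x) \<and>
    (\<forall>x\<in>carr X. 0 \<le> nrm X x)"

lemma qsnormD:
  assumes "qsnorm X" "x \<in> carr X"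
  shows "y \<in> carr X \<Longrightarrow> x + y \<in> carr X"
    and "y \<in> carr X \<Longrightarrow> nrm X (x + y) \<le> 2 * (nrm X x + nrm X y)"
    and "r *\<^sub>R x \<in> carr X"
    and "nrm X (r *\<^sub>R x) \<le> \<bar>r\<bar> * nrm X x"
    and "0 \<le> nrm X x"
  using assms unfolding qsnorm_def by blast+

lemma qsnorm_diff:
  assumes "qsnorm X" "x \<in> carr X" "y \<in> carr X"
  shows "x - y \<in> carr X" "nrm X (x - y) \<le> 2 * (nrm X x + nrm X y)"
proof -
  have y: "- y \<in> carr X" "nrm X (- y) \<le> nrm X y"
    using qsnormD(3,4)[OF assms(1,3), of "-1"] by auto
  show "x - y \<in> carr X" using qsnormD(1)[OF assms(1,2) y(1)] by simp
  show "nrm X (x - y) \<le> 2 * (nrm X x + nrm X y)"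
    using qsnormD(2)[OF assms(1,2) y(1)] y(2) by simp
qed

lemma sqrt_scale:
  fixes a b r :: real
  assumes "0 \<le> r"
  shows "sqrt ((r * a)\<^sup>2 + (r * b)\<^sup>2) = r * sqrt (a\<^sup>2 + b\<^sup>2)"
proof -
  have "(r * a)\<^sup>2 + (r * b)\<^sup>2 = r\<^sup>2 * (a\<^sup>2 + b\<^sup>2)"
    by (simp add: power_mult_distrib distrib_left)
  then show ?thesis using assms by (simp add: real_sqrt_mult)
qed

lemma qsnorm_prod_space:
  assumes X: "qsnorm X" and Y: "qsnorm Y"
  shows "qsnorm (prod_space X Y)"
proof -
  have add: "sqrt ((nrm X (a + c))\<^sup>2 + (nrm Y (b + d))\<^sup>2)
      \<le> 2 * (sqrt ((nrm X a)\<^sup>2 + (nrm Y b)\<^sup>2) + sqrt ((nrm X c)\<^sup>2 + (nrm Y d)\<^sup>2))"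
    if "a \<in> carr X" "c \<in> carr X" "b \<in> carr Y" "d \<in> carr Y" for a b c d
  proof -
    have "sqrt ((nrm X (a + c))\<^sup>2 + (nrm Y (b + d))\<^sup>2)
      \<le> sqrt ((2 * nrm X a + 2 * nrm X c)\<^sup>2 + (2 * nrm Y b + 2 * nrm Y d)\<^sup>2)"
      using qsnormD(2,5)[OF X] qsnormD(1,2,5)[OF Y] qsnormD(1)[OF X] that
      by (intro real_sqrt_le_mono add_mono power_mono) simp_all
    also have "\<dots> \<le> sqrt ((2 * nrm X a)\<^sup>2 + (2 * nrm Y b)\<^sup>2) + sqrt ((2 * nrm X c)\<^sup>2 + (2 * nrm Y d)\<^sup>2)"
      by (rule real_sqrt_sum_squares_triangle_ineq)
    also have "\<dots> = 2 * (sqrt ((nrm X a)\<^sup>2 + (nrm Y b)\<^sup>2) + sqrt ((nrm X c)\<^sup>2 + (nrm Y d)\<^sup>2))"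
      by (simp only: sqrt_scale[of 2] zero_le_numeral distrib_left)
    finally show ?thesis .
  qed
  have scale: "sqrt ((nrm X (r *\<^sub>R a))\<^sup>2 + (nrm Y (r *\<^sub>R b))\<^sup>2) \<le> \<bar>r\<bar> * sqrt ((nrm X a)\<^sup>2 + (nrm Y b)\<^sup>2)"
    if "a \<in> carr X" "b \<in> carr Y" for a b r
  proof -
    have "sqrt ((nrm X (r *\<^sub>R a))\<^sup>2 + (nrm Y (r *\<^sub>R b))\<^sup>2) \<le> sqrt ((\<bar>r\<bar> * nrm X a)\<^sup>2 + (\<bar>r\<bar> * nrm Y b)\<^sup>2)"
      using qsnormD[OF X that(1)] qsnormD[OF Y that(2)]
        qsnormD(5)[OF X qsnormD(3)[OF X that(1)]] qsnormD(5)[OF Y qsnormD(3)[OF Y that(2)]]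
      by (intro real_sqrt_le_mono add_mono power_mono)
    also have "\<dots> = \<bar>r\<bar> * sqrt ((nrm X a)\<^sup>2 + (nrm Y b)\<^sup>2)"
      by (rule sqrt_scale) simp
    finally show ?thesis .
  qed
  show ?thesis
    unfolding qsnorm_def prod_space_def
    using add scale qsnormD(1,3)[OF X] qsnormD(1,3)[OF Y] by (auto simp: split_def)
qed

lemma qsnorm_cube_space: "qsnorm X \<Longrightarrow> qsnorm (cube_space X)"
  unfolding cube_space_def by (intro qsnorm_prod_space)

lemma qsnorm_vec_space:
  assumes X: "qsnorm X"
  shows "qsnorm (vec_space X :: ('a::real_vector, 'n::finite) vec nspace)"
proof -
  have L2: "sqrt (\<Sum>j\<in>UNIV. (nrm X (x $ j))\<^sup>2) = L2_set (\<lambda>j. nrm X (x $ j)) UNIV" for x :: "('a, 'n) vec"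
    by (simp add: L2_set_def)
  have add: "L2_set (\<lambda>j. nrm X ((x + y) $ j)) UNIV \<le> 2 * (L2_set (\<lambda>j. nrm X (x $ j)) UNIV + L2_set (\<lambda>j. nrm X (y $ j)) UNIV)"
    if "\<forall>j. x $ j \<in> carr X" "\<forall>j. y $ j \<in> carr X" for x y :: "('a, 'n) vec"
  proof -
    have "L2_set (\<lambda>j. nrm X ((x + y) $ j)) UNIV \<le> L2_set (\<lambda>j. 2 * nrm X (x $ j) + 2 * nrm X (y $ j)) UNIV"
      using qsnormD(1,2,5)[OF X] that by (intro L2_set_mono) auto
    also have "\<dots> \<le> L2_set (\<lambda>j. 2 * nrm X (x $ j)) UNIV + L2_set (\<lambda>j. 2 * nrm X (y $ j)) UNIV"
      by (rule L2_set_triangle_ineq)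
    also have "\<dots> = 2 * (L2_set (\<lambda>j. nrm X (x $ j)) UNIV + L2_set (\<lambda>j. nrm X (y $ j)) UNIV)"
      by (simp only: L2_set_right_distrib[symmetric, of 2] zero_le_numeral distrib_left)
    finally show ?thesis .
  qed
  have scale: "L2_set (\<lambda>j. nrm X ((r *\<^sub>R x) $ j)) UNIV \<le> \<bar>r\<bar> * L2_set (\<lambda>j. nrm X (x $ j)) UNIV"
    if "\<forall>j. x $ j \<in> carr X" for x :: "('a, 'n) vec" and r
  proof -
    have "L2_set (\<lambda>j. nrm X ((r *\<^sub>R x) $ j)) UNIV \<le> L2_set (\<lambda>j. \<bar>r\<bar> * nrm X (x $ j)) UNIV"
      using qsnormD(3,4,5)[OF X] that by (intro L2_set_mono) auto
    then show ?thesis by (simp add: L2_set_right_distrib)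
  qed
  show ?thesis
    unfolding qsnorm_def vec_space_def fst_conv snd_conv L2
    using add scale qsnormD(1,3)[OF X] by (auto simp: L2_set_nonneg)
qed

text \<open>The supremum norm on curves is meaningful only for bounded sets of values. Continuity is
  expressed through \<open>nrm\<close> and not through a topology, so compactness of
  \<open>[0,T]\<close> enters by bisection: boundedness near each point implies boundedness on the
  interval.\<close>

lemma curve_space_bounded:
  assumes X: "qsnorm X" and f: "f \<in> carr (curve_space T X)"
  shows "bdd_above ((\<lambda>t. nrm X (f t)) ` {0..T})"
proof (cases "0 \<le> T")
  case True
  have fX: "f t \<in> carr X" if "t \<in> {0..T}" for t
    using f that by (simp add: curve_space_def)
  have "\<exists>M. \<forall>t\<in>{0..T}. t \<le> T \<longrightarrow> nrm X (f t) \<le> M"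
  proof (induction rule: Bolzano[where P = "\<lambda>a b. \<exists>M. \<forall>t\<in>{0..T}. a \<le> t \<and> t \<le> b \<longrightarrow> nrm X (f t) \<le> M", OF True, THEN exE])
    case (1 a b c)
    then obtain M N where "\<forall>t\<in>{0..T}. a \<le> t \<and> t \<le> b \<longrightarrow> nrm X (f t) \<le> M" "\<forall>t\<in>{0..T}. b \<le> t \<and> t \<le> c \<longrightarrow> nrm X (f t) \<le> N"
      by blast
    then have "\<forall>t\<in>{0..T}. a \<le> t \<and> t \<le> c \<longrightarrow> nrm X (f t) \<le> max M N"
      by (metis le_cases max.coboundedI1 max.coboundedI2)
    then show ?case by blast
  next
    case (2 x)
    then have x: "x \<in> {0..T}" by simp
    then have "((\<lambda>t'. nrm X (f t' - f x)) \<longlongrightarrow> 0) (at x within {0..T})"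
      using f by (simp add: curve_space_def)
    then have "eventually (\<lambda>t'. nrm X (f t' - f x) < 1) (at x within {0..T})"
      by (rule order_tendstoD) simp
    then obtain d where d: "d > 0" "\<And>t. t \<in> {0..T} \<Longrightarrow> t \<noteq> x \<Longrightarrow> dist t x < d \<Longrightarrow> nrm X (f t - f x) < 1"
      unfolding eventually_at by blast
    have "nrm X (f t) \<le> 2 * (1 + nrm X (f x)) + nrm X (f x)" if t: "t \<in> {0..T}" "dist t x < d" for t
    proof (cases "t = x")
      case False
      have "nrm X ((f t - f x) + f x) \<le> 2 * (nrm X (f t - f x) + nrm X (f x))"
        by (intro qsnormD(2)[OF X] qsnorm_diff[OF X] fX t x)
      also have "\<dots> \<le> 2 * (1 + nrm X (f x))"
        using d(2)[OF t(1) False t(2)] by simp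
      finally show ?thesis using qsnormD(5)[OF X fX[OF x]] by simp
    qed (use qsnormD(5)[OF X fX[OF x]] in simp)
    then have "\<forall>t\<in>{0..T}. a \<le> t \<and> t \<le> b \<longrightarrow> nrm X (f t) \<le> 2 * (1 + nrm X (f x)) + nrm X (f x)"
      if "a \<le> x" "x \<le> b" "b - a < d" for a b
      using that by (auto simp: dist_real_def abs_if)
    with d(1) show ?case by blast
  next
    case (3 M)
    then show ?case by auto
  qed
  then show ?thesis by (auto simp: bdd_above_def)
qed simp

lemma curve_space_nrm_ge:
  assumes "qsnorm X" "f \<in> carr (curve_space T X)" "t \<in> {0..T}"
  shows "nrm X (f t) \<le> nrm (curve_space T X) f"
  using cSUP_upper[OF assms(3) curve_space_bounded[OF assms(1,2)]]
  by (simp add: curve_space_def)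

lemma qsnorm_curve_space:
  assumes X: "qsnorm X" and T: "0 \<le> T"
  shows "qsnorm (curve_space T X)"
  unfolding qsnorm_def
proof (intro conjI ballI allI)
  let ?Y = "curve_space T X"
  have ne: "{0..T} \<noteq> {}" using T by simp
  have nrmY: "nrm ?Y h = (SUP t\<in>{0..T}. nrm X (h t))" for h by (simp add: curve_space_def)
  fix f assume f: "f \<in> carr ?Y"
  have fX: "f t \<in> carr X" and fc: "((\<lambda>t'. nrm X (f t' - f t)) \<longlongrightarrow> 0) (at t within {0..T})" if "t \<in> {0..T}" for t
    using f that by (simp_all add: curve_space_def)
  have f0: "f t = 0" if "t \<notin> {0..T}" for t
    using f that by (auto simp: curve_space_def)
  have "0 \<le> nrm X (f 0)" using qsnormD(5)[OF X fX] T by simp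
  also have "\<dots> \<le> nrm ?Y f" using curve_space_nrm_ge[OF X f, of 0] T by simp
  finally show "0 \<le> nrm ?Y f" .
  { fix g assume g: "g \<in> carr ?Y"
    have gX: "g t \<in> carr X" and gc: "((\<lambda>t'. nrm X (g t' - g t)) \<longlongrightarrow> 0) (at t within {0..T})" if "t \<in> {0..T}" for t
      using g that by (simp_all add: curve_space_def)
    have g0: "g t = 0" if "t \<notin> {0..T}" for t
      using g that by (auto simp: curve_space_def)
    have "((\<lambda>t'. nrm X ((f + g) t' - (f + g) t)) \<longlongrightarrow> 0) (at t within {0..T})" if t: "t \<in> {0..T}" for t
    proof (rule tendsto_sandwich[OF _ _ tendsto_const])
      have *: "(f + g) t' - (f + g) t = (f t' - f t) + (g t' - g t)" for t' by simp
      show "eventually (\<lambda>t'. 0 \<le> nrm X ((f + g) t' - (f + g) t)) (at t within {0..T})"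
        unfolding eventually_at_filter *
        by (intro always_eventually allI impI qsnormD(5)[OF X] qsnormD(1)[OF X] qsnorm_diff[OF X] fX gX t)
      show "eventually (\<lambda>t'. nrm X ((f + g) t' - (f + g) t) \<le> 2 * (nrm X (f t' - f t) + nrm X (g t' - g t))) (at t within {0..T})"
        unfolding eventually_at_filter *
        by (intro always_eventually allI impI qsnormD(2)[OF X] qsnorm_diff[OF X] fX gX t)
      show "((\<lambda>t'. 2 * (nrm X (f t' - f t) + nrm X (g t' - g t))) \<longlongrightarrow> 0) (at t within {0..T})"
        by (rule tendsto_eq_intros fc gc t refl | simp)+
    qed
    then show "f + g \<in> carr ?Y"
      using fX gX f0 g0 qsnormD(1)[OF X] by (simp add: curve_space_def)
    show "nrm ?Y (f + g) \<le> 2 * (nrm ?Y f + nrm ?Y g)"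
      unfolding nrmY[of "f + g"]
    proof (rule cSUP_least[OF ne])
      fix t assume t: "t \<in> {0..T}"
      have "nrm X ((f + g) t) \<le> 2 * (nrm X (f t) + nrm X (g t))"
        using qsnormD(2)[OF X fX[OF t] gX[OF t]] by simp
      also have "\<dots> \<le> 2 * (nrm ?Y f + nrm ?Y g)"
        using curve_space_nrm_ge[OF X f t] curve_space_nrm_ge[OF X g t] by simp
      finally show "nrm X ((f + g) t) \<le> 2 * (nrm ?Y f + nrm ?Y g)" .
    qed }
  fix r :: real
  have "((\<lambda>t'. nrm X ((r *\<^sub>R f) t' - (r *\<^sub>R f) t)) \<longlongrightarrow> 0) (at t within {0..T})" if t: "t \<in> {0..T}" for t
  proof (rule tendsto_sandwich[OF _ _ tendsto_const])
    have *: "(r *\<^sub>R f) t' - (r *\<^sub>R f) t = r *\<^sub>R (f t' - f t)" for t'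
      by (simp add: scaleR_fun_def scaleR_diff_right)
    show "eventually (\<lambda>t'. 0 \<le> nrm X ((r *\<^sub>R f) t' - (r *\<^sub>R f) t)) (at t within {0..T})"
      unfolding eventually_at_filter *
      by (intro always_eventually allI impI qsnormD(5)[OF X] qsnormD(3)[OF X] qsnorm_diff[OF X] fX t)
    show "eventually (\<lambda>t'. nrm X ((r *\<^sub>R f) t' - (r *\<^sub>R f) t) \<le> \<bar>r\<bar> * nrm X (f t' - f t)) (at t within {0..T})"
      unfolding eventually_at_filter *
      by (intro always_eventually allI impI qsnormD(4)[OF X] qsnorm_diff[OF X] fX t)
    show "((\<lambda>t'. \<bar>r\<bar> * nrm X (f t' - f t)) \<longlongrightarrow> 0) (at t within {0..T})"
      by (rule tendsto_eq_intros fc t refl | simp)+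
  qed
  then show "r *\<^sub>R f \<in> carr ?Y"
    using fX f0 qsnormD(3)[OF X] by (simp add: curve_space_def scaleR_fun_def)
  show "nrm ?Y (r *\<^sub>R f) \<le> \<bar>r\<bar> * nrm ?Y f"
    unfolding nrmY[of "r *\<^sub>R f"]
  proof (rule cSUP_least[OF ne])
    fix t assume t: "t \<in> {0..T}"
    have "nrm X ((r *\<^sub>R f) t) \<le> \<bar>r\<bar> * nrm X (f t)"
      using qsnormD(4)[OF X fX[OF t]] by (simp add: scaleR_fun_def)
    also have "\<dots> \<le> \<bar>r\<bar> * nrm ?Y f"
      using curve_space_nrm_ge[OF X f t] by (intro mult_left_mono) auto
    finally show "nrm X ((r *\<^sub>R f) t) \<le> \<bar>r\<bar> * nrm ?Y f" .
  qed
qed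


section \<open>Sobolev norms through the Fourier transform\<close>

definition sob_weight :: "real \<Rightarrow> real^'d::finite \<Rightarrow> real"
  where "sob_weight s \<xi> = (1 + (norm \<xi>)\<^sup>2) powr s"

lemma sob_weight_pos: "0 < sob_weight s \<xi>"
proof -
  have "0 < 1 + (norm \<xi>)\<^sup>2" by (simp add: add_pos_nonneg)
  then show ?thesis by (simp add: sob_weight_def)
qed

lemma sob_weight_measurable [measurable]: "sob_weight s \<in> borel_measurable borel"
  unfolding sob_weight_def[abs_def] by measurable

lemma sob_weight_minus: "sob_weight (- s) \<xi> * sob_weight s \<xi> = 1"
proof -
  have "1 + (norm \<xi>)\<^sup>2 \<noteq> 0" using zero_le_power2[of "norm \<xi>"] by linarith
  then show ?thesis by (simp add: sob_weight_def powr_add[symmetric])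
qed

lemma has_fourier_transform_measurable:
  "has_fourier_transform F g \<Longrightarrow> g \<in> borel_measurable borel"
  by (simp add: has_fourier_transform_def)

lemma has_fourier_transform_unique:
  assumes "has_fourier_transform F g" "has_fourier_transform F h"
  shows "AE \<xi> in lborel. g \<xi> = h \<xi>"
proof -
  have "AE \<xi> in lborel. g \<xi> - h \<xi> = 0"
  proof (rule schwartz_separating)
    show "(\<lambda>\<xi>. g \<xi> - h \<xi>) \<in> borel_measurable borel"
      by (intro borel_measurable_diff has_fourier_transform_measurable[OF assms(1)] has_fourier_transform_measurable[OF assms(2)])
    fix \<phi> :: "real^'a \<Rightarrow> complex" assume \<phi>: "schwartz \<phi>"
    have g: "integrable lborel (\<lambda>\<xi>. g \<xi> * \<phi> \<xi>)" "F (fourier \<phi>) = (LINT \<xi>|lborel. g \<xi> * \<phi> \<xi>)"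
      and h: "integrable lborel (\<lambda>\<xi>. h \<xi> * \<phi> \<xi>)" "F (fourier \<phi>) = (LINT \<xi>|lborel. h \<xi> * \<phi> \<xi>)"
      using assms \<phi> unfolding has_fourier_transform_def by blast+
    show "integrable lborel (\<lambda>\<xi>. (g \<xi> - h \<xi>) * \<phi> \<xi>)"
      using g(1) h(1) by (simp add: left_diff_distrib)
    show "(LINT \<xi>|lborel. (g \<xi> - h \<xi>) * \<phi> \<xi>) = 0"
      using g h by (simp add: left_diff_distrib)
  qed
  then show ?thesis by simp
qed

lemma has_fourier_transform_fourier_transform:
  "has_fourier_transform F g \<Longrightarrow> has_fourier_transform F (fourier_transform F)"
  unfolding fourier_transform_def by (rule someI[of "has_fourier_transform F"])

lemma fourier_transform_AE:
  "has_fourier_transform F g \<Longrightarrow> AE \<xi> in lborel. fourier_transform F \<xi> = g \<xi>"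
  by (rule has_fourier_transform_unique[OF has_fourier_transform_fourier_transform])

lemma has_fourier_transform_add:
  assumes "has_fourier_transform F g" "has_fourier_transform H h"
  shows "has_fourier_transform (F + H) (\<lambda>\<xi>. g \<xi> + h \<xi>)"
  using assms borel_measurable_add[OF assms[THEN has_fourier_transform_measurable]]
  unfolding has_fourier_transform_def by (simp add: distrib_right)

lemma has_fourier_transform_scale:
  assumes "has_fourier_transform F g"
  shows "has_fourier_transform (r *\<^sub>R F) (\<lambda>\<xi>. r *\<^sub>R g \<xi>)"
  using assms borel_measurable_scaleR[OF borel_measurable_const[of r] has_fourier_transform_measurable[OF assms]]
  unfolding has_fourier_transform_def by (simp add: scaleR_fun_def)

lemma sobolev_carr_iff:
  "F \<in> carr (sobolev s) \<longleftrightarrow> tempered F \<and>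
    (\<exists>g. has_fourier_transform F g \<and> integrable lborel (\<lambda>\<xi>. sob_weight s \<xi> * (norm (g \<xi>))\<^sup>2))"
  by (simp add: sobolev_def sob_weight_def)

text \<open>The norm is defined through a chosen representative of the transform; representatives
  agree almost everywhere, so any transform at hand computes it.\<close>

lemma sobolev_nrm:
  assumes "has_fourier_transform F g"
  shows "nrm (sobolev s) F = sqrt (LINT \<xi>|lborel. sob_weight s \<xi> * (norm (g \<xi>))\<^sup>2)"
proof -
  have [measurable]: "g \<in> borel_measurable borel" "fourier_transform F \<in> borel_measurable borel"
    using assms has_fourier_transform_fourier_transform[OF assms] by (simp_all add: has_fourier_transform_def)
  have "(LINT \<xi>|lborel. sob_weight s \<xi> * (norm (fourier_transform F \<xi>))\<^sup>2) = (LINT \<xi>|lborel. sob_weight s \<xi> * (norm (g \<xi>))\<^sup>2)"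
    by (intro integral_cong_AE) (use fourier_transform_AE[OF assms] in \<open>measurable; auto\<close>)+
  then show ?thesis by (simp add: sobolev_def sob_weight_def)
qed

lemma schwartz_seminorm_bdd:
  fixes \<phi> :: "real^'d::finite \<Rightarrow> complex"
  assumes "schwartz \<phi>"
  shows "bdd_above ((\<lambda>(js, x). (1 + norm x) ^ N * norm (iter_partial js \<phi> x)) ` ({js. length js \<le> N} \<times> UNIV))"
proof -
  have "\<exists>M. \<forall>x. (1 + norm x) ^ N * norm (iter_partial js \<phi> x) \<le> M" for js
  proof -
    have "bounded (range (\<lambda>x. (1 + norm x) ^ N * norm (iter_partial js \<phi> x)))"
      using assms unfolding schwartz_def by blast
    then show ?thesis unfolding bounded_iff by (auto intro: order_trans[OF abs_ge_self])
  qed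
  then obtain M where M: "\<And>js x. (1 + norm x) ^ N * norm (iter_partial js \<phi> x) \<le> M js" by metis
  have fin: "finite {js :: 'd list. length js \<le> N}"
    using finite_lists_length_le[of "UNIV :: 'd set" N] by simp
  show ?thesis
  proof (rule bdd_aboveI2, clarify)
    fix js :: "'d list" and x :: "real^'d" assume "length js \<le> N"
    then have "M js \<le> Max (M ` {js. length js \<le> N})" using fin by (intro Max_ge) auto
    then show "(1 + norm x) ^ N * norm (iter_partial js \<phi> x) \<le> Max (M ` {js. length js \<le> N})"
      using M order_trans by blast
  qed
qed

lemma schwartz_seminorm_ge:
  assumes "schwartz \<phi>"
  shows "(1 + norm x) ^ N * norm (\<phi> x) \<le> schwartz_seminorm N \<phi>"
  using cSUP_upper[OF _ schwartz_seminorm_bdd[OF assms], of "([], x)" N]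
  by (simp add: schwartz_seminorm_def)

lemma schwartz_seminorm_nonneg: "schwartz \<phi> \<Longrightarrow> 0 \<le> schwartz_seminorm N \<phi>"
  by (rule order_trans[OF _ schwartz_seminorm_ge[of _ 0]]) auto

lemma schwartz_seminorm_mono:
  fixes \<phi> :: "real^'d::finite \<Rightarrow> complex"
  assumes "schwartz \<phi>" "M \<le> N"
  shows "schwartz_seminorm M \<phi> \<le> schwartz_seminorm N \<phi>"
  unfolding schwartz_seminorm_def[of M]
proof (rule cSUP_least)
  have "([], 0) \<in> {js :: 'd list. length js \<le> M} \<times> (UNIV :: (real^'d) set)" by simp
  then show "{js :: 'd list. length js \<le> M} \<times> (UNIV :: (real^'d) set) \<noteq> {}" by blast
  fix p assume "p \<in> {js :: 'd list. length js \<le> M} \<times> (UNIV :: (real^'d) set)"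
  then obtain js x where p: "p = (js, x)" "length js \<le> M" by auto
  have "(1 + norm x) ^ M * norm (iter_partial js \<phi> x) \<le> (1 + norm x) ^ N * norm (iter_partial js \<phi> x)"
    by (intro mult_right_mono power_increasing assms) auto
  also have "\<dots> \<le> schwartz_seminorm N \<phi>"
    using cSUP_upper[OF _ schwartz_seminorm_bdd[OF assms(1)], of "(js, x)" N] p assms(2)
    by (simp add: schwartz_seminorm_def)
  finally show "(case p of (js, x) \<Rightarrow> (1 + norm x) ^ M * norm (iter_partial js \<phi> x)) \<le> schwartz_seminorm N \<phi>"
    using p by simp
qed

lemma tempered_add:
  assumes "tempered F" "tempered H"
  shows "tempered (F + H)"
proof -
  have F: "\<And>\<phi> \<psi>. schwartz \<phi> \<Longrightarrow> schwartz \<psi> \<Longrightarrow> F (\<lambda>x. \<phi> x + \<psi> x) = F \<phi> + F \<psi>"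
    "\<And>c \<phi>. schwartz \<phi> \<Longrightarrow> F (\<lambda>x. c * \<phi> x) = c * F \<phi>" "\<And>\<phi>. \<not> schwartz \<phi> \<Longrightarrow> F \<phi> = 0"
    using assms(1) by (simp_all add: tempered_def)
  have H: "\<And>\<phi> \<psi>. schwartz \<phi> \<Longrightarrow> schwartz \<psi> \<Longrightarrow> H (\<lambda>x. \<phi> x + \<psi> x) = H \<phi> + H \<psi>"
    "\<And>c \<phi>. schwartz \<phi> \<Longrightarrow> H (\<lambda>x. c * \<phi> x) = c * H \<phi>" "\<And>\<phi>. \<not> schwartz \<phi> \<Longrightarrow> H \<phi> = 0"
    using assms(2) by (simp_all add: tempered_def)
  obtain M C where M: "\<And>\<phi>. schwartz \<phi> \<Longrightarrow> norm (F \<phi>) \<le> C * schwartz_seminorm M \<phi>"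
    using assms(1) unfolding tempered_def by blast
  obtain N D where N: "\<And>\<phi>. schwartz \<phi> \<Longrightarrow> norm (H \<phi>) \<le> D * schwartz_seminorm N \<phi>"
    using assms(2) unfolding tempered_def by blast
  have "norm ((F + H) \<phi>) \<le> (\<bar>C\<bar> + \<bar>D\<bar>) * schwartz_seminorm (max M N) \<phi>" if \<phi>: "schwartz \<phi>" for \<phi>
  proof -
    have 1: "norm (F \<phi>) \<le> \<bar>C\<bar> * schwartz_seminorm (max M N) \<phi>"
    proof -
      note M[OF \<phi>]
      also have "C * schwartz_seminorm M \<phi> \<le> \<bar>C\<bar> * schwartz_seminorm M \<phi>"
        by (intro mult_right_mono schwartz_seminorm_nonneg \<phi>) auto
      also have "\<dots> \<le> \<bar>C\<bar> * schwartz_seminorm (max M N) \<phi>"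
        by (intro mult_left_mono schwartz_seminorm_mono \<phi>) auto
      finally show ?thesis .
    qed
    have 2: "norm (H \<phi>) \<le> \<bar>D\<bar> * schwartz_seminorm (max M N) \<phi>"
    proof -
      note N[OF \<phi>]
      also have "D * schwartz_seminorm N \<phi> \<le> \<bar>D\<bar> * schwartz_seminorm N \<phi>"
        by (intro mult_right_mono schwartz_seminorm_nonneg \<phi>) auto
      also have "\<dots> \<le> \<bar>D\<bar> * schwartz_seminorm (max M N) \<phi>"
        by (intro mult_left_mono schwartz_seminorm_mono \<phi>) auto
      finally show ?thesis .
    qed
    show ?thesis
      using norm_triangle_ineq[of "F \<phi>" "H \<phi>"] 1 2 by (simp add: distrib_right)
  qed
  then show ?thesis
    unfolding tempered_def using F H by (auto simp: distrib_left)
qed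

lemma tempered_scale:
  assumes "tempered F"
  shows "tempered (r *\<^sub>R F)"
proof -
  obtain M C where M: "\<And>\<phi>. schwartz \<phi> \<Longrightarrow> norm (F \<phi>) \<le> C * schwartz_seminorm M \<phi>"
    using assms unfolding tempered_def by blast
  have "norm ((r *\<^sub>R F) \<phi>) \<le> (\<bar>r\<bar> * C) * schwartz_seminorm M \<phi>" if "schwartz \<phi>" for \<phi>
    using mult_left_mono[OF M[OF that], of "\<bar>r\<bar>"] by (simp add: scaleR_fun_def)
  moreover have "F (\<lambda>x. \<phi> x + \<psi> x) = F \<phi> + F \<psi>" if "schwartz \<phi>" "schwartz \<psi>" for \<phi> \<psi>
    using assms that by (simp add: tempered_def)
  moreover have "F (\<lambda>x. c * \<phi> x) = c * F \<phi>" if "schwartz \<phi>" for c \<phi>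
    using assms that by (simp add: tempered_def)
  moreover have "F \<phi> = 0" if "\<not> schwartz \<phi>" for \<phi>
    using assms that by (simp add: tempered_def)
  ultimately show ?thesis
    unfolding tempered_def by (auto simp: scaleR_fun_def scaleR_add_right)
qed

text \<open>The pointwise bound \<open>(a + b)\<^sup>2 \<le> 2 * a\<^sup>2 + 2 * b\<^sup>2\<close>
  and subadditivity of the root give the triangle inequality with constant \<open>sqrt 2\<close>,
  which is below 2.\<close>

lemma qsnorm_sobolev: "qsnorm (sobolev s :: 'd::finite distr nspace)"
  unfolding qsnorm_def
proof (intro conjI ballI allI)
  fix F :: "'d distr" assume F: "F \<in> carr (sobolev s)"
  then obtain g where tF: "tempered F" and g: "has_fourier_transform F g"
    and ig: "integrable lborel (\<lambda>\<xi>. sob_weight s \<xi> * (norm (g \<xi>))\<^sup>2)"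
    unfolding sobolev_carr_iff by blast
  have [measurable]: "g \<in> borel_measurable borel" using g by (simp add: has_fourier_transform_def)
  let ?I = "\<lambda>g. LINT \<xi>|lborel. sob_weight s \<xi> * (norm (g \<xi>))\<^sup>2"
  have I0: "0 \<le> ?I g" for g
    by (intro Bochner_Integration.integral_nonneg) (simp add: less_imp_le[OF sob_weight_pos])
  show "0 \<le> nrm (sobolev s) F" unfolding sobolev_nrm[OF g] using I0 by simp
  { fix H :: "'d distr" assume H: "H \<in> carr (sobolev s)"
    then obtain h where tH: "tempered H" and h: "has_fourier_transform H h"
      and ih: "integrable lborel (\<lambda>\<xi>. sob_weight s \<xi> * (norm (h \<xi>))\<^sup>2)"
      unfolding sobolev_carr_iff by blast
    have [measurable]: "h \<in> borel_measurable borel" using h by (simp add: has_fourier_transform_def)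
    let ?b = "\<lambda>\<xi>. 2 * (sob_weight s \<xi> * (norm (g \<xi>))\<^sup>2) + 2 * (sob_weight s \<xi> * (norm (h \<xi>))\<^sup>2)"
    have b: "sob_weight s \<xi> * (norm (g \<xi> + h \<xi>))\<^sup>2 \<le> ?b \<xi>" for \<xi>
    proof -
      have "(norm (g \<xi> + h \<xi>))\<^sup>2 \<le> (norm (g \<xi>) + norm (h \<xi>))\<^sup>2"
        by (intro power_mono norm_triangle_ineq) auto
      also have "\<dots> \<le> 2 * (norm (g \<xi>))\<^sup>2 + 2 * (norm (h \<xi>))\<^sup>2"
        using zero_le_power2[of "norm (g \<xi>) - norm (h \<xi>)"] by (simp add: power2_eq_square algebra_simps)
      finally have "sob_weight s \<xi> * (norm (g \<xi> + h \<xi>))\<^sup>2 \<le> sob_weight s \<xi> * (2 * (norm (g \<xi>))\<^sup>2 + 2 * (norm (h \<xi>))\<^sup>2)"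
        by (intro mult_left_mono less_imp_le[OF sob_weight_pos])
      then show ?thesis by (simp add: algebra_simps)
    qed
    have ib: "integrable lborel ?b"
      by (intro Bochner_Integration.integrable_add integrable_mult_right ig ih)
    have i: "integrable lborel (\<lambda>\<xi>. sob_weight s \<xi> * (norm (g \<xi> + h \<xi>))\<^sup>2)"
    proof (rule Bochner_Integration.integrable_bound[OF ib])
      show "AE \<xi> in lborel. norm (sob_weight s \<xi> * (norm (g \<xi> + h \<xi>))\<^sup>2) \<le> norm (?b \<xi>)"
      proof (rule AE_I2)
        fix \<xi> :: "real^'d"
        have "0 \<le> sob_weight s \<xi> * (norm (g \<xi> + h \<xi>))\<^sup>2"
          by (simp add: less_imp_le[OF sob_weight_pos])
        with b[of \<xi>] show "norm (sob_weight s \<xi> * (norm (g \<xi> + h \<xi>))\<^sup>2) \<le> norm (?b \<xi>)"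
          unfolding real_norm_def by linarith
      qed
    qed measurable
    note gh = has_fourier_transform_add[OF g h]
    show "F + H \<in> carr (sobolev s)"
      unfolding sobolev_carr_iff using tempered_add[OF tF tH] gh i by blast
    have "?I (\<lambda>\<xi>. g \<xi> + h \<xi>) \<le> (LINT \<xi>|lborel. ?b \<xi>)"
      by (intro integral_mono i ib b)
    also have "\<dots> = 2 * ?I g + 2 * ?I h"
      using ig ih by simp
    finally have "sqrt (?I (\<lambda>\<xi>. g \<xi> + h \<xi>)) \<le> sqrt (2 * ?I g + 2 * ?I h)"
      by (rule real_sqrt_le_mono)
    also have "\<dots> \<le> sqrt (2 * ?I g) + sqrt (2 * ?I h)"
      using I0 by (intro sqrt_add_le_add_sqrt) auto
    also have "\<dots> \<le> 2 * sqrt (?I g) + 2 * sqrt (?I h)"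
      using I0 sqrt2_less_2 by (intro add_mono) (auto simp: real_sqrt_mult intro!: mult_right_mono)
    finally show "nrm (sobolev s) (F + H) \<le> 2 * (nrm (sobolev s) F + nrm (sobolev s) H)"
      unfolding sobolev_nrm[OF g] sobolev_nrm[OF h] sobolev_nrm[OF gh] by simp }
  fix r :: real
  note rg = has_fourier_transform_scale[OF g, of r]
  have *: "sob_weight s \<xi> * (norm (r *\<^sub>R g \<xi>))\<^sup>2 = r\<^sup>2 * (sob_weight s \<xi> * (norm (g \<xi>))\<^sup>2)" for \<xi>
    by (simp add: power_mult_distrib mult_ac)
  show "r *\<^sub>R F \<in> carr (sobolev s)"
    unfolding sobolev_carr_iff using tempered_scale[OF tF] rg integrable_mult_right[OF ig, of "r\<^sup>2"]
    by (auto simp: *[symmetric])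
  show "nrm (sobolev s) (r *\<^sub>R F) \<le> \<bar>r\<bar> * nrm (sobolev s) F"
    unfolding sobolev_nrm[OF g] sobolev_nrm[OF rg] * by (simp add: real_sqrt_mult)
qed


section \<open>Distributions given by Fourier integrals\<close>

definition sdistr :: "(real^'d::finite \<Rightarrow> complex) \<Rightarrow> 'd distr"
  where "sdistr f = (\<lambda>\<phi>. if schwartz \<phi> then (LINT x|lborel. f x * \<phi> x) else 0)"

lemma distr_of_nth: "distr_of f $ j = sdistr (\<lambda>x. f x $ j)"
  by (simp add: distr_of_def sdistr_def)

lemma ift_continuous: "rapid A \<Longrightarrow> continuous_on UNIV (ift A)"
  by (intro continuous_at_imp_continuous_on ballI has_derivative_continuous[OF has_derivative_ift])

lemma ift_times_integrable:
  assumes A: "rapid A" and \<phi>: "rapid \<phi>"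
  shows "integrable lborel (\<lambda>x. ift A x * \<phi> x)"
proof (rule rapid_integrable[OF rapid_mult[OF \<phi> ift_continuous[OF A]]])
  show "norm (ift A x) \<le> (LINT \<xi>|lborel. norm (A \<xi>)) * (1 + norm x) ^ 0" for x
    using norm_ift_le[of A x] by simp
qed

text \<open>Adjointness moves \<open>ift\<close> from \<open>A\<close> to
  \<open>fourier \<phi>\<close>, where inversion returns \<open>\<phi>\<close> with the factor
  \<open>(2 * pi) ^ CARD('d)\<close>. The factor stays in all norms, since neither transform is
  normalised.\<close>

lemma has_fourier_transform_sdistr:
  fixes A :: "real^'d::finite \<Rightarrow> complex"
  assumes A: "rapid A"
  shows "has_fourier_transform (sdistr (ift A)) (\<lambda>\<xi>. complex_of_real ((2 * pi) ^ CARD('d)) * A \<xi>)"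
  unfolding has_fourier_transform_def
proof (intro conjI allI impI)
  show "(\<lambda>\<xi>. complex_of_real ((2 * pi) ^ CARD('d)) * A \<xi>) \<in> borel_measurable lborel"
    using rapid_measurable[OF rapid_cmult[OF A]] by simp
  fix \<phi> :: "real^'d \<Rightarrow> complex" assume \<phi>: "schwartz \<phi>"
  note r = schwartz_rapid[OF \<phi>] schwartz_rapid[OF schwartz_fourier[OF \<phi>]]
  obtain M where M: "\<And>x. norm (A x) \<le> M" using rapidE[OF A, of 0] by auto
  have "integrable lborel (\<lambda>\<xi>. A \<xi> * \<phi> \<xi>)"
    by (rule rapid_integrable[OF rapid_mult[OF r(1) rapid_continuous[OF A], of M 0]]) (simp add: M)
  then show "integrable lborel (\<lambda>\<xi>. complex_of_real ((2 * pi) ^ CARD('d)) * A \<xi> * \<phi> \<xi>)"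
    using integrable_mult_right by (simp add: mult.assoc)
  have "sdistr (ift A) (fourier \<phi>) = (LINT x|lborel. ift A x * fourier \<phi> x)"
    by (simp add: sdistr_def schwartz_fourier[OF \<phi>])
  also have "\<dots> = (LINT \<xi>|lborel. A \<xi> * ift (fourier \<phi>) \<xi>)"
    by (rule ift_adjoint[OF rapid_integrable[OF A] rapid_integrable[OF r(2)]])
  finally show "sdistr (ift A) (fourier \<phi>) = (LINT \<xi>|lborel. complex_of_real ((2 * pi) ^ CARD('d)) * A \<xi> * \<phi> \<xi>)"
    by (simp add: fourier_inversion[OF \<phi>] mult_ac)
qed

text \<open>\<open>ift A\<close> is bounded by the integral of \<open>norm (A \<xi>)\<close>, and
  the seminorm of order \<open>2 * CARD('d)\<close> bounds a Schwartz function by a multiple of the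
  integrable \<open>1 / decay_weight x\<close>.\<close>

lemma tempered_sdistr:
  fixes A :: "real^'d::finite \<Rightarrow> complex"
  assumes A: "rapid A"
  shows "tempered (sdistr (ift A))"
proof -
  let ?N = "2 * CARD('d)"
  let ?C = "(LINT \<xi>|lborel. norm (A \<xi>)) * (LINT x|lborel. 1 / decay_weight (x :: real^'d))"
  have "norm (sdistr (ift A) \<phi>) \<le> ?C * schwartz_seminorm ?N \<phi>" if \<phi>: "schwartz \<phi>" for \<phi>
  proof -
    note r = schwartz_rapid[OF \<phi>]
    have "norm (LINT x|lborel. ift A x * \<phi> x)
      \<le> (LINT x|lborel. (LINT \<xi>|lborel. norm (A \<xi>)) * schwartz_seminorm ?N \<phi> * (1 / decay_weight (x :: real^'d)))"
    proof (rule Bochner_Integration.integral_norm_bound_integral[OF ift_times_integrable[OF A r]])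
      show "integrable lborel (\<lambda>x::real^'d. (LINT \<xi>|lborel. norm (A \<xi>)) * schwartz_seminorm ?N \<phi> * (1 / decay_weight x))"
        by (intro integrable_mult_right integrable_inverse_decay_weight)
      fix x :: "real^'d"
      have "norm (\<phi> x) \<le> schwartz_seminorm ?N \<phi> * (1 / decay_weight x)"
        using schwartz_seminorm_ge[OF \<phi>, of x ?N] decay_weight_pos[of x]
        by (simp add: decay_weight_def pos_le_divide_eq mult.commute)
      then show "norm (ift A x * \<phi> x) \<le> (LINT \<xi>|lborel. norm (A \<xi>)) * schwartz_seminorm ?N \<phi> * (1 / decay_weight x)"
        unfolding norm_mult mult.assoc by (intro mult_mono norm_ift_le) auto
    qed
    also have "\<dots> = (LINT \<xi>|lborel. norm (A \<xi>)) * schwartz_seminorm ?N \<phi> * (LINT x|lborel. 1 / decay_weight (x :: real^'d))"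
      by (rule integral_mult_right_zero)
    also have "\<dots> = ?C * schwartz_seminorm ?N \<phi>" by (simp only: mult_ac)
    finally show ?thesis using \<phi> by (simp only: sdistr_def if_True)
  qed
  moreover have "sdistr (ift A) (\<lambda>x. \<phi> x + \<psi> x) = sdistr (ift A) \<phi> + sdistr (ift A) \<psi>"
    if "schwartz \<phi>" "schwartz \<psi>" for \<phi> \<psi>
    using that ift_times_integrable[OF A schwartz_rapid[OF that(1)]] ift_times_integrable[OF A schwartz_rapid[OF that(2)]]
    by (simp add: sdistr_def schwartz_add distrib_left)
  moreover have "sdistr (ift A) (\<lambda>x. c * \<phi> x) = c * sdistr (ift A) \<phi>" if "schwartz \<phi>" for c \<phi>
    using that by (simp add: sdistr_def schwartz_cmult mult.left_commute[of _ c])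
  ultimately show ?thesis
    unfolding tempered_def by (auto simp: sdistr_def)
qed

lemma sob_weight_le: "sob_weight s \<xi> \<le> (1 + norm \<xi>) ^ (2 * nat \<lceil>\<bar>s\<bar>\<rceil>)"
proof -
  have 1: "1 \<le> 1 + (norm \<xi>)\<^sup>2" by simp
  have "sob_weight s \<xi> \<le> (1 + (norm \<xi>)\<^sup>2) powr real (nat \<lceil>\<bar>s\<bar>\<rceil>)"
    unfolding sob_weight_def using 1 by (intro powr_mono) linarith+
  also have "\<dots> = (1 + (norm \<xi>)\<^sup>2) ^ nat \<lceil>\<bar>s\<bar>\<rceil>"
    using 1 by (intro powr_realpow) linarith
  also have "\<dots> \<le> ((1 + norm \<xi>)\<^sup>2) ^ nat \<lceil>\<bar>s\<bar>\<rceil>"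
    by (intro power_mono) (auto simp: power2_sum)
  finally show ?thesis by (simp add: power_mult)
qed

lemma rapid_sobolev_integrable:
  assumes A: "rapid A"
  shows "integrable lborel (\<lambda>\<xi>. sob_weight s \<xi> * (norm (A \<xi>))\<^sup>2)"
proof -
  obtain M where M: "0 \<le> M" "\<And>x. norm (A x) \<le> M" using rapidE[OF A, of 0] by auto
  note [measurable] = rapid_measurable[OF A]
  let ?n = "2 * nat \<lceil>\<bar>s\<bar>\<rceil>"
  show ?thesis
  proof (rule Bochner_Integration.integrable_bound)
    show "integrable lborel (\<lambda>\<xi>. M * ((1 + norm \<xi>) ^ ?n * norm (A \<xi>)))"
      by (intro integrable_mult_right rapid_integrable_power A)
    show "AE \<xi> in lborel. norm (sob_weight s \<xi> * (norm (A \<xi>))\<^sup>2) \<le> norm (M * ((1 + norm \<xi>) ^ ?n * norm (A \<xi>)))"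
    proof (rule AE_I2)
      fix \<xi> :: "real^'a"
      have "sob_weight s \<xi> * (norm (A \<xi>))\<^sup>2 \<le> (1 + norm \<xi>) ^ ?n * (M * norm (A \<xi>))"
        unfolding power2_eq_square using M
        by (intro mult_mono sob_weight_le mult_right_mono) auto
      then show "norm (sob_weight s \<xi> * (norm (A \<xi>))\<^sup>2) \<le> norm (M * ((1 + norm \<xi>) ^ ?n * norm (A \<xi>)))"
        using M(1) less_imp_le[OF sob_weight_pos[of s \<xi>]] by (simp add: abs_mult mult_ac)
    qed
  qed measurable
qed

lemma sdistr_sobolev:
  fixes A :: "real^'d::finite \<Rightarrow> complex"
  assumes A: "rapid A"
  shows "sdistr (ift A) \<in> carr (sobolev s)"
    and "nrm (sobolev s) (sdistr (ift A)) = (2 * pi) ^ CARD('d) * sqrt (LINT \<xi>|lborel. sob_weight s \<xi> * (norm (A \<xi>))\<^sup>2)"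
proof -
  let ?c = "(2 * pi) ^ CARD('d)"
  show "sdistr (ift A) \<in> carr (sobolev s)"
    unfolding sobolev_carr_iff
    using tempered_sdistr[OF A] has_fourier_transform_sdistr[OF A] rapid_sobolev_integrable[OF rapid_cmult[OF A]]
    by blast
  have "(LINT \<xi>|lborel. sob_weight s \<xi> * (norm (complex_of_real ?c * A \<xi>))\<^sup>2)
    = (LINT \<xi>|lborel. ?c\<^sup>2 * (sob_weight s \<xi> * (norm (A \<xi>))\<^sup>2))"
    by (intro Bochner_Integration.integral_cong) (simp_all add: norm_mult norm_power power_mult_distrib mult_ac)
  also have "\<dots> = ?c\<^sup>2 * (LINT \<xi>|lborel. sob_weight s \<xi> * (norm (A \<xi>))\<^sup>2)" by simp
  finally show "nrm (sobolev s) (sdistr (ift A)) = ?c * sqrt (LINT \<xi>|lborel. sob_weight s \<xi> * (norm (A \<xi>))\<^sup>2)"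
    unfolding sobolev_nrm[OF has_fourier_transform_sdistr[OF A]] by (simp add: real_sqrt_mult)
qed

lemma ift_cmult: "ift (\<lambda>\<xi>. c * A \<xi>) x = c * ift A x"
  unfolding ift_def by (subst integral_mult_right_zero[symmetric]) (simp add: mult_ac)

lemma ift_diff:
  assumes "integrable lborel A" "integrable lborel B"
  shows "ift (\<lambda>\<xi>. A \<xi> - B \<xi>) x = ift A x - ift B x"
  unfolding ift_def right_diff_distrib using assms by (intro Bochner_Integration.integral_diff integrable_cis_mult)

lemma sdistr_diff:
  assumes "rapid A" "rapid B"
  shows "sdistr (ift A) - sdistr (ift B) = sdistr (ift (\<lambda>\<xi>. A \<xi> - B \<xi>))"
proof (rule ext)
  fix \<phi> :: "real^'a \<Rightarrow> complex"
  show "(sdistr (ift A) - sdistr (ift B)) \<phi> = sdistr (ift (\<lambda>\<xi>. A \<xi> - B \<xi>)) \<phi>"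
  proof (cases "schwartz \<phi>")
    case True
    note r = schwartz_rapid[OF True]
    show ?thesis
      using True ift_times_integrable[OF assms(1) r] ift_times_integrable[OF assms(2) r]
      by (simp add: sdistr_def ift_diff[OF rapid_integrable[OF assms(1)] rapid_integrable[OF assms(2)]] left_diff_distrib)
  qed (simp add: sdistr_def)
qed

lemma sdistr_scale: "sdistr (ift (\<lambda>\<xi>. complex_of_real r * A \<xi>)) = r *\<^sub>R sdistr (ift A)"
  by (rule ext) (simp add: sdistr_def scaleR_fun_def ift_cmult scaleR_conv_of_real[where 'a = complex] mult.assoc)


section \<open>Vector valued Fourier integrals\<close>

definition vift :: "('d \<Rightarrow> real^'d::finite \<Rightarrow> complex) \<Rightarrow> real^'d \<Rightarrow> complex^'d"
  where "vift A x = (\<chi> j. ift (A j) x)"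

lemma has_derivative_vec:
  fixes f :: "'n::finite \<Rightarrow> 'a::real_normed_vector \<Rightarrow> 'b::real_normed_vector"
  assumes "\<And>j. (f j has_derivative f' j) (at x within S)"
  shows "((\<lambda>x. \<chi> j. f j x) has_derivative (\<lambda>h. \<chi> j. f' j h)) (at x within S)"
proof -
  have bl: "bounded_linear (\<lambda>h. \<chi> j. f' j h)"
  proof -
    have f': "bounded_linear (f' j)" for j
      by (rule has_derivative_bounded_linear[OF assms])
    have "\<forall>j. \<exists>K. \<forall>h. norm (f' j h) \<le> norm h * K"
      using bounded_linear.bounded[OF f'] by blast
    then obtain K where K: "\<And>j h. norm (f' j h) \<le> norm h * K j"
      using choice by metis
    show ?thesis
    proof (rule bounded_linear_intro)
      fix a b and r :: real
      show "(\<chi> j. f' j (a + b)) = (\<chi> j. f' j a) + (\<chi> j. f' j b)"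
        by (simp add: vec_eq_iff linear_add[OF bounded_linear.linear[OF f']])
      show "(\<chi> j. f' j (r *\<^sub>R a)) = r *\<^sub>R (\<chi> j. f' j a)"
        by (simp add: vec_eq_iff linear_cmul[OF bounded_linear.linear[OF f']])
      have "norm (\<chi> j. f' j a) \<le> (\<Sum>j\<in>UNIV. norm (f' j a))"
        unfolding norm_vec_def by (rule order_trans[OF L2_set_le_sum]) auto
      also have "\<dots> \<le> (\<Sum>j\<in>UNIV. norm a * K j)" by (intro sum_mono K)
      finally show "norm (\<chi> j. f' j a) \<le> norm a * (\<Sum>j\<in>UNIV. K j)" by (simp add: sum_distrib_left)
    qed
  qed
  have "((\<lambda>y. \<chi> j. ((f j y - f j x) - f' j (y - x)) /\<^sub>R norm (y - x)) \<longlongrightarrow> (\<chi> j. 0)) (at x within S)"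
    using assms unfolding has_derivative_at_within
    by (intro vec_tendstoI) (simp add: diff_diff_eq)
  moreover have "(\<chi> j. ((f j y - f j x) - f' j (y - x)) /\<^sub>R norm (y - x))
    = ((\<chi> j. f j y) - (\<chi> j. f j x) - (\<chi> j. f' j (y - x))) /\<^sub>R norm (y - x)" for y
    by (simp add: vec_eq_iff)
  ultimately show ?thesis
    using bl unfolding has_derivative_at_within zero_vec_def by (simp only:)
qed

lemma has_derivative_vift:
  assumes "\<And>j. rapid (A j)"
  shows "(vift A has_derivative
    (\<lambda>h. \<chi> j. \<Sum>i\<in>UNIV. (h $ i) *\<^sub>R ift (\<lambda>\<xi>. \<i> * complex_of_real (\<xi> $ i) * A j \<xi>) x)) (at x)"
  unfolding vift_def[abs_def] by (intro has_derivative_vec has_derivative_ift assms)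

lemma partial_deriv_vift:
  assumes "\<And>j. rapid (A j)"
  shows "partial_deriv i (vift A) = vift (\<lambda>j \<xi>. \<i> * complex_of_real (\<xi> $ i) * A j \<xi>)"
proof
  fix x
  have "partial_deriv i (vift A) x = (\<chi> j. \<Sum>k\<in>UNIV. (axis i 1 $ k) *\<^sub>R ift (\<lambda>\<xi>. \<i> * complex_of_real (\<xi> $ k) * A j \<xi>) x)"
    by (rule partial_deriv_eq[OF has_derivative_vift[OF assms]])
  also have "\<dots> = (\<chi> j. \<Sum>k\<in>UNIV. if k = i then ift (\<lambda>\<xi>. \<i> * complex_of_real (\<xi> $ k) * A j \<xi>) x else 0)"
    by (intro arg_cong[where f = vec_lambda] ext sum.cong) (auto simp: axis_def)
  finally show "partial_deriv i (vift A) x = vift (\<lambda>j \<xi>. \<i> * complex_of_real (\<xi> $ i) * A j \<xi>) x"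
    by (simp add: vift_def)
qed

lemma smooth_vift:
  assumes "\<And>j. rapid (A j)"
  shows "smooth (vift A)"
proof (rule smoothI_class[where \<F> = "{vift A | A. \<forall>j. rapid (A j)}"])
  show "vift A \<in> {vift A | A. \<forall>j. rapid (A j)}" using assms by blast
next
  fix g x assume "g \<in> {vift A | A. \<forall>j. rapid (A j :: real^'a \<Rightarrow> complex)}"
  then show "g differentiable (at x)"
    using has_derivative_vift differentiableI by blast
next
  fix g i assume "g \<in> {vift A | A. \<forall>j. rapid (A j :: real^'a \<Rightarrow> complex)}"
  then obtain B where B: "g = vift B" "\<And>j. rapid (B j)" by blast
  have "partial_deriv i g = vift (\<lambda>j \<xi>. \<i> * complex_of_real (\<xi> $ i) * B j \<xi>)"
    unfolding B(1) by (rule partial_deriv_vift[OF B(2)])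
  moreover have "\<forall>j. rapid (\<lambda>\<xi>. \<i> * complex_of_real (\<xi> $ i) * B j \<xi>)"
    using rapid_icoord[OF B(2)] by blast
  ultimately show "partial_deriv i g \<in> {vift A | A. \<forall>j. rapid (A j)}" by blast
qed

lemma distr_of_vift: "distr_of (vift A) = (\<chi> j. sdistr (ift (A j)))"
  by (simp add: vec_eq_iff distr_of_nth vift_def)

lemma distr_of_vift_sobolev:
  assumes "\<And>j. rapid (A j)"
  shows "distr_of (vift A) \<in> carr (vec_space (sobolev s))"
  using sdistr_sobolev(1)[OF assms] by (simp add: distr_of_vift vec_space_def)

lemma H_infty_vift:
  assumes "\<And>j. rapid (A j)"
  shows "H_infty (vift A)"
  unfolding H_infty_def
  using smooth_vift[OF assms] distr_of_vift_sobolev[OF assms] ift_times_integrable[OF assms schwartz_rapid]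
  by (simp add: vift_def)


section \<open>Testing Sobolev distributions against a function\<close>

lemma cauchy_schwarz_integral:
  fixes f g :: "'a \<Rightarrow> real"
  assumes [measurable]: "f \<in> borel_measurable M" "g \<in> borel_measurable M"
    and f: "integrable M (\<lambda>x. (f x)\<^sup>2)" and g: "integrable M (\<lambda>x. (g x)\<^sup>2)"
  shows "integrable M (\<lambda>x. f x * g x)"
    and "(LINT x|M. \<bar>f x * g x\<bar>) \<le> sqrt (LINT x|M. (f x)\<^sup>2) * sqrt (LINT x|M. (g x)\<^sup>2)"
proof -
  let ?I = "LINT x|M. (f x)\<^sup>2" and ?J = "LINT x|M. (g x)\<^sup>2"
  have F: "(\<integral>\<^sup>+x. (ennreal \<bar>f x\<bar>)\<^sup>2 \<partial>M) = ennreal ?I" "(\<integral>\<^sup>+x. (ennreal \<bar>g x\<bar>)\<^sup>2 \<partial>M) = ennreal ?J"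
    using nn_integral_eq_integral[OF f] nn_integral_eq_integral[OF g]
    by (simp_all add: ennreal_power)
  have "(\<integral>\<^sup>+x. ennreal \<bar>f x\<bar> * ennreal \<bar>g x\<bar> \<partial>M)\<^sup>2 \<le> ennreal ?I * ennreal ?J"
    unfolding F[symmetric] by (rule Cauchy_Schwarz_nn_integral) auto
  also have "\<dots> = ennreal (?I * ?J)"
    by (rule ennreal_mult[symmetric]) auto
  finally have le: "(\<integral>\<^sup>+x. ennreal \<bar>f x * g x\<bar> \<partial>M)\<^sup>2 \<le> ennreal (?I * ?J)"
    by (simp add: abs_mult ennreal_mult)
  then have "(\<integral>\<^sup>+x. ennreal \<bar>f x * g x\<bar> \<partial>M)\<^sup>2 < \<infinity>"
    by (rule le_less_trans) simp
  then have fin: "(\<integral>\<^sup>+x. ennreal \<bar>f x * g x\<bar> \<partial>M) < \<infinity>"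
    by (auto simp: power2_eq_square ennreal_mult_less_top top.not_eq_extremum)
  show i: "integrable M (\<lambda>x. f x * g x)"
    by (rule integrableI_bounded) (use fin in auto)
  have "(\<integral>\<^sup>+x. ennreal \<bar>f x * g x\<bar> \<partial>M) = ennreal (LINT x|M. \<bar>f x * g x\<bar>)"
    using i by (intro nn_integral_eq_integral) auto
  with le have "ennreal ((LINT x|M. \<bar>f x * g x\<bar>)\<^sup>2) \<le> ennreal (?I * ?J)"
    by (simp add: ennreal_power)
  then have "(LINT x|M. \<bar>f x * g x\<bar>)\<^sup>2 \<le> ?I * ?J"
    by (subst (asm) ennreal_le_iff) (auto intro!: mult_nonneg_nonneg)
  then have "sqrt ((LINT x|M. \<bar>f x * g x\<bar>)\<^sup>2) \<le> sqrt (?I * ?J)"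
    by (rule real_sqrt_le_mono)
  then show "(LINT x|M. \<bar>f x * g x\<bar>) \<le> sqrt ?I * sqrt ?J"
    by (simp add: real_sqrt_mult)
qed

text \<open>Differentiability is over the reals, so the functional is made real-valued by taking the
  real part. There is no conjugation: a phase wanted in the test is built into \<open>G\<close>. The
  functional is bounded on \<open>sobolev s\<close> if \<open>G\<close> is square integrable with
  weight \<open>sob_weight (- s)\<close>.\<close>

definition pairing :: "(real^'d::finite \<Rightarrow> complex) \<Rightarrow> 'd distr \<Rightarrow> real"
  where "pairing G F = Re (LINT \<xi>|lborel. fourier_transform F \<xi> * G \<xi>)"

lemma pairing_eq:
  assumes F: "has_fourier_transform F g" and [measurable]: "G \<in> borel_measurable borel"
  shows "pairing G F = Re (LINT \<xi>|lborel. g \<xi> * G \<xi>)"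
proof -
  have [measurable]: "g \<in> borel_measurable borel" "fourier_transform F \<in> borel_measurable borel"
    using has_fourier_transform_measurable F has_fourier_transform_fourier_transform[OF F] by blast+
  have "(LINT \<xi>|lborel. fourier_transform F \<xi> * G \<xi>) = (LINT \<xi>|lborel. g \<xi> * G \<xi>)"
    by (intro integral_cong_AE) (use fourier_transform_AE[OF F] in \<open>measurable; auto\<close>)+
  then show ?thesis by (simp add: pairing_def)
qed

text \<open>Cauchy-Schwarz after distributing the weight: the roots of \<open>sob_weight s\<close>
  and \<open>sob_weight (- s)\<close> multiply to 1.\<close>

lemma pairing_integrable:
  fixes g G :: "real^'d::finite \<Rightarrow> complex"
  assumes [measurable]: "g \<in> borel_measurable borel" "G \<in> borel_measurable borel"
    and g: "integrable lborel (\<lambda>\<xi>. sob_weight s \<xi> * (norm (g \<xi>))\<^sup>2)"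
    and G: "integrable lborel (\<lambda>\<xi>. sob_weight (- s) \<xi> * (norm (G \<xi>))\<^sup>2)"
  shows "integrable lborel (\<lambda>\<xi>. g \<xi> * G \<xi>)"
    and "(LINT \<xi>|lborel. norm (g \<xi> * G \<xi>)) \<le> sqrt (LINT \<xi>|lborel. sob_weight s \<xi> * (norm (g \<xi>))\<^sup>2)
        * sqrt (LINT \<xi>|lborel. sob_weight (- s) \<xi> * (norm (G \<xi>))\<^sup>2)"
proof -
  let ?f = "\<lambda>\<xi>. sqrt (sob_weight s \<xi>) * norm (g \<xi>)" and ?h = "\<lambda>\<xi>. sqrt (sob_weight (- s) \<xi>) * norm (G \<xi>)"
  have sq: "(?f \<xi>)\<^sup>2 = sob_weight s \<xi> * (norm (g \<xi>))\<^sup>2" "(?h \<xi>)\<^sup>2 = sob_weight (- s) \<xi> * (norm (G \<xi>))\<^sup>2" for \<xi>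
    by (simp_all add: power_mult_distrib less_imp_le[OF sob_weight_pos])
  have pr: "?f \<xi> * ?h \<xi> = norm (g \<xi> * G \<xi>)" for \<xi>
  proof -
    have "?f \<xi> * ?h \<xi> = sqrt (sob_weight (- s) \<xi> * sob_weight s \<xi>) * (norm (g \<xi>) * norm (G \<xi>))"
      by (simp only: real_sqrt_mult mult_ac)
    also have "\<dots> = norm (g \<xi> * G \<xi>)" by (simp add: sob_weight_minus norm_mult)
    finally show ?thesis .
  qed
  have m: "?f \<in> borel_measurable lborel" "?h \<in> borel_measurable lborel" by measurable
  note cs = cauchy_schwarz_integral[OF m, unfolded sq pr, OF g G]
  show "integrable lborel (\<lambda>\<xi>. g \<xi> * G \<xi>)"
    using cs(1) by (subst integrable_norm_iff[symmetric]) auto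
  show "(LINT \<xi>|lborel. norm (g \<xi> * G \<xi>)) \<le> sqrt (LINT \<xi>|lborel. sob_weight s \<xi> * (norm (g \<xi>))\<^sup>2)
        * sqrt (LINT \<xi>|lborel. sob_weight (- s) \<xi> * (norm (G \<xi>))\<^sup>2)"
    using cs(2) by simp
qed

lemma pairing_bound:
  assumes G: "G \<in> borel_measurable borel" "integrable lborel (\<lambda>\<xi>. sob_weight (- s) \<xi> * (norm (G \<xi>))\<^sup>2)"
    and F: "F \<in> carr (sobolev s)"
  shows "\<bar>pairing G F\<bar> \<le> sqrt (LINT \<xi>|lborel. sob_weight (- s) \<xi> * (norm (G \<xi>))\<^sup>2) * nrm (sobolev s) F"
proof -
  obtain g where g: "has_fourier_transform F g" "integrable lborel (\<lambda>\<xi>. sob_weight s \<xi> * (norm (g \<xi>))\<^sup>2)"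
    using F unfolding sobolev_carr_iff by blast
  have "\<bar>pairing G F\<bar> \<le> norm (LINT \<xi>|lborel. g \<xi> * G \<xi>)"
    unfolding pairing_eq[OF g(1) G(1)] by (rule abs_Re_le_cmod)
  also have "\<dots> \<le> (LINT \<xi>|lborel. norm (g \<xi> * G \<xi>))"
    by (rule integral_norm_bound)
  also note pairing_integrable(2)[OF has_fourier_transform_measurable[OF g(1)] G(1) g(2) G(2)]
  finally show ?thesis by (simp add: sobolev_nrm[OF g(1)] mult.commute)
qed

lemma pairing_add:
  assumes G: "G \<in> borel_measurable borel" "integrable lborel (\<lambda>\<xi>. sob_weight (- s) \<xi> * (norm (G \<xi>))\<^sup>2)"
    and F: "F \<in> carr (sobolev s)" and H: "H \<in> carr (sobolev s)"
  shows "pairing G (F + H) = pairing G F + pairing G H"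
proof -
  obtain g where g: "has_fourier_transform F g" "integrable lborel (\<lambda>\<xi>. sob_weight s \<xi> * (norm (g \<xi>))\<^sup>2)"
    using F unfolding sobolev_carr_iff by blast
  obtain h where h: "has_fourier_transform H h" "integrable lborel (\<lambda>\<xi>. sob_weight s \<xi> * (norm (h \<xi>))\<^sup>2)"
    using H unfolding sobolev_carr_iff by blast
  have "integrable lborel (\<lambda>\<xi>. g \<xi> * G \<xi>)" "integrable lborel (\<lambda>\<xi>. h \<xi> * G \<xi>)"
    by (rule pairing_integrable(1)[OF has_fourier_transform_measurable[OF g(1)] G(1) g(2) G(2)],
        rule pairing_integrable(1)[OF has_fourier_transform_measurable[OF h(1)] G(1) h(2) G(2)])
  then show ?thesis
    unfolding pairing_eq[OF g(1) G(1)] pairing_eq[OF h(1) G(1)] pairing_eq[OF has_fourier_transform_add[OF g(1) h(1)] G(1)]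
    by (simp add: distrib_right)
qed

lemma pairing_scale:
  assumes G: "G \<in> borel_measurable borel" and F: "F \<in> carr (sobolev s)"
  shows "pairing G (r *\<^sub>R F) = r * pairing G F"
proof -
  obtain g where g: "has_fourier_transform F g"
    using F unfolding sobolev_carr_iff by blast
  show ?thesis
    unfolding pairing_eq[OF g G] pairing_eq[OF has_fourier_transform_scale[OF g] G]
    by simp
qed


section \<open>Quadratic bounds for twice differentiable maps\<close>

lemma blin_space_carrD:
  assumes "L \<in> carr (blin_space X Y)"
  shows "x \<in> carr X \<Longrightarrow> L x \<in> carr Y"
    and "x \<in> carr X \<Longrightarrow> y \<in> carr X \<Longrightarrow> L (x + y) = L x + L y"
    and "x \<in> carr X \<Longrightarrow> L (r *\<^sub>R x) = r *\<^sub>R L x"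
    and "\<exists>K. \<forall>x\<in>carr X. nrm Y (L x) \<le> K * nrm X x"
    and "x \<notin> carr X \<Longrightarrow> L x = 0"
  using assms by (simp_all add: blin_space_def)

text \<open>Normalise \<open>x\<close> to the unit ball. Where \<open>nrm X x = 0\<close> this is
  impossible, and there any bound \<open>K\<close> of the operator gives the claim directly.\<close>

lemma blin_space_bound:
  assumes X: "qsnorm X" and Y: "qsnorm Y" and L: "L \<in> carr (blin_space X Y)" and x: "x \<in> carr X"
  shows "nrm Y (L x) \<le> nrm (blin_space X Y) L * nrm X x"
proof -
  obtain K where K: "\<And>x. x \<in> carr X \<Longrightarrow> nrm Y (L x) \<le> K * nrm X x"
    using blin_space_carrD(4)[OF L] by blast
  have bdd: "bdd_above ((\<lambda>x. nrm Y (L x)) ` {x \<in> carr X. nrm X x \<le> 1})"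
  proof (rule bdd_aboveI2)
    fix x assume x: "x \<in> {x \<in> carr X. nrm X x \<le> 1}"
    have "nrm Y (L x) \<le> K * nrm X x" using K x by blast
    also have "\<dots> \<le> \<bar>K\<bar> * nrm X x" using qsnormD(5)[OF X] x by (intro mult_right_mono) auto
    also have "\<dots> \<le> \<bar>K\<bar> * 1" using x by (intro mult_left_mono) auto
    finally show "nrm Y (L x) \<le> \<bar>K\<bar>" by simp
  qed
  have n0: "0 \<le> nrm X x" by (rule qsnormD(5)[OF X x])
  show ?thesis
  proof (cases "nrm X x = 0")
    case True
    then show ?thesis using K[OF x] by simp
  next
    case False
    then have n: "0 < nrm X x" using n0 by simp
    let ?u = "(1 / nrm X x) *\<^sub>R x"
    have u: "?u \<in> carr X" by (rule qsnormD(3)[OF X x])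
    have "nrm X ?u \<le> \<bar>1 / nrm X x\<bar> * nrm X x" by (rule qsnormD(4)[OF X x])
    also have "\<dots> = 1" using n by simp
    finally have "nrm Y (L ?u) \<le> nrm (blin_space X Y) L"
      using cSUP_upper[OF _ bdd, of ?u] u by (simp add: blin_space_def)
    have "x = nrm X x *\<^sub>R ?u" using n by simp
    then have "nrm Y (L x) = nrm Y (nrm X x *\<^sub>R L ?u)"
      using blin_space_carrD(3)[OF L u, of "nrm X x"] by simp
    also have "\<dots> \<le> \<bar>nrm X x\<bar> * nrm Y (L ?u)"
      by (rule qsnormD(4)[OF Y blin_space_carrD(1)[OF L u]])
    also have "\<dots> \<le> nrm X x * nrm (blin_space X Y) L"
      using n \<open>nrm Y (L ?u) \<le> nrm (blin_space X Y) L\<close> by simp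
    finally show ?thesis by (simp add: mult.commute)
  qed
qed

lemma blin_space_diff:
  assumes X: "qsnorm X" and Y: "qsnorm Y" and L: "L \<in> carr (blin_space X Y)" and M: "M \<in> carr (blin_space X Y)"
  shows "L - M \<in> carr (blin_space X Y)"
proof -
  have "\<exists>K. \<forall>x\<in>carr X. nrm Y ((L - M) x) \<le> K * nrm X x"
  proof -
    obtain K J where K: "\<And>x. x \<in> carr X \<Longrightarrow> nrm Y (L x) \<le> K * nrm X x"
      and J: "\<And>x. x \<in> carr X \<Longrightarrow> nrm Y (M x) \<le> J * nrm X x"
      using blin_space_carrD(4)[OF L] blin_space_carrD(4)[OF M] by blast
    have "nrm Y ((L - M) x) \<le> (2 * (K + J)) * nrm X x" if x: "x \<in> carr X" for x
    proof -
      have "nrm Y (L x - M x) \<le> 2 * (nrm Y (L x) + nrm Y (M x))"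
        by (intro qsnorm_diff(2)[OF Y] blin_space_carrD(1)[OF L] blin_space_carrD(1)[OF M] x)
      also have "\<dots> \<le> 2 * (K * nrm X x + J * nrm X x)"
        by (intro mult_left_mono add_mono K J x) auto
      finally show ?thesis by (simp add: algebra_simps)
    qed
    then show ?thesis by blast
  qed
  moreover have "L x - M x \<in> carr Y" if "x \<in> carr X" for x
    by (intro qsnorm_diff(1)[OF Y] blin_space_carrD(1)[OF L] blin_space_carrD(1)[OF M] that)
  ultimately show ?thesis
    using blin_space_carrD(2,3,5)[OF L] blin_space_carrD(2,3,5)[OF M]
    by (simp add: blin_space_def scaleR_diff_right)
qed

text \<open>Testing \<open>\<epsilon> \<mapsto> S (\<epsilon> h)\<close> against a functional \<open>l\<close> gives a real function whose derivative is
  Lipschitz at \<open>0\<close> with constant \<open>K M \<parallel>h\<parallel>\<^sup>2\<close>; the mean value theorem then bounds its second order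
  coefficient.\<close>

lemma C2_quadratic_bound:
  fixes X :: "'a::real_vector nspace" and Y :: "'b::real_vector nspace"
  assumes X: "qsnorm X" and Y: "qsnorm Y" and C2: "C2_near_0 X Y S"
  obtains K where "\<And>h l M c. h \<in> carr X \<Longrightarrow>
      (\<And>y z. y \<in> carr Y \<Longrightarrow> z \<in> carr Y \<Longrightarrow> l (y + z) = l y + l z) \<Longrightarrow>
      (\<And>r y. y \<in> carr Y \<Longrightarrow> l (r *\<^sub>R y) = r * l y) \<Longrightarrow>
      (\<And>y. y \<in> carr Y \<Longrightarrow> \<bar>l y\<bar> \<le> M * nrm Y y) \<Longrightarrow> 0 \<le> M \<Longrightarrow>
      ((\<lambda>\<epsilon>. l (S (\<epsilon> *\<^sub>R h)) / \<epsilon>\<^sup>2) \<longlongrightarrow> c) (at_right 0) \<Longrightarrow> \<bar>c\<bar> \<le> K * M * (nrm X h)\<^sup>2"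
proof -
  let ?B = "blin_space X Y"
  obtain r D1 D2 where r: "0 < r"
    and D1: "\<And>x. x \<in> carr X \<Longrightarrow> nrm X x < r \<Longrightarrow> has_frechet_derivative X Y S (D1 x) x"
    and D2: "\<And>x. x \<in> carr X \<Longrightarrow> nrm X x < r \<Longrightarrow> has_frechet_derivative X ?B D1 (D2 x) x"
    using C2 unfolding C2_near_0_def by blast
  have bound: "\<bar>c\<bar> \<le> (\<bar>K2\<bar> + 1) * M * (nrm X h)\<^sup>2"
    if z: "0 \<in> carr X" "nrm X 0 < r"
      and K2: "\<And>x. x \<in> carr X \<Longrightarrow> nrm ?B (D2 0 x) \<le> K2 * nrm X x"
      and h: "h \<in> carr X"
      and ladd: "\<And>y z. y \<in> carr Y \<Longrightarrow> z \<in> carr Y \<Longrightarrow> l (y + z) = l y + l z"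
      and lsc: "\<And>r y. y \<in> carr Y \<Longrightarrow> l (r *\<^sub>R y) = r * l y"
      and lb: "\<And>y. y \<in> carr Y \<Longrightarrow> \<bar>l y\<bar> \<le> M * nrm Y y" and M: "0 \<le> M"
      and lim: "((\<lambda>\<epsilon>. l (S (\<epsilon> *\<^sub>R h)) / \<epsilon>\<^sup>2) \<longlongrightarrow> c) (at_right 0)" for K2 h l M c
  proof -
    define n where "n = nrm X h"
    \<comment> \<open>\<open>K2\<close> bounds \<open>D2 0\<close>; the summand 1 accounts for the
      remainder of \<open>D1\<close> at 0, estimated with tolerance 1.\<close>
    define K where "K = \<bar>K2\<bar> + 1"
    have n0: "0 \<le> n" unfolding n_def by (rule qsnormD(5)[OF X h])
    have K0: "0 \<le> K" by (simp add: K_def)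
    have ldiff: "l (y - z) = l y - l z" if "y \<in> carr Y" "z \<in> carr Y" for y z
    proof -
      have "- z \<in> carr Y" "l (- z) = - l z"
        using qsnormD(3)[OF Y that(2), of "-1"] lsc[OF that(2), of "-1"] by simp_all
      then show ?thesis using ladd[OF that(1), of "- z"] by simp
    qed
    obtain d0 where d0: "0 < d0" "\<And>k. k \<in> carr X \<Longrightarrow> nrm X k < d0 \<Longrightarrow>
        D1 (0 + k) \<in> carr ?B \<and> nrm ?B (D1 (0 + k) - D1 0 - D2 0 k) \<le> 1 * nrm X k"
      using D2[OF z] unfolding has_frechet_derivative_def by (metis zero_less_one)
    have D20: "D2 0 \<in> carr (blin_space X ?B)"
      using D2[OF z] unfolding has_frechet_derivative_def by blast
    \<comment> \<open>For \<open>\<tau>\<close> below this size the point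
      \<open>\<tau> *\<^sub>R h\<close> lies in both balls; the divisor is \<open>n + 1\<close>
      because \<open>n\<close> may be 0.\<close>
    define t0 where "t0 = min r d0 / (n + 1)"
    have t0: "0 < t0" using r d0 n0 by (simp add: t0_def)
    have small: "\<tau> *\<^sub>R h \<in> carr X" "nrm X (\<tau> *\<^sub>R h) \<le> \<bar>\<tau>\<bar> * n" "\<bar>\<tau>\<bar> < t0 \<Longrightarrow> nrm X (\<tau> *\<^sub>R h) < r \<and> nrm X (\<tau> *\<^sub>R h) < d0" for \<tau>
    proof -
      show "\<tau> *\<^sub>R h \<in> carr X" by (rule qsnormD(3)[OF X h])
      show le: "nrm X (\<tau> *\<^sub>R h) \<le> \<bar>\<tau>\<bar> * n" unfolding n_def by (rule qsnormD(4)[OF X h])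
      assume "\<bar>\<tau>\<bar> < t0"
      have "\<bar>\<tau>\<bar> * n \<le> \<bar>\<tau>\<bar> * (n + 1)" by (simp add: mult_left_mono)
      also have "\<dots> < t0 * (n + 1)" using \<open>\<bar>\<tau>\<bar> < t0\<close> n0 by (intro mult_strict_right_mono) auto
      also have "\<dots> = min r d0" using n0 by (simp add: t0_def)
      finally show "nrm X (\<tau> *\<^sub>R h) < r \<and> nrm X (\<tau> *\<^sub>R h) < d0" using le by linarith
    qed
    define f where "f \<tau> = l (S (\<tau> *\<^sub>R h))" for \<tau>
    define f' where "f' \<tau> = l (D1 (\<tau> *\<^sub>R h) h)" for \<tau>
    have D1c: "D1 (\<tau> *\<^sub>R h) \<in> carr ?B" if "\<bar>\<tau>\<bar> < t0" for \<tau>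
      using D1[OF small(1), of \<tau>] small(3)[OF that] unfolding has_frechet_derivative_def by blast
    have der: "(f has_real_derivative f' \<tau>) (at \<tau>)" if \<tau>: "\<bar>\<tau>\<bar> < t0" for \<tau>
    proof -
      note F = D1[OF small(1), of \<tau>]
      have F: "has_frechet_derivative X Y S (D1 (\<tau> *\<^sub>R h)) (\<tau> *\<^sub>R h)"
        using F small(3)[OF \<tau>] by blast
      have "((\<lambda>\<sigma>. (f \<sigma> - f \<tau>) / (\<sigma> - \<tau>)) \<longlongrightarrow> f' \<tau>) (at \<tau>)"
      proof (rule LIM_I)
        fix e :: real assume e: "0 < e"
        \<comment> \<open>The summand 1 avoids division by 0, and half of \<open>e\<close> makes the
          final inequality strict.\<close>
        define e' where "e' = (e / 2) / (M * n + 1)"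
        have Mn: "0 \<le> M * n" using M n0 by simp
        have e': "0 < e'" using e Mn by (simp add: e'_def add_nonneg_pos)
        obtain d where d: "0 < d" "\<And>k. k \<in> carr X \<Longrightarrow> nrm X k < d \<Longrightarrow>
          S (\<tau> *\<^sub>R h + k) \<in> carr Y \<and> nrm Y (S (\<tau> *\<^sub>R h + k) - S (\<tau> *\<^sub>R h) - D1 (\<tau> *\<^sub>R h) k) \<le> e' * nrm X k"
          using F e' unfolding has_frechet_derivative_def by blast
        have S0: "S (\<tau> *\<^sub>R h) \<in> carr Y"
        proof -
          have "nrm X (0 *\<^sub>R h) \<le> \<bar>0\<bar> * n" by (rule small(2))
          then show ?thesis using d(2)[of "0 *\<^sub>R h"] small(1)[of 0] d(1) by simp
        qed
        show "\<exists>s>0. \<forall>\<sigma>. \<sigma> \<noteq> \<tau> \<and> norm (\<sigma> - \<tau>) < s \<longrightarrow> norm ((f \<sigma> - f \<tau>) / (\<sigma> - \<tau>) - f' \<tau>) < e"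
        proof (intro exI[of _ "d / (n + 1)"] conjI allI impI)
          show "0 < d / (n + 1)" using d(1) n0 by simp
          fix \<sigma> assume \<sigma>: "\<sigma> \<noteq> \<tau> \<and> norm (\<sigma> - \<tau>) < d / (n + 1)"
          let ?k = "(\<sigma> - \<tau>) *\<^sub>R h"
          have "nrm X ?k \<le> \<bar>\<sigma> - \<tau>\<bar> * n" by (rule small(2))
          also have "\<dots> \<le> \<bar>\<sigma> - \<tau>\<bar> * (n + 1)" by (simp add: mult_left_mono)
          also have "\<dots> < d" using \<sigma> n0 by (simp add: pos_less_divide_eq)
          finally have kd: "nrm X ?k < d" .
          have eq: "\<tau> *\<^sub>R h + ?k = \<sigma> *\<^sub>R h" by (simp add: scaleR_diff_left)
          have S1: "S (\<sigma> *\<^sub>R h) \<in> carr Y" and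
            bd: "nrm Y (S (\<sigma> *\<^sub>R h) - S (\<tau> *\<^sub>R h) - D1 (\<tau> *\<^sub>R h) ?k) \<le> e' * nrm X ?k"
            using d(2)[OF small(1) kd] unfolding eq by blast+
          have Lh: "D1 (\<tau> *\<^sub>R h) h \<in> carr Y" by (rule blin_space_carrD(1)[OF D1c[OF \<tau>] h])
          have Lk: "D1 (\<tau> *\<^sub>R h) ?k = (\<sigma> - \<tau>) *\<^sub>R D1 (\<tau> *\<^sub>R h) h"
            by (rule blin_space_carrD(3)[OF D1c[OF \<tau>] h])
          have LkY: "D1 (\<tau> *\<^sub>R h) ?k \<in> carr Y" unfolding Lk by (rule qsnormD(3)[OF Y Lh])
          have "f \<sigma> - f \<tau> - (\<sigma> - \<tau>) * f' \<tau> = l (S (\<sigma> *\<^sub>R h) - S (\<tau> *\<^sub>R h) - D1 (\<tau> *\<^sub>R h) ?k)"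
            by (simp add: ldiff qsnorm_diff(1)[OF Y] S0 S1 LkY f_def f'_def Lk lsc[OF Lh] qsnormD(3)[OF Y Lh])
          also have "\<bar>\<dots>\<bar> \<le> M * nrm Y (S (\<sigma> *\<^sub>R h) - S (\<tau> *\<^sub>R h) - D1 (\<tau> *\<^sub>R h) ?k)"
            by (intro lb qsnorm_diff(1)[OF Y] S0 S1 LkY)
          also have "\<dots> \<le> M * (e' * (\<bar>\<sigma> - \<tau>\<bar> * n))"
            using bd small(2)[of "\<sigma> - \<tau>"] e' M
            by (intro mult_left_mono order_trans[OF bd] mult_left_mono) auto
          also have "\<dots> \<le> (e / 2) * \<bar>\<sigma> - \<tau>\<bar>"
          proof -
            have "e' * (M * n) \<le> e' * (M * n + 1)" using e' by simp
            also have "\<dots> = e / 2"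
            proof -
              have "M * n + 1 \<noteq> 0" using Mn by linarith
              from nonzero_eq_divide_eq[OF this, THEN iffD1, OF refl] show ?thesis unfolding e'_def .
            qed
            finally have "e' * (M * n) * \<bar>\<sigma> - \<tau>\<bar> \<le> (e / 2) * \<bar>\<sigma> - \<tau>\<bar>"
              by (intro mult_right_mono) auto
            then show ?thesis by (simp add: mult_ac)
          qed
          finally have b: "\<bar>f \<sigma> - f \<tau> - (\<sigma> - \<tau>) * f' \<tau>\<bar> \<le> (e / 2) * \<bar>\<sigma> - \<tau>\<bar>" .
          have "(f \<sigma> - f \<tau>) / (\<sigma> - \<tau>) - f' \<tau> = (f \<sigma> - f \<tau> - (\<sigma> - \<tau>) * f' \<tau>) / (\<sigma> - \<tau>)"
            using \<sigma> by (simp add: diff_divide_distrib)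
          then have "norm ((f \<sigma> - f \<tau>) / (\<sigma> - \<tau>) - f' \<tau>) \<le> e / 2"
            using b \<sigma> by (simp add: abs_divide divide_le_eq)
          then show "norm ((f \<sigma> - f \<tau>) / (\<sigma> - \<tau>) - f' \<tau>) < e" using e by simp
        qed
      qed
      then show ?thesis by (simp add: has_field_derivative_iff)
    qed
    have f'b: "\<bar>f' \<tau> - f' 0\<bar> \<le> K * M * n\<^sup>2 * \<tau>" if \<tau>: "0 \<le> \<tau>" "\<tau> < t0" for \<tau>
    proof -
      let ?k = "\<tau> *\<^sub>R h" and ?R = "D1 (\<tau> *\<^sub>R h) - D1 0 - D2 0 (\<tau> *\<^sub>R h)"
      have at: "\<bar>\<tau>\<bar> < t0" using \<tau> by simp
      have c1: "D1 ?k \<in> carr ?B" by (rule D1c[OF at])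
      have c0: "D1 0 \<in> carr ?B" using D1c[of 0] t0 by simp
      have c2: "D2 0 ?k \<in> carr ?B" by (rule blin_space_carrD(1)[OF D20 small(1)])
      have R: "?R \<in> carr ?B" by (intro blin_space_diff[OF X Y] c1 c0 c2)
      have nR: "nrm ?B ?R \<le> \<tau> * n"
        using d0(2)[OF small(1), of \<tau>] small(2)[of \<tau>] small(3)[OF at] \<tau> by simp
      have nD: "nrm ?B (D2 0 ?k) \<le> \<bar>K2\<bar> * (\<tau> * n)"
      proof -
        have "nrm ?B (D2 0 ?k) \<le> K2 * nrm X ?k" by (rule K2[OF small(1)])
        also have "\<dots> \<le> \<bar>K2\<bar> * nrm X ?k" using qsnormD(5)[OF X small(1)] by (intro mult_right_mono) auto
        also have "\<dots> \<le> \<bar>K2\<bar> * (\<tau> * n)" using small(2)[of \<tau>] \<tau> by (intro mult_left_mono) auto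
        finally show ?thesis .
      qed
      have eq: "D1 ?k h - D1 0 h = ?R h + D2 0 ?k h" by simp
      have "f' \<tau> - f' 0 = l (D1 ?k h - D1 0 h)"
        using ldiff[OF blin_space_carrD(1)[OF c1 h] blin_space_carrD(1)[OF c0 h]] by (simp add: f'_def)
      also have "\<dots> = l (?R h) + l (D2 0 ?k h)"
        unfolding eq by (rule ladd[OF blin_space_carrD(1)[OF R h] blin_space_carrD(1)[OF c2 h]])
      also have "\<bar>\<dots>\<bar> \<le> M * nrm Y (?R h) + M * nrm Y (D2 0 ?k h)"
        using lb[OF blin_space_carrD(1)[OF R h]] lb[OF blin_space_carrD(1)[OF c2 h]] by linarith
      also have "\<dots> \<le> M * (nrm ?B ?R * n) + M * (nrm ?B (D2 0 ?k) * n)"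
        unfolding n_def
        by (intro add_mono mult_left_mono M blin_space_bound[OF X Y _ h] R c2)
      also have "\<dots> \<le> M * ((\<tau> * n) * n) + M * ((\<bar>K2\<bar> * (\<tau> * n)) * n)"
        by (intro add_mono mult_left_mono mult_right_mono M n0 nR nD)
      also have "\<dots> = K * M * n\<^sup>2 * \<tau>"
        by (simp add: K_def power2_eq_square algebra_simps)
      finally show ?thesis .
    qed
    have limf: "((\<lambda>\<epsilon>. f \<epsilon> / \<epsilon>\<^sup>2) \<longlongrightarrow> c) (at_right 0)" using lim by (simp add: f_def)
    \<comment> \<open>A finite limit of \<open>f \<epsilon> / \<epsilon>\<^sup>2\<close> forces the
      value and the derivative of \<open>f\<close> at 0 to vanish, by continuity and
      differentiability there.\<close>
    have f0: "f 0 = 0"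
    proof -
      have "((\<lambda>\<epsilon>. f \<epsilon> / \<epsilon>\<^sup>2 * \<epsilon>\<^sup>2) \<longlongrightarrow> c * 0\<^sup>2) (at_right 0)"
        by (intro tendsto_mult limf tendsto_power tendsto_ident_at)
      moreover have "eventually (\<lambda>\<epsilon>. f \<epsilon> / \<epsilon>\<^sup>2 * \<epsilon>\<^sup>2 = f \<epsilon>) (at_right 0)"
        unfolding eventually_at_filter by (rule always_eventually) auto
      ultimately have "(f \<longlongrightarrow> 0) (at_right 0)" by (simp add: tendsto_cong)
      moreover have "(f \<longlongrightarrow> f 0) (at_right 0)"
        using DERIV_isCont[OF der[of 0]] t0 unfolding isCont_def by (simp add: filterlim_at_split)
      ultimately show ?thesis using tendsto_unique[OF trivial_limit_at_right_real] by blast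
    qed
    have f'0: "f' 0 = 0"
    proof -
      have "((\<lambda>\<epsilon>. f \<epsilon> / \<epsilon>\<^sup>2 * \<epsilon>) \<longlongrightarrow> c * 0) (at_right 0)"
        by (intro tendsto_mult limf tendsto_ident_at)
      moreover have "eventually (\<lambda>\<epsilon>. f \<epsilon> / \<epsilon>\<^sup>2 * \<epsilon> = f \<epsilon> / \<epsilon>) (at_right 0)"
        unfolding eventually_at_filter by (rule always_eventually) (auto simp: power2_eq_square)
      ultimately have "((\<lambda>\<epsilon>. f \<epsilon> / \<epsilon>) \<longlongrightarrow> 0) (at_right 0)" by (simp add: tendsto_cong)
      moreover have "((\<lambda>\<epsilon>. f \<epsilon> / \<epsilon>) \<longlongrightarrow> f' 0) (at_right 0)"
        using der[of 0] t0 f0 unfolding has_field_derivative_iff by (simp add: filterlim_at_split)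
      ultimately show ?thesis using tendsto_unique[OF trivial_limit_at_right_real] by blast
    qed
    have "eventually (\<lambda>\<epsilon>. \<bar>f \<epsilon> / \<epsilon>\<^sup>2\<bar> \<le> K * M * n\<^sup>2) (at_right 0)"
      unfolding eventually_at_right_field
    proof (intro exI[of _ t0] conjI t0 allI impI)
      fix \<epsilon> assume e: "0 < \<epsilon>" "\<epsilon> < t0"
      have "\<exists>z>0. z < \<epsilon> \<and> f \<epsilon> - f 0 = (\<epsilon> - 0) * f' z"
        using e by (intro MVT2) (auto intro: der)
      then obtain z where z: "0 < z" "z < \<epsilon>" "f \<epsilon> = \<epsilon> * f' z" using f0 by auto
      have "\<bar>f' z\<bar> \<le> K * M * n\<^sup>2 * z" using f'b[of z] z e f'0 by simp
      also have "\<dots> \<le> K * M * n\<^sup>2 * \<epsilon>" using z K0 M by (intro mult_left_mono) auto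
      finally have "\<epsilon> * \<bar>f' z\<bar> \<le> \<epsilon> * (K * M * n\<^sup>2 * \<epsilon>)" using e by (intro mult_left_mono) auto
      then show "\<bar>f \<epsilon> / \<epsilon>\<^sup>2\<bar> \<le> K * M * n\<^sup>2"
        using e z(3) by (simp add: abs_mult abs_divide divide_le_eq power2_eq_square mult_ac)
    qed
    then have "\<bar>c\<bar> \<le> K * M * n\<^sup>2"
      by (rule tendsto_upperbound[OF tendsto_rabs[OF limf]]) simp
    then show ?thesis by (simp add: K_def n_def)
  qed
  show ?thesis
  proof (cases "carr X = {}")
    case True
    then show ?thesis using that by blast
  next
    case False
    then obtain h where h: "h \<in> carr X" by blast
    have z: "0 \<in> carr X" using qsnormD(3)[OF X h, of 0] by simp
    have "nrm X (0 *\<^sub>R h) \<le> \<bar>0\<bar> * nrm X h" by (rule qsnormD(4)[OF X h])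
    then have zr: "nrm X 0 < r" using r by simp
    have "D2 0 \<in> carr (blin_space X ?B)"
      using D2[OF z zr] unfolding has_frechet_derivative_def by blast
    from blin_space_carrD(4)[OF this] obtain K2 where "\<And>x. x \<in> carr X \<Longrightarrow> nrm ?B (D2 0 x) \<le> K2 * nrm X x"
      by blast
    from bound[OF z zr this] show ?thesis by (rule that)
  qed
qed


section \<open>Convolution and Duhamel operators in exponentially weighted spaces\<close>

text \<open>Times outside \<open>[0,T]\<close> are clamped, so that all functions of time live on the whole line. The
  exponential weight loses one unit of decay rate over each unit of time; this pays for the
  derivative in the nonlinearity.\<close>

definition clampT :: "real \<Rightarrow> real \<Rightarrow> real"
  where "clampT T t = max 0 (min T t)"

text \<open>The rate runs from \<open>1 + T\<close> down to 1, so even at the final time every power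
  of \<open>norm \<xi>\<close> is controlled. The exponentials alone are only submultiplicative; the
  additional \<open>decay_weight\<close> makes convolution integrals converge.\<close>

definition wt :: "real \<Rightarrow> real \<Rightarrow> real^'d::finite \<Rightarrow> real"
  where "wt T t \<xi> = exp ((1 + T - clampT T t) * (1 + norm \<xi>)) * decay_weight \<xi>"

text \<open>\<open>r\<close> counts the powers of \<open>1 + norm \<xi>\<close> gained beyond the
  weight. The scalar unknowns for u and v will have \<open>r = 1\<close>, the potential of w will
  have \<open>r = 2\<close>.\<close>

definition decays :: "real \<Rightarrow> nat \<Rightarrow> real \<Rightarrow> (real \<Rightarrow> real^'d::finite \<Rightarrow> complex) \<Rightarrow> bool"
  where "decays T r M f \<longleftrightarrow> continuous_on UNIV (\<lambda>p. f (fst p) (snd p)) \<and>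
    (\<forall>t \<xi>. norm (f t \<xi>) \<le> M / ((1 + norm \<xi>) ^ r * wt T t \<xi>))"

lemma clampT_bounds: "0 \<le> T \<Longrightarrow> 0 \<le> clampT T t" "0 \<le> T \<Longrightarrow> clampT T t \<le> T"
  by (auto simp: clampT_def)

lemma clampT_id: "t \<in> {0..T} \<Longrightarrow> clampT T t = t"
  by (auto simp: clampT_def)

lemma continuous_on_clampT [continuous_intros]:
  "continuous_on S f \<Longrightarrow> continuous_on S (\<lambda>x. clampT T (f x))"
  unfolding clampT_def by (intro continuous_intros)

lemma wt_pos: "0 < wt T t \<xi>"
  by (simp add: wt_def decay_weight_pos)

lemma wt_ge_exp:
  assumes "0 \<le> T"
  shows "exp (1 + norm \<xi>) \<le> wt T t \<xi>"
proof -
  have "1 * (1 + norm \<xi>) \<le> (1 + T - clampT T t) * (1 + norm \<xi>)"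
    using clampT_bounds[OF assms, of t] by (intro mult_right_mono) auto
  then have "exp (1 + norm \<xi>) * 1 \<le> exp ((1 + T - clampT T t) * (1 + norm \<xi>)) * decay_weight \<xi>"
    by (intro mult_mono decay_weight_ge_1) auto
  then show ?thesis by (simp add: wt_def)
qed

lemma continuous_on_wt [continuous_intros]:
  "continuous_on S f \<Longrightarrow> continuous_on S g \<Longrightarrow> continuous_on S (\<lambda>x. wt T (f x) (g x))"
  unfolding wt_def by (intro continuous_intros)

lemma decaysD:
  assumes "decays T r M f"
  shows "continuous_on UNIV (\<lambda>p. f (fst p) (snd p))" "norm (f t \<xi>) \<le> M / ((1 + norm \<xi>) ^ r * wt T t \<xi>)"
  using assms by (auto simp: decays_def)

lemma decays_nonneg:
  fixes f :: "real \<Rightarrow> real^'d::finite \<Rightarrow> complex"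
  assumes "decays T r M f"
  shows "0 \<le> M"
proof -
  have "0 \<le> M / ((1 + norm (0::real^'d)) ^ r * wt T 0 (0::real^'d))"
    using decaysD(2)[OF assms, of 0 0] norm_ge_zero order_trans by blast
  then show ?thesis using wt_pos[of T 0 "0::real^'d"] by (simp add: zero_le_divide_iff)
qed

lemma decays_comp:
  assumes "decays T r M f" "continuous_on S a" "continuous_on S b"
  shows "continuous_on S (\<lambda>x. f (a x) (b x))"
proof -
  have "continuous_on S (\<lambda>x. (\<lambda>p. f (fst p) (snd p)) (a x, b x))"
    by (rule continuous_on_compose2[OF decaysD(1)[OF assms(1)]]) (auto intro!: continuous_intros assms)
  then show ?thesis by simp
qed

lemma decays_mono:
  fixes f :: "real \<Rightarrow> real^'d::finite \<Rightarrow> complex"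
  assumes f: "decays T r M f" and "M \<le> N"
  shows "decays T r N f"
  unfolding decays_def
proof (intro conjI allI)
  fix t and \<xi> :: "real^'d"
  have "M / ((1 + norm \<xi>) ^ r * wt T t \<xi>) \<le> N / ((1 + norm \<xi>) ^ r * wt T t \<xi>)"
    using assms(2) wt_pos[of T t \<xi>] by (intro divide_right_mono) (auto simp: less_imp_le)
  with decaysD(2)[OF f] show "norm (f t \<xi>) \<le> N / ((1 + norm \<xi>) ^ r * wt T t \<xi>)"
    by (rule order_trans)
qed (rule decaysD(1)[OF f])

lemma decays_le_order:
  fixes f :: "real \<Rightarrow> real^'d::finite \<Rightarrow> complex"
  assumes f: "decays T r M f" and "q \<le> r"
  shows "decays T q M f"
  unfolding decays_def
proof (intro conjI allI)
  fix t and \<xi> :: "real^'d"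
  have "(1 + norm \<xi>) ^ q * wt T t \<xi> \<le> (1 + norm \<xi>) ^ r * wt T t \<xi>"
    using assms(2) wt_pos[of T t \<xi>] by (intro mult_right_mono power_increasing) auto
  then have "M / ((1 + norm \<xi>) ^ r * wt T t \<xi>) \<le> M / ((1 + norm \<xi>) ^ q * wt T t \<xi>)"
    using wt_pos[of T t \<xi>] decays_nonneg[OF f] by (intro divide_left_mono mult_pos_pos zero_less_power) (auto simp: add_pos_nonneg)
  with decaysD(2)[OF f] show "norm (f t \<xi>) \<le> M / ((1 + norm \<xi>) ^ q * wt T t \<xi>)"
    by (rule order_trans)
qed (rule decaysD(1)[OF f])

lemma decays_add:
  assumes f: "decays T r M f" and g: "decays T r N g"
  shows "decays T r (M + N) (\<lambda>t \<xi>. f t \<xi> + g t \<xi>)"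
  unfolding decays_def
proof (intro conjI allI)
  show "norm (f t \<xi> + g t \<xi>) \<le> (M + N) / ((1 + norm \<xi>) ^ r * wt T t \<xi>)" for t \<xi>
    using norm_triangle_mono[OF decaysD(2)[OF f] decaysD(2)[OF g]] by (simp add: add_divide_distrib)
qed (intro continuous_intros decaysD(1)[OF f] decaysD(1)[OF g])

lemma decays_cmult:
  assumes f: "decays T r M f"
  shows "decays T r (norm c * M) (\<lambda>t \<xi>. c * f t \<xi>)"
  unfolding decays_def
proof (intro conjI allI)
  show "norm (c * f t \<xi>) \<le> (norm c * M) / ((1 + norm \<xi>) ^ r * wt T t \<xi>)" for t \<xi>
    using mult_left_mono[OF decaysD(2)[OF f], of "norm c"] by (simp add: norm_mult)
qed (intro continuous_intros decaysD(1)[OF f])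

lemma decays_rapid:
  fixes f :: "real \<Rightarrow> real^'d::finite \<Rightarrow> complex"
  assumes f: "decays T r M f" and T: "0 \<le> T"
  shows "rapid (f t)"
  unfolding rapid_def
proof (intro conjI allI)
  show "continuous_on UNIV (f t)"
    by (rule decays_comp[OF f]) (auto intro: continuous_intros)
  fix k
  have "(1 + norm \<xi>) ^ k * norm (f t \<xi>) \<le> fact k * M" for \<xi>
  proof -
    have M: "0 \<le> M" by (rule decays_nonneg[OF f])
    have "norm (f t \<xi>) \<le> M / wt T t \<xi>"
      using decaysD(2)[OF decays_le_order[OF f, of 0]] by simp
    also have "\<dots> \<le> M / exp (1 + norm \<xi>)"
      using wt_pos[of T t \<xi>] wt_ge_exp[OF T, of \<xi> t] M by (intro divide_left_mono mult_pos_pos) auto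
    finally have "(1 + norm \<xi>) ^ k * norm (f t \<xi>) \<le> (fact k * exp (1 + norm \<xi>)) * (M / exp (1 + norm \<xi>))"
      by (intro mult_mono one_plus_power_le_exp) auto
    then show ?thesis by simp
  qed
  then show "\<exists>M. \<forall>\<xi>. (1 + norm \<xi>) ^ k * norm (f t \<xi>) \<le> M" by blast
qed

definition lap :: "(real \<Rightarrow> real^'d::finite \<Rightarrow> complex) \<Rightarrow> real \<Rightarrow> real^'d \<Rightarrow> complex"
  where "lap f t \<xi> = complex_of_real ((norm \<xi>)\<^sup>2) * f t \<xi>"

text \<open>The Fourier side of complex conjugation.\<close>

definition crefl :: "(real \<Rightarrow> real^'d::finite \<Rightarrow> complex) \<Rightarrow> real \<Rightarrow> real^'d \<Rightarrow> complex"
  where "crefl f t \<xi> = cnj (f t (- \<xi>))"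

definition conv :: "(real \<Rightarrow> real^'d::finite \<Rightarrow> complex) \<Rightarrow> (real \<Rightarrow> real^'d \<Rightarrow> complex) \<Rightarrow> real \<Rightarrow> real^'d \<Rightarrow> complex"
  where "conv f g t \<xi> = (LINT \<eta>|lborel. f t \<eta> * g t (\<xi> - \<eta>))"

text \<open>The Duhamel integral of i u' = \<kappa> |\<xi>|^2 u + f, that is -i times the integral
  of exp(-i \<kappa> (t - s) |\<xi>|^2) f(s) over s in [0,t]. The factor at time t is pulled out, so
  that only the upper limit of the integral depends on t.\<close>

definition duh :: "real \<Rightarrow> real \<Rightarrow> (real \<Rightarrow> real^'d::finite \<Rightarrow> complex) \<Rightarrow> real \<Rightarrow> real^'d \<Rightarrow> complex"
  where "duh T \<kappa> f t \<xi> = - \<i> * cis (- (\<kappa> * clampT T t * (norm \<xi>)\<^sup>2)) *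
    integral {0..clampT T t} (\<lambda>s. cis (\<kappa> * s * (norm \<xi>)\<^sup>2) * f s \<xi>)"

definition free :: "real \<Rightarrow> real \<Rightarrow> (real^'d::finite \<Rightarrow> complex) \<Rightarrow> real \<Rightarrow> real^'d \<Rightarrow> complex"
  where "free T \<kappa> A t \<xi> = cis (- (\<kappa> * clampT T t * (norm \<xi>)\<^sup>2)) * A \<xi>"

lemma decays_lap:
  fixes f :: "real \<Rightarrow> real^'d::finite \<Rightarrow> complex"
  assumes f: "decays T 2 M f"
  shows "decays T 0 M (lap f)"
  unfolding decays_def
proof (intro conjI allI)
  show "continuous_on UNIV (\<lambda>p. lap f (fst p) (snd p))"
    unfolding lap_def by (intro continuous_intros decaysD(1)[OF f])
  fix t and \<xi> :: "real^'d"
  have p: "1 + norm \<xi> \<noteq> 0" using norm_ge_zero[of \<xi>] by linarith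
  have "norm (lap f t \<xi>) = (norm \<xi>)\<^sup>2 * norm (f t \<xi>)"
    by (simp add: lap_def norm_mult norm_power)
  also have "\<dots> \<le> (1 + norm \<xi>)\<^sup>2 * (M / ((1 + norm \<xi>)\<^sup>2 * wt T t \<xi>))"
    by (intro mult_mono decaysD(2)[OF f] power_mono) auto
  also have "\<dots> = M / ((1 + norm \<xi>) ^ 0 * wt T t \<xi>)" using p by simp
  finally show "norm (lap f t \<xi>) \<le> M / ((1 + norm \<xi>) ^ 0 * wt T t \<xi>)" .
qed

lemma decays_crefl:
  assumes f: "decays T r M f"
  shows "decays T r M (crefl f)"
  unfolding decays_def
proof (intro conjI allI)
  show "continuous_on UNIV (\<lambda>p. crefl f (fst p) (snd p))"
    unfolding crefl_def by (intro continuous_on_cnj decays_comp[OF f] continuous_intros)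
  show "norm (crefl f t \<xi>) \<le> M / ((1 + norm \<xi>) ^ r * wt T t \<xi>)" for t \<xi>
    using decaysD(2)[OF f, of t "- \<xi>"] by (simp add: crefl_def wt_def decay_weight_def)
qed

lemma decays_free:
  fixes A :: "real^'d::finite \<Rightarrow> complex"
  assumes A: "continuous_on UNIV A" "\<And>\<xi>. norm (A \<xi>) \<le> M / ((1 + norm \<xi>) ^ r * wt T 0 \<xi>)" and M: "0 \<le> M" and T: "0 \<le> T"
  shows "decays T r M (free T \<kappa> A)"
  unfolding decays_def
proof (intro conjI allI)
  show "continuous_on UNIV (\<lambda>p. free T \<kappa> A (fst p) (snd p))"
    unfolding free_def by (intro continuous_intros continuous_on_compose2[OF A(1)]) auto
  fix t and \<xi> :: "real^'d"
  have "wt T t \<xi> \<le> wt T 0 \<xi>"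
    unfolding wt_def using clampT_bounds[OF T, of t] clampT_id[of 0 T] T
    by (intro mult_right_mono) (auto intro!: mult_right_mono less_imp_le[OF decay_weight_pos])
  then have "M / ((1 + norm \<xi>) ^ r * wt T 0 \<xi>) \<le> M / ((1 + norm \<xi>) ^ r * wt T t \<xi>)"
    using wt_pos[of T t \<xi>] wt_pos[of T 0 \<xi>] M
    by (intro divide_left_mono mult_left_mono mult_pos_pos zero_less_power) (auto simp: add_pos_nonneg)
  then show "norm (free T \<kappa> A t \<xi>) \<le> M / ((1 + norm \<xi>) ^ r * wt T t \<xi>)"
    using order_trans[OF A(2)] by (simp add: free_def norm_mult)
qed

definition conv_const :: "'d::finite itself \<Rightarrow> real"
  where "conv_const _ = 2 ^ (2 * CARD('d)) * (2 * (LINT \<eta>|lborel. 1 / decay_weight (\<eta> :: real^'d)))"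

lemma conv_const_nonneg: "0 \<le> conv_const TYPE('d::finite)"
proof -
  have "0 \<le> (LINT \<eta>|lborel. 1 / decay_weight (\<eta> :: real^'d))"
    by (rule Bochner_Integration.integral_nonneg) (simp add: less_imp_le[OF decay_weight_pos])
  then show ?thesis by (simp add: conv_const_def)
qed

text \<open>One of \<open>\<eta>\<close> and \<open>\<xi> - \<eta>\<close> carries at least half of
  \<open>\<xi>\<close>, so the larger of the two weights is worth a weight at \<open>\<xi>\<close>;
  what remains is integrable in \<open>\<eta>\<close>, uniformly in \<open>\<xi>\<close>.\<close>

lemma inverse_decay_weight_split:
  fixes \<xi> \<eta> :: "real^'d::finite"
  shows "1 / (decay_weight \<eta> * decay_weight (\<xi> - \<eta>))
    \<le> 2 ^ (2 * CARD('d)) / decay_weight \<xi> * (1 / decay_weight \<eta> + 1 / decay_weight (\<xi> - \<eta>))"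
proof -
  let ?a = "1 + norm \<eta>" and ?b = "1 + norm (\<xi> - \<eta>)" and ?n = "2 * CARD('d)"
  have "norm \<xi> \<le> norm \<eta> + norm (\<xi> - \<eta>)"
    using norm_triangle_ineq[of \<eta> "\<xi> - \<eta>"] by simp
  then have "1 + norm \<xi> \<le> 2 * max ?a ?b" by (auto simp: max_def)
  then have "(1 + norm \<xi>) ^ ?n \<le> (2 * max ?a ?b) ^ ?n" by (intro power_mono) auto
  also have "\<dots> = 2 ^ ?n * max ?a ?b ^ ?n" by (rule power_mult_distrib)
  also have "max ?a ?b ^ ?n \<le> ?a ^ ?n + ?b ^ ?n" by (auto simp: max_def)
  finally have le: "decay_weight \<xi> \<le> 2 ^ ?n * (decay_weight \<eta> + decay_weight (\<xi> - \<eta>))"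
    by (simp add: decay_weight_def)
  have p: "0 < decay_weight \<xi>" "0 < decay_weight \<eta>" "0 < decay_weight (\<xi> - \<eta>)"
    by (rule decay_weight_pos)+
  have "1 / (decay_weight \<eta> * decay_weight (\<xi> - \<eta>))
    = decay_weight \<xi> / (decay_weight \<xi> * (decay_weight \<eta> * decay_weight (\<xi> - \<eta>)))"
    using p by simp
  also have "\<dots> \<le> (2 ^ ?n * (decay_weight \<eta> + decay_weight (\<xi> - \<eta>))) / (decay_weight \<xi> * (decay_weight \<eta> * decay_weight (\<xi> - \<eta>)))"
    using le p by (intro divide_right_mono) auto
  also have "\<dots> = 2 ^ ?n / decay_weight \<xi> * (1 / decay_weight \<eta> + 1 / decay_weight (\<xi> - \<eta>))"
    using p by (simp add: field_simps)
  finally show ?thesis .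
qed

text \<open>Powers and exponentials are both submultiplicative along \<xi> = \<eta> + (\<xi> -
  \<eta>), the latter because the rate is nonnegative. The first bound carries the decay of the
  convolution; the second is a majorant free of \<open>t\<close> and \<open>\<xi>\<close>, for
  continuity in both.\<close>

lemma conv_integrand_bound:
  fixes f g :: "real \<Rightarrow> real^'d::finite \<Rightarrow> complex"
  assumes f: "decays T r M f" and g: "decays T r N g" and T: "0 \<le> T"
  shows "norm (f t \<eta> * g t (\<xi> - \<eta>)) \<le> M * N / ((1 + norm \<xi>) ^ r * wt T t \<xi>) *
      (2 ^ (2 * CARD('d)) * (1 / decay_weight \<eta> + 1 / decay_weight (\<xi> - \<eta>)))"
    and "norm (f t \<eta> * g t (\<xi> - \<eta>)) \<le> M * N * (1 / decay_weight \<eta>)"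
proof -
  have MN: "0 \<le> M" "0 \<le> N" using decays_nonneg[OF f] decays_nonneg[OF g] by auto
  let ?\<zeta> = "\<xi> - \<eta>" and ?\<sigma> = "1 + T - clampT T t"
  have tri: "norm \<xi> \<le> norm \<eta> + norm ?\<zeta>"
    using norm_triangle_ineq[of \<eta> ?\<zeta>] by simp
  have \<sigma>: "0 \<le> ?\<sigma>" using clampT_bounds[OF T, of t] by simp
  let ?P = "(1 + norm \<eta>) ^ r * (1 + norm ?\<zeta>) ^ r"
  let ?E = "exp (?\<sigma> * (1 + norm \<eta>)) * exp (?\<sigma> * (1 + norm ?\<zeta>))"
  let ?D = "decay_weight \<eta> * decay_weight ?\<zeta>"
  have pos: "0 < (1 + norm \<eta>) ^ r" "0 < (1 + norm ?\<zeta>) ^ r" "0 < (1 + norm \<xi>) ^ r" "0 < ?D"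
    using decay_weight_pos by (auto intro!: mult_pos_pos zero_less_power add_pos_nonneg)
  have "norm (f t \<eta> * g t ?\<zeta>) \<le> (M / ((1 + norm \<eta>) ^ r * wt T t \<eta>)) * (N / ((1 + norm ?\<zeta>) ^ r * wt T t ?\<zeta>))"
    unfolding norm_mult using MN wt_pos[of T t \<eta>]
    by (intro mult_mono decaysD(2)[OF f] decaysD(2)[OF g]) (auto simp: less_imp_le)
  also have "\<dots> = M * N / (?P * ?E) * (1 / ?D)"
    by (simp add: wt_def mult_ac)
  finally have b: "norm (f t \<eta> * g t ?\<zeta>) \<le> M * N / (?P * ?E) * (1 / ?D)" .
  have E1: "exp (?\<sigma> * (1 + norm \<xi>)) \<le> ?E"
    unfolding exp_add[symmetric] distrib_left[symmetric] exp_le_cancel_iff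
    using tri \<sigma> by (intro mult_left_mono) auto
  have P1: "(1 + norm \<xi>) ^ r \<le> ?P"
    unfolding power_mult_distrib[symmetric]
  proof (rule power_mono)
    have "(1 + norm \<eta>) * (1 + norm ?\<zeta>) = 1 + (norm \<eta> + norm ?\<zeta>) + norm \<eta> * norm ?\<zeta>"
      by (simp add: algebra_simps)
    moreover have "0 \<le> norm \<eta> * norm ?\<zeta>" by simp
    ultimately show "1 + norm \<xi> \<le> (1 + norm \<eta>) * (1 + norm ?\<zeta>)"
      using tri by linarith
  qed simp
  have "M * N / (?P * ?E) \<le> M * N / ((1 + norm \<xi>) ^ r * exp (?\<sigma> * (1 + norm \<xi>)))"
    using MN pos by (intro divide_left_mono mult_mono E1 P1 mult_pos_pos) auto
  then have "M * N / (?P * ?E) * (1 / ?D) \<le> M * N / ((1 + norm \<xi>) ^ r * exp (?\<sigma> * (1 + norm \<xi>))) *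
      (2 ^ (2 * CARD('d)) / decay_weight \<xi> * (1 / decay_weight \<eta> + 1 / decay_weight ?\<zeta>))"
    using MN pos by (intro mult_mono inverse_decay_weight_split) auto
  with b have "norm (f t \<eta> * g t ?\<zeta>) \<le> M * N / ((1 + norm \<xi>) ^ r * exp (?\<sigma> * (1 + norm \<xi>))) *
      (2 ^ (2 * CARD('d)) / decay_weight \<xi> * (1 / decay_weight \<eta> + 1 / decay_weight ?\<zeta>))"
    by (rule order_trans)
  also have "\<dots> = M * N / ((1 + norm \<xi>) ^ r * wt T t \<xi>) *
      (2 ^ (2 * CARD('d)) * (1 / decay_weight \<eta> + 1 / decay_weight ?\<zeta>))"
    by (simp add: wt_def mult_ac)
  finally show "norm (f t \<eta> * g t (\<xi> - \<eta>)) \<le> M * N / ((1 + norm \<xi>) ^ r * wt T t \<xi>) *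
      (2 ^ (2 * CARD('d)) * (1 / decay_weight \<eta> + 1 / decay_weight (\<xi> - \<eta>)))" .
  have "1 \<le> exp (?\<sigma> * (1 + norm \<xi>))" using \<sigma> by simp
  with E1 have "1 \<le> ?E" by linarith
  moreover have "1 \<le> ?P"
    by (rule order_trans[OF one_le_power P1]) simp
  ultimately have "1 \<le> ?P * ?E" using mult_mono[of 1 ?P 1 ?E] by simp
  then have "M * N / (?P * ?E) \<le> M * N / 1"
    using MN by (intro divide_left_mono) auto
  moreover have "1 / ?D \<le> 1 / decay_weight \<eta>"
    using decay_weight_ge_1[of ?\<zeta>] decay_weight_pos[of \<eta>] pos(4)
    by (intro divide_left_mono) auto
  ultimately have "M * N / (?P * ?E) * (1 / ?D) \<le> M * N / 1 * (1 / decay_weight \<eta>)"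
    using MN pos by (intro mult_mono) auto
  with b show "norm (f t \<eta> * g t (\<xi> - \<eta>)) \<le> M * N * (1 / decay_weight \<eta>)" by simp
qed

lemma conv_integrable:
  fixes f g :: "real \<Rightarrow> real^'d::finite \<Rightarrow> complex"
  assumes f: "decays T r M f" and g: "decays T r N g" and T: "0 \<le> T"
  shows "integrable lborel (\<lambda>\<eta>. f t \<eta> * g t (\<xi> - \<eta>))"
proof (rule Bochner_Integration.integrable_bound)
  have MN: "0 \<le> M" "0 \<le> N" using decays_nonneg[OF f] decays_nonneg[OF g] by auto
  show "integrable lborel (\<lambda>\<eta>::real^'d. M * N * (1 / decay_weight \<eta>))"
    by (intro integrable_mult_right integrable_inverse_decay_weight)
  show "(\<lambda>\<eta>. f t \<eta> * g t (\<xi> - \<eta>)) \<in> borel_measurable lborel"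
    by (intro continuous_imp_lborel_measurable continuous_on_mult decays_comp[OF f] decays_comp[OF g] continuous_intros)
  show "AE \<eta> in lborel. norm (f t \<eta> * g t (\<xi> - \<eta>)) \<le> norm (M * N * (1 / decay_weight \<eta>))"
    unfolding real_norm_def
    by (rule AE_I2) (rule order_trans[OF conv_integrand_bound(2)[OF f g T] abs_ge_self])
qed

lemma integrable_inverse_decay_weight_shift:
  fixes \<xi> :: "real^'d::finite"
  shows "integrable lborel (\<lambda>\<eta>. 1 / decay_weight (\<xi> - \<eta>))"
    and "(LINT \<eta>|lborel. 1 / decay_weight (\<xi> - \<eta>)) = (LINT \<eta>|lborel. 1 / decay_weight (\<eta> :: real^'d))"
proof -
  have m: "(\<lambda>\<eta>::real^'d. 1 / decay_weight \<eta>) \<in> borel_measurable borel"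
    using borel_measurable_integrable[OF integrable_inverse_decay_weight] by simp
  show "integrable lborel (\<lambda>\<eta>. 1 / decay_weight (\<xi> - \<eta>))"
    using integrable_scale[OF integrable_inverse_decay_weight, of "-1" \<xi>] by simp
  show "(LINT \<eta>|lborel. 1 / decay_weight (\<xi> - \<eta>)) = (LINT \<eta>|lborel. 1 / decay_weight (\<eta> :: real^'d))"
    using integral_scale[OF m, of "-1" \<xi>] by simp
qed

lemma decays_conv:
  fixes f g :: "real \<Rightarrow> real^'d::finite \<Rightarrow> complex"
  assumes f: "decays T r M f" and g: "decays T r N g" and T: "0 \<le> T"
  shows "decays T r (conv_const TYPE('d) * M * N) (conv f g)"
  unfolding decays_def
proof (intro conjI allI)
  show "continuous_on UNIV (\<lambda>p. conv f g (fst p) (snd p))"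
  proof (rule continuous_on_sequentiallyI)
    fix u :: "nat \<Rightarrow> real \<times> (real^'d)" and a assume u: "u \<longlonglongrightarrow> a"
    have m: "(\<lambda>\<eta>. f (fst p) \<eta> * g (fst p) (snd p - \<eta>)) \<in> borel_measurable lborel" for p
      by (rule borel_measurable_integrable[OF conv_integrable[OF f g T]])
    have w: "integrable lborel (\<lambda>\<eta>::real^'d. M * N * (1 / decay_weight \<eta>))"
      by (intro integrable_mult_right integrable_inverse_decay_weight)
    have c: "continuous_on UNIV (\<lambda>p. f (fst p) \<eta> * g (fst p) (snd p - \<eta>))" for \<eta>
      by (intro continuous_on_mult decays_comp[OF f] decays_comp[OF g] continuous_intros)
    have lim: "(\<lambda>n. f (fst (u n)) \<eta> * g (fst (u n)) (snd (u n) - \<eta>)) \<longlonglongrightarrow> f (fst a) \<eta> * g (fst a) (snd a - \<eta>)" for \<eta>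
      by (rule isCont_tendsto_compose[OF continuous_UNIV_isCont[OF c] u])
    show "(\<lambda>n. conv f g (fst (u n)) (snd (u n))) \<longlonglongrightarrow> conv f g (fst a) (snd a)"
      unfolding conv_def
      by (rule integral_dominated_convergence[OF m m w AE_I2[OF lim] AE_I2[OF conv_integrand_bound(2)[OF f g T]]])
  qed
  fix t and \<xi> :: "real^'d"
  let ?c = "M * N / ((1 + norm \<xi>) ^ r * wt T t \<xi>)"
  have "norm (conv f g t \<xi>) \<le> (LINT \<eta>|lborel. ?c * (2 ^ (2 * CARD('d)) * (1 / decay_weight \<eta> + 1 / decay_weight (\<xi> - \<eta>))))"
    unfolding conv_def
    by (rule Bochner_Integration.integral_norm_bound_integral[OF conv_integrable[OF f g T]])
       (intro integrable_mult_right Bochner_Integration.integrable_add integrable_inverse_decay_weight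
          integrable_inverse_decay_weight_shift, rule conv_integrand_bound(1)[OF f g T])
  also have "\<dots> = ?c * (2 ^ (2 * CARD('d)) * (2 * (LINT \<eta>|lborel. 1 / decay_weight (\<eta> :: real^'d))))"
  proof -
    have "(LINT \<eta>|lborel. 1 / decay_weight \<eta> + 1 / decay_weight (\<xi> - \<eta>))
      = (LINT \<eta>|lborel. 1 / decay_weight (\<eta> :: real^'d)) + (LINT \<eta>|lborel. 1 / decay_weight (\<xi> - \<eta>))"
      by (intro Bochner_Integration.integral_add integrable_inverse_decay_weight integrable_inverse_decay_weight_shift)
    then show ?thesis
      unfolding integrable_inverse_decay_weight_shift(2) by (simp only: integral_mult_right_zero mult_2)
  qed
  finally show "norm (conv f g t \<xi>) \<le> conv_const TYPE('d) * M * N / ((1 + norm \<xi>) ^ r * wt T t \<xi>)"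
    by (simp add: conv_const_def mult_ac)
qed

text \<open>Moves a variable upper limit into the integrand, so that continuity of parameter
  integrals over the fixed interval \<open>[0,1]\<close> applies to \<open>duh\<close>.\<close>

lemma integral_stretch_unit:
  fixes g :: "real \<Rightarrow> complex"
  assumes "0 \<le> t" "continuous_on {0..t} g"
  shows "integral {0..t} g = t *\<^sub>R integral {0..1} (\<lambda>s. g (t * s))"
proof (cases "t = 0")
  case False
  then have t: "0 < t" using assms by simp
  have im: "(\<lambda>x. x / t) ` {0..t} = {0..1}"
    using t by (auto simp: image_iff field_simps intro!: bexI[of _ "t * _"])
  have "(g has_integral integral {0..t} g) {0..t}"
    by (rule integrable_integral[OF integrable_continuous_real[OF assms(2)]])
  from has_integral_stretch_real[OF this, of t] t
  have "((\<lambda>s. g (t * s)) has_integral (1 / t) *\<^sub>R integral {0..t} g) {0..1}"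
    by (simp add: im)
  then show ?thesis using t by (simp add: integral_unique)
qed simp

lemma duh_continuous:
  fixes f :: "real \<Rightarrow> real^'d::finite \<Rightarrow> complex"
  assumes f: "decays T r M f" and T: "0 \<le> T"
  shows "continuous_on UNIV (\<lambda>p. duh T \<kappa> f (fst p) (snd p))"
proof -
  let ?F = "\<lambda>p s. cis (\<kappa> * (clampT T (fst p) * s) * (norm (snd p))\<^sup>2) * f (clampT T (fst p) * s) (snd p)"
  have c: "continuous_on (UNIV \<times> cbox 0 1) (\<lambda>(p, s). ?F p s)"
    unfolding split_beta by (intro continuous_on_mult decays_comp[OF f] continuous_intros)
  have i: "continuous_on UNIV (\<lambda>p::real \<times> (real^'d). integral (cbox 0 1) (?F p))"
    by (rule integral_continuous_on_param[OF c])
  have eq: "integral {0..clampT T t} (\<lambda>s. cis (\<kappa> * s * (norm \<xi>)\<^sup>2) * f s \<xi>)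
    = clampT T t *\<^sub>R integral (cbox 0 1) (?F (t, \<xi>))" for t and \<xi> :: "real^'d"
  proof -
    have "continuous_on {0..clampT T t} (\<lambda>s. cis (\<kappa> * s * (norm \<xi>)\<^sup>2) * f s \<xi>)"
      by (intro continuous_on_mult decays_comp[OF f] continuous_intros)
    from integral_stretch_unit[OF clampT_bounds(1)[OF T] this] show ?thesis by simp
  qed
  have "continuous_on UNIV (\<lambda>p::real \<times> (real^'d). - \<i> * cis (- (\<kappa> * clampT T (fst p) * (norm (snd p))\<^sup>2)) *
    (clampT T (fst p) *\<^sub>R integral (cbox 0 1) (?F p)))"
    by (intro continuous_intros i)
  then show ?thesis unfolding duh_def eq by simp
qed

lemma integral_exp_bound:
  fixes j b t :: real
  assumes "0 < j" "0 \<le> t"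
  shows "((\<lambda>s. exp (- ((b - s) * j))) has_integral ((exp (- ((b - t) * j)) - exp (- (b * j))) / j)) {0..t}"
proof -
  have "((\<lambda>s. exp (- ((b - s) * j)) / j) has_vector_derivative exp (- ((b - s) * j))) (at s within {0..t})" for s
    using assms unfolding has_real_derivative_iff_has_vector_derivative[symmetric]
    by (auto intro!: derivative_eq_intros)
  then have "((\<lambda>s. exp (- ((b - s) * j))) has_integral (exp (- ((b - t) * j)) / j - exp (- ((b - 0) * j)) / j)) {0..t}"
    using assms by (intro fundamental_theorem_of_calculus) auto
  then show ?thesis by (simp add: diff_divide_distrib)
qed

text \<open>Here the derivative is regained. The weight deteriorates in time, and with j = 1 +
  |\<xi>| the integral of exp(-(1 + T - s) j) over s up to t is at most 1/j times its integrand at s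
  = t. The gain 1/j is one more order of decay.\<close>

lemma decays_duh:
  fixes f :: "real \<Rightarrow> real^'d::finite \<Rightarrow> complex"
  assumes f: "decays T r M f" and T: "0 \<le> T"
  shows "decays T (Suc r) M (duh T \<kappa> f)"
  unfolding decays_def
proof (intro conjI allI duh_continuous[OF f T])
  fix t and \<xi> :: "real^'d"
  let ?t = "clampT T t" and ?j = "1 + norm \<xi>"
  let ?c = "M / (?j ^ r * decay_weight \<xi>)"
  have M: "0 \<le> M" by (rule decays_nonneg[OF f])
  have j: "0 < ?j" by (simp add: add_pos_nonneg)
  have t: "0 \<le> ?t" "?t \<le> T" using clampT_bounds[OF T] by auto
  have c: "0 \<le> ?c" using M j decay_weight_pos[of \<xi>] by simp
  note I = has_integral_mult_right[OF integral_exp_bound[OF j t(1), of "1 + T"], of ?c]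
  have "norm (duh T \<kappa> f t \<xi>) = norm (integral {0..?t} (\<lambda>s. cis (\<kappa> * s * (norm \<xi>)\<^sup>2) * f s \<xi>))"
    by (simp add: duh_def norm_mult)
  also have "\<dots> \<le> integral {0..?t} (\<lambda>s. ?c * exp (- ((1 + T - s) * ?j)))"
  proof (rule Henstock_Kurzweil_Integration.integral_norm_bound_integral)
    show "(\<lambda>s. cis (\<kappa> * s * (norm \<xi>)\<^sup>2) * f s \<xi>) integrable_on {0..?t}"
      by (intro integrable_continuous_real continuous_on_mult decays_comp[OF f] continuous_intros)
    show "(\<lambda>s. ?c * exp (- ((1 + T - s) * ?j))) integrable_on {0..?t}"
      using I by blast
    fix s assume s: "s \<in> {0..?t}"
    then have "clampT T s = s" using t by (intro clampT_id) auto
    then have "M / (?j ^ r * wt T s \<xi>) = ?c * exp (- ((1 + T - s) * ?j))"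
      by (simp add: wt_def exp_minus divide_inverse mult_ac)
    then show "norm (cis (\<kappa> * s * (norm \<xi>)\<^sup>2) * f s \<xi>) \<le> ?c * exp (- ((1 + T - s) * ?j))"
      using decaysD(2)[OF f, of s \<xi>] by (simp add: norm_mult)
  qed
  also have "\<dots> = ?c * ((exp (- ((1 + T - ?t) * ?j)) - exp (- ((1 + T) * ?j))) / ?j)"
    by (rule integral_unique[OF I])
  also have "\<dots> \<le> ?c * (exp (- ((1 + T - ?t) * ?j)) / ?j)"
    using j c by (intro mult_left_mono divide_right_mono) auto
  also have "\<dots> = M / (?j ^ Suc r * wt T t \<xi>)"
    by (simp add: wt_def exp_minus divide_inverse mult_ac)
  finally show "norm (duh T \<kappa> f t \<xi>) \<le> M / (?j ^ Suc r * wt T t \<xi>)" .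
qed


section \<open>The scalar system on the Fourier side\<close>

text \<open>For w the gradient of a potential, the divergence of w has transform
  \<open>- lap C\<close>, and this sign cancels the minus in front of the nonlinearity.\<close>

definition qdiv :: "real \<Rightarrow> real \<Rightarrow> (real \<Rightarrow> real^'d::finite \<Rightarrow> complex) \<Rightarrow> (real \<Rightarrow> real^'d \<Rightarrow> complex) \<Rightarrow> real \<Rightarrow> real^'d \<Rightarrow> complex"
  where "qdiv T \<kappa> C B = duh T \<kappa> (conv (lap C) B)"

text \<open>The gradient on the right of the third equation is matched by the gradient in the ansatz
  for w, so the equation for the potential contains no derivative. In return \<open>C\<close> must
  have order 2, because \<open>qdiv\<close> applies \<open>lap\<close> to it.\<close>

definition qgrad :: "real \<Rightarrow> real \<Rightarrow> (real \<Rightarrow> real^'d::finite \<Rightarrow> complex) \<Rightarrow> (real \<Rightarrow> real^'d \<Rightarrow> complex) \<Rightarrow> real \<Rightarrow> real^'d \<Rightarrow> complex"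
  where "qgrad T \<kappa> A B = duh T \<kappa> (conv A (crefl B))"

text \<open>The orders 1, 1, 2 close up: \<open>lap\<close> takes order 2 to order 0 and Duhamel
  returns order 1; in \<open>decays_qgrad\<close> the convolution keeps order 1 and Duhamel raises
  it to 2.\<close>

lemma decays_qdiv:
  fixes C B :: "real \<Rightarrow> real^'d::finite \<Rightarrow> complex"
  assumes C: "decays T 2 M C" and B: "decays T 1 N B" and T: "0 \<le> T"
  shows "decays T 1 (conv_const TYPE('d) * M * N) (qdiv T \<kappa> C B)"
  using decays_duh[OF decays_conv[OF decays_lap[OF C] decays_le_order[OF B] T] T]
  unfolding qdiv_def by simp

lemma decays_qgrad:
  fixes A B :: "real \<Rightarrow> real^'d::finite \<Rightarrow> complex"
  assumes A: "decays T 1 M A" and B: "decays T 1 N B" and T: "0 \<le> T"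
  shows "decays T 2 (conv_const TYPE('d) * M * N) (qgrad T \<kappa> A B)"
  using decays_duh[OF decays_conv[OF A decays_crefl[OF B] T] T]
  unfolding qgrad_def by (simp add: numeral_2_eq_2)

lemma conv_diff_left:
  assumes f: "decays T r M f" and f': "decays T r M' f'" and g: "decays T r N g" and T: "0 \<le> T"
  shows "conv (\<lambda>t \<xi>. f t \<xi> - f' t \<xi>) g = (\<lambda>t \<xi>. conv f g t \<xi> - conv f' g t \<xi>)"
  unfolding conv_def left_diff_distrib
  by (intro ext Bochner_Integration.integral_diff conv_integrable[OF f g T] conv_integrable[OF f' g T])

lemma conv_diff_right:
  assumes f: "decays T r M f" and g: "decays T r N g" and g': "decays T r N' g'" and T: "0 \<le> T"
  shows "conv f (\<lambda>t \<xi>. g t \<xi> - g' t \<xi>) = (\<lambda>t \<xi>. conv f g t \<xi> - conv f g' t \<xi>)"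
  unfolding conv_def right_diff_distrib
  by (intro ext Bochner_Integration.integral_diff conv_integrable[OF f g T] conv_integrable[OF f g' T])

lemma duh_diff:
  assumes f: "decays T r M f" and g: "decays T r N g"
  shows "duh T \<kappa> (\<lambda>t \<xi>. f t \<xi> - g t \<xi>) = (\<lambda>t \<xi>. duh T \<kappa> f t \<xi> - duh T \<kappa> g t \<xi>)"
proof (intro ext)
  fix t \<xi>
  have "(\<lambda>s. cis (\<kappa> * s * (norm \<xi>)\<^sup>2) * f s \<xi>) integrable_on {0..clampT T t}"
    "(\<lambda>s. cis (\<kappa> * s * (norm \<xi>)\<^sup>2) * g s \<xi>) integrable_on {0..clampT T t}"
    by (intro integrable_continuous_real continuous_on_mult decays_comp[OF f] decays_comp[OF g] continuous_intros)+
  then show "duh T \<kappa> (\<lambda>t \<xi>. f t \<xi> - g t \<xi>) t \<xi> = duh T \<kappa> f t \<xi> - duh T \<kappa> g t \<xi>"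
    unfolding duh_def right_diff_distrib
    by (subst Henstock_Kurzweil_Integration.integral_diff) (auto simp: algebra_simps)
qed

lemma conv_cmult_left: "conv (\<lambda>t \<xi>. c * f t \<xi>) g = (\<lambda>t \<xi>. c * conv f g t \<xi>)"
  unfolding conv_def mult.assoc by (intro ext integral_mult_right_zero)

lemma conv_cmult_right: "conv f (\<lambda>t \<xi>. c * g t \<xi>) = (\<lambda>t \<xi>. c * conv f g t \<xi>)"
  unfolding conv_def mult.left_commute[of _ c] by (intro ext integral_mult_right_zero)

lemma duh_cmult: "duh T \<kappa> (\<lambda>t \<xi>. c * f t \<xi>) = (\<lambda>t \<xi>. c * duh T \<kappa> f t \<xi>)"
  unfolding duh_def mult.left_commute[of _ c] by (intro ext) (simp add: mult_ac)

lemma lap_diff: "lap (\<lambda>t \<xi>. f t \<xi> - g t \<xi>) = (\<lambda>t \<xi>. lap f t \<xi> - lap g t \<xi>)"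
  by (intro ext) (simp add: lap_def right_diff_distrib)

lemma lap_cmult: "lap (\<lambda>t \<xi>. c * f t \<xi>) = (\<lambda>t \<xi>. c * lap f t \<xi>)"
  by (intro ext) (simp add: lap_def mult_ac)

lemma crefl_diff: "crefl (\<lambda>t \<xi>. f t \<xi> - g t \<xi>) = (\<lambda>t \<xi>. crefl f t \<xi> - crefl g t \<xi>)"
  by (intro ext) (simp add: crefl_def)

lemma crefl_of_real: "crefl (\<lambda>t \<xi>. complex_of_real c * f t \<xi>) = (\<lambda>t \<xi>. complex_of_real c * crefl f t \<xi>)"
  by (intro ext) (simp add: crefl_def)

lemma qdiv_diff:
  fixes C C' B B' :: "real \<Rightarrow> real^'d::finite \<Rightarrow> complex"
  assumes C: "decays T 2 M C" and C': "decays T 2 M' C'" and B: "decays T 1 N B" and B': "decays T 1 N' B'" and T: "0 \<le> T"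
  shows "qdiv T \<kappa> C B t \<xi> - qdiv T \<kappa> C' B' t \<xi> =
    qdiv T \<kappa> (\<lambda>t \<xi>. C t \<xi> - C' t \<xi>) B t \<xi> + qdiv T \<kappa> C' (\<lambda>t \<xi>. B t \<xi> - B' t \<xi>) t \<xi>"
proof -
  note b = decays_le_order[OF B le0] and b' = decays_le_order[OF B' le0]
  note c = decays_lap[OF C] and c' = decays_lap[OF C']
  show ?thesis
    unfolding qdiv_def lap_diff conv_diff_left[OF c c' b T] conv_diff_right[OF c' b b' T]
      duh_diff[OF decays_conv[OF c b T] decays_conv[OF c' b T]] duh_diff[OF decays_conv[OF c' b T] decays_conv[OF c' b' T]]
    by simp
qed

lemma qgrad_diff:
  fixes A A' B B' :: "real \<Rightarrow> real^'d::finite \<Rightarrow> complex"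
  assumes A: "decays T 1 M A" and A': "decays T 1 M' A'" and B: "decays T 1 N B" and B': "decays T 1 N' B'" and T: "0 \<le> T"
  shows "qgrad T \<kappa> A B t \<xi> - qgrad T \<kappa> A' B' t \<xi> =
    qgrad T \<kappa> (\<lambda>t \<xi>. A t \<xi> - A' t \<xi>) B t \<xi> + qgrad T \<kappa> A' (\<lambda>t \<xi>. B t \<xi> - B' t \<xi>) t \<xi>"
proof -
  note b = decays_crefl[OF B] and b' = decays_crefl[OF B']
  show ?thesis
    unfolding qgrad_def crefl_diff conv_diff_left[OF A A' b T] conv_diff_right[OF A' b b' T]
      duh_diff[OF decays_conv[OF A b T] decays_conv[OF A' b T]] duh_diff[OF decays_conv[OF A' b T] decays_conv[OF A' b' T]]
    by simp
qed

lemma qdiv_cmult: "qdiv T \<kappa> (\<lambda>t \<xi>. c * C t \<xi>) (\<lambda>t \<xi>. e * B t \<xi>) t \<xi> = c * e * qdiv T \<kappa> C B t \<xi>"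
  unfolding qdiv_def lap_cmult conv_cmult_left conv_cmult_right duh_cmult by (simp add: mult_ac)

text \<open>A triple holds the three unknowns multiplied by their weights \<open>wgt T 1\<close>, \<open>wgt T 1\<close>, \<open>wgt T 2\<close>, so that
  the supremum norm of bounded continuous functions is the norm needed for the contraction.\<close>

type_synonym 'd triple = "(real \<times> ((real, 'd) vec)) \<Rightarrow>\<^sub>C (complex \<times> complex \<times> complex)"

definition wgt :: "real \<Rightarrow> nat \<Rightarrow> real \<Rightarrow> real^'d::finite \<Rightarrow> real"
  where "wgt T r t \<xi> = (1 + norm \<xi>) ^ r * wt T t \<xi>"

lemma wgt_pos: "0 < wgt T r t \<xi>"
  unfolding wgt_def by (intro mult_pos_pos zero_less_power wt_pos) (simp add: add_pos_nonneg)

lemma continuous_on_wgt [continuous_intros]: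
  "continuous_on S f \<Longrightarrow> continuous_on S g \<Longrightarrow> continuous_on S (\<lambda>x. wgt T r (f x) (g x))"
  unfolding wgt_def by (intro continuous_intros)

definition compA :: "real \<Rightarrow> 'd::finite triple \<Rightarrow> real \<Rightarrow> real^'d \<Rightarrow> complex"
  where "compA T x t \<xi> = fst (apply_bcontfun x (t, \<xi>)) / complex_of_real (wgt T 1 t \<xi>)"

definition compB :: "real \<Rightarrow> 'd::finite triple \<Rightarrow> real \<Rightarrow> real^'d \<Rightarrow> complex"
  where "compB T x t \<xi> = fst (snd (apply_bcontfun x (t, \<xi>))) / complex_of_real (wgt T 1 t \<xi>)"

definition compC :: "real \<Rightarrow> 'd::finite triple \<Rightarrow> real \<Rightarrow> real^'d \<Rightarrow> complex"
  where "compC T x t \<xi> = snd (snd (apply_bcontfun x (t, \<xi>))) / complex_of_real (wgt T 2 t \<xi>)"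

lemma comp_diff:
  "compA T (x - y) = (\<lambda>t \<xi>. compA T x t \<xi> - compA T y t \<xi>)"
  "compB T (x - y) = (\<lambda>t \<xi>. compB T x t \<xi> - compB T y t \<xi>)"
  "compC T (x - y) = (\<lambda>t \<xi>. compC T x t \<xi> - compC T y t \<xi>)"
  by (simp_all add: fun_eq_iff compA_def compB_def compC_def diff_divide_distrib)

lemma comp_inject:
  fixes x y :: "'d::finite triple"
  assumes "compA T x = compA T y" "compB T x = compB T y" "compC T x = compC T y"
  shows "x = y"
proof (rule bcontfun_eqI)
  fix p :: "real \<times> (real^'d)"
  obtain t \<xi> where p: "p = (t, \<xi>)" by force
  have "compA T x t \<xi> = compA T y t \<xi>" "compB T x t \<xi> = compB T y t \<xi>" "compC T x t \<xi> = compC T y t \<xi>"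
    using assms by simp_all
  then show "apply_bcontfun x p = apply_bcontfun y p"
    using wgt_pos[of T 1 t \<xi>] wgt_pos[of T 2 t \<xi>]
    by (simp add: compA_def compB_def compC_def p prod_eq_iff)
qed

lemma decays_div:
  fixes f :: "real \<times> (real^'d::finite) \<Rightarrow> complex"
  assumes "continuous_on UNIV f" "\<And>p. norm (f p) \<le> M"
  shows "decays T r M (\<lambda>t \<xi>. f (t, \<xi>) / complex_of_real (wgt T r t \<xi>))"
  unfolding decays_def
proof (intro conjI allI)
  have "\<forall>p\<in>UNIV. complex_of_real (wgt T r (fst p) (snd p)) \<noteq> 0"
    by (intro ballI) (simp only: of_real_eq_0_iff, rule less_imp_neq[OF wgt_pos, THEN not_sym])
  then show "continuous_on UNIV (\<lambda>p. f (fst p, snd p) / complex_of_real (wgt T r (fst p) (snd p)))"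
    by (intro continuous_on_divide continuous_intros) (simp_all add: assms(1))
  show "norm (f (t, \<xi>) / complex_of_real (wgt T r t \<xi>)) \<le> M / ((1 + norm \<xi>) ^ r * wt T t \<xi>)" for t \<xi>
    using assms(2)[of "(t, \<xi>)"] wgt_pos[of T r t \<xi>]
    by (simp add: norm_divide divide_right_mono wgt_def[symmetric])
qed

lemma norm_fst_snd_le: "norm (fst (snd z)) \<le> norm z"
  and norm_snd_snd_le: "norm (snd (snd z)) \<le> norm z"
proof -
  obtain a b c where z: "z = (a, b, c)" by (cases z)
  have "norm (b, c) \<le> norm z" unfolding z by (rule norm_snd_le)
  moreover have "norm b \<le> norm (b, c)" "norm c \<le> norm (b, c)"
    by (rule norm_fst_le norm_snd_le)+
  ultimately show "norm (fst (snd z)) \<le> norm z" "norm (snd (snd z)) \<le> norm z"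
    unfolding z by auto
qed

lemma decays_comp_triple:
  shows "decays T 1 (norm x) (compA T x)" "decays T 1 (norm x) (compB T x)" "decays T 2 (norm x) (compC T x)"
proof -
  have c: "continuous_on UNIV (apply_bcontfun x)" by simp
  have n: "norm (fst (apply_bcontfun x p)) \<le> norm x" "norm (fst (snd (apply_bcontfun x p))) \<le> norm x"
    "norm (snd (snd (apply_bcontfun x p))) \<le> norm x" for p
  proof -
    have "norm (fst (apply_bcontfun x p)) \<le> norm (apply_bcontfun x p)"
      using norm_fst_le[of "fst (apply_bcontfun x p)" "snd (apply_bcontfun x p)"] by simp
    then show "norm (fst (apply_bcontfun x p)) \<le> norm x"
      by (rule order_trans[OF _ norm_bounded])
    show "norm (fst (snd (apply_bcontfun x p))) \<le> norm x"
      by (rule order_trans[OF norm_fst_snd_le norm_bounded])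
    show "norm (snd (snd (apply_bcontfun x p))) \<le> norm x"
      by (rule order_trans[OF norm_snd_snd_le norm_bounded])
  qed
  show "decays T 1 (norm x) (compA T x)"
    unfolding compA_def by (rule decays_div) (auto intro!: continuous_intros c n)
  show "decays T 1 (norm x) (compB T x)"
    unfolding compB_def by (rule decays_div) (auto intro!: continuous_intros c n)
  show "decays T 2 (norm x) (compC T x)"
    unfolding compC_def by (rule decays_div) (auto intro!: continuous_intros c n)
qed

text \<open>Multiplication by the weights turns decay into boundedness; the norm of a triple is at
  most the sum of the norms of its three entries.\<close>

lemma triple_exists:
  fixes A B C :: "real \<Rightarrow> real^'d::finite \<Rightarrow> complex"
  assumes A: "decays T 1 M A" and B: "decays T 1 M B" and C: "decays T 2 M C"
  shows "\<exists>x :: 'd triple. compA T x = A \<and> compB T x = B \<and> compC T x = C \<and> norm x \<le> 3 * M"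
proof -
  define F where "F p = (complex_of_real (wgt T 1 (fst p) (snd p)) * A (fst p) (snd p),
    complex_of_real (wgt T 1 (fst p) (snd p)) * B (fst p) (snd p),
    complex_of_real (wgt T 2 (fst p) (snd p)) * C (fst p) (snd p))" for p
  have c: "continuous_on UNIV F"
    unfolding F_def by (intro continuous_intros decaysD(1)[OF A] decaysD(1)[OF B] decaysD(1)[OF C])
  have b: "norm (complex_of_real (wgt T r t \<xi>) * f t \<xi>) \<le> M" if "decays T r M f" for r f t and \<xi> :: "real^'d"
    using decaysD(2)[OF that, of t \<xi>, folded wgt_def] wgt_pos[of T r t \<xi>]
    by (simp add: norm_mult pos_le_divide_eq mult.commute)
  have n: "norm (F p) \<le> 3 * M" for p
  proof -
    have "norm (F p) \<le> norm (fst (F p)) + (norm (fst (snd (F p))) + norm (snd (snd (F p))))"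
      using norm_Pair_le[of "fst (F p)" "snd (F p)"] norm_Pair_le[of "fst (snd (F p))" "snd (snd (F p))"] by simp
    also have "\<dots> \<le> M + (M + M)"
      unfolding F_def fst_conv snd_conv by (intro add_mono b A B C)
    finally show ?thesis by simp
  qed
  have F: "F \<in> bcontfun" by (rule bcontfun_normI[OF c n])
  obtain x where x: "F = apply_bcontfun x" using bcontfunE[OF F] by blast
  have "wgt T r t \<xi> \<noteq> 0" for r t and \<xi> :: "real^'d" using wgt_pos[of T r t \<xi>] by simp
  then have "compA T x = A" "compB T x = B" "compC T x = C"
    by (simp_all add: fun_eq_iff compA_def compB_def compC_def x[symmetric] F_def)
  moreover have "norm x \<le> 3 * M"
    by (rule norm_bound) (simp add: x[symmetric] n)
  ultimately show ?thesis by blast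
qed

text \<open>The ansatz \<open>u = U e\<^sub>k\<close>, \<open>v = V e\<^sub>k\<close>, \<open>w = \<nabla>\<psi>\<close> is preserved by the system and reduces it to three
  scalar equations; \<open>A\<close>, \<open>B\<close>, \<open>C\<close> are the Fourier transforms of \<open>U\<close>, \<open>V\<close>, \<open>\<psi>\<close>.\<close>

locale fourier_system =
  fixes T \<alpha> \<beta> \<gamma> D :: real and A0 B0 C0 :: "real^'d::finite \<Rightarrow> complex"
  assumes T: "0 \<le> T"
    and dA: "decays T 1 D (free T \<alpha> A0)" and dB: "decays T 1 D (free T \<beta> B0)" and dC: "decays T 2 D (free T \<gamma> C0)"
begin

definition solves :: "real \<Rightarrow> (real \<Rightarrow> real^'d \<Rightarrow> complex) \<Rightarrow> (real \<Rightarrow> real^'d \<Rightarrow> complex) \<Rightarrow> (real \<Rightarrow> real^'d \<Rightarrow> complex) \<Rightarrow> bool"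
  where "solves \<epsilon> A B C \<longleftrightarrow>
    A = (\<lambda>t \<xi>. complex_of_real \<epsilon> * free T \<alpha> A0 t \<xi> + qdiv T \<alpha> C B t \<xi>) \<and>
    B = (\<lambda>t \<xi>. complex_of_real \<epsilon> * free T \<beta> B0 t \<xi> + qdiv T \<beta> (crefl C) A t \<xi>) \<and>
    C = (\<lambda>t \<xi>. complex_of_real \<epsilon> * free T \<gamma> C0 t \<xi> + qgrad T \<gamma> A B t \<xi>)"

lemma D_nonneg: "0 \<le> D"
  by (rule decays_nonneg[OF dA])

text \<open>A contraction on a ball of radius proportional to \<open>\<epsilon>\<close>. The
  bilinear constant \<open>k\<close> does not depend on \<open>T\<close>, and the bounds offer no
  factor that is small in \<open>T\<close>; the smallness of \<open>\<epsilon>\<close> does all the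
  work.\<close>

lemma small_solution:
  obtains e0 N where "0 < e0" "0 \<le> N"
    "\<And>\<epsilon>. 0 < \<epsilon> \<Longrightarrow> \<epsilon> \<le> e0 \<Longrightarrow> \<exists>A B C. solves \<epsilon> A B C \<and> decays T 1 (N * \<epsilon>) A \<and> decays T 1 (N * \<epsilon>) B \<and> decays T 2 (N * \<epsilon>) C"
proof -
  define k where "k = conv_const TYPE('d)"
  have k: "0 \<le> k" unfolding k_def by (rule conv_const_nonneg)
  \<comment> \<open>The free parts contribute at most \<open>3 * \<epsilon> * D\<close> to the norm
    of a triple; \<open>6 * D\<close> leaves half of the radius to the nonlinearity, and the summand
    1 keeps \<open>N\<close> positive.\<close>
  define N where "N = 6 * D + 1"
  have N: "0 < N" using D_nonneg by (simp add: N_def)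
  \<comment> \<open>Chosen for \<open>12 * k * R \<le> 1\<close> with the radius
    \<open>R = N * \<epsilon>\<close>, which makes the map Lipschitz with constant 1/2 on the
    ball.\<close>
  define e0 where "e0 = 1 / (12 * (k + 1) * N)"
  have e0: "0 < e0" using k N by (simp add: e0_def)
  have main: "\<exists>A B C. solves \<epsilon> A B C \<and> decays T 1 (N * \<epsilon>) A \<and> decays T 1 (N * \<epsilon>) B \<and> decays T 2 (N * \<epsilon>) C"
    if e: "0 < \<epsilon>" "\<epsilon> \<le> e0" for \<epsilon>
  proof -
    define R where "R = N * \<epsilon>"
    have R0: "0 \<le> R" using N e by (simp add: R_def)
    have kR: "12 * k * R \<le> 1"
    proof -
      have "12 * k * R \<le> 12 * (k + 1) * (N * e0)"
        unfolding R_def using k N e by (intro mult_mono) auto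
      also have "\<dots> = 1" using k N by (simp add: e0_def)
      finally show ?thesis .
    qed
    let ?GA = "\<lambda>x. (\<lambda>t \<xi>. complex_of_real \<epsilon> * free T \<alpha> A0 t \<xi> + qdiv T \<alpha> (compC T x) (compB T x) t \<xi>)"
    let ?GB = "\<lambda>x. (\<lambda>t \<xi>. complex_of_real \<epsilon> * free T \<beta> B0 t \<xi> + qdiv T \<beta> (crefl (compC T x)) (compA T x) t \<xi>)"
    let ?GC = "\<lambda>x. (\<lambda>t \<xi>. complex_of_real \<epsilon> * free T \<gamma> C0 t \<xi> + qgrad T \<gamma> (compA T x) (compB T x) t \<xi>)"
    have G: "decays T 1 (\<epsilon> * D + k * norm x * norm x) (?GA x)" "decays T 1 (\<epsilon> * D + k * norm x * norm x) (?GB x)"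
      "decays T 2 (\<epsilon> * D + k * norm x * norm x) (?GC x)" for x
    proof -
      note c = decays_comp_triple[of T x]
      have ne: "norm (complex_of_real \<epsilon>) = \<epsilon>" using e by simp
      show "decays T 1 (\<epsilon> * D + k * norm x * norm x) (?GA x)"
        using decays_add[OF decays_cmult[OF dA, of "complex_of_real \<epsilon>"] decays_qdiv[OF c(3) c(2) T]] by (simp only: ne k_def)
      show "decays T 1 (\<epsilon> * D + k * norm x * norm x) (?GB x)"
        using decays_add[OF decays_cmult[OF dB, of "complex_of_real \<epsilon>"] decays_qdiv[OF decays_crefl[OF c(3)] c(1) T]] by (simp only: ne k_def)
      show "decays T 2 (\<epsilon> * D + k * norm x * norm x) (?GC x)"
        using decays_add[OF decays_cmult[OF dC, of "complex_of_real \<epsilon>"] decays_qgrad[OF c(1) c(2) T]] by (simp only: ne k_def)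
    qed
    let ?P = "\<lambda>x (y :: 'd triple). compA T y = ?GA x \<and> compB T y = ?GB x \<and> compC T y = ?GC x \<and>
        norm y \<le> 3 * (\<epsilon> * D + k * norm x * norm x)"
    have "\<forall>x. \<exists>y. ?P x y"
      by (intro allI triple_exists[OF G])
    from choice[OF this] obtain \<Gamma> :: "'d triple \<Rightarrow> 'd triple" where "\<forall>x. ?P x (\<Gamma> x)" ..
    then have \<Gamma>: "compA T (\<Gamma> x) = ?GA x" "compB T (\<Gamma> x) = ?GB x" "compC T (\<Gamma> x) = ?GC x"
      "norm (\<Gamma> x) \<le> 3 * (\<epsilon> * D + k * norm x * norm x)" for x
      by simp_all
    have lip: "norm (\<Gamma> x - \<Gamma> y) \<le> 3 * (k * norm (x - y) * (norm x + norm y))" for x y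
    proof -
      note x = decays_comp_triple[of T x] and y = decays_comp_triple[of T y]
      note d = decays_comp_triple[of T "x - y", unfolded comp_diff]
      let ?M = "k * norm (x - y) * norm x + k * norm y * norm (x - y)"
      have M: "?M = k * norm (x - y) * (norm x + norm y)" by (simp add: algebra_simps)
      have a: "compA T (\<Gamma> x - \<Gamma> y) = (\<lambda>t \<xi>. qdiv T \<alpha> (\<lambda>t \<xi>. compC T x t \<xi> - compC T y t \<xi>) (compB T x) t \<xi> +
          qdiv T \<alpha> (compC T y) (\<lambda>t \<xi>. compB T x t \<xi> - compB T y t \<xi>) t \<xi>)"
        unfolding comp_diff \<Gamma> by (intro ext) (simp add: qdiv_diff[OF x(3) y(3) x(2) y(2) T, symmetric])
      have b: "compB T (\<Gamma> x - \<Gamma> y) = (\<lambda>t \<xi>. qdiv T \<beta> (crefl (\<lambda>t \<xi>. compC T x t \<xi> - compC T y t \<xi>)) (compA T x) t \<xi> +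
          qdiv T \<beta> (crefl (compC T y)) (\<lambda>t \<xi>. compA T x t \<xi> - compA T y t \<xi>) t \<xi>)"
        unfolding comp_diff \<Gamma> crefl_diff
        by (intro ext) (simp add: qdiv_diff[OF decays_crefl[OF x(3)] decays_crefl[OF y(3)] x(1) y(1) T, symmetric])
      have c: "compC T (\<Gamma> x - \<Gamma> y) = (\<lambda>t \<xi>. qgrad T \<gamma> (\<lambda>t \<xi>. compA T x t \<xi> - compA T y t \<xi>) (compB T x) t \<xi> +
          qgrad T \<gamma> (compA T y) (\<lambda>t \<xi>. compB T x t \<xi> - compB T y t \<xi>) t \<xi>)"
        unfolding comp_diff \<Gamma> by (intro ext) (simp add: qgrad_diff[OF x(1) y(1) x(2) y(2) T, symmetric])
      have "decays T 1 ?M (compA T (\<Gamma> x - \<Gamma> y))"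
        unfolding a k_def by (rule decays_add[OF decays_qdiv[OF d(3) x(2) T] decays_qdiv[OF y(3) d(2) T]])
      moreover have "decays T 1 ?M (compB T (\<Gamma> x - \<Gamma> y))"
        unfolding b k_def
        by (rule decays_add[OF decays_qdiv[OF decays_crefl[OF d(3)] x(1) T] decays_qdiv[OF decays_crefl[OF y(3)] d(1) T]])
      moreover have "decays T 2 ?M (compC T (\<Gamma> x - \<Gamma> y))"
        unfolding c k_def by (rule decays_add[OF decays_qgrad[OF d(1) x(2) T] decays_qgrad[OF y(1) d(2) T]])
      \<comment> \<open>Decay of the components bounds the norm of the triple rebuilt from them; by
        injectivity of the components this triple is the difference itself.\<close>
      ultimately obtain z :: "'d triple" where z: "compA T z = compA T (\<Gamma> x - \<Gamma> y)" "compB T z = compB T (\<Gamma> x - \<Gamma> y)"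
        "compC T z = compC T (\<Gamma> x - \<Gamma> y)" "norm z \<le> 3 * ?M"
        using triple_exists by blast
      then have "\<Gamma> x - \<Gamma> y = z" using comp_inject[of T z "\<Gamma> x - \<Gamma> y"] by simp
      with z(4) show ?thesis unfolding M by simp
    qed
    have "\<exists>!x\<in>cball 0 R. \<Gamma> x = x"
    proof (rule Banach_fix[OF complete_eq_closed[THEN iffD2, OF closed_cball]])
      show "cball (0 :: 'd triple) R \<noteq> {}" using R0 by simp
      show "\<Gamma> ` cball 0 R \<subseteq> cball 0 R"
      proof safe
        fix x :: "'d triple" assume "x \<in> cball 0 R"
        then have x: "norm x \<le> R" by simp
        have "norm (\<Gamma> x) \<le> 3 * (\<epsilon> * D + k * norm x * norm x)" by (rule \<Gamma>(4))
        also have "\<dots> \<le> 3 * (\<epsilon> * D + k * R * R)"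
          using x k R0 by (intro mult_left_mono add_left_mono mult_mono) auto
        also have "\<dots> \<le> R"
        proof -
          have "12 * k * R * R \<le> 1 * R" using kR R0 by (intro mult_right_mono)
          moreover have "6 * (\<epsilon> * D) \<le> R"
            unfolding R_def N_def using e by (simp add: algebra_simps)
          ultimately show ?thesis using R0 by simp
        qed
        finally show "\<Gamma> x \<in> cball 0 R" by simp
      qed
      fix x y :: "'d triple" assume "x \<in> cball 0 R" "y \<in> cball 0 R"
      then have xy: "norm x \<le> R" "norm y \<le> R" by simp_all
      have "norm (\<Gamma> x - \<Gamma> y) \<le> 3 * (k * norm (x - y) * (norm x + norm y))" by (rule lip)
      also have "\<dots> \<le> 3 * (k * norm (x - y) * (R + R))"
        using xy k by (intro mult_left_mono add_mono) auto
      also have "\<dots> = (6 * (k * R)) * norm (x - y)" by simp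
      also have "\<dots> \<le> (1 / 2) * norm (x - y)" using kR by (intro mult_right_mono) auto
      finally show "dist (\<Gamma> x) (\<Gamma> y) \<le> (1 / 2) * dist x y" by (simp add: dist_norm)
    qed auto
    then obtain x where x: "norm x \<le> R" "\<Gamma> x = x" by auto
    note c = decays_comp_triple[of T x, THEN decays_mono, OF x(1)]
    have "solves \<epsilon> (compA T x) (compB T x) (compC T x)"
      unfolding solves_def using \<Gamma>(1-3)[of x] unfolding x(2) by blast
    then show ?thesis using c unfolding R_def by blast
  qed
  show ?thesis by (rule that[OF e0 less_imp_le[OF N] main])
qed

text \<open>In each Duhamel term the factors are replaced one at a time by \<open>\<epsilon>\<close>
  times free evolutions. The error in a factor is itself a Duhamel term, of size
  \<open>\<epsilon>\<^sup>2\<close>, and it meets a factor of size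
  \<open>\<epsilon>\<close>.\<close>

lemma second_order:
  assumes s: "solves \<epsilon> A B C" and e: "0 < \<epsilon>"
    and A: "decays T 1 (N * \<epsilon>) A" and B: "decays T 1 (N * \<epsilon>) B" and C: "decays T 2 (N * \<epsilon>) C" and N: "0 \<le> N"
  shows "decays T 1 (conv_const TYPE('d) * conv_const TYPE('d) * (N + D) ^ 3 * \<epsilon> ^ 3)
      (\<lambda>t \<xi>. A t \<xi> - complex_of_real \<epsilon> * free T \<alpha> A0 t \<xi> - complex_of_real (\<epsilon>\<^sup>2) * qdiv T \<alpha> (free T \<gamma> C0) (free T \<beta> B0) t \<xi>)"
    and "decays T 1 (conv_const TYPE('d) * conv_const TYPE('d) * (N + D) ^ 3 * \<epsilon> ^ 3)
      (\<lambda>t \<xi>. B t \<xi> - complex_of_real \<epsilon> * free T \<beta> B0 t \<xi> - complex_of_real (\<epsilon>\<^sup>2) * qdiv T \<beta> (crefl (free T \<gamma> C0)) (free T \<alpha> A0) t \<xi>)"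
proof -
  let ?e = "complex_of_real \<epsilon>"
  define k where "k = conv_const TYPE('d)"
  have k: "0 \<le> k" unfolding k_def by (rule conv_const_nonneg)
  have eqs: "A = (\<lambda>t \<xi>. ?e * free T \<alpha> A0 t \<xi> + qdiv T \<alpha> C B t \<xi>)"
    "B = (\<lambda>t \<xi>. ?e * free T \<beta> B0 t \<xi> + qdiv T \<beta> (crefl C) A t \<xi>)"
    "C = (\<lambda>t \<xi>. ?e * free T \<gamma> C0 t \<xi> + qgrad T \<gamma> A B t \<xi>)"
    using s unfolding solves_def by blast+
  have ne: "norm ?e = \<epsilon>" using e by simp
  let ?M = "k * (N * \<epsilon>) * (N * \<epsilon>)"
  note fA = decays_cmult[OF dA, of ?e, unfolded ne] and fB = decays_cmult[OF dB, of ?e, unfolded ne]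
    and fC = decays_cmult[OF dC, of ?e, unfolded ne]
  have rA: "decays T 1 ?M (\<lambda>t \<xi>. A t \<xi> - ?e * free T \<alpha> A0 t \<xi>)"
  proof -
    have "(\<lambda>t \<xi>. A t \<xi> - ?e * free T \<alpha> A0 t \<xi>) = qdiv T \<alpha> C B"
      by (subst eqs(1)) (simp add: fun_eq_iff)
    then show ?thesis using decays_qdiv[OF C B T] by (simp add: k_def)
  qed
  have rB: "decays T 1 ?M (\<lambda>t \<xi>. B t \<xi> - ?e * free T \<beta> B0 t \<xi>)"
  proof -
    have "(\<lambda>t \<xi>. B t \<xi> - ?e * free T \<beta> B0 t \<xi>) = qdiv T \<beta> (crefl C) A"
      by (subst eqs(2)) (simp add: fun_eq_iff)
    then show ?thesis using decays_qdiv[OF decays_crefl[OF C] A T] by (simp add: k_def)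
  qed
  have rC: "decays T 2 ?M (\<lambda>t \<xi>. C t \<xi> - ?e * free T \<gamma> C0 t \<xi>)"
  proof -
    have "(\<lambda>t \<xi>. C t \<xi> - ?e * free T \<gamma> C0 t \<xi>) = qgrad T \<gamma> A B"
      by (subst eqs(3)) (simp add: fun_eq_iff)
    then show ?thesis using decays_qgrad[OF A B T] by (simp add: k_def)
  qed
  have bound: "k * ?M * (N * \<epsilon>) + k * (\<epsilon> * D) * ?M \<le> k * k * (N + D) ^ 3 * \<epsilon> ^ 3"
  proof -
    have "k * ?M * (N * \<epsilon>) + k * (\<epsilon> * D) * ?M = k * k * (N ^ 2 * (N + D)) * \<epsilon> ^ 3"
      by (simp add: power2_eq_square power3_eq_cube algebra_simps)
    also have "\<dots> \<le> k * k * ((N + D) ^ 2 * (N + D)) * \<epsilon> ^ 3"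
      using k N D_nonneg e by (intro mult_right_mono mult_left_mono power_mono) auto
    also have "\<dots> = k * k * (N + D) ^ 3 * \<epsilon> ^ 3"
      by (simp add: power2_eq_square power3_eq_cube)
    finally show ?thesis .
  qed
  have e2: "complex_of_real (\<epsilon>\<^sup>2) = ?e * ?e" by (simp add: power2_eq_square)
  have "(\<lambda>t \<xi>. A t \<xi> - ?e * free T \<alpha> A0 t \<xi> - complex_of_real (\<epsilon>\<^sup>2) * qdiv T \<alpha> (free T \<gamma> C0) (free T \<beta> B0) t \<xi>)
    = (\<lambda>t \<xi>. qdiv T \<alpha> C B t \<xi> - qdiv T \<alpha> (\<lambda>t \<xi>. ?e * free T \<gamma> C0 t \<xi>) (\<lambda>t \<xi>. ?e * free T \<beta> B0 t \<xi>) t \<xi>)"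
    by (subst eqs(1)) (simp add: fun_eq_iff qdiv_cmult power2_eq_square)
  also have "\<dots> = (\<lambda>t \<xi>. qdiv T \<alpha> (\<lambda>t \<xi>. C t \<xi> - ?e * free T \<gamma> C0 t \<xi>) B t \<xi> +
      qdiv T \<alpha> (\<lambda>t \<xi>. ?e * free T \<gamma> C0 t \<xi>) (\<lambda>t \<xi>. B t \<xi> - ?e * free T \<beta> B0 t \<xi>) t \<xi>)"
    by (intro ext qdiv_diff[OF C fC B fB T])
  finally have eqA: "(\<lambda>t \<xi>. A t \<xi> - ?e * free T \<alpha> A0 t \<xi> - complex_of_real (\<epsilon>\<^sup>2) * qdiv T \<alpha> (free T \<gamma> C0) (free T \<beta> B0) t \<xi>) = \<dots>" .
  show "decays T 1 (conv_const TYPE('d) * conv_const TYPE('d) * (N + D) ^ 3 * \<epsilon> ^ 3)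
      (\<lambda>t \<xi>. A t \<xi> - ?e * free T \<alpha> A0 t \<xi> - complex_of_real (\<epsilon>\<^sup>2) * qdiv T \<alpha> (free T \<gamma> C0) (free T \<beta> B0) t \<xi>)"
    unfolding eqA k_def[symmetric]
    by (rule decays_mono[OF decays_add[OF decays_qdiv[OF rC B T] decays_qdiv[OF fC rB T]], folded k_def, OF bound])
  have cr: "crefl (\<lambda>t \<xi>. ?e * free T \<gamma> C0 t \<xi>) = (\<lambda>t \<xi>. ?e * crefl (free T \<gamma> C0) t \<xi>)"
    by (rule crefl_of_real)
  have "(\<lambda>t \<xi>. B t \<xi> - ?e * free T \<beta> B0 t \<xi> - complex_of_real (\<epsilon>\<^sup>2) * qdiv T \<beta> (crefl (free T \<gamma> C0)) (free T \<alpha> A0) t \<xi>)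
    = (\<lambda>t \<xi>. qdiv T \<beta> (crefl C) A t \<xi> - qdiv T \<beta> (crefl (\<lambda>t \<xi>. ?e * free T \<gamma> C0 t \<xi>)) (\<lambda>t \<xi>. ?e * free T \<alpha> A0 t \<xi>) t \<xi>)"
    unfolding cr by (subst eqs(2)) (simp add: fun_eq_iff qdiv_cmult power2_eq_square)
  also have "\<dots> = (\<lambda>t \<xi>. qdiv T \<beta> (crefl (\<lambda>t \<xi>. C t \<xi> - ?e * free T \<gamma> C0 t \<xi>)) A t \<xi> +
      qdiv T \<beta> (crefl (\<lambda>t \<xi>. ?e * free T \<gamma> C0 t \<xi>)) (\<lambda>t \<xi>. A t \<xi> - ?e * free T \<alpha> A0 t \<xi>) t \<xi>)"
    unfolding crefl_diff by (intro ext qdiv_diff[OF decays_crefl[OF C] decays_crefl[OF fC] A fA T])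
  finally have eqB: "(\<lambda>t \<xi>. B t \<xi> - ?e * free T \<beta> B0 t \<xi> - complex_of_real (\<epsilon>\<^sup>2) * qdiv T \<beta> (crefl (free T \<gamma> C0)) (free T \<alpha> A0) t \<xi>) = \<dots>" .
  show "decays T 1 (conv_const TYPE('d) * conv_const TYPE('d) * (N + D) ^ 3 * \<epsilon> ^ 3)
      (\<lambda>t \<xi>. B t \<xi> - ?e * free T \<beta> B0 t \<xi> - complex_of_real (\<epsilon>\<^sup>2) * qdiv T \<beta> (crefl (free T \<gamma> C0)) (free T \<alpha> A0) t \<xi>)"
    unfolding eqB k_def[symmetric]
    by (rule decays_mono[OF decays_add[OF decays_qdiv[OF decays_crefl[OF rC] A T] decays_qdiv[OF decays_crefl[OF fC] rA T]],
        folded k_def, OF bound])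
qed

end


section \<open>From the Fourier side to smooth solutions\<close>

lemma has_vector_derivativeI_quotient:
  assumes "((\<lambda>t. (g t - g a) /\<^sub>R (t - a)) \<longlongrightarrow> d) (at a within S)"
  shows "(g has_vector_derivative d) (at a within S)"
  unfolding has_vector_derivative_def has_derivative_iff_norm
proof (intro conjI bounded_linear_scaleR_left)
  have "((\<lambda>y. norm ((g y - g a) /\<^sub>R (y - a) - d)) \<longlongrightarrow> 0) (at a within S)"
    by (rule tendsto_norm_zero[OF LIM_zero[OF assms]])
  moreover have "eventually (\<lambda>y. norm ((g y - g a) /\<^sub>R (y - a) - d)
      = norm (g y - g a - (y - a) *\<^sub>R d) / norm (y - a)) (at a within S)"
    unfolding eventually_at_filter
  proof (intro always_eventually allI impI)
    fix y assume "y \<noteq> a"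
    then have "(g y - g a) /\<^sub>R (y - a) - d = (g y - g a - (y - a) *\<^sub>R d) /\<^sub>R (y - a)"
      by (simp only: scaleR_diff_right scaleR_scaleR) simp
    then show "norm ((g y - g a) /\<^sub>R (y - a) - d) = norm (g y - g a - (y - a) *\<^sub>R d) / norm (y - a)"
      by (simp only: norm_scaleR) (simp add: divide_inverse mult.commute abs_inverse)
  qed
  ultimately show "((\<lambda>y. norm (g y - g a - (y - a) *\<^sub>R d) / norm (y - a)) \<longlongrightarrow> 0) (at a within S)"
    by (rule Lim_transform_eventually)
qed

text \<open>At every time the rate is at least 1, and an exponential of rate 1 beats the power
  \<open>n\<close> at the cost of \<open>fact n\<close>; \<open>decay_weight\<close> is kept as an
  integrable majorant.\<close>

lemma decays_power_bound:
  fixes f :: "real \<Rightarrow> real^'d::finite \<Rightarrow> complex"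
  assumes f: "decays T r M f" and T: "0 \<le> T"
  shows "(1 + norm \<xi>) ^ n * norm (f t \<xi>) \<le> fact n * M / decay_weight \<xi>"
proof -
  have M: "0 \<le> M" by (rule decays_nonneg[OF f])
  have "1 * (1 + norm \<xi>) \<le> (1 + T - clampT T t) * (1 + norm \<xi>)"
    using clampT_bounds[OF T, of t] by (intro mult_right_mono) auto
  then have w: "exp (1 + norm \<xi>) * decay_weight \<xi> \<le> wt T t \<xi>"
    unfolding wt_def by (intro mult_right_mono less_imp_le[OF decay_weight_pos]) simp
  have "norm (f t \<xi>) \<le> M / wt T t \<xi>"
    using decaysD(2)[OF decays_le_order[OF f, of 0]] by simp
  also have "\<dots> \<le> M / (exp (1 + norm \<xi>) * decay_weight \<xi>)"
    using w M wt_pos[of T t \<xi>] decay_weight_pos[of \<xi>] by (intro divide_left_mono mult_pos_pos) auto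
  finally have "(1 + norm \<xi>) ^ n * norm (f t \<xi>) \<le> (fact n * exp (1 + norm \<xi>)) * (M / (exp (1 + norm \<xi>) * decay_weight \<xi>))"
    by (intro mult_mono one_plus_power_le_exp) auto
  then show ?thesis by simp
qed

text \<open>Dominated convergence for the difference quotients in time; the mean value inequality
  turns the bound on \<open>g\<close> into a majorant for them.\<close>

lemma has_vector_derivative_ift:
  fixes f g :: "real \<Rightarrow> real^'d::finite \<Rightarrow> complex"
  assumes der: "\<And>t \<xi>. t \<in> {0..T} \<Longrightarrow> ((\<lambda>\<tau>. f \<tau> \<xi>) has_vector_derivative g t \<xi>) (at t within {0..T})"
    and bound: "\<And>t \<xi>. norm (g t \<xi>) \<le> K / decay_weight \<xi>"
    and rf: "\<And>t. rapid (f t)" and rg: "\<And>t. rapid (g t)" and t: "t \<in> {0..T}"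
  shows "((\<lambda>\<tau>. ift (f \<tau>) x) has_vector_derivative ift (g t) x) (at t within {0..T})"
proof (rule has_vector_derivativeI_quotient)
  show "((\<lambda>\<tau>. (ift (f \<tau>) x - ift (f t) x) /\<^sub>R (\<tau> - t)) \<longlongrightarrow> ift (g t) x) (at t within {0..T})"
    unfolding tendsto_at_iff_sequentially o_def
  proof (intro allI impI)
    fix X assume X: "\<forall>i. X i \<in> {0..T} - {t}" "X \<longlonglongrightarrow> t"
    have "(\<lambda>n. LINT \<xi>|lborel. cis (x \<bullet> \<xi>) * ((f (X n) \<xi> - f t \<xi>) /\<^sub>R (X n - t))) \<longlonglongrightarrow> (LINT \<xi>|lborel. cis (x \<bullet> \<xi>) * g t \<xi>)"
    proof (rule integral_dominated_convergence)
      show "integrable lborel (\<lambda>\<xi>::real^'d. K * (1 / decay_weight \<xi>))"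
        by (intro integrable_mult_right integrable_inverse_decay_weight)
      show "(\<lambda>\<xi>. cis (x \<bullet> \<xi>) * g t \<xi>) \<in> borel_measurable lborel"
        by (intro continuous_imp_lborel_measurable continuous_intros rapid_continuous rg)
      show "(\<lambda>\<xi>. cis (x \<bullet> \<xi>) * ((f (X n) \<xi> - f t \<xi>) /\<^sub>R (X n - t))) \<in> borel_measurable lborel" for n
        by (intro continuous_imp_lborel_measurable continuous_intros rapid_continuous rf)
      show "AE \<xi> in lborel. (\<lambda>n. cis (x \<bullet> \<xi>) * ((f (X n) \<xi> - f t \<xi>) /\<^sub>R (X n - t))) \<longlonglongrightarrow> cis (x \<bullet> \<xi>) * g t \<xi>"
      proof (intro AE_I2 tendsto_mult tendsto_const)
        fix \<xi> :: "real^'d"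
        show "(\<lambda>n. (f (X n) \<xi> - f t \<xi>) /\<^sub>R (X n - t)) \<longlonglongrightarrow> g t \<xi>"
          using has_vector_derivative_quotient[OF der[OF t, of \<xi>]] X
          unfolding tendsto_at_iff_sequentially o_def by blast
      qed
      show "AE \<xi> in lborel. norm (cis (x \<bullet> \<xi>) * ((f (X n) \<xi> - f t \<xi>) /\<^sub>R (X n - t))) \<le> K * (1 / decay_weight \<xi>)" for n
      proof (rule AE_I2)
        fix \<xi> :: "real^'d"
        have Xn: "X n \<in> {0..T}" "X n \<noteq> t" using X(1) by auto
        have "norm (f (X n) \<xi> - f t \<xi>) \<le> (K / decay_weight \<xi>) * norm (X n - t)"
        proof (rule differentiable_bound[OF convex_real_interval(5) _ _ Xn(1) t])
          fix s assume s: "s \<in> {0..T}"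
          show "((\<lambda>\<tau>. f \<tau> \<xi>) has_derivative (\<lambda>h. h *\<^sub>R g s \<xi>)) (at s within {0..T})"
            using der[OF s] by (simp add: has_vector_derivative_def)
          have "norm (h *\<^sub>R g s \<xi>) \<le> (K / decay_weight \<xi>) * norm h" for h :: real
            unfolding norm_scaleR real_norm_def mult.commute[of "\<bar>h\<bar>"]
            by (intro mult_right_mono bound) auto
          then show "onorm (\<lambda>h. h *\<^sub>R g s \<xi>) \<le> K / decay_weight \<xi>"
            using order_trans[OF norm_ge_zero bound[of s \<xi>]] by (intro onorm_bound) auto
        qed
        then show "norm (cis (x \<bullet> \<xi>) * ((f (X n) \<xi> - f t \<xi>) /\<^sub>R (X n - t))) \<le> K * (1 / decay_weight \<xi>)"
          using Xn(2) by (simp add: norm_mult divide_inverse[symmetric] mult.commute[of "inverse _"] pos_divide_le_eq)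
      qed
    qed
    moreover have "(LINT \<xi>|lborel. cis (x \<bullet> \<xi>) * ((f (X n) \<xi> - f t \<xi>) /\<^sub>R (X n - t))) = (ift (f (X n)) x - ift (f t) x) /\<^sub>R (X n - t)" for n
    proof -
      have "ift (f (X n)) x - ift (f t) x = ift (\<lambda>\<xi>. f (X n) \<xi> - f t \<xi>) x"
        by (rule ift_diff[OF rapid_integrable[OF rf] rapid_integrable[OF rf], symmetric])
      then have "(ift (f (X n)) x - ift (f t) x) /\<^sub>R (X n - t) = complex_of_real (inverse (X n - t)) * ift (\<lambda>\<xi>. f (X n) \<xi> - f t \<xi>) x"
        by (simp only: scaleR_conv_of_real)
      also have "\<dots> = ift (\<lambda>\<xi>. complex_of_real (inverse (X n - t)) * (f (X n) \<xi> - f t \<xi>)) x"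
        by (rule ift_cmult[symmetric])
      finally show ?thesis by (simp only: ift_def scaleR_conv_of_real)
    qed
    ultimately have "(\<lambda>n. (ift (f (X n)) x - ift (f t) x) /\<^sub>R (X n - t)) \<longlonglongrightarrow> (LINT \<xi>|lborel. cis (x \<bullet> \<xi>) * g t \<xi>)"
      by (simp only:)
    then show "(\<lambda>n. (ift (f (X n)) x - ift (f t) x) /\<^sub>R (X n - t)) \<longlonglongrightarrow> ift (g t) x"
      by (simp only: ift_def[of "g t"])
  qed
qed

lemma duh_zero: "0 \<le> T \<Longrightarrow> duh T \<kappa> f 0 \<xi> = 0"
  by (simp add: duh_def clampT_id)

lemma free_zero: "0 \<le> T \<Longrightarrow> free T \<kappa> A 0 \<xi> = A \<xi>"
  by (simp add: free_def clampT_id)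

text \<open>On \<open>[0,T]\<close> clamping has no effect, and \<open>F\<close> is an oscillating
  factor times a constant plus an integral with continuous integrand. In the product rule the
  oscillations in front of \<open>N\<close> cancel.\<close>

lemma duhamel_derivative:
  fixes N :: "real \<Rightarrow> real^'d::finite \<Rightarrow> complex"
  assumes N: "decays T r M N" and F: "F = (\<lambda>t \<xi>. c * free T \<kappa> F0 t \<xi> + duh T \<kappa> N t \<xi>)"
    and t: "t \<in> {0..T}"
  shows "((\<lambda>\<tau>. F \<tau> \<xi>) has_vector_derivative (- \<i> * (\<kappa> * lap F t \<xi>) - \<i> * N t \<xi>)) (at t within {0..T})"
proof -
  let ?q = "\<kappa> * (norm \<xi>)\<^sup>2"
  let ?I = "\<lambda>t. integral {0..t} (\<lambda>s. cis (\<kappa> * s * (norm \<xi>)\<^sup>2) * N s \<xi>)"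
  have eq: "F \<tau> \<xi> = cis (\<tau> * - ?q) * (c * F0 \<xi> - \<i> * ?I \<tau>)" if "\<tau> \<in> {0..T}" for \<tau>
    unfolding F free_def duh_def clampT_id[OF that] by (simp add: algebra_simps)
  have c: "continuous_on {0..T} (\<lambda>s. cis (\<kappa> * s * (norm \<xi>)\<^sup>2) * N s \<xi>)"
    by (intro continuous_on_mult decays_comp[OF N] continuous_intros)
  have dI: "(?I has_vector_derivative cis (\<kappa> * t * (norm \<xi>)\<^sup>2) * N t \<xi>) (at t within {0..T})"
    by (rule integral_has_vector_derivative[OF c t])
  have dc: "((\<lambda>\<tau>. cis (\<tau> * - ?q)) has_vector_derivative (- ?q) *\<^sub>R (\<i> * cis (t * - ?q))) (at t within {0..T})"
    by (rule has_vector_derivative_cis_mult)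
  have di: "((\<lambda>\<tau>. c * F0 \<xi> - \<i> * ?I \<tau>) has_vector_derivative (0 - \<i> * (cis (\<kappa> * t * (norm \<xi>)\<^sup>2) * N t \<xi>))) (at t within {0..T})"
    by (intro has_vector_derivative_diff has_vector_derivative_const has_vector_derivative_mult_right dI)
  have "((\<lambda>\<tau>. cis (\<tau> * - ?q) * (c * F0 \<xi> - \<i> * ?I \<tau>)) has_vector_derivative
    (cis (t * - ?q) * (0 - \<i> * (cis (\<kappa> * t * (norm \<xi>)\<^sup>2) * N t \<xi>)) +
     (- ?q) *\<^sub>R (\<i> * cis (t * - ?q)) * (c * F0 \<xi> - \<i> * ?I t))) (at t within {0..T})"
    by (rule has_vector_derivative_mult[OF dc di])
  moreover have "cis (t * - ?q) * (0 - \<i> * (cis (\<kappa> * t * (norm \<xi>)\<^sup>2) * N t \<xi>)) +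
     (- ?q) *\<^sub>R (\<i> * cis (t * - ?q)) * (c * F0 \<xi> - \<i> * ?I t) = - \<i> * (\<kappa> * lap F t \<xi>) - \<i> * N t \<xi>"
  proof -
    have "cis (t * - ?q) * cis (\<kappa> * t * (norm \<xi>)\<^sup>2) = 1"
      by (simp add: cis_mult mult_ac)
    then have "cis (t * - ?q) * (\<i> * (cis (\<kappa> * t * (norm \<xi>)\<^sup>2) * N t \<xi>)) = \<i> * N t \<xi>"
      by (metis (no_types, lifting) mult.assoc mult.left_commute mult_1)
    moreover have "(- ?q) *\<^sub>R (\<i> * cis (t * - ?q)) * (c * F0 \<xi> - \<i> * ?I t) = - \<i> * (\<kappa> * lap F t \<xi>)"
      unfolding lap_def eq[OF t] scaleR_conv_of_real by (simp add: mult_ac)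
    ultimately show ?thesis by (simp add: algebra_simps)
  qed
  ultimately have "((\<lambda>\<tau>. cis (\<tau> * - ?q) * (c * F0 \<xi> - \<i> * ?I \<tau>)) has_vector_derivative (- \<i> * (\<kappa> * lap F t \<xi>) - \<i> * N t \<xi>)) (at t within {0..T})"
    by simp
  then show ?thesis
    by (rule has_vector_derivative_transform[OF t, rotated]) (simp add: eq)
qed

text \<open>Fubini and the splitting \<xi> = \<eta> + (\<xi> - \<eta>) in the exponential. There is
  no constant because \<open>ift\<close> carries none.\<close>

lemma ift_conv:
  fixes f g :: "real \<Rightarrow> real^'d::finite \<Rightarrow> complex"
  assumes f: "rapid (f t)" and g: "rapid (g t)"
  shows "ift (conv f g t) x = ift (f t) x * ift (g t) x"
proof -
  have [measurable]: "f t \<in> borel_measurable borel" "g t \<in> borel_measurable borel"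
    by (rule rapid_measurable[OF f], rule rapid_measurable[OF g])
  have cm: "(\<lambda>p::(real^'d) \<times> (real^'d). cis (x \<bullet> snd p)) \<in> borel_measurable (lborel \<Otimes>\<^sub>M lborel)"
    unfolding lborel_prod by (intro continuous_imp_lborel_measurable continuous_intros)
  have ig: "integrable lborel (\<lambda>\<xi>. g t (\<xi> - \<eta>))" for \<eta>
    using integrable_scale[OF rapid_integrable[OF g], of 1 "- \<eta>"] by simp
  have ng: "(LINT \<xi>|lborel. norm (g t (\<xi> - \<eta>))) = (LINT \<xi>|lborel. norm (g t \<xi>))" for \<eta>
    using integral_translation[of "\<lambda>\<xi>. norm (g t \<xi>)" "- \<eta>"] by simp
  have int: "integrable (lborel \<Otimes>\<^sub>M lborel) (\<lambda>p. cis (x \<bullet> snd p) * (f t (fst p) * g t (snd p - fst p)))"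
  proof (rule lborel_pair.Fubini_integrable)
    show "(\<lambda>p. cis (x \<bullet> snd p) * (f t (fst p) * g t (snd p - fst p))) \<in> borel_measurable (lborel \<Otimes>\<^sub>M lborel)"
      using cm by measurable
    show "integrable lborel (\<lambda>\<eta>. LINT \<xi>|lborel. norm (cis (x \<bullet> snd (\<eta>, \<xi>)) * (f t (fst (\<eta>, \<xi>)) * g t (snd (\<eta>, \<xi>) - fst (\<eta>, \<xi>)))))"
      using integrable_mult_left[OF integrable_norm[OF rapid_integrable[OF f]]]
      by (simp add: norm_mult ng)
    show "AE \<eta> in lborel. integrable lborel (\<lambda>\<xi>. cis (x \<bullet> snd (\<eta>, \<xi>)) * (f t (fst (\<eta>, \<xi>)) * g t (snd (\<eta>, \<xi>) - fst (\<eta>, \<xi>))))"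
      unfolding fst_conv snd_conv
      by (intro AE_I2 integrable_cis_mult integrable_mult_right ig)
  qed
  have "ift (conv f g t) x = (LINT \<xi>|lborel. LINT \<eta>|lborel. cis (x \<bullet> \<xi>) * (f t \<eta> * g t (\<xi> - \<eta>)))"
    unfolding ift_def conv_def integral_mult_right_zero ..
  also have "\<dots> = (LINT \<eta>|lborel. LINT \<xi>|lborel. cis (x \<bullet> \<xi>) * (f t \<eta> * g t (\<xi> - \<eta>)))"
    using int by (intro lborel_pair.Fubini_integral) (simp add: case_prod_unfold)
  also have "\<dots> = (LINT \<eta>|lborel. cis (x \<bullet> \<eta>) * f t \<eta> * ift (g t) x)"
  proof (intro Bochner_Integration.integral_cong refl)
    fix \<eta> :: "real^'d"
    have m: "(\<lambda>\<xi>. cis (x \<bullet> \<xi>) * g t \<xi>) \<in> borel_measurable borel"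
      by (intro borel_measurable_continuous_onI continuous_intros rapid_continuous g)
    have "(LINT \<xi>|lborel. cis (x \<bullet> \<xi>) * (f t \<eta> * g t (\<xi> - \<eta>)))
      = (LINT \<xi>|lborel. cis (x \<bullet> \<eta>) * f t \<eta> * (cis (x \<bullet> (- \<eta> + \<xi>)) * g t (- \<eta> + \<xi>)))"
    proof (intro Bochner_Integration.integral_cong refl)
      fix \<xi> :: "real^'d"
      have "cis (x \<bullet> \<xi>) = cis (x \<bullet> \<eta>) * cis (x \<bullet> (- \<eta> + \<xi>))"
        by (simp add: cis_mult inner_add_right inner_diff_right)
      then show "cis (x \<bullet> \<xi>) * (f t \<eta> * g t (\<xi> - \<eta>)) = cis (x \<bullet> \<eta>) * f t \<eta> * (cis (x \<bullet> (- \<eta> + \<xi>)) * g t (- \<eta> + \<xi>))"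
        by (simp add: mult_ac)
    qed
    also have "\<dots> = cis (x \<bullet> \<eta>) * f t \<eta> * (LINT \<xi>|lborel. cis (x \<bullet> (- \<eta> + \<xi>)) * g t (- \<eta> + \<xi>))"
      by (rule integral_mult_right_zero)
    also have "(LINT \<xi>|lborel. cis (x \<bullet> (- \<eta> + \<xi>)) * g t (- \<eta> + \<xi>)) = ift (g t) x"
      unfolding ift_def by (rule integral_translation[OF m])
    finally show "(LINT \<xi>|lborel. cis (x \<bullet> \<xi>) * (f t \<eta> * g t (\<xi> - \<eta>))) = cis (x \<bullet> \<eta>) * f t \<eta> * ift (g t) x" .
  qed
  also have "\<dots> = ift (f t) x * ift (g t) x"
    unfolding ift_def by (rule integral_mult_left_zero)
  finally show ?thesis .
qed

lemma ift_crefl: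
  assumes "rapid (f t)"
  shows "ift (crefl f t) x = cnj (ift (f t) x)"
proof -
  have m: "(\<lambda>\<xi>. cis (x \<bullet> \<xi>) * cnj (f t (- \<xi>))) \<in> borel_measurable borel"
    by (intro borel_measurable_continuous_onI continuous_on_mult continuous_on_cnj
        rapid_continuous[OF rapid_reflect[OF assms]] continuous_intros)
  have "ift (crefl f t) x = (LINT \<xi>|lborel. cis (x \<bullet> - \<xi>) * cnj (f t (- (- \<xi>))))"
    unfolding ift_def crefl_def by (rule integral_reflect[OF m, symmetric])
  also have "\<dots> = (LINT \<xi>|lborel. cnj (cis (x \<bullet> \<xi>) * f t \<xi>))"
    by (simp add: cis_cnj)
  also have "\<dots> = cnj (ift (f t) x)"
    unfolding ift_def
    by (rule integral_bounded_linear[OF bounded_linear_cnj integrable_cis_mult[OF rapid_integrable[OF assms]]])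
  finally show ?thesis .
qed

text \<open>The decay is uniform in time and beats every Sobolev weight, so pointwise continuity in
  \<open>t\<close> passes to every Sobolev norm by dominated convergence.\<close>

lemma C_H_infty_vift:
  fixes F :: "'d \<Rightarrow> real \<Rightarrow> real^'d::finite \<Rightarrow> complex"
  assumes F: "\<And>j. decays T r M (F j)" and T: "0 \<le> T"
  shows "C_H_infty T (\<lambda>t. vift (\<lambda>j. F j t))"
  unfolding C_H_infty_def
proof (intro conjI ballI allI)
  have rF: "rapid (F j t)" for j t by (rule decays_rapid[OF F T])
  show "H_infty (vift (\<lambda>j. F j t))" for t
    by (rule H_infty_vift[OF rF])
  fix \<sigma> :: real
  let ?c = "distr_curve T (\<lambda>t. vift (\<lambda>j. F j t))"
  let ?V = "vec_space (sobolev \<sigma>) :: (('d distr)^'d) nspace"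
  let ?k = "(2 * pi) ^ CARD('d) :: real"
  let ?J = "\<lambda>j t t'. LINT \<xi>|lborel. sob_weight \<sigma> \<xi> * (norm (F j t' \<xi> - F j t \<xi>))\<^sup>2"
  have ct: "?c t = (\<chi> j. sdistr (ift (F j t)))" if "t \<in> {0..T}" for t
    using that by (simp add: distr_curve_def distr_of_vift)
  have carr: "?c t \<in> carr ?V" if "t \<in> {0..T}" for t
    using sdistr_sobolev(1)[OF rF] by (simp add: ct[OF that] vec_space_def)
  have nd: "nrm ?V (?c t' - ?c t) = sqrt (\<Sum>j\<in>UNIV. (?k * sqrt (?J j t t'))\<^sup>2)" if "t \<in> {0..T}" "t' \<in> {0..T}" for t t'
  proof -
    have "(?c t' - ?c t) $ j = sdistr (ift (\<lambda>\<xi>. F j t' \<xi> - F j t \<xi>))" for j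
      unfolding ct[OF that(1)] ct[OF that(2)] by (simp add: sdistr_diff[OF rF rF])
    moreover have "rapid (\<lambda>\<xi>. F j t' \<xi> - F j t \<xi>)" for j
      using rapid_add[OF rF rapid_cmult[OF rF, of "-1"]] by simp
    ultimately show ?thesis
      by (simp add: vec_space_def sdistr_sobolev(2))
  qed
  have lim: "((\<lambda>t'. nrm ?V (?c t' - ?c t)) \<longlongrightarrow> 0) (at t within {0..T})" if t: "t \<in> {0..T}" for t
    unfolding tendsto_at_iff_sequentially o_def
  proof (intro allI impI)
    fix X assume X: "\<forall>i. X i \<in> {0..T} - {t}" "X \<longlonglongrightarrow> t"
    have "(\<lambda>n. ?J j t (X n)) \<longlonglongrightarrow> (LINT \<xi>|(lborel :: (real^'d) measure). 0 :: real)" for j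
    proof (rule integral_dominated_convergence)
      \<comment> \<open>The Sobolev weight is at most this power of \<open>1 + norm \<xi>\<close>.
        One factor of the square absorbs the power and still decays, the other is bounded by
        \<open>2 * M\<close>.\<close>
      let ?n = "2 * nat \<lceil>\<bar>\<sigma>\<bar>\<rceil>"
      let ?w = "\<lambda>\<xi>::real^'d. (fact ?n * M * 2 * (2 * M)) * (1 / decay_weight \<xi>)"
      show "integrable lborel ?w"
        by (intro integrable_mult_right integrable_inverse_decay_weight)
      have mF: "F j t \<in> borel_measurable borel" for t by (rule rapid_measurable[OF rF])
      show "(\<lambda>\<xi>. sob_weight \<sigma> \<xi> * (norm (F j (X n) \<xi> - F j t \<xi>))\<^sup>2) \<in> borel_measurable lborel" for n
        using mF[of t] mF[of "X n"] by measurable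
      show "AE \<xi> in lborel. (\<lambda>n. sob_weight \<sigma> \<xi> * (norm (F j (X n) \<xi> - F j t \<xi>))\<^sup>2) \<longlonglongrightarrow> 0"
      proof (rule AE_I2)
        fix \<xi> :: "real^'d"
        have "continuous_on UNIV (\<lambda>t. F j t \<xi>)"
          by (intro decays_comp[OF F] continuous_intros)
        then have "(\<lambda>n. F j (X n) \<xi>) \<longlonglongrightarrow> F j t \<xi>"
          by (rule isCont_tendsto_compose[OF continuous_UNIV_isCont X(2)])
        then have "(\<lambda>n. sob_weight \<sigma> \<xi> * (norm (F j (X n) \<xi> - F j t \<xi>))\<^sup>2) \<longlonglongrightarrow> sob_weight \<sigma> \<xi> * (norm (F j t \<xi> - F j t \<xi>))\<^sup>2"
          by (intro tendsto_intros)
        then show "(\<lambda>n. sob_weight \<sigma> \<xi> * (norm (F j (X n) \<xi> - F j t \<xi>))\<^sup>2) \<longlonglongrightarrow> 0" by simp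
      qed
      show "AE \<xi> in lborel. norm (sob_weight \<sigma> \<xi> * (norm (F j (X n) \<xi> - F j t \<xi>))\<^sup>2) \<le> ?w \<xi>" for n
      proof (rule AE_I2)
        fix \<xi> :: "real^'d"
        have M: "0 \<le> M" by (rule decays_nonneg[OF F])
        have b0: "norm (F j s \<xi>) \<le> M" for s
        proof -
          have "norm (F j s \<xi>) \<le> M / decay_weight \<xi>"
            using decays_power_bound[OF F T, where n = 0] by simp
          also have "\<dots> \<le> M / 1" using M decay_weight_ge_1[of \<xi>] by (intro divide_left_mono) auto
          finally show ?thesis by simp
        qed
        have d: "norm (F j (X n) \<xi> - F j t \<xi>) \<le> norm (F j (X n) \<xi>) + norm (F j t \<xi>)"
          by (rule norm_triangle_ineq4)
        have "(1 + norm \<xi>) ^ ?n * norm (F j (X n) \<xi> - F j t \<xi>)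
          \<le> (1 + norm \<xi>) ^ ?n * norm (F j (X n) \<xi>) + (1 + norm \<xi>) ^ ?n * norm (F j t \<xi>)"
          unfolding distrib_left[symmetric] by (intro mult_left_mono d) auto
        also have "\<dots> \<le> fact ?n * M / decay_weight \<xi> + fact ?n * M / decay_weight \<xi>"
          by (intro add_mono decays_power_bound[OF F T])
        finally have 1: "(1 + norm \<xi>) ^ ?n * norm (F j (X n) \<xi> - F j t \<xi>) \<le> fact ?n * M * 2 / decay_weight \<xi>"
          by (simp add: mult_ac)
        have 2: "norm (F j (X n) \<xi> - F j t \<xi>) \<le> 2 * M"
          using d b0[of "X n"] b0[of t] by linarith
        have "sob_weight \<sigma> \<xi> * (norm (F j (X n) \<xi> - F j t \<xi>))\<^sup>2
          \<le> (1 + norm \<xi>) ^ ?n * (norm (F j (X n) \<xi> - F j t \<xi>))\<^sup>2"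
          by (intro mult_right_mono sob_weight_le) auto
        also have "\<dots> = ((1 + norm \<xi>) ^ ?n * norm (F j (X n) \<xi> - F j t \<xi>)) * norm (F j (X n) \<xi> - F j t \<xi>)"
          by (simp add: power2_eq_square mult.assoc)
        also have "\<dots> \<le> (fact ?n * M * 2 / decay_weight \<xi>) * (2 * M)"
          using M less_imp_le[OF decay_weight_pos[of \<xi>]]
          by (intro mult_mono 1 2) (auto intro!: divide_nonneg_nonneg mult_nonneg_nonneg)
        finally have "sob_weight \<sigma> \<xi> * (norm (F j (X n) \<xi> - F j t \<xi>))\<^sup>2 \<le> ?w \<xi>"
          by (simp only: times_divide_eq_left times_divide_eq_right mult_1_right)
        moreover have "0 \<le> sob_weight \<sigma> \<xi> * (norm (F j (X n) \<xi> - F j t \<xi>))\<^sup>2"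
          by (simp add: less_imp_le[OF sob_weight_pos])
        ultimately show "norm (sob_weight \<sigma> \<xi> * (norm (F j (X n) \<xi> - F j t \<xi>))\<^sup>2) \<le> ?w \<xi>"
          unfolding real_norm_def by linarith
      qed
    qed simp
    then have "(\<lambda>n. sqrt (\<Sum>j\<in>UNIV. (?k * sqrt (?J j t (X n)))\<^sup>2)) \<longlonglongrightarrow> sqrt (\<Sum>j\<in>(UNIV :: 'd set). (?k * sqrt (LINT \<xi>|(lborel :: (real^'d) measure). 0))\<^sup>2)"
      by (intro tendsto_intros)
    then have "(\<lambda>n. sqrt (\<Sum>j\<in>UNIV. (?k * sqrt (?J j t (X n)))\<^sup>2)) \<longlonglongrightarrow> 0" by simp
    moreover have "nrm ?V (?c (X n) - ?c t) = sqrt (\<Sum>j\<in>UNIV. (?k * sqrt (?J j t (X n)))\<^sup>2)" for n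
      using X(1) by (intro nd t) blast
    ultimately show "(\<lambda>n. nrm ?V (?c (X n) - ?c t)) \<longlonglongrightarrow> 0" by (simp only:)
  qed
  show "?c \<in> carr (curve_space T ?V)"
    using carr lim by (simp add: curve_space_def distr_curve_def)
qed


section \<open>Fields along a coordinate vector and gradient fields\<close>

definition dirvec :: "'d \<Rightarrow> (real^'d::finite \<Rightarrow> complex) \<Rightarrow> real^'d \<Rightarrow> complex^'d"
  where "dirvec k f = vift (\<lambda>j \<xi>. if j = k then f \<xi> else 0)"

definition gradvec :: "(real^'d::finite \<Rightarrow> complex) \<Rightarrow> real^'d \<Rightarrow> complex^'d"
  where "gradvec f = vift (\<lambda>j \<xi>. \<i> * complex_of_real (\<xi> $ j) * f \<xi>)"

lemma ift_zero [simp]: "ift (\<lambda>\<xi>. 0) x = 0"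
  by (simp add: ift_def)

lemma dirvec_nth: "dirvec k f x $ j = (if j = k then ift f x else 0)"
  by (simp add: dirvec_def vift_def)

lemma gradvec_nth: "gradvec f x $ j = ift (\<lambda>\<xi>. \<i> * complex_of_real (\<xi> $ j) * f \<xi>) x"
  by (simp add: gradvec_def vift_def)

lemma rapid_zero: "rapid (\<lambda>\<xi>. 0)"
  by (auto simp: rapid_def)

lemma rapid_norm_sq:
  assumes "rapid f"
  shows "rapid (\<lambda>\<xi>. complex_of_real ((norm \<xi>)\<^sup>2) * f \<xi>)"
proof (rule rapid_mult[OF assms, where C = 1 and m = 2])
  show "norm (complex_of_real ((norm x)\<^sup>2)) \<le> 1 * (1 + norm x)\<^sup>2" for x :: "real^'a"
    by (simp add: norm_power power_mono)
qed (auto intro!: continuous_intros)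

lemma sum_coord_sq: "(\<Sum>i\<in>UNIV. \<i> * complex_of_real (\<xi> $ i) * (\<i> * complex_of_real (\<xi> $ i) * z)) = - (complex_of_real ((norm \<xi>)\<^sup>2) * z)"
proof -
  have "(norm \<xi>)\<^sup>2 = (\<Sum>i\<in>UNIV. (\<xi> $ i)\<^sup>2)"
    by (simp add: norm_vec_def L2_set_def sum_nonneg)
  then show ?thesis
    by (simp add: sum_distrib_left power2_eq_square mult_ac sum_negf)
qed

lemma ift_sum:
  assumes "finite I" "\<And>i. i \<in> I \<Longrightarrow> rapid (f i)"
  shows "(\<Sum>i\<in>I. ift (f i) x) = ift (\<lambda>\<xi>. \<Sum>i\<in>I. f i \<xi>) x"
  unfolding ift_def sum_distrib_left
  by (subst Bochner_Integration.integral_sum) (simp_all add: integrable_cis_mult rapid_integrable assms)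

lemma sum_ift_coord_sq:
  assumes f: "rapid f"
  shows "(\<Sum>i\<in>UNIV. ift (\<lambda>\<xi>. \<i> * complex_of_real (\<xi> $ i) * (\<i> * complex_of_real (\<xi> $ i) * f \<xi>)) x)
    = - ift (\<lambda>\<xi>. complex_of_real ((norm \<xi>)\<^sup>2) * f \<xi>) x"
proof -
  have "(\<Sum>i\<in>UNIV. ift (\<lambda>\<xi>. \<i> * complex_of_real (\<xi> $ i) * (\<i> * complex_of_real (\<xi> $ i) * f \<xi>)) x)
    = ift (\<lambda>\<xi>. - (complex_of_real ((norm \<xi>)\<^sup>2) * f \<xi>)) x"
    by (subst ift_sum[OF finite rapid_icoord[OF rapid_icoord[OF f]]]) (simp add: sum_coord_sq)
  also have "\<dots> = - ift (\<lambda>\<xi>. complex_of_real ((norm \<xi>)\<^sup>2) * f \<xi>) x"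
    using ift_cmult[of "-1" "\<lambda>\<xi>. complex_of_real ((norm \<xi>)\<^sup>2) * f \<xi>" x] by simp
  finally show ?thesis .
qed

lemma laplacian_vift:
  assumes A: "\<And>j. rapid (A j)"
  shows "laplacian (vift A) x $ j = - ift (\<lambda>\<xi>. complex_of_real ((norm \<xi>)\<^sup>2) * A j \<xi>) x"
proof -
  have "partial_deriv i (partial_deriv i (vift A)) = vift (\<lambda>j \<xi>. \<i> * complex_of_real (\<xi> $ i) * (\<i> * complex_of_real (\<xi> $ i) * A j \<xi>))" for i
    by (simp only: partial_deriv_vift[OF A] partial_deriv_vift[OF rapid_icoord[OF A]])
  then show ?thesis
    by (simp add: laplacian_def sum_component vift_def sum_ift_coord_sq[OF A])
qed

lemma divergence_gradvec:
  assumes f: "rapid f"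
  shows "divergence (gradvec f) x = - ift (\<lambda>\<xi>. complex_of_real ((norm \<xi>)\<^sup>2) * f \<xi>) x"
  unfolding divergence_def gradvec_nth partial_deriv_ift[OF rapid_icoord[OF f]]
  by (rule sum_ift_coord_sq[OF f])

text \<open>Conjugating a gradient field replaces \<open>f\<close> by \<open>crefl f\<close>,
  because the symbol \<open>\<i> * \<xi> $ j\<close> is invariant under conjugation combined with
  reflection.\<close>

lemma divergence_cnj_gradvec:
  fixes f :: "real \<Rightarrow> real^'d::finite \<Rightarrow> complex"
  assumes f: "rapid (f t)"
  shows "divergence (\<lambda>y. cnj_vec (gradvec (f t) y)) x = - ift (lap (crefl f) t) x"
proof -
  have r: "rapid (crefl f t)"
    unfolding crefl_def by (rule rapid_cnj[OF rapid_reflect[OF f]])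
  have eq: "cnj_vec (gradvec (f t) y) = gradvec (crefl f t) y" for y
  proof -
    have "cnj (ift (\<lambda>\<xi>. \<i> * complex_of_real (\<xi> $ j) * f t \<xi>) y) = ift (\<lambda>\<xi>. \<i> * complex_of_real (\<xi> $ j) * crefl f t \<xi>) y" for j
    proof -
      have "crefl (\<lambda>t \<xi>. \<i> * complex_of_real (\<xi> $ j) * f t \<xi>) t = (\<lambda>\<xi>. \<i> * complex_of_real (\<xi> $ j) * crefl f t \<xi>)"
        by (simp add: fun_eq_iff crefl_def)
      with ift_crefl[of "\<lambda>t \<xi>. \<i> * complex_of_real (\<xi> $ j) * f t \<xi>" t y, OF rapid_icoord[OF f, of j]]
      show ?thesis by simp
    qed
    then show ?thesis by (simp add: vec_eq_iff cnj_vec_def gradvec_nth)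
  qed
  have "divergence (gradvec (crefl f t)) x = - ift (lap (crefl f) t) x"
    unfolding divergence_gradvec[OF r] lap_def ..
  then show ?thesis unfolding eq .
qed

lemma has_vector_derivative_vec:
  fixes f :: "'n::finite \<Rightarrow> real \<Rightarrow> 'b::real_normed_vector"
  assumes "\<And>j. (f j has_vector_derivative f' j) (at t within S)"
  shows "((\<lambda>t. \<chi> j. f j t) has_vector_derivative (\<chi> j. f' j)) (at t within S)"
proof -
  have "((\<lambda>t. \<chi> j. f j t) has_derivative (\<lambda>h. \<chi> j. h *\<^sub>R f' j)) (at t within S)"
    using assms unfolding has_vector_derivative_def by (rule has_derivative_vec)
  moreover have "(\<lambda>h. \<chi> j. h *\<^sub>R f' j) = (\<lambda>h. h *\<^sub>R (\<chi> j. f' j))"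
    by (simp add: fun_eq_iff vec_eq_iff)
  ultimately show ?thesis by (simp add: has_vector_derivative_def)
qed

lemma decays_coord:
  fixes C :: "real \<Rightarrow> real^'d::finite \<Rightarrow> complex"
  assumes C: "decays T 2 M C"
  shows "decays T 1 M (\<lambda>t \<xi>. \<i> * complex_of_real (\<xi> $ j) * C t \<xi>)"
  unfolding decays_def
proof (intro conjI allI)
  show "continuous_on UNIV (\<lambda>p. \<i> * complex_of_real (snd p $ j) * C (fst p) (snd p))"
    by (intro continuous_intros decaysD(1)[OF C])
  fix t and \<xi> :: "real^'d"
  have n: "1 + norm \<xi> \<noteq> 0" using norm_ge_zero[of \<xi>] by linarith
  have "norm (\<i> * complex_of_real (\<xi> $ j) * C t \<xi>) \<le> (1 + norm \<xi>) * (M / ((1 + norm \<xi>)\<^sup>2 * wt T t \<xi>))"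
    unfolding norm_mult using component_le_norm_cart[of \<xi> j]
    by (intro mult_mono decaysD(2)[OF C]) auto
  also have "\<dots> = M / ((1 + norm \<xi>) ^ 1 * wt T t \<xi>)"
    using n by (simp add: power2_eq_square)
  finally show "norm (\<i> * complex_of_real (\<xi> $ j) * C t \<xi>) \<le> M / ((1 + norm \<xi>) ^ 1 * wt T t \<xi>)" .
qed

text \<open>The multiplier \<open>m\<close> is 1 for fields along a coordinate vector and
  \<open>\<i> * \<xi> $ j\<close> for the components of a gradient; hence the linear growth allowed
  for it.\<close>

lemma ift_evolution:
  fixes F N :: "real \<Rightarrow> real^'d::finite \<Rightarrow> complex"
  assumes F: "decays T r M F" and N: "decays T q K N" and T: "0 \<le> T"
    and eq: "F = (\<lambda>t \<xi>. c * free T \<kappa> F0 t \<xi> + duh T \<kappa> N t \<xi>)" and t: "t \<in> {0..T}"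
    and m: "\<And>\<xi>. norm (m \<xi>) \<le> 1 + norm \<xi>" "continuous_on UNIV m"
  shows "((\<lambda>\<tau>. ift (\<lambda>\<xi>. m \<xi> * F \<tau> \<xi>) x) has_vector_derivative
    ift (\<lambda>\<xi>. m \<xi> * (- \<i> * (\<kappa> * lap F t \<xi>) - \<i> * N t \<xi>)) x) (at t within {0..T})"
proof (rule has_vector_derivative_ift[where g = "\<lambda>t \<xi>. m \<xi> * (- \<i> * (\<kappa> * lap F t \<xi>) - \<i> * N t \<xi>)"])
  have rF: "rapid (F t)" and rN: "rapid (N t)" for t
    by (rule decays_rapid[OF F T], rule decays_rapid[OF N T])
  have rm: "rapid (\<lambda>\<xi>. m \<xi> * f \<xi>)" if "rapid f" for f
    by (rule rapid_mult[OF that m(2), where C = 1 and m = 1]) (simp add: m(1))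
  show "rapid (\<lambda>\<xi>. m \<xi> * F t \<xi>)" for t by (rule rm[OF rF])
  show "rapid (\<lambda>\<xi>. m \<xi> * (- \<i> * (\<kappa> * lap F t \<xi>) - \<i> * N t \<xi>))" for t
  proof (rule rm)
    have "rapid (\<lambda>\<xi>. (- \<i> * \<kappa>) * (complex_of_real ((norm \<xi>)\<^sup>2) * F t \<xi>) + (- \<i>) * N t \<xi>)"
      by (intro rapid_add rapid_cmult rapid_norm_sq rF rN)
    then show "rapid (\<lambda>\<xi>. - \<i> * (\<kappa> * lap F t \<xi>) - \<i> * N t \<xi>)"
      by (simp add: lap_def mult.assoc)
  qed
  show "((\<lambda>\<tau>. m \<xi> * F \<tau> \<xi>) has_vector_derivative m \<xi> * (- \<i> * (\<kappa> * lap F t \<xi>) - \<i> * N t \<xi>)) (at t within {0..T})"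
    if "t \<in> {0..T}" for t \<xi>
    by (intro has_vector_derivative_mult_right duhamel_derivative[OF N eq that])
  \<comment> \<open>The 6 is \<open>fact 3\<close>, for three powers of
    \<open>1 + norm \<xi>\<close>: one from \<open>m\<close>, two from \<open>lap\<close>.\<close>
  show "norm (m \<xi> * (- \<i> * (\<kappa> * lap F t \<xi>) - \<i> * N t \<xi>)) \<le> (\<bar>\<kappa>\<bar> * (6 * M) + K) / decay_weight \<xi>" for t \<xi>
  proof -
    have "norm (m \<xi> * (- \<i> * (\<kappa> * lap F t \<xi>) - \<i> * N t \<xi>))
      \<le> (1 + norm \<xi>) * (\<bar>\<kappa>\<bar> * ((norm \<xi>)\<^sup>2 * norm (F t \<xi>)) + norm (N t \<xi>))"
      unfolding norm_mult
    proof (intro mult_mono m(1))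
      show "norm (- \<i> * (\<kappa> * lap F t \<xi>) - \<i> * N t \<xi>) \<le> \<bar>\<kappa>\<bar> * ((norm \<xi>)\<^sup>2 * norm (F t \<xi>)) + norm (N t \<xi>)"
        by (rule order_trans[OF norm_triangle_ineq4]) (simp add: norm_mult lap_def norm_power)
    qed auto
    also have "\<dots> \<le> (1 + norm \<xi>) * (\<bar>\<kappa>\<bar> * ((1 + norm \<xi>)\<^sup>2 * norm (F t \<xi>)) + norm (N t \<xi>))"
      by (intro mult_left_mono add_right_mono mult_right_mono power_mono) auto
    also have "\<dots> = \<bar>\<kappa>\<bar> * ((1 + norm \<xi>) ^ 3 * norm (F t \<xi>)) + (1 + norm \<xi>) ^ 1 * norm (N t \<xi>)"
      by (simp add: power2_eq_square power3_eq_cube algebra_simps)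
    also have "\<dots> \<le> \<bar>\<kappa>\<bar> * (fact 3 * M / decay_weight \<xi>) + fact 1 * K / decay_weight \<xi>"
      by (intro add_mono mult_left_mono decays_power_bound[OF F T] decays_power_bound[OF N T]) auto
    also have "\<dots> = (\<bar>\<kappa>\<bar> * (6 * M) + K) / decay_weight \<xi>"
      by (simp add: fact_numeral add_divide_distrib)
    finally show ?thesis .
  qed
qed (rule t)

context fourier_system
begin

text \<open>Convolutions become products and \<open>crefl\<close> becomes conjugation, so
  differentiating the Duhamel equations yields the system. Since u and v point along the same
  coordinate vector, the right sides keep that direction and \<open>cdot\<close> reduces to a single
  product.\<close>

lemma smooth_solution_of_solves:
  fixes k :: 'd
  assumes s: "solves \<epsilon> A B C" and A: "decays T 1 M A" and B: "decays T 1 M B" and C: "decays T 2 M C"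
  shows "smooth_solution \<alpha> \<beta> \<gamma> T (dirvec k (A 0)) (dirvec k (B 0)) (gradvec (C 0))
    (\<lambda>t. dirvec k (A t)) (\<lambda>t. dirvec k (B t)) (\<lambda>t. gradvec (C t))"
proof -
  note eqA = conjunct1[OF s[unfolded solves_def], unfolded qdiv_def]
    and eqB = conjunct1[OF conjunct2[OF s[unfolded solves_def]], unfolded qdiv_def]
    and eqC = conjunct2[OF conjunct2[OF s[unfolded solves_def]], unfolded qgrad_def]
  note NA = decays_conv[OF decays_lap[OF C] decays_le_order[OF B le0] T]
    and NB = decays_conv[OF decays_lap[OF decays_crefl[OF C]] decays_le_order[OF A le0] T]
    and NC = decays_conv[OF A decays_crefl[OF B] T]
  have rA: "rapid (A t)" and rB: "rapid (B t)" and rC: "rapid (C t)" for t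
    by (rule decays_rapid[OF A T], rule decays_rapid[OF B T], rule decays_rapid[OF C T])
  have rcB: "rapid (crefl B t)" and rcC: "rapid (crefl C t)" for t
    by (rule decays_rapid[OF decays_crefl[OF B] T], rule decays_rapid[OF decays_crefl[OF C] T])
  have rl: "rapid (lap C t)" "rapid (lap (crefl C) t)" for t
    by (rule decays_rapid[OF decays_lap[OF C] T], rule decays_rapid[OF decays_lap[OF decays_crefl[OF C]] T])
  have rNA: "rapid (conv (lap C) B t)" and rNB: "rapid (conv (lap (crefl C)) A t)" and rNC: "rapid (conv A (crefl B) t)" for t
    by (rule decays_rapid[OF NA T], rule decays_rapid[OF NB T], rule decays_rapid[OF NC T])
  have M: "0 \<le> M" by (rule decays_nonneg[OF A])
  have z: "decays T 1 M (\<lambda>t (\<xi>::real^'d). 0)"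
    unfolding decays_def using M less_imp_le[OF wt_pos] by (auto intro!: divide_nonneg_nonneg mult_nonneg_nonneg)
  have dir: "C_H_infty T (\<lambda>t. dirvec k (F t))" if F: "decays T 1 M F" for F
    unfolding dirvec_def
  proof (rule C_H_infty_vift[OF _ T, where F = "\<lambda>j t \<xi>. if j = k then F t \<xi> else 0"])
    show "decays T 1 M (\<lambda>t \<xi>. if j = k then F t \<xi> else 0)" for j
      using F z by (cases "j = k") simp_all
  qed
  have gr: "C_H_infty T (\<lambda>t. gradvec (C t))"
    unfolding gradvec_def by (rule C_H_infty_vift[OF decays_coord[OF C] T])
  have one: "norm (1 :: complex) \<le> 1 + norm \<xi>" for \<xi> :: "real^'d" by simp
  have eqs: "\<exists>u' v' w'.
       ((\<lambda>\<tau>. dirvec k (A \<tau>) x) has_vector_derivative u') (at t within {0..T}) \<and>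
       ((\<lambda>\<tau>. dirvec k (B \<tau>) x) has_vector_derivative v') (at t within {0..T}) \<and>
       ((\<lambda>\<tau>. gradvec (C \<tau>) x) has_vector_derivative w') (at t within {0..T}) \<and>
       \<i> *s u' + \<alpha> *\<^sub>R laplacian (dirvec k (A t)) x = - (divergence (gradvec (C t)) x *s dirvec k (B t) x) \<and>
       \<i> *s v' + \<beta> *\<^sub>R laplacian (dirvec k (B t)) x = - (divergence (\<lambda>y. cnj_vec (gradvec (C t) y)) x *s dirvec k (A t) x) \<and>
       \<i> *s w' + \<gamma> *\<^sub>R laplacian (gradvec (C t)) x = gradient (\<lambda>y. cdot (dirvec k (A t) y) (cnj_vec (dirvec k (B t) y))) x"
    if t: "t \<in> {0..T}" for t x
  proof -
    let ?dA = "\<lambda>\<xi>. 1 * (- \<i> * (\<alpha> * lap A t \<xi>) - \<i> * conv (lap C) B t \<xi>)"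
    let ?dB = "\<lambda>\<xi>. 1 * (- \<i> * (\<beta> * lap B t \<xi>) - \<i> * conv (lap (crefl C)) A t \<xi>)"
    let ?dC = "\<lambda>j \<xi>. \<i> * complex_of_real (\<xi> $ j) * (- \<i> * (\<gamma> * lap C t \<xi>) - \<i> * conv A (crefl B) t \<xi>)"
    have dA: "((\<lambda>\<tau>. ift (A \<tau>) x) has_vector_derivative ift ?dA x) (at t within {0..T})"
      using ift_evolution[OF A NA T eqA t one continuous_on_const] by simp
    have dB: "((\<lambda>\<tau>. ift (B \<tau>) x) has_vector_derivative ift ?dB x) (at t within {0..T})"
      using ift_evolution[OF B NB T eqB t one continuous_on_const] by simp
    have dC: "((\<lambda>\<tau>. ift (\<lambda>\<xi>. \<i> * complex_of_real (\<xi> $ j) * C \<tau> \<xi>) x) has_vector_derivative ift (?dC j) x) (at t within {0..T})" for j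
    proof (rule ift_evolution[OF C NC T eqC t])
      show "norm (\<i> * complex_of_real (\<xi> $ j)) \<le> 1 + norm \<xi>" for \<xi> :: "real^'d"
        using component_le_norm_cart[of \<xi> j] by (simp add: norm_mult)
    qed (intro continuous_intros)
    have rlA: "rapid (lap A t)" "rapid (lap B t)" "rapid (lap C t)"
      unfolding lap_def[abs_def] by (rule rapid_norm_sq[OF rA], rule rapid_norm_sq[OF rB], rule rapid_norm_sq[OF rC])
    have iA: "\<i> * ift ?dA x = complex_of_real \<alpha> * ift (lap A t) x + ift (lap C t) x * ift (B t) x"
    proof -
      have "?dA = (\<lambda>\<xi>. (- \<i> * \<alpha>) * lap A t \<xi> - \<i> * conv (lap C) B t \<xi>)" by (simp add: fun_eq_iff mult_ac)
      then have "ift ?dA x = (- \<i> * \<alpha>) * ift (lap A t) x - \<i> * ift (conv (lap C) B t) x"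
        using ift_diff[OF rapid_integrable[OF rapid_cmult[OF rlA(1)]] rapid_integrable[OF rapid_cmult[OF rNA]], of "- \<i> * \<alpha>" \<i>]
        by (simp only: ift_cmult)
      also have "ift (conv (lap C) B t) x = ift (lap C t) x * ift (B t) x" by (rule ift_conv[OF rl(1) rB])
      finally have e: "ift ?dA x = (- \<i> * \<alpha>) * ift (lap A t) x - \<i> * (ift (lap C t) x * ift (B t) x)" .
      show ?thesis unfolding e by (simp add: algebra_simps)
    qed
    have iB: "\<i> * ift ?dB x = complex_of_real \<beta> * ift (lap B t) x + ift (lap (crefl C) t) x * ift (A t) x"
    proof -
      have "?dB = (\<lambda>\<xi>. (- \<i> * \<beta>) * lap B t \<xi> - \<i> * conv (lap (crefl C)) A t \<xi>)" by (simp add: fun_eq_iff mult_ac)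
      then have "ift ?dB x = (- \<i> * \<beta>) * ift (lap B t) x - \<i> * ift (conv (lap (crefl C)) A t) x"
        using ift_diff[OF rapid_integrable[OF rapid_cmult[OF rlA(2)]] rapid_integrable[OF rapid_cmult[OF rNB]], of "- \<i> * \<beta>" \<i>]
        by (simp only: ift_cmult)
      also have "ift (conv (lap (crefl C)) A t) x = ift (lap (crefl C) t) x * ift (A t) x" by (rule ift_conv[OF rl(2) rA])
      finally have e: "ift ?dB x = (- \<i> * \<beta>) * ift (lap B t) x - \<i> * (ift (lap (crefl C) t) x * ift (A t) x)" .
      show ?thesis unfolding e by (simp add: algebra_simps)
    qed
    have iC: "\<i> * ift (?dC j) x = complex_of_real \<gamma> * ift (\<lambda>\<xi>. complex_of_real ((norm \<xi>)\<^sup>2) * (\<i> * complex_of_real (\<xi> $ j) * C t \<xi>)) x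
        + ift (\<lambda>\<xi>. \<i> * complex_of_real (\<xi> $ j) * conv A (crefl B) t \<xi>) x" for j
    proof -
      have "?dC j = (\<lambda>\<xi>. (- \<i> * \<gamma>) * (complex_of_real ((norm \<xi>)\<^sup>2) * (\<i> * complex_of_real (\<xi> $ j) * C t \<xi>)) - \<i> * (\<i> * complex_of_real (\<xi> $ j) * conv A (crefl B) t \<xi>))"
        by (simp add: fun_eq_iff lap_def algebra_simps)
      then have e: "ift (?dC j) x = (- \<i> * \<gamma>) * ift (\<lambda>\<xi>. complex_of_real ((norm \<xi>)\<^sup>2) * (\<i> * complex_of_real (\<xi> $ j) * C t \<xi>)) x
         - \<i> * ift (\<lambda>\<xi>. \<i> * complex_of_real (\<xi> $ j) * conv A (crefl B) t \<xi>) x"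
        using ift_diff[OF rapid_integrable[OF rapid_cmult[OF rapid_norm_sq[OF rapid_icoord[OF rC]]]]
            rapid_integrable[OF rapid_cmult[OF rapid_icoord[OF rNC]]], of "- \<i> * \<gamma>" j t \<i> j t x]
        by (simp only: ift_cmult)
      show ?thesis unfolding e by (simp add: algebra_simps)
    qed
    have lapdir: "laplacian (dirvec k (f t)) x $ j = (if j = k then - ift (lap f t) x else 0)" if "rapid (f t)" for f j
    proof -
      have lf: "lap f t = (\<lambda>\<xi>. complex_of_real ((norm \<xi>)\<^sup>2) * f t \<xi>)"
        by (simp add: fun_eq_iff lap_def)
      have "rapid (\<lambda>\<xi>. if j = k then f t \<xi> else 0)" for j
        using that rapid_zero by (cases "j = k") simp_all
      from laplacian_vift[OF this] show ?thesis unfolding dirvec_def lf by (cases "j = k") simp_all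
    qed
    have lapgr: "laplacian (gradvec (C t)) x $ j = - ift (\<lambda>\<xi>. complex_of_real ((norm \<xi>)\<^sup>2) * (\<i> * complex_of_real (\<xi> $ j) * C t \<xi>)) x" for j
      unfolding gradvec_def by (rule laplacian_vift[OF rapid_icoord[OF rC]])
    have cd: "(\<lambda>y. cdot (dirvec k (A t) y) (cnj_vec (dirvec k (B t) y))) = ift (conv A (crefl B) t)"
    proof
      fix y
      have "cdot (dirvec k (A t) y) (cnj_vec (dirvec k (B t) y)) = (\<Sum>j\<in>UNIV. if j = k then ift (A t) y * cnj (ift (B t) y) else 0)"
        unfolding cdot_def by (intro sum.cong) (auto simp: cnj_vec_def dirvec_nth)
      also have "\<dots> = ift (A t) y * ift (crefl B t) y" by (simp add: ift_crefl[where f = B and t = t, OF rB])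
      also have "\<dots> = ift (conv A (crefl B) t) y" by (rule ift_conv[OF rA rcB, symmetric])
      finally show "cdot (dirvec k (A t) y) (cnj_vec (dirvec k (B t) y)) = ift (conv A (crefl B) t) y" .
    qed
    have grd: "gradient (\<lambda>y. cdot (dirvec k (A t) y) (cnj_vec (dirvec k (B t) y))) x $ j = ift (\<lambda>\<xi>. \<i> * complex_of_real (\<xi> $ j) * conv A (crefl B) t \<xi>) x" for j
      unfolding cd gradient_def partial_deriv_ift[OF rNC] by simp
    have div1: "divergence (gradvec (C t)) x = - ift (lap C t) x"
      unfolding divergence_gradvec[OF rC] lap_def ..
    have div2: "divergence (\<lambda>y. cnj_vec (gradvec (C t) y)) x = - ift (lap (crefl C) t) x"
      by (rule divergence_cnj_gradvec[OF rC])
    have du: "((\<lambda>\<tau>. dirvec k (f \<tau>) x) has_vector_derivative (\<chi> j. if j = k then d else 0)) (at t within {0..T})"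
      if "((\<lambda>\<tau>. ift (f \<tau>) x) has_vector_derivative d) (at t within {0..T})" for f d
    proof -
      have "((\<lambda>\<tau>. \<chi> j. if j = k then ift (f \<tau>) x else 0) has_vector_derivative (\<chi> j. if j = k then d else 0)) (at t within {0..T})"
        using that by (intro has_vector_derivative_vec) auto
      moreover have "(\<lambda>\<tau>. \<chi> j. if j = k then ift (f \<tau>) x else 0) = (\<lambda>\<tau>. dirvec k (f \<tau>) x)"
        by (simp add: fun_eq_iff vec_eq_iff dirvec_nth)
      ultimately show ?thesis by simp
    qed
    have dw: "((\<lambda>\<tau>. gradvec (C \<tau>) x) has_vector_derivative (\<chi> j. ift (?dC j) x)) (at t within {0..T})"
      using has_vector_derivative_vec[OF dC] by (simp add: gradvec_def vift_def)
    show ?thesis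
    proof (intro exI conjI)
      show "((\<lambda>\<tau>. dirvec k (A \<tau>) x) has_vector_derivative (\<chi> j. if j = k then ift ?dA x else 0)) (at t within {0..T})"
        by (rule du[OF dA])
      show "((\<lambda>\<tau>. dirvec k (B \<tau>) x) has_vector_derivative (\<chi> j. if j = k then ift ?dB x else 0)) (at t within {0..T})"
        by (rule du[OF dB])
      show "((\<lambda>\<tau>. gradvec (C \<tau>) x) has_vector_derivative (\<chi> j. ift (?dC j) x)) (at t within {0..T})"
        by (rule dw)
      show "\<i> *s (\<chi> j. if j = k then ift ?dA x else 0) + \<alpha> *\<^sub>R laplacian (dirvec k (A t)) x = - (divergence (gradvec (C t)) x *s dirvec k (B t) x)"
        unfolding vec_eq_iff
      proof
        fix j
        show "(\<i> *s (\<chi> j. if j = k then ift ?dA x else 0) + \<alpha> *\<^sub>R laplacian (dirvec k (A t)) x) $ j = (- (divergence (gradvec (C t)) x *s dirvec k (B t) x)) $ j"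
          using iA by (cases "j = k") (simp_all add: lapdir[where f = A, OF rA] dirvec_nth div1 scaleR_conv_of_real[where 'a = complex])
      qed
      show "\<i> *s (\<chi> j. if j = k then ift ?dB x else 0) + \<beta> *\<^sub>R laplacian (dirvec k (B t)) x = - (divergence (\<lambda>y. cnj_vec (gradvec (C t) y)) x *s dirvec k (A t) x)"
        unfolding vec_eq_iff
      proof
        fix j
        show "(\<i> *s (\<chi> j. if j = k then ift ?dB x else 0) + \<beta> *\<^sub>R laplacian (dirvec k (B t)) x) $ j = (- (divergence (\<lambda>y. cnj_vec (gradvec (C t) y)) x *s dirvec k (A t) x)) $ j"
          using iB by (cases "j = k") (simp_all add: lapdir[where f = B, OF rB] dirvec_nth div2 scaleR_conv_of_real[where 'a = complex])
      qed
      show "\<i> *s (\<chi> j. ift (?dC j) x) + \<gamma> *\<^sub>R laplacian (gradvec (C t)) x = gradient (\<lambda>y. cdot (dirvec k (A t) y) (cnj_vec (dirvec k (B t) y))) x"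
        unfolding vec_eq_iff
      proof
        fix j
        show "(\<i> *s (\<chi> j. ift (?dC j) x) + \<gamma> *\<^sub>R laplacian (gradvec (C t)) x) $ j = gradient (\<lambda>y. cdot (dirvec k (A t) y) (cnj_vec (dirvec k (B t) y))) x $ j"
          unfolding grd using iC[of j] by (simp add: lapgr scaleR_conv_of_real[where 'a = complex])
      qed
    qed
  qed
  show ?thesis
    unfolding smooth_solution_def using dir[OF A] dir[OF B] gr eqs by blast
qed

lemma solves_initial:
  assumes s: "solves \<epsilon> A B C"
  shows "A 0 = (\<lambda>\<xi>. complex_of_real \<epsilon> * A0 \<xi>)" "B 0 = (\<lambda>\<xi>. complex_of_real \<epsilon> * B0 \<xi>)" "C 0 = (\<lambda>\<xi>. complex_of_real \<epsilon> * C0 \<xi>)"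
  using s unfolding solves_def qdiv_def qgrad_def
  by (auto simp: fun_eq_iff duh_zero[OF T] free_zero[OF T])

end


section \<open>What a twice differentiable flow would imply\<close>

text \<open>Compact support makes every exponential weight harmless, whatever the \<open>T\<close>
  of the flow map; continuity is what the weighted spaces ask for.\<close>

definition cutoff_data :: "(real^'d::finite \<Rightarrow> complex) \<Rightarrow> bool"
  where "cutoff_data f \<longleftrightarrow> continuous_on UNIV f \<and> (\<exists>R. \<forall>\<xi>. norm \<xi> > R \<longrightarrow> f \<xi> = 0)"

lemma cutoff_data_zero: "cutoff_data (\<lambda>\<xi>. 0)"
  by (simp add: cutoff_data_def)

lemma cutoff_data_decays:
  fixes f :: "real^'d::finite \<Rightarrow> complex"
  assumes f: "cutoff_data f" and T: "0 \<le> T"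
  shows "\<exists>D. decays T r D (free T \<kappa> f)"
proof -
  obtain R where c: "continuous_on UNIV f" and R: "\<And>\<xi>. norm \<xi> > R \<Longrightarrow> f \<xi> = 0"
    using f unfolding cutoff_data_def by blast
  let ?g = "\<lambda>\<xi>. complex_of_real ((1 + norm \<xi>) ^ r * wt T 0 \<xi>) * f \<xi>"
  have "continuous_on (cball 0 R) ?g"
    by (intro continuous_intros continuous_on_subset[OF c]) auto
  then have "bounded (?g ` cball 0 R)"
    by (intro compact_imp_bounded compact_continuous_image) auto
  then obtain B where B: "\<And>\<xi>. \<xi> \<in> cball 0 R \<Longrightarrow> norm (?g \<xi>) \<le> B"
    unfolding bounded_iff by blast
  have pos: "0 < (1 + norm \<xi>) ^ r * wt T 0 \<xi>" for \<xi> :: "real^'d"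
    by (intro mult_pos_pos zero_less_power wt_pos) (simp add: add_pos_nonneg)
  have "norm (f \<xi>) \<le> max B 0 / ((1 + norm \<xi>) ^ r * wt T 0 \<xi>)" for \<xi>
  proof (cases "norm \<xi> \<le> R")
    case True
    then have "norm (?g \<xi>) \<le> B" by (intro B) simp
    then have "norm (f \<xi>) * ((1 + norm \<xi>) ^ r * wt T 0 \<xi>) \<le> B"
      using pos[of \<xi>] unfolding norm_mult norm_of_real by (simp only: abs_of_pos mult.commute)
    then have "norm (f \<xi>) * ((1 + norm \<xi>) ^ r * wt T 0 \<xi>) \<le> max B 0" by simp
    then show ?thesis unfolding pos_le_divide_eq[OF pos] .
  next
    case False
    then show ?thesis using R[of \<xi>] pos[of \<xi>] less_imp_le by simp
  qed
  then have "decays T r (max B 0) (free T \<kappa> f)"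
    by (intro decays_free c T) auto
  then show ?thesis by blast
qed

text \<open>For \<open>T = 0\<close> the free evolution at time 0 is the datum itself, so this is a
  special case of the rapid decay of curves.\<close>

lemma cutoff_data_rapid:
  assumes "cutoff_data f"
  shows "rapid f"
proof -
  obtain D where "decays 0 0 D (free 0 0 f)"
    using cutoff_data_decays[OF assms order_refl] by blast
  from decays_rapid[OF this, of 0] have "rapid (free 0 0 f 0)" by simp
  moreover have "free 0 0 f 0 = f" by (simp add: fun_eq_iff free_zero)
  ultimately show ?thesis by simp
qed

lemma rapid_if: "rapid f \<Longrightarrow> rapid (\<lambda>\<xi>. if P then f \<xi> else 0)"
  using rapid_zero by (cases P) simp_all

lemma distr_of_dirvec: "distr_of (dirvec k f) = (\<chi> j. sdistr (ift (\<lambda>\<xi>. if j = k then f \<xi> else 0)))"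
  by (simp add: dirvec_def distr_of_vift)

lemma distr_of_gradvec: "distr_of (gradvec f) = (\<chi> j. sdistr (ift (\<lambda>\<xi>. \<i> * complex_of_real (\<xi> $ j) * f \<xi>)))"
  by (simp add: gradvec_def distr_of_vift)

lemma distr_of_dirvec_scale: "distr_of (dirvec k (\<lambda>\<xi>. complex_of_real r * f \<xi>)) = r *\<^sub>R distr_of (dirvec k f)"
proof -
  have "(\<lambda>\<xi>. if j = k then complex_of_real r * f \<xi> else 0) = (\<lambda>\<xi>. complex_of_real r * (if j = k then f \<xi> else 0))" for j
    by auto
  then show ?thesis by (simp add: distr_of_dirvec vec_eq_iff sdistr_scale)
qed

lemma distr_of_gradvec_scale: "distr_of (gradvec (\<lambda>\<xi>. complex_of_real r * f \<xi>)) = r *\<^sub>R distr_of (gradvec f)"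
proof -
  have "(\<lambda>\<xi>. \<i> * complex_of_real (\<xi> $ j) * (complex_of_real r * f \<xi>)) = (\<lambda>\<xi>. complex_of_real r * (\<i> * complex_of_real (\<xi> $ j) * f \<xi>))" for j
    by (simp add: mult_ac)
  then show ?thesis by (simp add: distr_of_gradvec vec_eq_iff sdistr_scale)
qed

lemma dirvec_carr: "rapid f \<Longrightarrow> distr_of (dirvec k f) \<in> carr (vec_space (sobolev s))"
  unfolding dirvec_def by (intro distr_of_vift_sobolev rapid_if)

lemma gradvec_carr: "rapid f \<Longrightarrow> distr_of (gradvec f) \<in> carr (vec_space (sobolev s))"
  unfolding gradvec_def by (intro distr_of_vift_sobolev rapid_icoord)

lemma dirvec_nrm:
  fixes f :: "real^'d::finite \<Rightarrow> complex"
  assumes f: "rapid f"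
  shows "(nrm (vec_space (sobolev s)) (distr_of (dirvec k f)))\<^sup>2 = ((2 * pi) ^ CARD('d))\<^sup>2 * (LINT \<xi>|lborel. sob_weight s \<xi> * (norm (f \<xi>))\<^sup>2)"
proof -
  let ?I = "\<lambda>g. LINT \<xi>|lborel. sob_weight s \<xi> * (norm (g \<xi>))\<^sup>2" and ?c = "(2 * pi) ^ CARD('d) :: real"
  have I0: "0 \<le> ?I g" for g
    by (intro Bochner_Integration.integral_nonneg) (simp add: less_imp_le[OF sob_weight_pos])
  have "(nrm (vec_space (sobolev s)) (distr_of (dirvec k f)))\<^sup>2 = (\<Sum>j\<in>UNIV. (?c * sqrt (?I (\<lambda>\<xi>. if j = k then f \<xi> else 0)))\<^sup>2)"
    by (simp add: vec_space_def distr_of_dirvec sdistr_sobolev(2)[OF rapid_if[OF f]] sum_nonneg)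
  also have "\<dots> = (\<Sum>j\<in>UNIV. if j = k then ?c\<^sup>2 * ?I f else 0)"
    using I0 by (intro sum.cong) (auto simp: power_mult_distrib)
  finally show ?thesis by simp
qed

lemma gradvec_nrm:
  fixes f :: "real^'d::finite \<Rightarrow> complex"
  assumes f: "rapid f"
  shows "(nrm (vec_space (sobolev s)) (distr_of (gradvec f)))\<^sup>2
    = ((2 * pi) ^ CARD('d))\<^sup>2 * (LINT \<xi>|lborel. sob_weight s \<xi> * ((norm \<xi>)\<^sup>2 * (norm (f \<xi>))\<^sup>2))"
proof -
  let ?c = "(2 * pi) ^ CARD('d) :: real"
  let ?g = "\<lambda>j \<xi>. \<i> * complex_of_real (\<xi> $ j) * f \<xi>"
  let ?I = "\<lambda>j. LINT \<xi>|lborel. sob_weight s \<xi> * (norm (?g j \<xi>))\<^sup>2"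
  have I0: "0 \<le> ?I j" for j
    by (intro Bochner_Integration.integral_nonneg) (simp add: less_imp_le[OF sob_weight_pos])
  have "(nrm (vec_space (sobolev s)) (distr_of (gradvec f)))\<^sup>2 = (\<Sum>j\<in>UNIV. (?c * sqrt (?I j))\<^sup>2)"
    by (simp add: vec_space_def distr_of_gradvec sdistr_sobolev(2)[OF rapid_icoord[OF f]] sum_nonneg)
  also have "\<dots> = ?c\<^sup>2 * (\<Sum>j\<in>UNIV. ?I j)"
    using I0 by (simp add: power_mult_distrib sum_distrib_left)
  also have "(\<Sum>j\<in>UNIV. ?I j) = (LINT \<xi>|lborel. (\<Sum>j\<in>UNIV. sob_weight s \<xi> * (norm (?g j \<xi>))\<^sup>2))"
    by (rule Bochner_Integration.integral_sum[symmetric]) (rule rapid_sobolev_integrable[OF rapid_icoord[OF f]])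
  also have "\<dots> = (LINT \<xi>|lborel. sob_weight s \<xi> * ((norm \<xi>)\<^sup>2 * (norm (f \<xi>))\<^sup>2))"
  proof (intro Bochner_Integration.integral_cong refl)
    fix \<xi> :: "real^'d"
    have "(norm \<xi>)\<^sup>2 = (\<Sum>j\<in>UNIV. (\<xi> $ j)\<^sup>2)"
      by (simp add: norm_vec_def L2_set_def sum_nonneg)
    then show "(\<Sum>j\<in>UNIV. sob_weight s \<xi> * (norm (?g j \<xi>))\<^sup>2) = sob_weight s \<xi> * ((norm \<xi>)\<^sup>2 * (norm (f \<xi>))\<^sup>2)"
      by (simp add: norm_mult power_mult_distrib sum_distrib_left sum_distrib_right)
  qed
  finally show ?thesis .
qed

text \<open>Square integrability with the dual weight makes the test bounded on
  \<open>sobolev s\<close>; integrability of \<open>G\<close> makes it bounded on remainders known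
  only in the supremum norm.\<close>

definition test_function :: "real \<Rightarrow> (real^'d::finite \<Rightarrow> complex) \<Rightarrow> bool"
  where "test_function s G \<longleftrightarrow> G \<in> borel_measurable borel \<and> integrable lborel G \<and>
    integrable lborel (\<lambda>\<xi>. sob_weight (- s) \<xi> * (norm (G \<xi>))\<^sup>2)"

lemma rapid_mult_integrable:
  assumes F: "rapid F" and G: "integrable lborel G"
  shows "integrable lborel (\<lambda>\<xi>. F \<xi> * G \<xi>)"
proof -
  obtain B where B: "\<And>\<xi>. norm (F \<xi>) \<le> B" using rapidE[OF F, of 0] by auto
  note [measurable] = rapid_measurable[OF F] borel_measurable_integrable[OF G]
  show ?thesis
  proof (rule Bochner_Integration.integrable_bound)
    show "integrable lborel (\<lambda>\<xi>. B * norm (G \<xi>))" by (intro integrable_mult_right integrable_norm G)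
    show "AE \<xi> in lborel. norm (F \<xi> * G \<xi>) \<le> norm (B * norm (G \<xi>))"
      using order_trans[OF B abs_ge_self] by (intro AE_I2) (simp add: norm_mult abs_mult mult_right_mono)
  qed measurable
qed

lemma Re_complex_of_real_mult: "Re (complex_of_real c * z) = c * Re z"
  by simp

text \<open>No term of order \<open>\<epsilon>\<close> is present, since the tested unknown will
  have zero datum. The remainder, of order \<open>\<epsilon> ^ 3\<close> uniformly in frequency, is
  integrated against \<open>G\<close> and disappears after division by
  \<open>\<epsilon>\<^sup>2\<close>.\<close>

lemma expansion_limit:
  fixes F2 G :: "real^'d::finite \<Rightarrow> complex"
  assumes G: "test_function s G" and F2: "rapid F2" and e1: "0 < e1"
    and F: "\<And>\<epsilon>. 0 < \<epsilon> \<Longrightarrow> \<epsilon> < e1 \<Longrightarrow> \<exists>F. rapid F \<and> L \<epsilon> = pairing G (sdistr (ift F)) \<and>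
      (\<forall>\<xi>. norm (F \<xi> - complex_of_real (\<epsilon>\<^sup>2) * F2 \<xi>) \<le> M * \<epsilon> ^ 3)"
  shows "((\<lambda>\<epsilon>. L \<epsilon> / \<epsilon>\<^sup>2) \<longlongrightarrow> (2 * pi) ^ CARD('d) * Re (LINT \<xi>|lborel. F2 \<xi> * G \<xi>)) (at_right 0)"
proof -
  let ?c = "(2 * pi) ^ CARD('d) :: real"
  note [measurable] = conjunct1[OF G[unfolded test_function_def]]
  have iG: "integrable lborel G" using G by (simp add: test_function_def)
  note int = rapid_mult_integrable[OF _ iG]
  let ?l = "?c * Re (LINT \<xi>|lborel. F2 \<xi> * G \<xi>)"
  let ?K = "?c * (M * (LINT \<xi>|lborel. norm (G \<xi>)))"
  have est: "\<bar>L \<epsilon> / \<epsilon>\<^sup>2 - ?l\<bar> \<le> ?K * \<epsilon>" if e: "0 < \<epsilon>" "\<epsilon> < e1" for \<epsilon>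
  proof -
    obtain F where F: "rapid F" "L \<epsilon> = pairing G (sdistr (ift F))"
      "\<And>\<xi>. norm (F \<xi> - complex_of_real (\<epsilon>\<^sup>2) * F2 \<xi>) \<le> M * \<epsilon> ^ 3"
      using F[OF e] by blast
    have r: "rapid (\<lambda>\<xi>. F \<xi> - complex_of_real (\<epsilon>\<^sup>2) * F2 \<xi>)"
      using rapid_add[OF F(1) rapid_cmult[OF F2, of "- complex_of_real (\<epsilon>\<^sup>2)"]] by simp
    have "L \<epsilon> = Re (LINT \<xi>|lborel. complex_of_real ?c * F \<xi> * G \<xi>)"
      unfolding F(2) by (rule pairing_eq[OF has_fourier_transform_sdistr[OF F(1)]]) measurable
    also have "\<dots> = Re (complex_of_real ?c * (LINT \<xi>|lborel. F \<xi> * G \<xi>))"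
      by (simp only: mult.assoc integral_mult_right_zero)
    also have "\<dots> = ?c * Re (LINT \<xi>|lborel. F \<xi> * G \<xi>)"
      by (rule Re_complex_of_real_mult)
    finally have Le: "L \<epsilon> = ?c * Re (LINT \<xi>|lborel. F \<xi> * G \<xi>)" .
    have "(LINT \<xi>|lborel. (F \<xi> - complex_of_real (\<epsilon>\<^sup>2) * F2 \<xi>) * G \<xi>)
      = (LINT \<xi>|lborel. F \<xi> * G \<xi>) - (LINT \<xi>|lborel. complex_of_real (\<epsilon>\<^sup>2) * (F2 \<xi> * G \<xi>))"
      unfolding left_diff_distrib mult.assoc
      by (intro Bochner_Integration.integral_diff int F(1) integrable_mult_right F2)
    then have d: "(LINT \<xi>|lborel. F \<xi> * G \<xi>) - complex_of_real (\<epsilon>\<^sup>2) * (LINT \<xi>|lborel. F2 \<xi> * G \<xi>)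
      = (LINT \<xi>|lborel. (F \<xi> - complex_of_real (\<epsilon>\<^sup>2) * F2 \<xi>) * G \<xi>)"
      by (simp only: integral_mult_right_zero)
    have "norm (LINT \<xi>|lborel. (F \<xi> - complex_of_real (\<epsilon>\<^sup>2) * F2 \<xi>) * G \<xi>) \<le> (LINT \<xi>|lborel. (M * \<epsilon> ^ 3) * norm (G \<xi>))"
      by (rule Bochner_Integration.integral_norm_bound_integral[OF int[OF r]])
         (simp_all add: norm_mult iG mult_right_mono[OF F(3)] del: of_real_power)
    then have b: "norm (LINT \<xi>|lborel. (F \<xi> - complex_of_real (\<epsilon>\<^sup>2) * F2 \<xi>) * G \<xi>) \<le> M * \<epsilon> ^ 3 * (LINT \<xi>|lborel. norm (G \<xi>))"
      by simp
    have "L \<epsilon> - \<epsilon>\<^sup>2 * ?l = ?c * Re ((LINT \<xi>|lborel. F \<xi> * G \<xi>) - complex_of_real (\<epsilon>\<^sup>2) * (LINT \<xi>|lborel. F2 \<xi> * G \<xi>))"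
      unfolding Le minus_complex.simps(1) Re_complex_of_real_mult by (simp add: right_diff_distrib)
    also have "\<bar>\<dots>\<bar> \<le> ?c * (M * \<epsilon> ^ 3 * (LINT \<xi>|lborel. norm (G \<xi>)))"
      unfolding d abs_mult using order_trans[OF abs_Re_le_cmod b] by (simp add: mult_left_mono)
    finally have "\<bar>L \<epsilon> - \<epsilon>\<^sup>2 * ?l\<bar> \<le> ?K * \<epsilon> * \<epsilon>\<^sup>2" by (simp add: power2_eq_square power3_eq_cube mult_ac)
    then have "\<bar>L \<epsilon> - \<epsilon>\<^sup>2 * ?l\<bar> / \<epsilon>\<^sup>2 \<le> ?K * \<epsilon>" using e by (subst pos_divide_le_eq) auto
    moreover have "L \<epsilon> / \<epsilon>\<^sup>2 - ?l = (L \<epsilon> - \<epsilon>\<^sup>2 * ?l) / \<epsilon>\<^sup>2" using e by (simp add: diff_divide_distrib)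
    ultimately show ?thesis by (simp only: abs_divide abs_power2)
  qed
  have "((\<lambda>\<epsilon>. L \<epsilon> / \<epsilon>\<^sup>2 - ?l) \<longlongrightarrow> 0) (at_right 0)"
  proof (rule tendsto_rabs_zero_cancel, rule tendsto_sandwich[OF _ _ tendsto_const])
    show "eventually (\<lambda>\<epsilon>. 0 \<le> \<bar>L \<epsilon> / \<epsilon>\<^sup>2 - ?l\<bar>) (at_right 0)" by simp
    show "eventually (\<lambda>\<epsilon>. \<bar>L \<epsilon> / \<epsilon>\<^sup>2 - ?l\<bar> \<le> ?K * \<epsilon>) (at_right 0)"
      unfolding eventually_at_right_field using e1 est by blast
    have "((\<lambda>\<epsilon>. ?K * \<epsilon>) \<longlongrightarrow> ?K * 0) (at_right 0)"
      by (intro tendsto_mult tendsto_const tendsto_ident_at)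
    then show "((\<lambda>\<epsilon>. ?K * \<epsilon>) \<longlongrightarrow> 0) (at_right 0)" by simp
  qed
  then show ?thesis by (rule LIM_zero_cancel)
qed

lemma curve_component:
  fixes s :: real and k :: "'d::finite"
  assumes F: "F \<in> carr (curve_space T (vec_space (sobolev s) :: (('d distr)^'d) nspace))" and t: "t \<in> {0..T}"
  shows "F t $ k \<in> carr (sobolev s)"
    and "nrm (sobolev s) (F t $ k) \<le> nrm (curve_space T (vec_space (sobolev s))) F"
proof -
  let ?V = "vec_space (sobolev s) :: (('d distr)^'d) nspace"
  have "F t \<in> carr ?V" using F t by (simp add: curve_space_def)
  then show "F t $ k \<in> carr (sobolev s)" by (simp add: vec_space_def)
  have "nrm (sobolev s) (F t $ k) \<le> nrm ?V (F t)"
    unfolding vec_space_def snd_conv L2_set_def[symmetric] by (rule member_le_L2_set) auto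
  also have "\<dots> \<le> nrm (curve_space T ?V) F"
    by (rule curve_space_nrm_ge[OF qsnorm_vec_space[OF qsnorm_sobolev] F t])
  finally show "nrm (sobolev s) (F t $ k) \<le> nrm (curve_space T ?V) F" .
qed

lemma cube_space_nrm_ge:
  assumes "qsnorm X" "F \<in> carr (cube_space X)"
  shows "fst F \<in> carr X" "fst (snd F) \<in> carr X"
    and "nrm X (fst F) \<le> nrm (cube_space X) F" "nrm X (fst (snd F)) \<le> nrm (cube_space X) F"
proof -
  show "fst F \<in> carr X" "fst (snd F) \<in> carr X"
    using assms(2) by (auto simp: cube_space_def prod_space_def)
  have "(nrm X (fst F))\<^sup>2 \<le> (nrm X (fst F))\<^sup>2 + ((nrm X (fst (snd F)))\<^sup>2 + (nrm X (snd (snd F)))\<^sup>2)"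
    "(nrm X (fst (snd F)))\<^sup>2 \<le> (nrm X (fst F))\<^sup>2 + ((nrm X (fst (snd F)))\<^sup>2 + (nrm X (snd (snd F)))\<^sup>2)"
    by auto
  then show "nrm X (fst F) \<le> nrm (cube_space X) F" "nrm X (fst (snd F)) \<le> nrm (cube_space X) F"
    by (auto simp: cube_space_def prod_space_def split_beta intro!: real_le_rsqrt)
qed

lemma cube_space_nrm_sq:
  "(nrm (cube_space X) (a, b, c))\<^sup>2 = (nrm X a)\<^sup>2 + (nrm X b)\<^sup>2 + (nrm X c)\<^sup>2"
  by (simp add: cube_space_def prod_space_def)

definition datum :: "'d \<Rightarrow> (real^'d::finite \<Rightarrow> complex) \<Rightarrow> (real^'d \<Rightarrow> complex) \<Rightarrow> (real^'d \<Rightarrow> complex) \<Rightarrow> (('d distr)^'d) \<times> (('d distr)^'d) \<times> (('d distr)^'d)"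
  where "datum k A0 B0 C0 = (distr_of (dirvec k A0), distr_of (dirvec k B0), distr_of (gradvec C0))"

text \<open>The threshold \<open>e1\<close> and the constant \<open>M\<close> depend on the data.
  This is harmless: the quadratic bound uses only the limit as \<open>\<epsilon>\<close> tends to 0
  for fixed data, and its own constant does not see them.\<close>

lemma flow_map_C2E:
  fixes \<alpha> \<beta> \<gamma> s :: real and k :: "'d::finite"
  assumes "flow_map_C2 TYPE('d) \<alpha> \<beta> \<gamma> s"
  obtains T S where "0 < T"
    "C2_near_0 (cube_space (vec_space (sobolev s) :: (('d distr)^'d) nspace)) (cube_space (curve_space T (vec_space (sobolev s)))) S"
    "\<And>A0 B0 C0. cutoff_data A0 \<Longrightarrow> cutoff_data B0 \<Longrightarrow> cutoff_data C0 \<Longrightarrow>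
      \<exists>e1>0. \<exists>M. \<forall>\<epsilon>. 0 < \<epsilon> \<and> \<epsilon> < e1 \<longrightarrow> (\<exists>A B C. (\<forall>t. rapid (A t) \<and> rapid (B t)) \<and>
        S (\<epsilon> *\<^sub>R datum k A0 B0 C0) = (distr_curve T (\<lambda>t. dirvec k (A t)), distr_curve T (\<lambda>t. dirvec k (B t)), distr_curve T (\<lambda>t. gradvec (C t))) \<and>
        (\<forall>t \<xi>. norm (A t \<xi> - complex_of_real \<epsilon> * free T \<alpha> A0 t \<xi> - complex_of_real (\<epsilon>\<^sup>2) * qdiv T \<alpha> (free T \<gamma> C0) (free T \<beta> B0) t \<xi>) \<le> M * \<epsilon> ^ 3) \<and>
        (\<forall>t \<xi>. norm (B t \<xi> - complex_of_real \<epsilon> * free T \<beta> B0 t \<xi> - complex_of_real (\<epsilon>\<^sup>2) * qdiv T \<beta> (crefl (free T \<gamma> C0)) (free T \<alpha> A0) t \<xi>) \<le> M * \<epsilon> ^ 3))"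
proof -
  let ?Hs = "vec_space (sobolev s) :: (('d distr)^'d) nspace"
  let ?X = "cube_space ?Hs"
  obtain T \<rho> S where T: "0 < T" and \<rho>: "0 < \<rho>" and C2: "C2_near_0 ?X (cube_space (curve_space T ?Hs)) S"
    and S: "\<And>u0 v0 w0 u v w. H_infty u0 \<Longrightarrow> H_infty v0 \<Longrightarrow> H_infty w0 \<Longrightarrow>
       nrm ?X (distr_of u0, distr_of v0, distr_of w0) \<le> \<rho> \<Longrightarrow> smooth_solution \<alpha> \<beta> \<gamma> T u0 v0 w0 u v w \<Longrightarrow>
       S (distr_of u0, distr_of v0, distr_of w0) = (distr_curve T u, distr_curve T v, distr_curve T w)"
    using assms unfolding flow_map_C2_def Let_def by blast
  have T0: "0 \<le> T" using T by simp
  have X: "qsnorm ?X" by (intro qsnorm_cube_space qsnorm_vec_space qsnorm_sobolev)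
  have main: "\<exists>e1>0. \<exists>M. \<forall>\<epsilon>. 0 < \<epsilon> \<and> \<epsilon> < e1 \<longrightarrow> (\<exists>A B C. (\<forall>t. rapid (A t) \<and> rapid (B t)) \<and>
        S (\<epsilon> *\<^sub>R datum k A0 B0 C0) = (distr_curve T (\<lambda>t. dirvec k (A t)), distr_curve T (\<lambda>t. dirvec k (B t)), distr_curve T (\<lambda>t. gradvec (C t))) \<and>
        (\<forall>t \<xi>. norm (A t \<xi> - complex_of_real \<epsilon> * free T \<alpha> A0 t \<xi> - complex_of_real (\<epsilon>\<^sup>2) * qdiv T \<alpha> (free T \<gamma> C0) (free T \<beta> B0) t \<xi>) \<le> M * \<epsilon> ^ 3) \<and>
        (\<forall>t \<xi>. norm (B t \<xi> - complex_of_real \<epsilon> * free T \<beta> B0 t \<xi> - complex_of_real (\<epsilon>\<^sup>2) * qdiv T \<beta> (crefl (free T \<gamma> C0)) (free T \<alpha> A0) t \<xi>) \<le> M * \<epsilon> ^ 3))"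
    if A0: "cutoff_data A0" and B0: "cutoff_data B0" and C0: "cutoff_data C0" for A0 B0 C0
  proof -
    obtain DA DB DC where DA: "decays T 1 DA (free T \<alpha> A0)" and DB: "decays T 1 DB (free T \<beta> B0)" and DC: "decays T 2 DC (free T \<gamma> C0)"
      using cutoff_data_decays[OF A0 T0] cutoff_data_decays[OF B0 T0] cutoff_data_decays[OF C0 T0] by meson
    define D where "D = max DA (max DB DC)"
    interpret fourier_system T \<alpha> \<beta> \<gamma> D A0 B0 C0
    proof
      show "decays T 1 D (free T \<alpha> A0)" by (rule decays_mono[OF DA]) (simp add: D_def)
      show "decays T 1 D (free T \<beta> B0)" by (rule decays_mono[OF DB]) (simp add: D_def)
      show "decays T 2 D (free T \<gamma> C0)" by (rule decays_mono[OF DC]) (simp add: D_def)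
    qed (rule T0)
    obtain e0 N where e0: "0 < e0" and N: "0 \<le> N"
      and sol: "\<And>\<epsilon>. 0 < \<epsilon> \<Longrightarrow> \<epsilon> \<le> e0 \<Longrightarrow> \<exists>A B C. solves \<epsilon> A B C \<and> decays T 1 (N * \<epsilon>) A \<and> decays T 1 (N * \<epsilon>) B \<and> decays T 2 (N * \<epsilon>) C"
      using small_solution by blast
    let ?h = "datum k A0 B0 C0"
    have rA0: "rapid A0" and rB0: "rapid B0" and rC0: "rapid C0"
      by (rule cutoff_data_rapid[OF A0], rule cutoff_data_rapid[OF B0], rule cutoff_data_rapid[OF C0])
    have hX: "?h \<in> carr ?X"
      by (simp add: datum_def cube_space_def prod_space_def dirvec_carr[OF rA0] dirvec_carr[OF rB0] gradvec_carr[OF rC0])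
    define n where "n = nrm ?X ?h"
    have n: "0 \<le> n" unfolding n_def by (rule qsnormD(5)[OF X hX])
    \<comment> \<open>The first entry permits the fixed point argument, the second keeps the scaled
      datum inside the ball of radius \<open>\<rho>\<close>.\<close>
    define e1 where "e1 = min e0 (\<rho> / (n + 1))"
    have e1: "0 < e1" using e0 \<rho> n by (simp add: e1_def)
    define M where "M = conv_const TYPE('d) * conv_const TYPE('d) * (N + D) ^ 3"
    have M: "0 \<le> M" unfolding M_def using N D_nonneg conv_const_nonneg[where 'd = 'd] by simp
    have "\<exists>A B C. (\<forall>t. rapid (A t) \<and> rapid (B t)) \<and>
        S (\<epsilon> *\<^sub>R ?h) = (distr_curve T (\<lambda>t. dirvec k (A t)), distr_curve T (\<lambda>t. dirvec k (B t)), distr_curve T (\<lambda>t. gradvec (C t))) \<and>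
        (\<forall>t \<xi>. norm (A t \<xi> - complex_of_real \<epsilon> * free T \<alpha> A0 t \<xi> - complex_of_real (\<epsilon>\<^sup>2) * qdiv T \<alpha> (free T \<gamma> C0) (free T \<beta> B0) t \<xi>) \<le> M * \<epsilon> ^ 3) \<and>
        (\<forall>t \<xi>. norm (B t \<xi> - complex_of_real \<epsilon> * free T \<beta> B0 t \<xi> - complex_of_real (\<epsilon>\<^sup>2) * qdiv T \<beta> (crefl (free T \<gamma> C0)) (free T \<alpha> A0) t \<xi>) \<le> M * \<epsilon> ^ 3)"
      if e: "0 < \<epsilon>" "\<epsilon> < e1" for \<epsilon>
    proof -
      obtain A B C where s: "solves \<epsilon> A B C" and A: "decays T 1 (N * \<epsilon>) A" and B: "decays T 1 (N * \<epsilon>) B" and C: "decays T 2 (N * \<epsilon>) C"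
        using sol[of \<epsilon>] e by (auto simp: e1_def)
      note init = solves_initial[OF s]
      have sm: "smooth_solution \<alpha> \<beta> \<gamma> T (dirvec k (A 0)) (dirvec k (B 0)) (gradvec (C 0))
        (\<lambda>t. dirvec k (A t)) (\<lambda>t. dirvec k (B t)) (\<lambda>t. gradvec (C t))"
        by (rule smooth_solution_of_solves[OF s A B C])
      have eh: "(distr_of (dirvec k (A 0)), distr_of (dirvec k (B 0)), distr_of (gradvec (C 0))) = \<epsilon> *\<^sub>R ?h"
        unfolding init distr_of_dirvec_scale distr_of_gradvec_scale datum_def by simp
      have Hinf: "H_infty (dirvec k f)" "H_infty (gradvec f)" if "rapid f" for f
        unfolding dirvec_def gradvec_def by (intro H_infty_vift rapid_if rapid_icoord that)+
      have r: "rapid (A t)" "rapid (B t)" "rapid (C t)" for t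
        by (rule decays_rapid[OF A T0], rule decays_rapid[OF B T0], rule decays_rapid[OF C T0])
      have "nrm ?X (\<epsilon> *\<^sub>R ?h) \<le> \<bar>\<epsilon>\<bar> * n" unfolding n_def by (rule qsnormD(4)[OF X hX])
      also have "\<dots> \<le> \<epsilon> * (n + 1)" using e by simp
      also have "\<dots> \<le> \<rho> / (n + 1) * (n + 1)" using e n by (intro mult_right_mono) (auto simp: e1_def)
      also have "\<dots> = \<rho>" using n by simp
      finally have "S (\<epsilon> *\<^sub>R ?h) = (distr_curve T (\<lambda>t. dirvec k (A t)), distr_curve T (\<lambda>t. dirvec k (B t)), distr_curve T (\<lambda>t. gradvec (C t)))"
        unfolding eh[symmetric] by (intro S Hinf r sm)
      moreover have le: "norm (R t \<xi>) \<le> M * \<epsilon> ^ 3" if R: "decays T 1 (M * \<epsilon> ^ 3) R" for R t and \<xi> :: "real^'d"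
      proof -
        have p: "0 \<le> M * \<epsilon> ^ 3" using M e by simp
        have "norm (R t \<xi>) \<le> M * \<epsilon> ^ 3 / decay_weight \<xi>"
          using decays_power_bound[OF R T0, of \<xi> 0] by simp
        also have "\<dots> \<le> M * \<epsilon> ^ 3 / 1"
          using p decay_weight_ge_1[of \<xi>] by (intro divide_left_mono) auto
        finally show ?thesis by simp
      qed
      ultimately show ?thesis
        using r le[OF second_order(1)[OF s e(1) A B C N, folded M_def]] le[OF second_order(2)[OF s e(1) A B C N, folded M_def]]
        by (intro exI[of _ A] exI[of _ B] exI[of _ C] conjI allI)
    qed
    then show ?thesis using e1 by blast
  qed
  show ?thesis by (rule that[OF T C2 main])
qed

text \<open>\<open>Q\<close> is the transform of a component of \<open>u\<close> or \<open>v\<close>, but \<open>P\<close> that of the potential of \<open>w\<close>; hence the factor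
  \<open>\<bar>\<xi>\<bar>\<^sup>2\<close> in the last integral.\<close>

definition bilinear_bound ::
    "real \<Rightarrow> real \<Rightarrow> real \<Rightarrow> ((real^'d::finite \<Rightarrow> complex) \<Rightarrow> (real^'d \<Rightarrow> complex) \<Rightarrow> real \<Rightarrow> real^'d \<Rightarrow> complex) \<Rightarrow> bool"
  where "bilinear_bound T K s B \<longleftrightarrow>
    (\<forall>P Q G t. cutoff_data P \<and> cutoff_data Q \<and> test_function s G \<and> t \<in> {0..T} \<longrightarrow>
      \<bar>Re (LINT \<xi>|lborel. B P Q t \<xi> * G \<xi>)\<bar>
        \<le> K * sqrt (LINT \<xi>|lborel. sob_weight (- s) \<xi> * (norm (G \<xi>))\<^sup>2) *
          ((LINT \<xi>|lborel. sob_weight s \<xi> * (norm (Q \<xi>))\<^sup>2) + (LINT \<xi>|lborel. sob_weight s \<xi> * ((norm \<xi>)\<^sup>2 * (norm (P \<xi>))\<^sup>2))))"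

text \<open>Testing u with the data (0, Q, P) isolates the first Duhamel term, testing v with (Q, 0,
  P) the second. The data enter through the sum of their squared norms and not through a product,
  because the bound evaluates a quadratic form at a single vector.\<close>

lemma flow_map_C2_bounds:
  fixes \<alpha> \<beta> \<gamma> s :: real
  assumes flow: "flow_map_C2 TYPE('d::finite) \<alpha> \<beta> \<gamma> s"
  obtains T K where "0 < T"
    "bilinear_bound T K s (\<lambda>P (Q :: real^'d \<Rightarrow> complex). qdiv T \<alpha> (free T \<gamma> P) (free T \<beta> Q))"
    "bilinear_bound T K s (\<lambda>P (Q :: real^'d \<Rightarrow> complex). qdiv T \<beta> (crefl (free T \<gamma> P)) (free T \<alpha> Q))"
proof -
  fix k :: 'd
  let ?Hs = "vec_space (sobolev s) :: (('d distr)^'d) nspace"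
  let ?X = "cube_space ?Hs"
  let ?c = "(2 * pi) ^ CARD('d) :: real"
  obtain T S where T: "0 < T" and C2: "C2_near_0 ?X (cube_space (curve_space T ?Hs)) S"
    and exp: "\<And>A0 B0 C0. cutoff_data A0 \<Longrightarrow> cutoff_data B0 \<Longrightarrow> cutoff_data C0 \<Longrightarrow>
      \<exists>e1>0. \<exists>M. \<forall>\<epsilon>. 0 < \<epsilon> \<and> \<epsilon> < e1 \<longrightarrow> (\<exists>A B C. (\<forall>t. rapid (A t) \<and> rapid (B t)) \<and>
        S (\<epsilon> *\<^sub>R datum k A0 B0 C0) = (distr_curve T (\<lambda>t. dirvec k (A t)), distr_curve T (\<lambda>t. dirvec k (B t)), distr_curve T (\<lambda>t. gradvec (C t))) \<and>
        (\<forall>t \<xi>. norm (A t \<xi> - complex_of_real \<epsilon> * free T \<alpha> A0 t \<xi> - complex_of_real (\<epsilon>\<^sup>2) * qdiv T \<alpha> (free T \<gamma> C0) (free T \<beta> B0) t \<xi>) \<le> M * \<epsilon> ^ 3) \<and>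
        (\<forall>t \<xi>. norm (B t \<xi> - complex_of_real \<epsilon> * free T \<beta> B0 t \<xi> - complex_of_real (\<epsilon>\<^sup>2) * qdiv T \<beta> (crefl (free T \<gamma> C0)) (free T \<alpha> A0) t \<xi>) \<le> M * \<epsilon> ^ 3))"
    using flow_map_C2E[OF flow, of k] by blast
  have T0: "0 \<le> T" using T by simp
  let ?Z = "curve_space T ?Hs"
  let ?Y = "cube_space ?Z"
  have X: "qsnorm ?X" by (intro qsnorm_cube_space qsnorm_vec_space qsnorm_sobolev)
  have Z: "qsnorm ?Z" by (intro qsnorm_curve_space qsnorm_vec_space qsnorm_sobolev T0)
  have Y: "qsnorm ?Y" by (intro qsnorm_cube_space Z)
  obtain K where K: "\<And>h l M c. h \<in> carr ?X \<Longrightarrow>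
      (\<And>y z. y \<in> carr ?Y \<Longrightarrow> z \<in> carr ?Y \<Longrightarrow> l (y + z) = l y + l z) \<Longrightarrow>
      (\<And>r y. y \<in> carr ?Y \<Longrightarrow> l (r *\<^sub>R y) = r * l y) \<Longrightarrow>
      (\<And>y. y \<in> carr ?Y \<Longrightarrow> \<bar>l y\<bar> \<le> M * nrm ?Y y) \<Longrightarrow> 0 \<le> M \<Longrightarrow>
      ((\<lambda>\<epsilon>. l (S (\<epsilon> *\<^sub>R h)) / \<epsilon>\<^sup>2) \<longlongrightarrow> c) (at_right 0) \<Longrightarrow> \<bar>c\<bar> \<le> K * M * (nrm ?X h)\<^sup>2"
    using C2_quadratic_bound[OF X Y C2] by blast
  let ?I = "\<lambda>s f. LINT \<xi>|lborel. sob_weight s \<xi> * (norm (f \<xi>))\<^sup>2"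
  let ?J = "\<lambda>f. LINT \<xi>|lborel. sob_weight s \<xi> * ((norm \<xi>)\<^sup>2 * (norm (f \<xi>))\<^sup>2)"
  have cpos: "0 < ?c" by simp
  \<comment> \<open>\<open>pr\<close> stands for the projection to the first or the second unknown,
    so that one argument serves both bounds.\<close>
  have core: "\<bar>Re (LINT \<xi>|lborel. F2 \<xi> * G \<xi>)\<bar> \<le> K * ?c * sqrt (?I (- s) G) * (?I s A0 + ?I s B0 + ?J C0)"
    if A0: "cutoff_data A0" and B0: "cutoff_data B0" and C0: "cutoff_data C0" and G: "test_function s G" and t: "t \<in> {0..T}"
      and pr: "\<And>y. y \<in> carr ?Y \<Longrightarrow> pr y \<in> carr ?Z" "\<And>y z. pr (y + z) = pr y + pr z" "\<And>r y. pr (r *\<^sub>R y) = r *\<^sub>R pr y"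
        "\<And>y. y \<in> carr ?Y \<Longrightarrow> nrm ?Z (pr y) \<le> nrm ?Y y"
      and F2: "rapid F2" and e1: "0 < e1"
      and F: "\<And>\<epsilon>. 0 < \<epsilon> \<Longrightarrow> \<epsilon> < e1 \<Longrightarrow> \<exists>F. rapid F \<and> pr (S (\<epsilon> *\<^sub>R datum k A0 B0 C0)) t $ k = sdistr (ift F) \<and>
        (\<forall>\<xi>. norm (F \<xi> - complex_of_real (\<epsilon>\<^sup>2) * F2 \<xi>) \<le> M * \<epsilon> ^ 3)"
    for A0 B0 C0 F2 G :: "real^'d \<Rightarrow> complex" and t e1 M :: real
      and pr :: "(real \<Rightarrow> (('d distr)^'d)) \<times> (real \<Rightarrow> (('d distr)^'d)) \<times> (real \<Rightarrow> (('d distr)^'d)) \<Rightarrow> (real \<Rightarrow> (('d distr)^'d))"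
  proof -
    let ?h = "datum k A0 B0 C0"
    let ?l = "\<lambda>y. pairing G (pr y t $ k)"
    have rA0: "rapid A0" and rB0: "rapid B0" and rC0: "rapid C0"
      by (rule cutoff_data_rapid[OF A0], rule cutoff_data_rapid[OF B0], rule cutoff_data_rapid[OF C0])
    have Gm: "G \<in> borel_measurable borel" "integrable lborel (\<lambda>\<xi>. sob_weight (- s) \<xi> * (norm (G \<xi>))\<^sup>2)"
      using G by (simp_all add: test_function_def)
    have hX: "?h \<in> carr ?X"
      by (simp add: datum_def cube_space_def prod_space_def dirvec_carr[OF rA0] dirvec_carr[OF rB0] gradvec_carr[OF rC0])
    have comp: "pr y t $ k \<in> carr (sobolev s)" "nrm (sobolev s) (pr y t $ k) \<le> nrm ?Y y" if y: "y \<in> carr ?Y" for y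
      using curve_component[OF pr(1)[OF y] t] pr(4)[OF y] order_trans by blast+
    have "\<bar>?c * Re (LINT \<xi>|lborel. F2 \<xi> * G \<xi>)\<bar> \<le> K * sqrt (?I (- s) G) * (nrm ?X ?h)\<^sup>2"
    proof (rule K[OF hX, of ?l])
      show "?l (y + z) = ?l y + ?l z" if "y \<in> carr ?Y" "z \<in> carr ?Y" for y z
        unfolding pr(2) using pairing_add[OF Gm comp(1)[OF that(1)] comp(1)[OF that(2)]] by simp
      show "?l (r *\<^sub>R y) = r * ?l y" if "y \<in> carr ?Y" for r y
        unfolding pr(3) using pairing_scale[OF Gm(1) comp(1)[OF that]] by (simp add: scaleR_fun_def[where 'b = "('d distr)^'d"])
      show "\<bar>?l y\<bar> \<le> sqrt (?I (- s) G) * nrm ?Y y" if y: "y \<in> carr ?Y" for y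
      proof -
        have "0 \<le> sqrt (?I (- s) G)"
          by (intro real_sqrt_ge_zero Bochner_Integration.integral_nonneg) (simp add: less_imp_le[OF sob_weight_pos])
        then show ?thesis
          using pairing_bound[OF Gm comp(1)[OF y]] mult_left_mono[OF comp(2)[OF y]] order_trans by blast
      qed
      show "0 \<le> sqrt (?I (- s) G)"
        by (intro real_sqrt_ge_zero Bochner_Integration.integral_nonneg) (simp add: less_imp_le[OF sob_weight_pos])
      show "((\<lambda>\<epsilon>. ?l (S (\<epsilon> *\<^sub>R ?h)) / \<epsilon>\<^sup>2) \<longlongrightarrow> ?c * Re (LINT \<xi>|lborel. F2 \<xi> * G \<xi>)) (at_right 0)"
      proof (rule expansion_limit[OF G F2 e1, where M = M])
        fix \<epsilon> :: real assume "0 < \<epsilon>" "\<epsilon> < e1"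
        then obtain F where "rapid F" "pr (S (\<epsilon> *\<^sub>R ?h)) t $ k = sdistr (ift F)"
          "\<forall>\<xi>. norm (F \<xi> - complex_of_real (\<epsilon>\<^sup>2) * F2 \<xi>) \<le> M * \<epsilon> ^ 3"
          using F by blast
        then show "\<exists>F. rapid F \<and> ?l (S (\<epsilon> *\<^sub>R ?h)) = pairing G (sdistr (ift F)) \<and> (\<forall>\<xi>. norm (F \<xi> - complex_of_real (\<epsilon>\<^sup>2) * F2 \<xi>) \<le> M * \<epsilon> ^ 3)"
          by (intro exI[of _ F]) simp
      qed
    qed
    also have "(nrm ?X ?h)\<^sup>2 = ?c\<^sup>2 * (?I s A0 + ?I s B0 + ?J C0)"
      unfolding datum_def cube_space_nrm_sq dirvec_nrm[OF rA0] dirvec_nrm[OF rB0] gradvec_nrm[OF rC0]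
      by (simp only: distrib_left)
    finally have "?c * \<bar>Re (LINT \<xi>|lborel. F2 \<xi> * G \<xi>)\<bar> \<le> ?c * (K * ?c * sqrt (?I (- s) G) * (?I s A0 + ?I s B0 + ?J C0))"
      unfolding abs_mult abs_of_pos[OF cpos] by (simp only: power2_eq_square mult_ac)
    then show ?thesis using cpos by (rule mult_left_le_imp_le)
  qed
  have rq: "rapid (qdiv T \<kappa> (free T \<gamma> P) (free T \<kappa>' Q) t)" "rapid (qdiv T \<kappa> (crefl (free T \<gamma> P)) (free T \<kappa>' Q) t)"
    if P: "cutoff_data P" and Q: "cutoff_data Q" for P Q :: "real^'d \<Rightarrow> complex" and t \<kappa> \<kappa>'
  proof -
    obtain DP DQ where DP: "decays T 2 DP (free T \<gamma> P)" and DQ: "decays T 1 DQ (free T \<kappa>' Q)"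
      using cutoff_data_decays[OF P T0] cutoff_data_decays[OF Q T0] by meson
    show "rapid (qdiv T \<kappa> (free T \<gamma> P) (free T \<kappa>' Q) t)"
      by (rule decays_rapid[OF decays_qdiv[OF DP DQ T0] T0])
    show "rapid (qdiv T \<kappa> (crefl (free T \<gamma> P)) (free T \<kappa>' Q) t)"
      by (rule decays_rapid[OF decays_qdiv[OF decays_crefl[OF DP] DQ T0] T0])
  qed
  have dc: "distr_curve T (\<lambda>t. dirvec k (A t)) t $ k = sdistr (ift (A t))" if "t \<in> {0..T}" for A :: "real \<Rightarrow> real^'d \<Rightarrow> complex" and t
    using that by (simp add: distr_curve_def distr_of_dirvec)
  have free0: "free T \<kappa> (\<lambda>\<xi>. 0) t \<xi> = 0" for \<kappa> t and \<xi> :: "real^'d" by (simp add: free_def)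
  have 1: "\<bar>Re (LINT \<xi>|lborel. qdiv T \<alpha> (free T \<gamma> P) (free T \<beta> Q) t \<xi> * G \<xi>)\<bar> \<le> (K * ?c) * sqrt (?I (- s) G) * (?I s Q + ?J P)"
    if P: "cutoff_data P" and Q: "cutoff_data Q" and G: "test_function s G" and t: "t \<in> {0..T}" for P Q G :: "real^'d \<Rightarrow> complex" and t
  proof -
    obtain e1 M where e1: "0 < e1" and E: "\<And>\<epsilon>. 0 < \<epsilon> \<Longrightarrow> \<epsilon> < e1 \<Longrightarrow> \<exists>A B C. (\<forall>t. rapid (A t) \<and> rapid (B t)) \<and>
        S (\<epsilon> *\<^sub>R datum k (\<lambda>\<xi>. 0) Q P) = (distr_curve T (\<lambda>t. dirvec k (A t)), distr_curve T (\<lambda>t. dirvec k (B t)), distr_curve T (\<lambda>t. gradvec (C t))) \<and>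
        (\<forall>t \<xi>. norm (A t \<xi> - complex_of_real \<epsilon> * free T \<alpha> (\<lambda>\<xi>. 0) t \<xi> - complex_of_real (\<epsilon>\<^sup>2) * qdiv T \<alpha> (free T \<gamma> P) (free T \<beta> Q) t \<xi>) \<le> M * \<epsilon> ^ 3)"
      by (rule exE[OF exp[OF cutoff_data_zero Q P]], elim conjE exE) (rule that, assumption, blast)
    have "\<bar>Re (LINT \<xi>|lborel. qdiv T \<alpha> (free T \<gamma> P) (free T \<beta> Q) t \<xi> * G \<xi>)\<bar>
      \<le> K * ?c * sqrt (?I (- s) G) * (?I s (\<lambda>\<xi> :: real^'d. 0 :: complex) + ?I s Q + ?J P)"
    proof (rule core[where ?pr2 = fst, OF cutoff_data_zero Q P G t _ _ _ _ rq(1)[OF P Q] e1])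
      fix \<epsilon> :: real assume e: "0 < \<epsilon>" "\<epsilon> < e1"
      obtain A B C where ABC: "\<forall>t. rapid (A t) \<and> rapid (B t)"
        "S (\<epsilon> *\<^sub>R datum k (\<lambda>\<xi>. 0) Q P) = (distr_curve T (\<lambda>t. dirvec k (A t)), distr_curve T (\<lambda>t. dirvec k (B t)), distr_curve T (\<lambda>t. gradvec (C t)))"
        "\<forall>t \<xi>. norm (A t \<xi> - complex_of_real \<epsilon> * free T \<alpha> (\<lambda>\<xi>. 0) t \<xi> - complex_of_real (\<epsilon>\<^sup>2) * qdiv T \<alpha> (free T \<gamma> P) (free T \<beta> Q) t \<xi>) \<le> M * \<epsilon> ^ 3"
        using E[OF e] by blast
      then show "\<exists>F. rapid F \<and> fst (S (\<epsilon> *\<^sub>R datum k (\<lambda>\<xi>. 0) Q P)) t $ k = sdistr (ift F) \<and>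
        (\<forall>\<xi>. norm (F \<xi> - complex_of_real (\<epsilon>\<^sup>2) * qdiv T \<alpha> (free T \<gamma> P) (free T \<beta> Q) t \<xi>) \<le> M * \<epsilon> ^ 3)"
        by (intro exI[of _ "A t"]) (simp add: dc[OF t] free0)
    qed (auto intro: cube_space_nrm_ge[OF Z])
    then show ?thesis by simp
  qed
  have 2: "\<bar>Re (LINT \<xi>|lborel. qdiv T \<beta> (crefl (free T \<gamma> P)) (free T \<alpha> Q) t \<xi> * G \<xi>)\<bar> \<le> (K * ?c) * sqrt (?I (- s) G) * (?I s Q + ?J P)"
    if P: "cutoff_data P" and Q: "cutoff_data Q" and G: "test_function s G" and t: "t \<in> {0..T}" for P Q G :: "real^'d \<Rightarrow> complex" and t
  proof -
    obtain e1 M where e1: "0 < e1" and E: "\<And>\<epsilon>. 0 < \<epsilon> \<Longrightarrow> \<epsilon> < e1 \<Longrightarrow> \<exists>A B C. (\<forall>t. rapid (A t) \<and> rapid (B t)) \<and>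
        S (\<epsilon> *\<^sub>R datum k Q (\<lambda>\<xi>. 0) P) = (distr_curve T (\<lambda>t. dirvec k (A t)), distr_curve T (\<lambda>t. dirvec k (B t)), distr_curve T (\<lambda>t. gradvec (C t))) \<and>
        (\<forall>t \<xi>. norm (B t \<xi> - complex_of_real \<epsilon> * free T \<beta> (\<lambda>\<xi>. 0) t \<xi> - complex_of_real (\<epsilon>\<^sup>2) * qdiv T \<beta> (crefl (free T \<gamma> P)) (free T \<alpha> Q) t \<xi>) \<le> M * \<epsilon> ^ 3)"
      by (rule exE[OF exp[OF Q cutoff_data_zero P]], elim conjE exE) (rule that, assumption, blast)
    have "\<bar>Re (LINT \<xi>|lborel. qdiv T \<beta> (crefl (free T \<gamma> P)) (free T \<alpha> Q) t \<xi> * G \<xi>)\<bar>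
      \<le> K * ?c * sqrt (?I (- s) G) * (?I s Q + ?I s (\<lambda>\<xi> :: real^'d. 0 :: complex) + ?J P)"
    proof (rule core[where ?pr2 = "\<lambda>y. fst (snd y)", OF Q cutoff_data_zero P G t _ _ _ _ rq(2)[OF P Q] e1])
      fix \<epsilon> :: real assume e: "0 < \<epsilon>" "\<epsilon> < e1"
      obtain A B C where ABC: "\<forall>t. rapid (A t) \<and> rapid (B t)"
        "S (\<epsilon> *\<^sub>R datum k Q (\<lambda>\<xi>. 0) P) = (distr_curve T (\<lambda>t. dirvec k (A t)), distr_curve T (\<lambda>t. dirvec k (B t)), distr_curve T (\<lambda>t. gradvec (C t)))"
        "\<forall>t \<xi>. norm (B t \<xi> - complex_of_real \<epsilon> * free T \<beta> (\<lambda>\<xi>. 0) t \<xi> - complex_of_real (\<epsilon>\<^sup>2) * qdiv T \<beta> (crefl (free T \<gamma> P)) (free T \<alpha> Q) t \<xi>) \<le> M * \<epsilon> ^ 3"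
        using E[OF e] by blast
      then show "\<exists>F. rapid F \<and> fst (snd (S (\<epsilon> *\<^sub>R datum k Q (\<lambda>\<xi>. 0) P))) t $ k = sdistr (ift F) \<and>
        (\<forall>\<xi>. norm (F \<xi> - complex_of_real (\<epsilon>\<^sup>2) * qdiv T \<beta> (crefl (free T \<gamma> P)) (free T \<alpha> Q) t \<xi>) \<le> M * \<epsilon> ^ 3)"
        by (intro exI[of _ "B t"]) (simp add: dc[OF t] free0)
    qed (auto intro: cube_space_nrm_ge[OF Z])
    then show ?thesis by simp
  qed
  have "bilinear_bound T (K * ?c) s (\<lambda>P (Q :: real^'d \<Rightarrow> complex). qdiv T \<alpha> (free T \<gamma> P) (free T \<beta> Q))"
    unfolding bilinear_bound_def by (intro allI impI, elim conjE, rule 1)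
  moreover have "bilinear_bound T (K * ?c) s (\<lambda>P (Q :: real^'d \<Rightarrow> complex). qdiv T \<beta> (crefl (free T \<gamma> P)) (free T \<alpha> Q))"
    unfolding bilinear_bound_def by (intro allI impI, elim conjE, rule 2)
  ultimately show ?thesis by (rule that[OF T])
qed


section \<open>Growth of the second iterate\<close>

text \<open>\<open>pi / 3\<close> exceeds 1.\<close>

lemma cos_ge_half:
  fixes x :: real
  assumes "\<bar>x\<bar> \<le> 1"
  shows "1 / 2 \<le> cos x"
proof -
  have "cos (pi / 3) \<le> cos \<bar>x\<bar>"
    using assms pi_gt3 by (intro cos_monotone_0_pi_le) auto
  then show ?thesis by (simp add: cos_60)
qed

text \<open>The factor \<open>\<i> * cis (a * t * (norm \<xi>)\<^sup>2)\<close> cancels the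
  prefactor of the Duhamel integral. What remains integrates a nonnegative density times
  \<open>cis\<close> of time times phase, and a cosine of at least 1/2 rules out cancellation.
  Integrability is a premise in the assumption on \<open>m\<close> because it follows from the
  cutoff hypotheses inside the proof.\<close>

lemma qdiv_free_Re_ge:
  fixes P Q :: "real^'d::finite \<Rightarrow> real"
  assumes P: "cutoff_data (\<lambda>\<eta>. complex_of_real (P \<eta>))" and Q: "cutoff_data (\<lambda>\<eta>. complex_of_real (Q \<eta>))"
    and P0: "\<And>\<eta>. 0 \<le> P \<eta>" and Q0: "\<And>\<eta>. 0 \<le> Q \<eta>" and t: "t \<in> {0..T}"
    and phase: "\<And>\<tau> \<eta>. \<tau> \<in> {0..t} \<Longrightarrow> P \<eta> \<noteq> 0 \<Longrightarrow> Q (\<xi> - \<eta>) \<noteq> 0 \<Longrightarrow>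
      1 / 2 \<le> cos (\<tau> * (a * (norm \<xi>)\<^sup>2 - g * (norm \<eta>)\<^sup>2 - b * (norm (\<xi> - \<eta>))\<^sup>2))"
    and m: "integrable lborel (\<lambda>\<eta>. (norm \<eta>)\<^sup>2 * P \<eta> * Q (\<xi> - \<eta>)) \<Longrightarrow> m \<le> (LINT \<eta>|lborel. (norm \<eta>)\<^sup>2 * P \<eta> * Q (\<xi> - \<eta>))"
  shows "t * m / 2 \<le> Re (qdiv T a (free T g (\<lambda>\<eta>. complex_of_real (P \<eta>))) (free T b (\<lambda>\<eta>. complex_of_real (Q \<eta>))) t \<xi> * (\<i> * cis (a * t * (norm \<xi>)\<^sup>2)))"
proof -
  let ?P = "\<lambda>\<eta>. complex_of_real (P \<eta>)" and ?Q = "\<lambda>\<eta>. complex_of_real (Q \<eta>)"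
  let ?c = "conv (lap (free T g ?P)) (free T b ?Q)"
  let ?\<Phi> = "\<lambda>\<eta>. a * (norm \<xi>)\<^sup>2 - g * (norm \<eta>)\<^sup>2 - b * (norm (\<xi> - \<eta>))\<^sup>2"
  have T: "0 \<le> T" and t0: "0 \<le> t" using t by auto
  obtain DP where DP: "decays T 2 DP (free T g ?P)" using cutoff_data_decays[OF P T] by blast
  obtain DQ where DQ: "decays T 0 DQ (free T b ?Q)" using cutoff_data_decays[OF Q T] by blast
  have cc: "continuous_on {0..t} (\<lambda>\<tau>. cis (a * \<tau> * (norm \<xi>)\<^sup>2) * ?c \<tau> \<xi>)"
    by (intro continuous_intros decays_comp[OF decays_conv[OF decays_lap[OF DP] DQ T]])
  have eq: "cis (a * \<tau> * (norm \<xi>)\<^sup>2) * (lap (free T g ?P) \<tau> \<eta> * free T b ?Q \<tau> (\<xi> - \<eta>))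
      = complex_of_real ((norm \<eta>)\<^sup>2 * P \<eta> * Q (\<xi> - \<eta>)) * cis (\<tau> * ?\<Phi> \<eta>)" if "\<tau> \<in> {0..t}" for \<tau> \<eta>
  proof -
    have c: "clampT T \<tau> = \<tau>" using that t by (intro clampT_id) auto
    have "cis (a * \<tau> * (norm \<xi>)\<^sup>2) * cis (- (g * \<tau> * (norm \<eta>)\<^sup>2)) * cis (- (b * \<tau> * (norm (\<xi> - \<eta>))\<^sup>2)) = cis (\<tau> * ?\<Phi> \<eta>)"
      unfolding cis_mult by (rule arg_cong[where f = cis]) (simp add: algebra_simps)
    then show ?thesis unfolding lap_def free_def c by (simp add: mult_ac)
  qed
  have intc: "integrable lborel (\<lambda>\<eta>. complex_of_real ((norm \<eta>)\<^sup>2 * P \<eta> * Q (\<xi> - \<eta>)) * cis (\<tau> * ?\<Phi> \<eta>))" if \<tau>: "\<tau> \<in> {0..t}" for \<tau>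
    using integrable_mult_right[OF conv_integrable[OF decays_lap[OF DP] DQ T, of \<tau> \<xi>], of "cis (a * \<tau> * (norm \<xi>)\<^sup>2)"]
    by (simp only: eq[OF \<tau>])
  have int0: "integrable lborel (\<lambda>\<eta>. (norm \<eta>)\<^sup>2 * P \<eta> * Q (\<xi> - \<eta>))"
    using integrable_Re[OF intc[of 0]] t0 by simp
  have ge: "m / 2 \<le> Re (cis (a * \<tau> * (norm \<xi>)\<^sup>2) * ?c \<tau> \<xi>)" if \<tau>: "\<tau> \<in> {0..t}" for \<tau>
  proof -
    have "cis (a * \<tau> * (norm \<xi>)\<^sup>2) * ?c \<tau> \<xi> = (LINT \<eta>|lborel. complex_of_real ((norm \<eta>)\<^sup>2 * P \<eta> * Q (\<xi> - \<eta>)) * cis (\<tau> * ?\<Phi> \<eta>))"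
      unfolding conv_def integral_mult_right_zero[symmetric] by (simp only: eq[OF \<tau>])
    then have "Re (cis (a * \<tau> * (norm \<xi>)\<^sup>2) * ?c \<tau> \<xi>) = (LINT \<eta>|lborel. Re (complex_of_real ((norm \<eta>)\<^sup>2 * P \<eta> * Q (\<xi> - \<eta>)) * cis (\<tau> * ?\<Phi> \<eta>)))"
      using integral_Re[OF intc[OF \<tau>]] by simp
    also have "\<dots> \<ge> (LINT \<eta>|lborel. 1 / 2 * ((norm \<eta>)\<^sup>2 * P \<eta> * Q (\<xi> - \<eta>)))"
    proof (rule integral_mono)
      show "integrable lborel (\<lambda>\<eta>. 1 / 2 * ((norm \<eta>)\<^sup>2 * P \<eta> * Q (\<xi> - \<eta>)))" by (intro integrable_mult_right int0)
      show "integrable lborel (\<lambda>\<eta>. Re (complex_of_real ((norm \<eta>)\<^sup>2 * P \<eta> * Q (\<xi> - \<eta>)) * cis (\<tau> * ?\<Phi> \<eta>)))"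
        by (rule integrable_Re[OF intc[OF \<tau>]])
      fix \<eta> :: "real^'d"
      show "1 / 2 * ((norm \<eta>)\<^sup>2 * P \<eta> * Q (\<xi> - \<eta>)) \<le> Re (complex_of_real ((norm \<eta>)\<^sup>2 * P \<eta> * Q (\<xi> - \<eta>)) * cis (\<tau> * ?\<Phi> \<eta>))"
      proof (cases "P \<eta> = 0 \<or> Q (\<xi> - \<eta>) = 0")
        case False
        then have "1 / 2 \<le> cos (\<tau> * ?\<Phi> \<eta>)" using phase[OF \<tau>] by blast
        from mult_right_mono[OF this, of "(norm \<eta>)\<^sup>2 * P \<eta> * Q (\<xi> - \<eta>)"] P0 Q0 show ?thesis
          unfolding Re_complex_of_real_mult by (simp add: mult_ac)
      qed auto
    qed
    finally show ?thesis using m[OF int0] by simp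
  qed
  have eqt: "qdiv T a (free T g ?P) (free T b ?Q) t \<xi> * (\<i> * cis (a * t * (norm \<xi>)\<^sup>2))
    = integral {0..t} (\<lambda>\<tau>. cis (a * \<tau> * (norm \<xi>)\<^sup>2) * ?c \<tau> \<xi>)"
  proof -
    have "cis (- (a * t * (norm \<xi>)\<^sup>2)) * cis (a * t * (norm \<xi>)\<^sup>2) = 1" by (simp add: cis_mult)
    moreover have "- \<i> * u * z * (\<i> * v) = u * v * z" for u v z :: complex
    proof -
      have "- \<i> * u * z * (\<i> * v) = - (\<i> * \<i>) * (u * v * z)" by (simp only: mult_ac minus_mult_left[symmetric] minus_mult_right[symmetric])
      then show ?thesis by simp
    qed
    ultimately show ?thesis unfolding qdiv_def duh_def clampT_id[OF t] by (simp only: mult_1_left)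
  qed
  have hi: "((\<lambda>\<tau>. Re (cis (a * \<tau> * (norm \<xi>)\<^sup>2) * ?c \<tau> \<xi>)) has_integral Re (integral {0..t} (\<lambda>\<tau>. cis (a * \<tau> * (norm \<xi>)\<^sup>2) * ?c \<tau> \<xi>))) {0..t}"
    using has_integral_linear[OF integrable_integral[OF integrable_continuous_real[OF cc]] bounded_linear_Re]
    by (simp add: o_def)
  have "((\<lambda>\<tau>. m / 2) has_integral t * (m / 2)) {0..t}"
    using has_integral_const_real[of "m / 2" 0 t] t0 by simp
  from has_integral_le[OF this hi ge] show ?thesis unfolding eqt by simp
qed

text \<open>The half-widths are \<open>\<rho> / \<Lambda>\<close> in the direction \<open>k\<close>
  and \<open>\<rho>\<close> in all others: a thin slab for large \<open>\<Lambda>\<close>, a cube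
  for \<open>\<Lambda> = 1\<close>. A box has an explicit measure.\<close>

definition slab :: "'d \<Rightarrow> real \<Rightarrow> real \<Rightarrow> real^'d::finite \<Rightarrow> (real^'d) set"
  where "slab k \<Lambda> \<rho> c = cbox (c - \<rho> *\<^sub>R (\<chi> i. if i = k then 1 / \<Lambda> else 1)) (c + \<rho> *\<^sub>R (\<chi> i. if i = k then 1 / \<Lambda> else 1))"

lemma mem_slab: "\<xi> \<in> slab k \<Lambda> \<rho> c \<longleftrightarrow> (\<forall>i. \<bar>\<xi> $ i - c $ i\<bar> \<le> \<rho> * (if i = k then 1 / \<Lambda> else 1))"
  by (auto simp: slab_def mem_box_cart abs_le_iff algebra_simps)

lemma slab_borel [measurable]: "slab k \<Lambda> \<rho> c \<in> sets borel"
  by (simp add: slab_def)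

lemma measure_slab:
  fixes c :: "real^'d::finite"
  assumes "0 < \<Lambda>" "0 \<le> \<rho>"
  shows "measure lborel (slab k \<Lambda> \<rho> c) = (2 * \<rho>) ^ CARD('d) / \<Lambda>"
proof -
  have "c \<in> slab k \<Lambda> \<rho> c" using assms by (simp add: mem_slab)
  then have "measure lborel (slab k \<Lambda> \<rho> c) = (\<Prod>i\<in>UNIV. 2 * \<rho> * (if i = k then 1 / \<Lambda> else 1))"
    unfolding slab_def by (subst content_cbox_cart) (auto intro!: prod.cong)
  also have "\<dots> = (2 * \<rho>) ^ CARD('d) / \<Lambda>"
    unfolding prod.distrib by simp
  finally show ?thesis .
qed

lemma integrable_slab: "integrable lborel (\<lambda>\<xi>. B * indicator (slab k \<Lambda> \<rho> c) \<xi> :: real)"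
  unfolding slab_def by (intro integrable_mult_right integrable_real_indicator) (auto simp: emeasure_lborel_cbox_eq)

lemma integral_slab_le:
  fixes c :: "real^'d::finite" and f :: "real^'d \<Rightarrow> real"
  assumes [measurable]: "f \<in> borel_measurable borel" and "0 < \<Lambda>" "0 \<le> \<rho>"
    and f0: "\<And>\<xi>. 0 \<le> f \<xi>" and B: "\<And>\<xi>. \<xi> \<in> slab k \<Lambda> \<rho> c \<Longrightarrow> f \<xi> \<le> B" and out: "\<And>\<xi>. \<xi> \<notin> slab k \<Lambda> \<rho> c \<Longrightarrow> f \<xi> = 0"
  shows "integrable lborel f" and "(LINT \<xi>|lborel. f \<xi>) \<le> B * ((2 * \<rho>) ^ CARD('d) / \<Lambda>)"
proof -
  have le: "f \<xi> \<le> B * indicator (slab k \<Lambda> \<rho> c) \<xi>" for \<xi>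
    using B[of \<xi>] out[of \<xi>] by (auto simp: indicator_def)
  show i: "integrable lborel f"
    by (rule Bochner_Integration.integrable_bound[OF integrable_slab[of B k \<Lambda> \<rho> c]]) (use le f0 in \<open>auto intro: order_trans[OF _ abs_ge_self]\<close>)
  have "(LINT \<xi>|lborel. f \<xi>) \<le> (LINT \<xi>|lborel. B * indicator (slab k \<Lambda> \<rho> c) \<xi>)"
    by (rule integral_mono[OF i integrable_slab le])
  then show "(LINT \<xi>|lborel. f \<xi>) \<le> B * ((2 * \<rho>) ^ CARD('d) / \<Lambda>)"
    using measure_slab[OF assms(2,3), of k c] by simp
qed

lemma integral_slab_ge:
  fixes c :: "real^'d::finite" and f :: "real^'d \<Rightarrow> real"
  assumes i: "integrable lborel f" and "0 < \<Lambda>" "0 \<le> \<rho>"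
    and f0: "\<And>\<xi>. 0 \<le> f \<xi>" and B: "\<And>\<xi>. \<xi> \<in> slab k \<Lambda> \<rho> c \<Longrightarrow> B \<le> f \<xi>"
  shows "B * ((2 * \<rho>) ^ CARD('d) / \<Lambda>) \<le> (LINT \<xi>|lborel. f \<xi>)"
proof -
  have "(LINT \<xi>|lborel. B * indicator (slab k \<Lambda> \<rho> c) \<xi>) \<le> (LINT \<xi>|lborel. f \<xi>)"
    by (rule integral_mono[OF integrable_slab i]) (use B f0 in \<open>auto simp: indicator_def\<close>)
  then show ?thesis using measure_slab[OF assms(2,3), of k c] by simp
qed

text \<open>A continuous substitute for the indicator of a slab intersected with a unit ball, since
  the data must be continuous. It vanishes outside and is bounded below near
  \<open>c\<close>.\<close>

definition tent :: "'d \<Rightarrow> real \<Rightarrow> real^'d::finite \<Rightarrow> real^'d \<Rightarrow> real"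
  where "tent k \<Lambda> c \<xi> = max 0 (1 - (\<Lambda> * \<bar>\<xi> $ k - c $ k\<bar> + norm (\<xi> - c)))"

lemma continuous_tent: "continuous_on UNIV (tent k \<Lambda> c)"
  unfolding tent_def[abs_def] by (intro continuous_intros)

lemma tent_nonneg: "0 \<le> tent k \<Lambda> c \<xi>"
  by (simp add: tent_def)

lemma tent_le_1: "0 \<le> \<Lambda> \<Longrightarrow> tent k \<Lambda> c \<xi> \<le> 1"
  unfolding tent_def using norm_ge_zero[of "\<xi> - c"] mult_nonneg_nonneg[of \<Lambda> "\<bar>\<xi> $ k - c $ k\<bar>"] by linarith

lemma tent_nonzeroD:
  assumes "tent k \<Lambda> c \<xi> \<noteq> 0" "0 \<le> \<Lambda>"
  shows "\<Lambda> * \<bar>\<xi> $ k - c $ k\<bar> \<le> 1" "norm (\<xi> - c) \<le> 1"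
proof -
  have "\<Lambda> * \<bar>\<xi> $ k - c $ k\<bar> + norm (\<xi> - c) \<le> 1" using assms(1) by (auto simp: tent_def)
  moreover have "0 \<le> \<Lambda> * \<bar>\<xi> $ k - c $ k\<bar>" using assms(2) by simp
  ultimately show "\<Lambda> * \<bar>\<xi> $ k - c $ k\<bar> \<le> 1" "norm (\<xi> - c) \<le> 1"
    using norm_ge_zero[of "\<xi> - c"] by linarith+
qed

lemma tent_support:
  assumes "tent k \<Lambda> c \<xi> \<noteq> 0" "0 < \<Lambda>"
  shows "\<xi> \<in> slab k \<Lambda> 1 c"
proof -
  have *: "\<Lambda> * \<bar>\<xi> $ k - c $ k\<bar> \<le> 1" "norm (\<xi> - c) \<le> 1" using tent_nonzeroD[OF assms(1)] assms(2) by auto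
  show ?thesis unfolding mem_slab
  proof
    fix i
    have "\<bar>\<xi> $ i - c $ i\<bar> \<le> 1" using component_le_norm_cart[of "\<xi> - c" i] *(2) by simp
    moreover have "\<bar>\<xi> $ k - c $ k\<bar> \<le> 1 / \<Lambda>" using *(1) assms(2) by (simp add: field_simps)
    ultimately show "\<bar>\<xi> $ i - c $ i\<bar> \<le> 1 * (if i = k then 1 / \<Lambda> else 1)" by auto
  qed
qed

text \<open>With this \<open>\<rho>\<close> both summands are at most 1/8, the norm through the sum
  over the \<open>CARD('d)\<close> coordinates. With the bound 1/4, the sum of two such
  displacements still leaves a tent value of at least 1/2.\<close>

lemma slab_norm_le:
  fixes c :: "real^'d::finite"
  assumes "\<xi> \<in> slab k \<Lambda> \<rho> c" "1 \<le> \<Lambda>" "0 \<le> \<rho>" "\<rho> = 1 / (8 * real CARD('d))"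
  shows "\<Lambda> * \<bar>\<xi> $ k - c $ k\<bar> + norm (\<xi> - c) \<le> 1 / 4"
proof -
  have *: "\<bar>\<xi> $ i - c $ i\<bar> \<le> \<rho> * (if i = k then 1 / \<Lambda> else 1)" for i using assms(1) by (simp add: mem_slab)
  have d: "1 \<le> real CARD('d)" using one_le_card_finite[where 'a='d] by simp
  have le: "\<bar>\<xi> $ i - c $ i\<bar> \<le> \<rho>" for i
  proof -
    have "\<rho> * (if i = k then 1 / \<Lambda> else 1) \<le> \<rho> * 1" using assms(2,3) by (intro mult_left_mono) auto
    then show ?thesis using *[of i] by linarith
  qed
  have "norm (\<xi> - c) \<le> (\<Sum>i\<in>UNIV. \<bar>(\<xi> - c) $ i\<bar>)" by (rule norm_le_l1_cart)
  also have "\<dots> \<le> (\<Sum>i\<in>(UNIV::'d set). \<rho>)" by (intro sum_mono) (use le in simp)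
  also have "\<dots> = 1 / 8" using assms(4) d by simp
  finally have "norm (\<xi> - c) \<le> 1 / 8" .
  moreover have "\<Lambda> * \<bar>\<xi> $ k - c $ k\<bar> \<le> \<rho>" using *[of k] assms(2) by (simp add: field_simps)
  moreover have "\<rho> \<le> 1 / 8" using d by (simp add: assms(4) field_simps)
  ultimately show ?thesis by linarith
qed

lemma tent_cutoff:
  fixes c :: "real^'d::finite"
  assumes "0 \<le> \<Lambda>"
  shows "cutoff_data (\<lambda>\<xi>. complex_of_real (x * tent k \<Lambda> c \<xi>))"
  unfolding cutoff_data_def
proof (intro conjI exI[of _ "1 + norm c"] allI impI)
  show "continuous_on UNIV (\<lambda>\<xi>. complex_of_real (x * tent k \<Lambda> c \<xi>))"
    by (intro continuous_intros continuous_on_compose2[OF continuous_tent]) auto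
  fix \<xi> :: "real^'d" assume \<xi>: "1 + norm c < norm \<xi>"
  have "tent k \<Lambda> c \<xi> = 0"
  proof (rule ccontr)
    assume "tent k \<Lambda> c \<xi> \<noteq> 0"
    from tent_nonzeroD(2)[OF this assms] have "norm (\<xi> - c) \<le> 1" .
    then show False using \<xi> norm_triangle_sub[of \<xi> c] by simp
  qed
  then show "complex_of_real (x * tent k \<Lambda> c \<xi>) = 0" by simp
qed

text \<open>For \<open>r \<noteq> 0\<close> the condition on \<open>N\<close> makes the unit radius
  at most half the distance \<open>\<bar>r\<bar> * N\<close> of the centre from 0, so the ball sits
  at frequencies of order \<open>N\<close>; for \<open>r = 0\<close> it stays at frequencies of
  order 1. \<open>R\<close> is this order.\<close>

lemma shell_bounds:
  fixes r N :: real and k :: "'d::finite" and \<xi> :: "real^'d"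
  assumes N: "1 \<le> N" and r: "r \<noteq> 0 \<Longrightarrow> 2 / \<bar>r\<bar> \<le> N" and \<xi>: "norm (\<xi> - (r * N) *\<^sub>R axis k 1) \<le> 1"
  defines "R \<equiv> if r = 0 then 1 else N"
  shows "(if r = 0 then 1 else r\<^sup>2 / 4) * R\<^sup>2 \<le> 1 + (norm \<xi>)\<^sup>2" "1 + (norm \<xi>)\<^sup>2 \<le> (1 + (\<bar>r\<bar> + 1)\<^sup>2) * R\<^sup>2"
    "r \<noteq> 0 \<Longrightarrow> \<bar>r\<bar> * N / 2 \<le> norm \<xi>"
proof -
  have n: "norm ((r * N) *\<^sub>R axis k (1::real)) = \<bar>r\<bar> * N" using N by (simp add: norm_axis_1 abs_mult)
  have "\<bar>norm \<xi> - \<bar>r\<bar> * N\<bar> \<le> 1"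
    using order_trans[OF norm_triangle_ineq3 \<xi>] by (simp only: n)
  then have up: "norm \<xi> \<le> \<bar>r\<bar> * N + 1" and lo: "\<bar>r\<bar> * N - 1 \<le> norm \<xi>"
    by (simp_all only: abs_le_iff diff_le_eq le_diff_eq minus_diff_eq add.commute)
  show lo2: "\<bar>r\<bar> * N / 2 \<le> norm \<xi>" if "r \<noteq> 0"
    using r[OF that] that lo by (simp add: field_simps)
  show "(if r = 0 then 1 else r\<^sup>2 / 4) * R\<^sup>2 \<le> 1 + (norm \<xi>)\<^sup>2"
  proof (cases "r = 0")
    case False
    have "(\<bar>r\<bar> * N / 2)\<^sup>2 \<le> (norm \<xi>)\<^sup>2" using lo2[OF False] N by (intro power_mono) auto
    then show ?thesis using False by (simp add: R_def power_mult_distrib power_divide)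
  qed (simp add: R_def)
  have R1: "1 \<le> R" using N by (simp add: R_def)
  have "norm \<xi> \<le> (\<bar>r\<bar> + 1) * R" using up N by (auto simp: R_def algebra_simps)
  then have "(norm \<xi>)\<^sup>2 \<le> ((\<bar>r\<bar> + 1) * R)\<^sup>2" by (intro power_mono) auto
  moreover have "1 \<le> R\<^sup>2" using R1 by (simp add: one_le_power)
  moreover have "(1 + (\<bar>r\<bar> + 1)\<^sup>2) * R\<^sup>2 = R\<^sup>2 + ((\<bar>r\<bar> + 1) * R)\<^sup>2"
    by (simp only: power_mult_distrib distrib_right[of 1] mult_1_left)
  ultimately show "1 + (norm \<xi>)\<^sup>2 \<le> (1 + (\<bar>r\<bar> + 1)\<^sup>2) * R\<^sup>2" by linarith
qed

text \<open>A nonnegative \<open>s\<close> uses the upper bound of the shell, a negative one the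
  lower bound; the constant is the sum of both. The lemma thus serves the data with \<open>s\<close>
  and the test function with \<open>- s\<close>.\<close>

lemma sob_weight_shell:
  fixes r s :: real and k :: "'d::finite"
  obtains W where "0 < W" "\<And>N \<xi>. 1 \<le> N \<Longrightarrow> (r \<noteq> 0 \<Longrightarrow> 2 / \<bar>r\<bar> \<le> N) \<Longrightarrow> norm (\<xi> - (r * N) *\<^sub>R axis k 1) \<le> 1 \<Longrightarrow>
    sob_weight s \<xi> \<le> W * (if r = 0 then 1 else N) powr (2 * s)"
proof -
  let ?c = "if r = 0 then 1 else r\<^sup>2 / 4" and ?C = "1 + (\<bar>r\<bar> + 1)\<^sup>2"
  have c: "0 < ?c" and C: "0 < ?C" by (auto simp: add_pos_nonneg)
  show ?thesis
  proof (rule that[of "?c powr s + ?C powr s"])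
    show "0 < ?c powr s + ?C powr s" using c C by (intro add_pos_pos) auto
    fix N :: real and \<xi> :: "real^'d"
    assume N: "1 \<le> N" "r \<noteq> 0 \<Longrightarrow> 2 / \<bar>r\<bar> \<le> N" and \<xi>: "norm (\<xi> - (r * N) *\<^sub>R axis k 1) \<le> 1"
    let ?R = "if r = 0 then 1 else N"
    have R: "0 < ?R" using N(1) by simp
    note z = shell_bounds(1,2)[OF N \<xi>]
    have e: "(A * ?R\<^sup>2) powr s = A powr s * ?R powr (2 * s)" if "0 < A" for A
    proof -
      have "?R\<^sup>2 = ?R powr 2" using R by (simp add: powr_numeral)
      then have "(?R\<^sup>2) powr s = ?R powr (2 * s)" by (simp only: powr_powr)
      then show ?thesis by (simp only: powr_mult)
    qed
    have p: "0 < ?c * ?R\<^sup>2" using c R by simp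
    have "sob_weight s \<xi> \<le> (?c * ?R\<^sup>2) powr s + (?C * ?R\<^sup>2) powr s"
    proof (cases "0 \<le> s")
      case True
      have "sob_weight s \<xi> \<le> (?C * ?R\<^sup>2) powr s"
        unfolding sob_weight_def by (rule powr_mono2[OF True _ z(2)]) (simp add: add_nonneg_nonneg)
      then show ?thesis by (simp add: add_increasing)
    next
      case False
      have "sob_weight s \<xi> \<le> (?c * ?R\<^sup>2) powr s"
        unfolding sob_weight_def by (rule powr_mono2'[OF _ p z(1)]) (use False in simp)
      then show ?thesis by (simp add: add_increasing2)
    qed
    then show "sob_weight s \<xi> \<le> (?c powr s + ?C powr s) * ?R powr (2 * s)"
      unfolding e[OF c] e[OF C] by (simp only: distrib_right)
  qed
qed

text \<open>For \<open>\<eta> = p N e\<^sub>k + u\<close> and \<open>\<xi> - \<eta> = q N e\<^sub>k + v\<close> the phase is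
  \<open>N\<^sup>2 (a (p + q)\<^sup>2 - g p\<^sup>2 - b q\<^sup>2) + 2 N (L\<^sub>1 u\<^sub>k + L\<^sub>2 v\<^sub>k) + O(1)\<close>. The resonance condition removes the first term;
  the second is bounded if \<open>u\<^sub>k\<close> and \<open>v\<^sub>k\<close> are \<open>O(1/N)\<close> or if \<open>L\<^sub>1 = L\<^sub>2 = 0\<close>.\<close>

lemma phase_bound:
  fixes \<xi> \<eta> :: "real^'d::finite" and k :: 'd
  assumes res: "a * (p + q)\<^sup>2 - g * p\<^sup>2 - b * q\<^sup>2 = 0"
    and l: "N \<le> \<Lambda> \<or> a * (p + q) - g * p = 0 \<and> a * (p + q) - b * q = 0" and N: "0 \<le> N"
    and \<eta>: "\<Lambda> * \<bar>\<eta> $ k - ((p * N) *\<^sub>R axis k 1) $ k\<bar> \<le> 1" "norm (\<eta> - (p * N) *\<^sub>R axis k 1) \<le> 1"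
    and \<zeta>: "\<Lambda> * \<bar>(\<xi> - \<eta>) $ k - ((q * N) *\<^sub>R axis k 1) $ k\<bar> \<le> 1" "norm (\<xi> - \<eta> - (q * N) *\<^sub>R axis k 1) \<le> 1"
  shows "\<bar>a * (norm \<xi>)\<^sup>2 - g * (norm \<eta>)\<^sup>2 - b * (norm (\<xi> - \<eta>))\<^sup>2\<bar>
    \<le> 2 * (\<bar>a * (p + q) - g * p\<bar> + \<bar>a * (p + q) - b * q\<bar>) + 4 * \<bar>a\<bar> + \<bar>g\<bar> + \<bar>b\<bar>"
proof -
  let ?e = "axis k 1 :: real^'d" and ?L1 = "a * (p + q) - g * p" and ?L2 = "a * (p + q) - b * q"
  define u where "u = \<eta> - (p * N) *\<^sub>R ?e"
  define v where "v = \<xi> - \<eta> - (q * N) *\<^sub>R ?e"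
  have sq: "(norm (r *\<^sub>R ?e + w))\<^sup>2 = r\<^sup>2 + 2 * r * w $ k + (norm w)\<^sup>2" for r w
    unfolding power2_norm_eq_inner
    by (simp add: inner_add_left inner_add_right inner_axis inner_axis' power2_eq_square algebra_simps)
  have \<eta>': "\<eta> = (p * N) *\<^sub>R ?e + u" and \<zeta>': "\<xi> - \<eta> = (q * N) *\<^sub>R ?e + v" and \<xi>': "\<xi> = ((p + q) * N) *\<^sub>R ?e + (u + v)"
    by (simp_all add: u_def v_def algebra_simps)
  have "a * (norm \<xi>)\<^sup>2 - g * (norm \<eta>)\<^sup>2 - b * (norm (\<xi> - \<eta>))\<^sup>2
    = N\<^sup>2 * (a * (p + q)\<^sup>2 - g * p\<^sup>2 - b * q\<^sup>2) + 2 * (?L1 * (N * u $ k)) + 2 * (?L2 * (N * v $ k))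
      + a * (norm (u + v))\<^sup>2 - g * (norm u)\<^sup>2 - b * (norm v)\<^sup>2"
    unfolding \<zeta>' sq unfolding \<eta>' sq unfolding \<xi>' sq by (simp add: algebra_simps power2_eq_square)
  then have eq: "a * (norm \<xi>)\<^sup>2 - g * (norm \<eta>)\<^sup>2 - b * (norm (\<xi> - \<eta>))\<^sup>2
    = 2 * (?L1 * (N * u $ k)) + 2 * (?L2 * (N * v $ k)) + a * (norm (u + v))\<^sup>2 - g * (norm u)\<^sup>2 - b * (norm v)\<^sup>2"
    by (simp only: res mult_zero_right add_0_left)
  have n: "norm u \<le> 1" "norm v \<le> 1" using \<eta>(2) \<zeta>(2) by (simp_all add: u_def v_def)
  have uv: "\<Lambda> * \<bar>u $ k\<bar> \<le> 1" "\<Lambda> * \<bar>v $ k\<bar> \<le> 1" using \<eta>(1) \<zeta>(1) by (simp_all add: u_def v_def)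
  have lin: "\<bar>L * (N * w)\<bar> \<le> \<bar>L\<bar>" if "N \<le> \<Lambda> \<or> L = 0" "\<Lambda> * \<bar>w\<bar> \<le> 1" for L w
  proof (cases "L = 0")
    case False
    then have "N * \<bar>w\<bar> \<le> \<Lambda> * \<bar>w\<bar>" using that(1) by (intro mult_right_mono) auto
    then have "N * \<bar>w\<bar> \<le> 1" using that(2) by linarith
    then show ?thesis using mult_left_mono[of "N * \<bar>w\<bar>" 1 "\<bar>L\<bar>"] N by (simp add: abs_mult)
  qed simp
  have quad: "\<bar>c * (norm w)\<^sup>2\<bar> \<le> \<bar>c\<bar> * n\<^sup>2" if "norm w \<le> n" for c n and w :: "real^'d"
    using that by (simp add: abs_mult mult_left_mono power_mono)
  \<comment> \<open>The source of the coefficient \<open>4 * \<bar>a\<bar>\<close>.\<close>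
  have "norm (u + v) \<le> 2" using norm_triangle_ineq[of u v] n by linarith
  from quad[OF this, of a] quad[OF n(1), of g] quad[OF n(2), of b] lin[OF _ uv(1), of ?L1] lin[OF _ uv(2), of ?L2] l
  show ?thesis unfolding eq by (simp only: abs_le_iff) (auto simp: abs_le_iff)
qed

text \<open>A power count. With R = 1 if q = 0 and R = N otherwise, the heights N^(-s-1) of
  \<open>P\<close> and R^(-s) of \<open>Q\<close> make both squared data norms O(1/\<Lambda>), the
  volume of the supports. The dual norm of \<open>G\<close> is O(N^(-s) \<Lambda>^(-1/2)). The
  tested iterate is at least a constant times N^2 N^(-s-1) R^(-s) \<Lambda>^(-2), with N^2 from the
  Laplacian and one volume each from the convolution and from the test. Dividing leaves N <= C
  \<Lambda>^(1/2) R^s.\<close>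

lemma growth_bound:
  fixes a b g p q s T K :: real
  assumes T: "0 < T"
    and H: "bilinear_bound T K s (\<lambda>P (Q :: real^'d::finite \<Rightarrow> complex). qdiv T a (free T g P) (free T b Q))"
    and p: "p \<noteq> 0" and pq: "p + q \<noteq> 0" and res: "a * (p + q)\<^sup>2 - g * p\<^sup>2 - b * q\<^sup>2 = 0"
  obtains C where "\<And>N \<Lambda>. 1 \<le> N \<Longrightarrow> 1 \<le> \<Lambda> \<Longrightarrow> 2 / \<bar>p\<bar> \<le> N \<Longrightarrow> 2 / \<bar>p + q\<bar> \<le> N \<Longrightarrow> (q \<noteq> 0 \<Longrightarrow> 2 / \<bar>q\<bar> \<le> N) \<Longrightarrow>
    N \<le> \<Lambda> \<or> a * (p + q) - g * p = 0 \<and> a * (p + q) - b * q = 0 \<Longrightarrow>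
    N \<le> C * sqrt \<Lambda> * (if q = 0 then 1 else N) powr s"
proof -
  fix k :: 'd
  let ?e = "axis k 1 :: real^'d"
  define \<rho> where "\<rho> = 1 / (8 * real CARD('d))"
  define V where "V = (2 * \<rho>) ^ CARD('d)"
  define V1 where "V1 = (2 * (1::real)) ^ CARD('d)"
  have \<rho>: "0 < \<rho>" by (simp add: \<rho>_def)
  have V: "0 < V" using \<rho> by (simp add: V_def)
  have V1: "0 < V1" by (simp add: V1_def)
  obtain W1 where W1: "0 < W1" "\<And>N \<xi>. 1 \<le> N \<Longrightarrow> (p \<noteq> 0 \<Longrightarrow> 2 / \<bar>p\<bar> \<le> N) \<Longrightarrow> norm (\<xi> - (p * N) *\<^sub>R ?e) \<le> 1 \<Longrightarrow>
    sob_weight s \<xi> \<le> W1 * (if p = 0 then 1 else N) powr (2 * s)" by (rule sob_weight_shell[of p k s]) blast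
  obtain W2 where W2: "0 < W2" "\<And>N \<xi>. 1 \<le> N \<Longrightarrow> (q \<noteq> 0 \<Longrightarrow> 2 / \<bar>q\<bar> \<le> N) \<Longrightarrow> norm (\<xi> - (q * N) *\<^sub>R ?e) \<le> 1 \<Longrightarrow>
    sob_weight s \<xi> \<le> W2 * (if q = 0 then 1 else N) powr (2 * s)" by (rule sob_weight_shell[of q k s]) blast
  obtain W3 where W3: "0 < W3" "\<And>N \<xi>. 1 \<le> N \<Longrightarrow> (p + q \<noteq> 0 \<Longrightarrow> 2 / \<bar>p + q\<bar> \<le> N) \<Longrightarrow> norm (\<xi> - ((p + q) * N) *\<^sub>R ?e) \<le> 1 \<Longrightarrow>
    sob_weight (- s) \<xi> \<le> W3 * (if p + q = 0 then 1 else N) powr (2 * - s)" by (rule sob_weight_shell[of "p + q" k "- s"]) blast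
  \<comment> \<open>The bound of \<open>phase_bound\<close>; the summand 1 allows division by
    \<open>M\<close>.\<close>
  define M where "M = 2 * (\<bar>a * (p + q) - g * p\<bar> + \<bar>a * (p + q) - b * q\<bar>) + 4 * \<bar>a\<bar> + \<bar>g\<bar> + \<bar>b\<bar> + 1"
  have M: "1 \<le> M" by (simp add: M_def)
  \<comment> \<open>A time independent of \<open>N\<close> and \<open>\<Lambda>\<close> during which
    the accumulated phase is at most 1.\<close>
  define t where "t = min T (1 / M)"
  have t: "t \<in> {0..T}" "0 < t" "t * M \<le> 1" using T M by (auto simp: t_def min_def field_simps)
  define Cp where "Cp = 1 + (\<bar>p\<bar> + 1)\<^sup>2"
  have Cp: "0 < Cp" by (simp add: Cp_def add_pos_nonneg)
  \<comment> \<open>Lower bounds, on the small slabs, for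
    \<open>(norm \<eta>)\<^sup>2 / N\<^sup>2\<close>, for the tent in \<open>P\<close> and for the
    tent in \<open>Q\<close>.\<close>
  define \<mu> where "\<mu> = (\<bar>p\<bar> / 2)\<^sup>2 * (3 / 4) * (1 / 2)"
  have \<mu>: "0 < \<mu>" using p by (simp add: \<mu>_def)
  define D where "D = \<bar>K\<bar> * sqrt (W3 * V) * ((W2 + W1 * Cp) * V1)"
  define E where "E = t * \<mu> * V\<^sup>2 / 2"
  have E: "0 < E" using t \<mu> V by (simp add: E_def)
  show ?thesis
  proof (rule that[of "D / E"])
    fix N \<Lambda> :: real
    assume N: "1 \<le> N" and L: "1 \<le> \<Lambda>" and Np: "2 / \<bar>p\<bar> \<le> N" and Npq: "2 / \<bar>p + q\<bar> \<le> N" and Nq: "q \<noteq> 0 \<Longrightarrow> 2 / \<bar>q\<bar> \<le> N"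
      and deg: "N \<le> \<Lambda> \<or> a * (p + q) - g * p = 0 \<and> a * (p + q) - b * q = 0"
    define R where "R = (if q = 0 then 1 else N)"
    have R: "0 < R" using N by (simp add: R_def)
    \<comment> \<open>The heights \<open>x\<close> and \<open>y\<close> compensate the Sobolev
      weights at the two data frequencies; \<open>y\<close> has one more power of \<open>N\<close>
      because the norm of the third datum is that of a gradient.\<close>
    define x where "x = R powr (- s)"
    define y where "y = N powr (- s) / N"
    have x: "0 < x" and y: "0 < y" using R N by (simp_all add: x_def y_def)
    let ?cP = "(p * N) *\<^sub>R ?e" and ?cQ = "(q * N) *\<^sub>R ?e" and ?cO = "((p + q) * N) *\<^sub>R ?e"
    define P where "P = (\<lambda>\<eta>. y * tent k \<Lambda> ?cP \<eta>)"
    define Q where "Q = (\<lambda>\<eta>. x * tent k \<Lambda> ?cQ \<eta>)"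
    have cutP: "cutoff_data (\<lambda>\<eta>. complex_of_real (P \<eta>))" and cutQ: "cutoff_data (\<lambda>\<eta>. complex_of_real (Q \<eta>))"
      unfolding P_def Q_def by (rule tent_cutoff, use L in simp)+
    have P0: "0 \<le> P \<eta>" and Q0: "0 \<le> Q \<eta>" for \<eta> using x y by (simp_all add: P_def Q_def tent_nonneg)
    define Out where "Out = slab k \<Lambda> \<rho> ?cO"
    \<comment> \<open>The phase cancels that of the Duhamel prefactor, so that all frequencies in
      \<open>Out\<close> contribute with the same sign.\<close>
    define G where "G = (\<lambda>\<xi>::real^'d. \<i> * cis (a * t * (norm \<xi>)\<^sup>2) * complex_of_real (indicator Out \<xi>))"
    have Out [measurable]: "Out \<in> sets borel" by (simp add: Out_def)
    have Gm [measurable]: "G \<in> borel_measurable borel"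
      unfolding G_def by (rule borel_measurable_times, rule borel_measurable_continuous_onI, intro continuous_intros, measurable)
    have nG: "norm (G \<xi>) = indicator Out \<xi>" for \<xi> by (simp add: G_def norm_mult indicator_def)
    have iG: "integrable lborel G"
      using integrable_slab[of 1 k \<Lambda> \<rho> ?cO] by (intro Bochner_Integration.integrable_bound[of lborel "indicator Out :: _ \<Rightarrow> real" G]) (auto simp: nG Out_def)
    have nO: "\<Lambda> * \<bar>\<xi> $ k - ?cO $ k\<bar> + norm (\<xi> - ?cO) \<le> 1 / 4" if "\<xi> \<in> Out" for \<xi>
      using slab_norm_le[OF that[unfolded Out_def] L _ \<rho>_def] \<rho> by simp
    have nP: "\<Lambda> * \<bar>\<eta> $ k - ?cP $ k\<bar> + norm (\<eta> - ?cP) \<le> 1 / 4" if "\<eta> \<in> slab k \<Lambda> \<rho> ?cP" for \<eta>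
      using slab_norm_le[OF that L _ \<rho>_def] \<rho> by simp
    have L0: "0 < \<Lambda>" using L by simp
    have Labs: "0 \<le> \<Lambda> * \<bar>z\<bar>" for z using L by simp

    have wG: "0 \<le> sob_weight (- s) \<xi> * (norm (G \<xi>))\<^sup>2" "\<xi> \<in> Out \<Longrightarrow> sob_weight (- s) \<xi> * (norm (G \<xi>))\<^sup>2 \<le> W3 * N powr (2 * - s)"
      "\<xi> \<notin> Out \<Longrightarrow> sob_weight (- s) \<xi> * (norm (G \<xi>))\<^sup>2 = 0" for \<xi>
    proof -
      show "0 \<le> sob_weight (- s) \<xi> * (norm (G \<xi>))\<^sup>2" by (simp add: less_imp_le[OF sob_weight_pos])
      show "sob_weight (- s) \<xi> * (norm (G \<xi>))\<^sup>2 = 0" if "\<xi> \<notin> Out" using that by (simp add: nG)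
      show "sob_weight (- s) \<xi> * (norm (G \<xi>))\<^sup>2 \<le> W3 * N powr (2 * - s)" if \<xi>: "\<xi> \<in> Out"
      proof -
        have "norm (\<xi> - ?cO) \<le> 1" using nO[OF \<xi>] Labs[of "\<xi> $ k - ?cO $ k"] by linarith
        from W3(2)[OF N Npq this] show ?thesis using pq \<xi> by (simp add: nG)
      qed
    qed
    have IG: "integrable lborel (\<lambda>\<xi>. sob_weight (- s) \<xi> * (norm (G \<xi>))\<^sup>2)"
      "(LINT \<xi>|lborel. sob_weight (- s) \<xi> * (norm (G \<xi>))\<^sup>2) \<le> W3 * N powr (2 * - s) * (V / \<Lambda>)"
    proof -
      have "(\<lambda>\<xi>. sob_weight (- s) \<xi> * (norm (G \<xi>))\<^sup>2) \<in> borel_measurable borel" by measurable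
      note I = integral_slab_le[OF this L0 less_imp_le[OF \<rho>], where k = k and c = ?cO, folded Out_def V_def]
      show "integrable lborel (\<lambda>\<xi>. sob_weight (- s) \<xi> * (norm (G \<xi>))\<^sup>2)"
        by (rule I(1)[OF wG(1)], rule wG(2), assumption, rule wG(3), assumption)
      show "(LINT \<xi>|lborel. sob_weight (- s) \<xi> * (norm (G \<xi>))\<^sup>2) \<le> W3 * N powr (2 * - s) * (V / \<Lambda>)"
        by (rule I(2)[OF wG(1)], rule wG(2), assumption, rule wG(3), assumption)
    qed
    have test: "test_function s G"
      unfolding test_function_def using Gm iG IG(1) by blast

    have tP: "sob_weight s \<xi> * ((norm \<xi>)\<^sup>2 * (norm (complex_of_real (P \<xi>)))\<^sup>2) \<le> W1 * Cp"
      "0 \<le> sob_weight s \<xi> * ((norm \<xi>)\<^sup>2 * (norm (complex_of_real (P \<xi>)))\<^sup>2)" for \<xi>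
    proof -
      show "0 \<le> sob_weight s \<xi> * ((norm \<xi>)\<^sup>2 * (norm (complex_of_real (P \<xi>)))\<^sup>2)" by (simp add: less_imp_le[OF sob_weight_pos])
      show "sob_weight s \<xi> * ((norm \<xi>)\<^sup>2 * (norm (complex_of_real (P \<xi>)))\<^sup>2) \<le> W1 * Cp"
      proof (cases "tent k \<Lambda> ?cP \<xi> = 0")
        case True
        then show ?thesis using W1(1) Cp by (simp add: P_def)
      next
        case False
        then have n1: "norm (\<xi> - ?cP) \<le> 1" using tent_nonzeroD(2) L0 by (meson less_imp_le)
        have "sob_weight s \<xi> \<le> W1 * N powr (2 * s)" using W1(2)[OF N Np n1] p by simp
        moreover have "(norm \<xi>)\<^sup>2 \<le> Cp * N\<^sup>2" using shell_bounds(2)[OF N Np n1] p by (simp add: Cp_def)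
        moreover have "(norm (complex_of_real (P \<xi>)))\<^sup>2 \<le> y\<^sup>2"
        proof -
          have "P \<xi> \<le> y * 1" unfolding P_def using tent_le_1[of \<Lambda> k ?cP \<xi>] L0 y by (intro mult_left_mono) auto
          from power_mono[OF this P0, of 2] show ?thesis by simp
        qed
        ultimately have "sob_weight s \<xi> * ((norm \<xi>)\<^sup>2 * (norm (complex_of_real (P \<xi>)))\<^sup>2) \<le> W1 * N powr (2 * s) * (Cp * N\<^sup>2 * y\<^sup>2)"
          using W1(1) Cp by (intro mult_mono) auto
        also have "N powr (2 * s) * (N\<^sup>2 * y\<^sup>2) = 1"
        proof -
          have "N\<^sup>2 * y\<^sup>2 = (N powr (- s))\<^sup>2" using N by (simp add: y_def power_divide)
          also have "\<dots> = N powr (- (2 * s))" by (simp add: power2_eq_square powr_add[symmetric])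
          finally show ?thesis using N by (simp add: powr_add[symmetric])
        qed
        then have "W1 * N powr (2 * s) * (Cp * N\<^sup>2 * y\<^sup>2) = W1 * Cp" by (simp add: mult_ac)
        finally show ?thesis .
      qed
    qed
    have JP: "(LINT \<xi>|lborel. sob_weight s \<xi> * ((norm \<xi>)\<^sup>2 * (norm (complex_of_real (P \<xi>)))\<^sup>2)) \<le> W1 * Cp * (V1 / \<Lambda>)"
      unfolding V1_def
    proof (rule integral_slab_le(2)[where k = k and c = ?cP])
      show "(\<lambda>\<xi>. sob_weight s \<xi> * ((norm \<xi>)\<^sup>2 * (norm (complex_of_real (P \<xi>)))\<^sup>2)) \<in> borel_measurable borel"
        using rapid_measurable[OF cutoff_data_rapid[OF cutP]] by measurable
      show "sob_weight s \<xi> * ((norm \<xi>)\<^sup>2 * (norm (complex_of_real (P \<xi>)))\<^sup>2) = 0" if "\<xi> \<notin> slab k \<Lambda> 1 ?cP" for \<xi>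
        using tent_support[of k \<Lambda> ?cP \<xi>] that L0 by (auto simp: P_def)
    qed (use tP L0 in auto)

    have tQ: "sob_weight s \<xi> * (norm (complex_of_real (Q \<xi>)))\<^sup>2 \<le> W2"
      "0 \<le> sob_weight s \<xi> * (norm (complex_of_real (Q \<xi>)))\<^sup>2" for \<xi>
    proof -
      show "0 \<le> sob_weight s \<xi> * (norm (complex_of_real (Q \<xi>)))\<^sup>2" by (simp add: less_imp_le[OF sob_weight_pos])
      show "sob_weight s \<xi> * (norm (complex_of_real (Q \<xi>)))\<^sup>2 \<le> W2"
      proof (cases "tent k \<Lambda> ?cQ \<xi> = 0")
        case True
        then show ?thesis using W2(1) by (simp add: Q_def)
      next
        case False
        then have n1: "norm (\<xi> - ?cQ) \<le> 1" using tent_nonzeroD(2) L0 by (meson less_imp_le)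
        have "sob_weight s \<xi> \<le> W2 * R powr (2 * s)" using W2(2)[OF N Nq n1] by (simp add: R_def)
        moreover have "(norm (complex_of_real (Q \<xi>)))\<^sup>2 \<le> x\<^sup>2"
        proof -
          have "Q \<xi> \<le> x * 1" unfolding Q_def using tent_le_1[of \<Lambda> k ?cQ \<xi>] L0 x by (intro mult_left_mono) auto
          from power_mono[OF this Q0, of 2] show ?thesis by simp
        qed
        ultimately have "sob_weight s \<xi> * (norm (complex_of_real (Q \<xi>)))\<^sup>2 \<le> W2 * R powr (2 * s) * x\<^sup>2"
          using W2(1) by (intro mult_mono) auto
        also have "x\<^sup>2 = R powr (- (2 * s))" by (simp add: x_def power2_eq_square powr_add[symmetric])
        then have "W2 * R powr (2 * s) * x\<^sup>2 = W2" using R by (simp add: powr_add[symmetric] mult.assoc)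
        finally show ?thesis .
      qed
    qed
    have IQ: "(LINT \<xi>|lborel. sob_weight s \<xi> * (norm (complex_of_real (Q \<xi>)))\<^sup>2) \<le> W2 * (V1 / \<Lambda>)"
      unfolding V1_def
    proof (rule integral_slab_le(2)[where k = k and c = ?cQ])
      show "(\<lambda>\<xi>. sob_weight s \<xi> * (norm (complex_of_real (Q \<xi>)))\<^sup>2) \<in> borel_measurable borel"
        using rapid_measurable[OF cutoff_data_rapid[OF cutQ]] by measurable
      show "sob_weight s \<xi> * (norm (complex_of_real (Q \<xi>)))\<^sup>2 = 0" if "\<xi> \<notin> slab k \<Lambda> 1 ?cQ" for \<xi>
        using tent_support[of k \<Lambda> ?cQ \<xi>] that L0 by (auto simp: Q_def)
    qed (use tQ L0 in auto)

    let ?A = "qdiv T a (free T g (\<lambda>\<eta>. complex_of_real (P \<eta>))) (free T b (\<lambda>\<eta>. complex_of_real (Q \<eta>))) t"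
    define m where "m = \<mu> * N\<^sup>2 * x * y * (V / \<Lambda>)"
    have m0: "0 \<le> t * m / 2" using t \<mu> x y V L0 by (simp add: m_def)
    have low: "t * m / 2 \<le> Re (?A \<xi> * G \<xi>)" if \<xi>: "\<xi> \<in> Out" for \<xi>
    proof -
      have "t * m / 2 \<le> Re (?A \<xi> * (\<i> * cis (a * t * (norm \<xi>)\<^sup>2)))"
      proof (rule qdiv_free_Re_ge[OF cutP cutQ P0 Q0 t(1)])
        fix \<tau> \<eta> assume \<tau>: "\<tau> \<in> {0..t}" and "P \<eta> \<noteq> 0" "Q (\<xi> - \<eta>) \<noteq> 0"
        then have nz: "tent k \<Lambda> ?cP \<eta> \<noteq> 0" "tent k \<Lambda> ?cQ (\<xi> - \<eta>) \<noteq> 0" by (auto simp: P_def Q_def)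
        note ph = phase_bound[OF res deg _ tent_nonzeroD[OF nz(1)] tent_nonzeroD[OF nz(2)]]
        let ?F = "a * (norm \<xi>)\<^sup>2 - g * (norm \<eta>)\<^sup>2 - b * (norm (\<xi> - \<eta>))\<^sup>2"
        have "\<bar>?F\<bar> \<le> M" using ph N L unfolding M_def by simp
        then have "\<bar>\<tau> * ?F\<bar> \<le> t * M" using \<tau> unfolding abs_mult by (intro mult_mono) auto
        then show "1 / 2 \<le> cos (\<tau> * ?F)" using t(3) by (intro cos_ge_half) linarith
      next
        assume i: "integrable lborel (\<lambda>\<eta>. (norm \<eta>)\<^sup>2 * P \<eta> * Q (\<xi> - \<eta>))"
        show "m \<le> (LINT \<eta>|lborel. (norm \<eta>)\<^sup>2 * P \<eta> * Q (\<xi> - \<eta>))"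
          unfolding m_def V_def
        proof (rule integral_slab_ge[OF i L0 less_imp_le[OF \<rho>], where k = k and c = ?cP])
          show "0 \<le> (norm \<eta>)\<^sup>2 * P \<eta> * Q (\<xi> - \<eta>)" for \<eta> using P0 Q0 by simp
          fix \<eta> assume \<eta>: "\<eta> \<in> slab k \<Lambda> \<rho> ?cP"
          have n1: "norm (\<eta> - ?cP) \<le> 1" using nP[OF \<eta>] Labs[of "\<eta> $ k - ?cP $ k"] by linarith
          have "\<bar>p\<bar> * N / 2 \<le> norm \<eta>" using shell_bounds(3)[OF N Np n1 p] .
          then have e1: "(\<bar>p\<bar> / 2)\<^sup>2 * N\<^sup>2 \<le> (norm \<eta>)\<^sup>2"
            using power_mono[of "\<bar>p\<bar> * N / 2" "norm \<eta>" 2] N by (simp add: power_mult_distrib power_divide)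
          have e2: "3 / 4 \<le> tent k \<Lambda> ?cP \<eta>" using nP[OF \<eta>] unfolding tent_def by linarith
          have d: "\<xi> - \<eta> - ?cQ = (\<xi> - ?cO) - (\<eta> - ?cP)" by (simp add: distrib_right scaleR_add_left)
          have "norm (\<xi> - \<eta> - ?cQ) \<le> norm (\<xi> - ?cO) + norm (\<eta> - ?cP)" unfolding d by (rule norm_triangle_ineq4)
          moreover have "(\<xi> - \<eta>) $ k - ?cQ $ k = (\<xi> $ k - ?cO $ k) - (\<eta> $ k - ?cP $ k)" by (simp add: distrib_right)
          then have "\<bar>(\<xi> - \<eta>) $ k - ?cQ $ k\<bar> \<le> \<bar>\<xi> $ k - ?cO $ k\<bar> + \<bar>\<eta> $ k - ?cP $ k\<bar>" by (simp only: abs_triangle_ineq4)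
          then have "\<Lambda> * \<bar>(\<xi> - \<eta>) $ k - ?cQ $ k\<bar> \<le> \<Lambda> * \<bar>\<xi> $ k - ?cO $ k\<bar> + \<Lambda> * \<bar>\<eta> $ k - ?cP $ k\<bar>"
            using L0 unfolding distrib_left[symmetric] by (intro mult_left_mono) auto
          ultimately have e3: "1 / 2 \<le> tent k \<Lambda> ?cQ (\<xi> - \<eta>)" using nO[OF \<xi>] nP[OF \<eta>] unfolding tent_def by linarith
          have "((\<bar>p\<bar> / 2)\<^sup>2 * N\<^sup>2) * (y * (3 / 4)) * (x * (1 / 2)) \<le> (norm \<eta>)\<^sup>2 * (y * tent k \<Lambda> ?cP \<eta>) * (x * tent k \<Lambda> ?cQ (\<xi> - \<eta>))"
            using e1 e2 e3 x y by (intro mult_mono mult_left_mono mult_nonneg_nonneg) (auto simp: tent_nonneg)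
          then show "\<mu> * N\<^sup>2 * x * y \<le> (norm \<eta>)\<^sup>2 * P \<eta> * Q (\<xi> - \<eta>)"
            unfolding P_def Q_def \<mu>_def by (simp only: mult_ac)
        qed
      qed
      then show ?thesis using \<xi> by (simp add: G_def)
    qed
    obtain DP DQ where dec: "decays T 2 DP (free T g (\<lambda>\<eta>. complex_of_real (P \<eta>)))" "decays T 1 DQ (free T b (\<lambda>\<eta>. complex_of_real (Q \<eta>)))"
      using cutoff_data_decays[OF cutP less_imp_le[OF T]] cutoff_data_decays[OF cutQ less_imp_le[OF T]] by meson
    have rA: "rapid ?A" by (rule decays_rapid[OF decays_qdiv[OF dec less_imp_le[OF T]] less_imp_le[OF T]])
    have iAG: "integrable lborel (\<lambda>\<xi>. ?A \<xi> * G \<xi>)" by (rule rapid_mult_integrable[OF rA iG])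
    have "t * m / 2 * (V / \<Lambda>) \<le> (LINT \<xi>|lborel. Re (?A \<xi> * G \<xi>))"
      unfolding V_def
    proof (rule integral_slab_ge[OF integrable_Re[OF iAG] L0 less_imp_le[OF \<rho>], where k = k and c = ?cO, folded Out_def])
      show "0 \<le> Re (?A \<xi> * G \<xi>)" for \<xi>
      proof (cases "\<xi> \<in> Out")
        case False
        then show ?thesis by (simp add: G_def)
      qed (use low m0 order_trans in blast)
    qed (rule low)
    also have "\<dots> = Re (LINT \<xi>|lborel. ?A \<xi> * G \<xi>)" by (rule integral_Re[OF iAG])
    also have "\<dots> \<le> K * sqrt (LINT \<xi>|lborel. sob_weight (- s) \<xi> * (norm (G \<xi>))\<^sup>2) *
          ((LINT \<xi>|lborel. sob_weight s \<xi> * (norm (complex_of_real (Q \<xi>)))\<^sup>2) + (LINT \<xi>|lborel. sob_weight s \<xi> * ((norm \<xi>)\<^sup>2 * (norm (complex_of_real (P \<xi>)))\<^sup>2)))"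
      using H cutP cutQ test t(1) unfolding bilinear_bound_def abs_le_iff by blast
    also have "\<dots> \<le> \<bar>K\<bar> * sqrt (W3 * N powr (2 * - s) * (V / \<Lambda>)) * (W2 * (V1 / \<Lambda>) + W1 * Cp * (V1 / \<Lambda>))"
      by (intro mult_mono add_mono IQ JP real_sqrt_le_mono IG(2) abs_ge_self mult_nonneg_nonneg real_sqrt_ge_zero add_nonneg_nonneg
          Bochner_Integration.integral_nonneg tP(2) tQ(2) wG(1)) (use W3(1) V L0 in simp_all)
    also have "sqrt (W3 * N powr (2 * - s) * (V / \<Lambda>)) = sqrt (W3 * V) * N powr (- s) / sqrt \<Lambda>"
    proof -
      have "N powr (2 * - s) = (N powr (- s))\<^sup>2" by (simp add: power2_eq_square powr_add[symmetric])
      then show ?thesis by (simp add: real_sqrt_mult real_sqrt_divide)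
    qed
    also have "W2 * (V1 / \<Lambda>) + W1 * Cp * (V1 / \<Lambda>) = (W2 + W1 * Cp) * V1 / \<Lambda>"
      by (simp add: add_divide_distrib distrib_right)
    finally have "t * m / 2 * (V / \<Lambda>) \<le> D * N powr (- s) / (sqrt \<Lambda> * \<Lambda>)"
      unfolding D_def by (simp only: times_divide_eq_left times_divide_eq_right divide_divide_eq_left mult_ac)
    moreover have "t * m / 2 * (V / \<Lambda>) = E * N * x * N powr (- s) / \<Lambda>\<^sup>2"
      using N by (simp add: m_def E_def y_def power2_eq_square field_simps)
    ultimately have "E * N * x * N powr (- s) / \<Lambda>\<^sup>2 * (\<Lambda>\<^sup>2 / N powr (- s)) \<le> D * N powr (- s) / (sqrt \<Lambda> * \<Lambda>) * (\<Lambda>\<^sup>2 / N powr (- s))"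
      using L0 by (intro mult_right_mono) auto
    moreover have "E * N * x * N powr (- s) / \<Lambda>\<^sup>2 * (\<Lambda>\<^sup>2 / N powr (- s)) = E * N * x"
      using N L0 by simp
    moreover have "D * N powr (- s) / (sqrt \<Lambda> * \<Lambda>) * (\<Lambda>\<^sup>2 / N powr (- s)) = D * (\<Lambda> / sqrt \<Lambda>)"
      using N L0 by (simp add: power2_eq_square)
    ultimately have "E * N * x \<le> D * sqrt \<Lambda>" using L0 by (simp add: real_div_sqrt)
    then have "E * N * x * R powr s \<le> D * sqrt \<Lambda> * R powr s" by (intro mult_right_mono) auto
    moreover have "x * R powr s = 1" using R by (simp add: x_def powr_add[symmetric])
    ultimately have "E * N \<le> D * sqrt \<Lambda> * R powr s" by (simp add: mult.assoc)
    then show "N \<le> D / E * sqrt \<Lambda> * (if q = 0 then 1 else N) powr s"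
      using E unfolding R_def[symmetric] by (simp add: field_simps)
  qed
qed

text \<open>Insert \<Lambda> = N^l: slabs (l = 1) if q = 0 or s < 1/2, cubes (l = 0) only where the
  linear terms of the phase vanish. The bound becomes N^\<delta> <= C with \<delta> = 1 - l/2 -
  \<sigma>. The three alternatives give \<delta> = 1/2, 1/2 - s and 1 - s, all positive.\<close>

lemma growth_contradiction:
  fixes a b g p q s T K :: real
  assumes T: "0 < T"
    and H: "bilinear_bound T K s (\<lambda>P (Q :: real^'d::finite \<Rightarrow> complex). qdiv T a (free T g P) (free T b Q))"
    and p: "p \<noteq> 0" and pq: "p + q \<noteq> 0" and res: "a * (p + q)\<^sup>2 - g * p\<^sup>2 - b * q\<^sup>2 = 0"
    and alt: "q = 0 \<or> s < 1 / 2 \<or> a * (p + q) - g * p = 0 \<and> a * (p + q) - b * q = 0 \<and> s < 1"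
  shows False
proof -
  obtain C where C: "\<And>N \<Lambda>. 1 \<le> N \<Longrightarrow> 1 \<le> \<Lambda> \<Longrightarrow> 2 / \<bar>p\<bar> \<le> N \<Longrightarrow> 2 / \<bar>p + q\<bar> \<le> N \<Longrightarrow> (q \<noteq> 0 \<Longrightarrow> 2 / \<bar>q\<bar> \<le> N) \<Longrightarrow>
    N \<le> \<Lambda> \<or> a * (p + q) - g * p = 0 \<and> a * (p + q) - b * q = 0 \<Longrightarrow>
    N \<le> C * sqrt \<Lambda> * (if q = 0 then 1 else N) powr s"
    by (rule growth_bound[OF T H p pq res]) (erule that)
  define \<sigma> where "\<sigma> = (if q = 0 then 0 else s)"
  define l where "l = (if q = 0 \<or> s < 1 / 2 then 1 else 0 :: real)"
  define \<delta> where "\<delta> = 1 - l / 2 - \<sigma>"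
  have \<delta>: "0 < \<delta>" using alt by (auto simp: \<delta>_def l_def \<sigma>_def)
  \<comment> \<open>For \<open>q = 0\<close> the entry \<open>2 / \<bar>q\<bar>\<close> is 0 by the
    convention on division and does no harm; the last entry makes \<open>N powr \<delta>\<close>
    exceed \<open>C\<close>.\<close>
  define N where "N = Max {1, 2 / \<bar>p\<bar>, 2 / \<bar>p + q\<bar>, 2 / \<bar>q\<bar>, (\<bar>C\<bar> + 1) powr (1 / \<delta>)}"
  have N: "1 \<le> N" "2 / \<bar>p\<bar> \<le> N" "2 / \<bar>p + q\<bar> \<le> N" "2 / \<bar>q\<bar> \<le> N" "(\<bar>C\<bar> + 1) powr (1 / \<delta>) \<le> N"
    unfolding N_def by (rule Max_ge; simp)+
  have "\<bar>C\<bar> + 1 = ((\<bar>C\<bar> + 1) powr (1 / \<delta>)) powr \<delta>" using \<delta> by (simp add: powr_powr)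
  also have "\<dots> \<le> N powr \<delta>" using N(5) \<delta> by (intro powr_mono2) auto
  finally have big: "\<bar>C\<bar> + 1 \<le> N powr \<delta>" .
  have "1 \<le> N powr l" using N(1) by (simp add: l_def)
  moreover have "N \<le> N powr l \<or> a * (p + q) - g * p = 0 \<and> a * (p + q) - b * q = 0"
    using alt N(1) by (auto simp: l_def)
  ultimately have "N \<le> C * sqrt (N powr l) * (if q = 0 then 1 else N) powr s"
    using C N by blast
  also have "(if q = 0 then 1 else N) powr s = N powr \<sigma>" using N(1) by (simp add: \<sigma>_def)
  also have "sqrt (N powr l) = N powr (l / 2)" using N(1) by (simp add: powr_half_sqrt[symmetric] powr_powr)
  finally have le: "N \<le> C * (N powr (l / 2) * N powr \<sigma>)" by (simp only: mult.assoc)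
  have "N = N powr \<delta> * (N powr (l / 2) * N powr \<sigma>)"
    using N(1) by (simp add: \<delta>_def powr_add[symmetric])
  with le have "N powr \<delta> * (N powr (l / 2) * N powr \<sigma>) \<le> C * (N powr (l / 2) * N powr \<sigma>)" by simp
  then have "N powr \<delta> \<le> C" by (rule mult_right_le_imp_le) (use N(1) in simp)
  then show False using big by linarith
qed

text \<open>Conjugation turns \<open>\<gamma>\<close> into \<open>- \<gamma>\<close>, so the second equation is the first one with the coefficients
  \<open>(\<beta>, \<alpha>, - \<gamma>)\<close>.\<close>

lemma crefl_free: "crefl (free T \<kappa> (\<lambda>\<eta>. cnj (P (- \<eta>)))) = free T (- \<kappa>) P"
  unfolding crefl_def[abs_def] free_def complex_cnj_mult cis_cnj complex_cnj_cnj norm_minus_cancel minus_minus minus_mult_left[symmetric] ..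

lemma cutoff_data_crefl:
  fixes P :: "real^'d::finite \<Rightarrow> complex"
  assumes "cutoff_data P"
  shows "cutoff_data (\<lambda>\<eta>. cnj (P (- \<eta>)))"
proof -
  obtain R where c: "continuous_on UNIV P" and R: "\<And>\<xi>. R < norm \<xi> \<Longrightarrow> P \<xi> = 0"
    using assms unfolding cutoff_data_def by blast
  have "continuous_on UNIV (\<lambda>\<eta>. P (- \<eta>))"
    by (rule continuous_on_compose2[OF c]) (auto intro: continuous_intros)
  then have "continuous_on UNIV (\<lambda>\<eta>. cnj (P (- \<eta>)))" by (rule continuous_on_cnj)
  moreover have "cnj (P (- \<eta>)) = 0" if "R < norm \<eta>" for \<eta> using R[of "- \<eta>"] that by simp
  ultimately show ?thesis unfolding cutoff_data_def by blast
qed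

lemma weighted_integral_crefl:
  fixes P :: "real^'d::finite \<Rightarrow> complex"
  assumes "cutoff_data P"
  shows "(LINT \<xi>|lborel. sob_weight s \<xi> * ((norm \<xi>)\<^sup>2 * (norm (cnj (P (- \<xi>))))\<^sup>2)) = (LINT \<xi>|lborel. sob_weight s \<xi> * ((norm \<xi>)\<^sup>2 * (norm (P \<xi>))\<^sup>2))"
proof -
  note [measurable] = rapid_measurable[OF cutoff_data_rapid[OF assms]]
  have "(\<lambda>\<xi>. sob_weight s \<xi> * ((norm \<xi>)\<^sup>2 * (norm (P \<xi>))\<^sup>2)) \<in> borel_measurable borel" by measurable
  from integral_scale[OF this, of "-1" 0] show ?thesis by (simp add: sob_weight_def)
qed

text \<open>\<open>P\<close> is exchanged for its conjugate reflection, which preserves the class of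
  cutoff data and the weighted norm.\<close>

lemma bilinear_bound_crefl:
  fixes B :: "(real \<Rightarrow> real^'d::finite \<Rightarrow> complex) \<Rightarrow> (real^'d \<Rightarrow> complex) \<Rightarrow> real \<Rightarrow> real^'d \<Rightarrow> complex"
  assumes "bilinear_bound T K s (\<lambda>P. B (crefl (free T \<kappa> P)))"
  shows "bilinear_bound T K s (\<lambda>P. B (free T (- \<kappa>) P))"
  unfolding bilinear_bound_def
proof (intro allI impI)
  fix P Q G :: "real^'d \<Rightarrow> complex" and t
  assume "cutoff_data P \<and> cutoff_data Q \<and> test_function s G \<and> t \<in> {0..T}"
  then have a: "cutoff_data P" "cutoff_data (\<lambda>\<eta>. cnj (P (- \<eta>))) \<and> cutoff_data Q \<and> test_function s G \<and> t \<in> {0..T}"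
    using cutoff_data_crefl by blast+
  show "\<bar>Re (LINT \<xi>|lborel. B (free T (- \<kappa>) P) Q t \<xi> * G \<xi>)\<bar>
    \<le> K * sqrt (LINT \<xi>|lborel. sob_weight (- s) \<xi> * (norm (G \<xi>))\<^sup>2) *
      ((LINT \<xi>|lborel. sob_weight s \<xi> * (norm (Q \<xi>))\<^sup>2) + (LINT \<xi>|lborel. sob_weight s \<xi> * ((norm \<xi>)\<^sup>2 * (norm (P \<xi>))\<^sup>2)))"
    using assms[unfolded bilinear_bound_def, rule_format, OF a(2)] unfolding crefl_free weighted_integral_crefl[OF a(1)] .
qed

theorem theorem1p5:
  fixes \<alpha> \<beta> \<gamma> \<theta> s :: real
  assumes "\<alpha> \<noteq> 0" and "\<beta> \<noteq> 0" and "\<gamma> \<noteq> 0"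
    and "\<theta> = \<alpha> * \<beta> * \<gamma> * (1 / \<alpha> - 1 / \<beta> - 1 / \<gamma>)"
    and "(\<alpha> - \<gamma>) * (\<beta> + \<gamma>) = 0 \<or> (\<theta> = 0 \<and> s < 1) \<or> (\<theta> < 0 \<and> s < 1 / 2)"
  shows "\<not> flow_map_C2 TYPE('d::finite) \<alpha> \<beta> \<gamma> s"
proof
  assume flow: "flow_map_C2 TYPE('d) \<alpha> \<beta> \<gamma> s"
  obtain T K where T: "0 < T"
    and A: "bilinear_bound T K s (\<lambda>P (Q :: real^'d \<Rightarrow> complex). qdiv T \<alpha> (free T \<gamma> P) (free T \<beta> Q))"
    and B: "bilinear_bound T K s (\<lambda>P (Q :: real^'d \<Rightarrow> complex). qdiv T \<beta> (crefl (free T \<gamma> P)) (free T \<alpha> Q))"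
    by (rule flow_map_C2_bounds[OF flow])
  have \<theta>: "\<theta> = \<beta> * \<gamma> - \<alpha> * \<gamma> - \<alpha> * \<beta>"
    unfolding assms(4) using assms(1-3) by (simp add: right_diff_distrib)
  consider "\<alpha> = \<gamma>" | "\<beta> + \<gamma> = 0" | "\<alpha> \<noteq> \<gamma>" "\<beta> + \<gamma> \<noteq> 0" "\<theta> = 0" "s < 1" | "\<alpha> \<noteq> \<gamma>" "\<beta> + \<gamma> \<noteq> 0" "\<theta> < 0" "s < 1 / 2"
    using assms(5) by fastforce
  then show False
  proof cases
    case 1
    \<comment> \<open>For \<open>q = 0\<close> the resonance condition is \<alpha> = \<gamma>. The
      exponent \<open>s\<close> is unrestricted since the datum of v sits at frequencies of order
      1.\<close>
    then show False by (intro growth_contradiction[OF T A, of 1 0]) auto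
  next
    case 2
    \<comment> \<open>After conjugation the second equation has \<open>a = \<beta>\<close> and
      \<open>g = - \<gamma>\<close>, so that \<open>q = 0\<close> is resonant if \<beta> =
      -\<gamma>.\<close>
    show False using 2 by (intro growth_contradiction[OF T bilinear_bound_crefl[OF B], of 1 0]) auto
  next
    case 3
    have ne: "\<alpha> - \<gamma> \<noteq> 0" using 3 by simp
    \<comment> \<open>The double root of the resonance quadratic for \<open>q = 1\<close>.\<close>
    let ?p = "- \<alpha> / (\<alpha> - \<gamma>)"
    have pq: "?p + 1 = - \<gamma> / (\<alpha> - \<gamma>)" using ne by (simp add: field_simps)
    have L1: "\<alpha> * (?p + 1) - \<gamma> * ?p = 0" unfolding pq by simp
    have L2: "\<alpha> * (?p + 1) - \<beta> * 1 = 0" unfolding pq using ne 3(3) \<theta> by (simp add: field_simps)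
    \<comment> \<open>Euler's identity for a quadratic form in \<open>p\<close> and \<open>q\<close>
      with half-gradient \<open>(L1, L2)\<close>, at \<open>q = 1\<close>: a critical point is
      automatically a zero.\<close>
    have "\<alpha> * (?p + 1)\<^sup>2 - \<gamma> * ?p\<^sup>2 - \<beta> * 1\<^sup>2 = ?p * (\<alpha> * (?p + 1) - \<gamma> * ?p) + (\<alpha> * (?p + 1) - \<beta> * 1)"
      by (simp only: power2_eq_square algebra_simps)
    then have res: "\<alpha> * (?p + 1)\<^sup>2 - \<gamma> * ?p\<^sup>2 - \<beta> * 1\<^sup>2 = 0" unfolding L1 L2 by simp
    have "?p \<noteq> 0" "?p + 1 \<noteq> 0" unfolding pq using assms(1,3) ne by auto
    from growth_contradiction[OF T A this res] L1 L2 3(4) show False by blast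
  next
    case 4
    have ne: "\<alpha> - \<gamma> \<noteq> 0" using 4 by simp
    define r where "r = sqrt (- \<theta>)"
    have r: "r\<^sup>2 = - \<theta>" "0 < r" using 4(3) by (simp_all add: r_def)
    have root: "\<alpha> * (p + 1)\<^sup>2 - \<gamma> * p\<^sup>2 - \<beta> * 1\<^sup>2 = 0" if "p = (- \<alpha> + c) / (\<alpha> - \<gamma>)" "c\<^sup>2 = - \<theta>" for p c
    proof -
      have e: "(\<alpha> - \<gamma>) * p + \<alpha> = c" using that(1) ne by simp
      \<comment> \<open>Completing the square; \<theta> enters as minus a quarter of the
        discriminant.\<close>
      have "(\<alpha> - \<gamma>) * (\<alpha> * (p + 1)\<^sup>2 - \<gamma> * p\<^sup>2 - \<beta> * 1\<^sup>2) = ((\<alpha> - \<gamma>) * p + \<alpha>)\<^sup>2 + \<theta>"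
        unfolding \<theta> by (simp add: power2_eq_square algebra_simps)
      then show ?thesis using ne that(2) unfolding e by simp
    qed
    \<comment> \<open>The roots \<open>r\<close> and \<open>- r\<close> are distinct, so at most one
      of them gives \<open>p = 0\<close>.\<close>
    obtain c where c: "c\<^sup>2 = - \<theta>" "- \<alpha> + c \<noteq> 0"
      using r by (cases "- \<alpha> + r = 0") (auto intro: that[of "- r"] that[of r])
    define p where "p = (- \<alpha> + c) / (\<alpha> - \<gamma>)"
    have res: "\<alpha> * (p + 1)\<^sup>2 - \<gamma> * p\<^sup>2 - \<beta> * 1\<^sup>2 = 0" by (rule root[OF p_def c(1)])
    have "p \<noteq> 0" using c(2) ne by (simp add: p_def)
    \<comment> \<open>At p = -1 the output would have frequency of order 1, but there the resonance
      condition reads \<beta> + \<gamma> = 0, which is the second case.\<close>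
    moreover have "p + 1 \<noteq> 0"
    proof
      assume "p + 1 = 0"
      then have "p = - 1" by simp
      then show False using res 4(2) by simp
    qed
    ultimately show False using growth_contradiction[OF T A _ _ res] 4(4) by blast
  qed
qed

end
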